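(* Let $b:[0,T]\times\mathbb{R}\times\mathcal{P}_1(\mathbb{R})\to\mathbb{R}$ be such that: (1) (decomposable form) $b=\hat b+\tilde b$ with $\hat b,\tilde b:[0,T]\times\mathbb{R}\times\mathcal{P}_1(\mathbb{R})\to\mathbb{R}$ measurable, $\hat b$ bounded, and for some constant $C>0$ and all $t\in[0,T]$, $y,y_1,y_2\in\mathbb{R}$, $\mu\in\mathcal{P}_1(\mathbb{R})$: $|\tilde b(t,y,\mu)|\le C(1+|y|+\mathcal{K}(\mu,\delta_0))$ and $|\tilde b(t,y_1,\mu)-\tilde b(t,y_2,\mu)|\le C|y_1-y_2|$; (2) (uniform Lipschitz continuity in the third variable) there is a constant $C>0$ with $|b(t,y,\mu)-b(t,y,\nu)|\le C\,\mathcal{K}(\mu,\nu)$ for all $t\in[0,T]$, $y\in\mathbb{R}$, $\mu,\nu\in\mathcal{P}_1(\mathbb{R})$. For $x\in\mathbb{R}$ let $(X_t^x)_{t\in[0,T]}$ be the unique strong solution of $$dX_t^x=b(t,X_t^x,\mathbb{P}_{X_t^x})\,dt+dB_t,\quad X_0^x=x,\quad t\in[0,T],$$ and let $U\subset\mathbb{R}$ be an open and bounded subset. Let $\Phi:\mathbb{R}\to\mathbb{R}$ be continuously differentiable with bounded and Lipschitz continuous derivative $\Phi'$. Then for every $t\in[0,T]$ and $1<p<\infty$, $$\big(x\mapsto\mathbb{E}[\Phi(X_t^x)]\big)\in W^{1,p}(U).$$ Moreover, for almost all $x\in U$, $$\partial_x\mathbb{E}[\Phi(X_t^x)]=\ma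thbb{E}\big[\Phi'(X_t^x)\,\partial_xX_t^x\big].$$
   Context: $T>0$ is a fixed time horizon. $\mathcal{P}_1(\mathbb{R})$ is the set of Borel probability measures $\mu$ on $\mathbb{R}$ with $\int|x|\,\mu(dx)<\infty$, endowed with the Kantorovich metric $\mathcal{K}(\lambda,\nu)=\sup\{|\int_{\mathbb{R}}h\,d(\lambda-\nu)| : h:\mathbb{R}\to\mathbb{R}\text{ Lipschitz with constant }1\}$; $\delta_0$ is the Dirac measure at $0$. $(\Omega,\mathcal{F},\mathbb{P})$ is a complete probability space carrying a one-dimensional Brownian motion $B=(B_t)_{t\in[0,T]}$, the same for all $x$; $\mathbb{E}$ is expectation under $\mathbb{P}$. A strong solution of the mean-field SDE is a continuous process $X^x$, adapted to the augmented filtration generated by $B$, whose laws $\mathbb{P}_{X_t^x}$ lie in $\mathcal{P}_1(\mathbb{R})$, and such that a.s. $X_t^x=x+\int_0^t b(s,X_s^x,\mathbb{P}_{X_s^x})\,ds+B_t$ for $t\in[0,T]$; "unique" means pathwise unique (equivalently here, unique in law). $\partial_xX_t^x$ is the weak (Sobolev) derivative of $x\mapsto X_t^x$, and $\partial_x\mathbb{E}[\Phi(X_t^x)]$ the weak derivative of $x\mapsto\mathbb{E}[\Phi(X_t^x)]$. *)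

theory Defs
  imports "HOL-Probability.Probability"
begin

definition P1 :: "real measure set" where
  "P1 = {\<mu>. prob_space \<mu> \<and> sets \<mu> = sets borel \<and> integrable \<mu> (\<lambda>x. \<bar>x\<bar>)}"

text \<open>On \<^term>\<open>P1\<close> the supremum is finite; outside, where it need not exist, the value is
  set to 0 so that the library's \<^locale>\<open>Metric_space\<close> applies.\<close>

definition kantorovich :: "real measure \<Rightarrow> real measure \<Rightarrow> real" where
  "kantorovich \<mu> \<nu> =
     (if \<mu> \<in> P1 \<and> \<nu> \<in> P1
      then SUP h\<in>{h :: real \<Rightarrow> real. 1-lipschitz_on UNIV h}. \<bar>(\<integral>y. h y \<partial>\<mu>) - (\<integral>y. h y \<partial>\<nu>)\<bar>
      else 0)"

lemma lipschitz_integrable_P1: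
  fixes h :: "real \<Rightarrow> real"
  assumes "\<mu> \<in> P1" "C-lipschitz_on UNIV h"
  shows "integrable \<mu> h"
proof -
  interpret prob_space \<mu> using assms(1) by (simp add: P1_def)
  have s: "sets \<mu> = sets borel" using assms(1) by (simp add: P1_def)
  have "h \<in> borel_measurable borel"
    by (rule borel_measurable_continuous_onI) (rule lipschitz_on_continuous_on[OF assms(2)])
  then have m: "h \<in> borel_measurable \<mu>"
    by (simp add: measurable_cong_sets[OF s refl])
  have i: "integrable \<mu> (\<lambda>x. \<bar>h 0\<bar> + C * \<bar>x\<bar>)"
    using assms(1) by (simp add: P1_def)
  have b: "norm (h x) \<le> norm (\<bar>h 0\<bar> + C * \<bar>x\<bar>)" for x
    using lipschitz_onD[OF assms(2), of x 0] lipschitz_on_nonneg[OF assms(2)]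
    by (auto simp: dist_real_def)
  show ?thesis
    by (rule Bochner_Integration.integrable_bound[OF i m]) (use b in simp)
qed

lemma kantorovich_bdd:
  assumes "\<mu> \<in> P1" "\<nu> \<in> P1"
  shows "bdd_above ((\<lambda>h. \<bar>(\<integral>y. h y \<partial>\<mu>) - (\<integral>y. h y \<partial>\<nu>)\<bar>) ` {h :: real \<Rightarrow> real. 1-lipschitz_on UNIV h})"
proof (rule bdd_aboveI2)
  fix h :: "real \<Rightarrow> real" assume "h \<in> {h. 1-lipschitz_on UNIV h}"
  then have h: "1-lipschitz_on UNIV h" by simp
  have *: "\<bar>(\<integral>y. h y \<partial>\<rho>) - h 0\<bar> \<le> (\<integral>y. \<bar>y\<bar> \<partial>\<rho>)" if r: "\<rho> \<in> P1" for \<rho>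
  proof -
    interpret prob_space \<rho> using r by (simp add: P1_def)
    have ih: "integrable \<rho> h" by (rule lipschitz_integrable_P1[OF r h])
    have "(\<integral>y. h y \<partial>\<rho>) - h 0 = (\<integral>y. h y - h 0 \<partial>\<rho>)"
      using ih by (simp add: prob_space)
    moreover have "\<bar>\<integral>y. h y - h 0 \<partial>\<rho>\<bar> \<le> (\<integral>y. \<bar>y\<bar> \<partial>\<rho>)"
      using r ih lipschitz_onD[OF h, of _ 0]
      by (intro integral_abs_bound[THEN order_trans] integral_mono) (auto simp: dist_real_def P1_def)
    ultimately show ?thesis by simp
  qed
  show "\<bar>(\<integral>y. h y \<partial>\<mu>) - (\<integral>y. h y \<partial>\<nu>)\<bar> \<le> (\<integral>y. \<bar>y\<bar> \<partial>\<mu>) + (\<integral>y. \<bar>y\<bar> \<partial>\<nu>)"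
    using *[OF assms(1)] *[OF assms(2)] by linarith
qed

lemma kantorovich_upper:
  assumes "\<mu> \<in> P1" "\<nu> \<in> P1" "1-lipschitz_on UNIV (h :: real \<Rightarrow> real)"
  shows "\<bar>(\<integral>y. h y \<partial>\<mu>) - (\<integral>y. h y \<partial>\<nu>)\<bar> \<le> kantorovich \<mu> \<nu>"
  using assms cSUP_upper[OF _ kantorovich_bdd[OF assms(1,2)], of h]
  by (simp add: kantorovich_def)

lemma lipschitz_nonempty: "{h :: real \<Rightarrow> real. 1-lipschitz_on UNIV h} \<noteq> {}"
  by (auto intro!: exI[of _ "\<lambda>x. x"] simp: lipschitz_on_def)

lemma kantorovich_zero_imp_eq:
  assumes P: "\<mu> \<in> P1" "\<nu> \<in> P1" and z: "kantorovich \<mu> \<nu> = 0"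
  shows "\<mu> = \<nu>"
proof -
  have lip: "(\<integral>y. h y \<partial>\<mu>) = (\<integral>y. h y \<partial>\<nu>)" if h: "1-lipschitz_on UNIV h" for h :: "real \<Rightarrow> real"
    using kantorovich_upper[OF P h] z by simp
  define g where "g a n x = max 0 (min 1 (1 - real n * (x - a)))" for a n and x :: real
  have glip: "(real n)-lipschitz_on UNIV (g a n)" for a n
  proof (rule lipschitz_onI)
    fix x y :: real
    have "\<bar>g a n x - g a n y\<bar> \<le> \<bar>real n * (x - a) - real n * (y - a)\<bar>"
      by (auto simp: g_def max_def min_def)
    also have "\<dots> = real n * \<bar>x - y\<bar>"
      by (simp add: abs_mult right_diff_distrib[symmetric])
    finally show "dist (g a n x) (g a n y) \<le> real n * dist x y"
      by (simp add: dist_real_def)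
  qed simp
  have geq: "(\<integral>y. g a n y \<partial>\<mu>) = (\<integral>y. g a n y \<partial>\<nu>)" for a n
  proof (cases "n = 0")
    case True
    then show ?thesis using P by (simp add: g_def P1_def prob_space.prob_space)
  next
    case False
    have "1-lipschitz_on UNIV (\<lambda>x. g a n x / real n)"
      using lipschitz_onD[OF glip[of n a]] False
      by (intro lipschitz_onI) (auto simp: dist_real_def field_simps simp flip: diff_divide_distrib)
    from lip[OF this] show ?thesis using False by simp
  qed
  have glim: "(\<lambda>n. \<integral>y. g a n y \<partial>\<rho>) \<longlonglongrightarrow> cdf \<rho> a" if r: "\<rho> \<in> P1" for \<rho> a
  proof -
    interpret prob_space \<rho> using r by (simp add: P1_def)
    have s: "sets \<rho> = sets borel" using r by (simp add: P1_def)
    have sp: "space \<rho> = UNIV" using sets_eq_imp_space_eq[OF s] by simp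
    have pt: "(\<lambda>n. g a n x) \<longlonglongrightarrow> indicator {..a} x" for x
    proof (cases "x \<le> a")
      case True
      then have "g a n x = 1" for n
        by (auto simp: g_def max_def min_def mult_nonneg_nonpos)
      then show ?thesis using True by simp
    next
      case False
      then obtain N where N: "1 / (x - a) < real N" using reals_Archimedean2 by blast
      have "g a n x = 0" if "n \<ge> N" for n
      proof -
        have "1 / (x - a) < real n" using N that by linarith
        then have "1 < real n * (x - a)" using False by (simp add: field_simps)
        then show ?thesis by (simp add: g_def)
      qed
      then have "eventually (\<lambda>n. g a n x = indicator {..a} x) sequentially"
        using False by (auto simp: eventually_sequentially)
      then show ?thesis by (rule tendsto_eventually)
    qed
    have "(\<lambda>n. \<integral>y. g a n y \<partial>\<rho>) \<longlonglongrightarrow> (\<integral>y. indicator {..a} y \<partial>\<rho>)"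
    proof (rule integral_dominated_convergence[where w = "\<lambda>_. 1"])
      show "g a n \<in> borel_measurable \<rho>" for n
        by (rule borel_measurable_integrable, rule lipschitz_integrable_P1[OF r glip])
    qed (use s pt in \<open>auto simp: g_def\<close>)
    then show ?thesis by (simp add: cdf_def sp)
  qed
  have "cdf \<mu> a = cdf \<nu> a" for a
    using LIMSEQ_unique[OF glim[OF P(1)] glim[OF P(2), folded geq]] .
  then have "cdf \<mu> = cdf \<nu>" by auto
  moreover have "real_distribution \<mu>" "real_distribution \<nu>"
    using P by (auto simp: P1_def real_distribution_def real_distribution_axioms_def)
  ultimately show ?thesis by (rule cdf_unique[rotated 2])
qed

lemma Metric_space_P1: "Metric_space P1 kantorovich"
proof
  fix x y z
  show "0 \<le> kantorovich x y"
    using kantorovich_upper[of x y "\<lambda>x. x"]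
    by (cases "x \<in> P1 \<and> y \<in> P1") (auto simp: lipschitz_on_def kantorovich_def intro: order_trans[OF abs_ge_zero])
  show "kantorovich x y = kantorovich y x"
    by (auto simp: kantorovich_def abs_minus_commute)
  show "kantorovich x y = 0 \<longleftrightarrow> x = y" if "x \<in> P1" "y \<in> P1"
    using that kantorovich_zero_imp_eq[of x y] cSUP_const[OF lipschitz_nonempty, of "0::real"]
    by (auto simp: kantorovich_def)
  show "kantorovich x z \<le> kantorovich x y + kantorovich y z" if P: "x \<in> P1" "y \<in> P1" "z \<in> P1"
  proof -
    have "(SUP h\<in>{h :: real \<Rightarrow> real. 1-lipschitz_on UNIV h}. \<bar>(\<integral>t. h t \<partial>x) - (\<integral>t. h t \<partial>z)\<bar>)
        \<le> kantorovich x y + kantorovich y z"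
    proof (rule cSUP_least[OF lipschitz_nonempty])
      fix h :: "real \<Rightarrow> real" assume "h \<in> {h. 1-lipschitz_on UNIV h}"
      then have h: "1-lipschitz_on UNIV h" by simp
      show "\<bar>(\<integral>t. h t \<partial>x) - (\<integral>t. h t \<partial>z)\<bar> \<le> kantorovich x y + kantorovich y z"
        using kantorovich_upper[OF P(1,2) h] kantorovich_upper[OF P(2,3) h] by linarith
    qed
    then show ?thesis using P by (simp add: kantorovich_def)
  qed
qed

lemma return_0_in_P1: "return borel 0 \<in> P1"
  by (auto simp: P1_def integrable_iff_bounded nn_integral_return intro: prob_space_return)

definition P1_borel :: "real measure measure" where
  "P1_borel = sigma P1 {S. openin (Metric_space.mtopology P1 kantorovich) S}"


text \<open>Drifts are total functions; only their values for times in \<open>{0..T}\<close> and measures in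
  \<^term>\<open>P1\<close> are ever constrained or used.\<close>

definition drift_measurable :: "real \<Rightarrow> (real \<Rightarrow> real \<Rightarrow> real measure \<Rightarrow> real) \<Rightarrow> bool" where
  "drift_measurable T f \<longleftrightarrow>
     (\<lambda>(t, y, \<mu>). f t y \<mu>) \<in> borel_measurable (restrict_space borel {0..T} \<Otimes>\<^sub>M (borel \<Otimes>\<^sub>M P1_borel))"

definition decomposable_drift :: "real \<Rightarrow> (real \<Rightarrow> real \<Rightarrow> real measure \<Rightarrow> real) \<Rightarrow> bool" where
  "decomposable_drift T b \<longleftrightarrow>
     (\<exists>bh bt. drift_measurable T bh \<and> drift_measurable T bt \<and>
        (\<forall>t\<in>{0..T}. \<forall>y. \<forall>\<mu>\<in>P1. b t y \<mu> = bh t y \<mu> + bt t y \<mu>) \<and>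
        (\<exists>K. \<forall>t\<in>{0..T}. \<forall>y. \<forall>\<mu>\<in>P1. \<bar>bh t y \<mu>\<bar> \<le> K) \<and>
        (\<exists>C>0. (\<forall>t\<in>{0..T}. \<forall>y. \<forall>\<mu>\<in>P1.
                   \<bar>bt t y \<mu>\<bar> \<le> C * (1 + \<bar>y\<bar> + kantorovich \<mu> (return borel 0))) \<and>
               (\<forall>t\<in>{0..T}. \<forall>y1 y2. \<forall>\<mu>\<in>P1.
                   \<bar>bt t y1 \<mu> - bt t y2 \<mu>\<bar> \<le> C * \<bar>y1 - y2\<bar>)))"

definition lipschitz_in_law :: "real \<Rightarrow> (real \<Rightarrow> real \<Rightarrow> real measure \<Rightarrow> real) \<Rightarrow> bool" where
  "lipschitz_in_law T b \<longleftrightarrow>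
     (\<exists>C>0. \<forall>t\<in>{0..T}. \<forall>y. \<forall>\<mu>\<in>P1. \<forall>\<nu>\<in>P1. \<bar>b t y \<mu> - b t y \<nu>\<bar> \<le> C * kantorovich \<mu> \<nu>)"


text \<open>Processes are written \<open>X t \<omega>\<close>; only times in \<open>{0..T}\<close> are relevant.\<close>

definition brownian_motion :: "'a measure \<Rightarrow> real \<Rightarrow> (real \<Rightarrow> 'a \<Rightarrow> real) \<Rightarrow> bool" where
  "brownian_motion M T B \<longleftrightarrow>
     (\<forall>t\<in>{0..T}. B t \<in> borel_measurable M) \<and>
     (AE \<omega> in M. B 0 \<omega> = 0) \<and>
     (AE \<omega> in M. continuous_on {0..T} (\<lambda>t. B t \<omega>)) \<and>
     (\<forall>s t. 0 \<le> s \<and> s < t \<and> t \<le> T \<longrightarrow>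
        distributed M lborel (\<lambda>\<omega>. B t \<omega> - B s \<omega>) (normal_density 0 (sqrt (t - s)))) \<and>
     (\<forall>(n :: nat) \<tau>. 0 \<le> \<tau> 0 \<and> \<tau> n \<le> T \<and> (\<forall>i<n. \<tau> i \<le> \<tau> (Suc i)) \<longrightarrow>
        prob_space.indep_vars M (\<lambda>_. borel) (\<lambda>i \<omega>. B (\<tau> (Suc i)) \<omega> - B (\<tau> i) \<omega>) {..<n})"

definition augmented_filtration :: "'a measure \<Rightarrow> (real \<Rightarrow> 'a \<Rightarrow> real) \<Rightarrow> real \<Rightarrow> 'a measure" where
  "augmented_filtration M B t =
     sigma (space M) ({B s -` A \<inter> space M | s A. s \<in> {0..t} \<and> A \<in> sets borel} \<union> null_sets M)"

text \<open>Integrability of the drift along the path is part of the meaning of the integral equation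
  (the library's integral of a non-integrable function is 0).\<close>

definition strong_solution ::
  "'a measure \<Rightarrow> real \<Rightarrow> (real \<Rightarrow> 'a \<Rightarrow> real) \<Rightarrow> (real \<Rightarrow> real \<Rightarrow> real measure \<Rightarrow> real) \<Rightarrow>
   real \<Rightarrow> (real \<Rightarrow> 'a \<Rightarrow> real) \<Rightarrow> bool" where
  "strong_solution M T B b x X \<longleftrightarrow>
     (\<forall>t\<in>{0..T}. X t \<in> borel_measurable (augmented_filtration M B t)) \<and>
     (AE \<omega> in M. continuous_on {0..T} (\<lambda>t. X t \<omega>)) \<and>
     (\<forall>t\<in>{0..T}. distr M borel (X t) \<in> P1) \<and>
     (AE \<omega> in M.
        set_integrable lborel {0..T} (\<lambda>s. b s (X s \<omega>) (distr M borel (X s))) \<and>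
        (\<forall>t\<in>{0..T}. X t \<omega> =
           x + (LINT s:{0..t}|lborel. b s (X s \<omega>) (distr M borel (X s))) + B t \<omega>))"

definition unique_strong_solution ::
  "'a measure \<Rightarrow> real \<Rightarrow> (real \<Rightarrow> 'a \<Rightarrow> real) \<Rightarrow> (real \<Rightarrow> real \<Rightarrow> real measure \<Rightarrow> real) \<Rightarrow>
   real \<Rightarrow> (real \<Rightarrow> 'a \<Rightarrow> real) \<Rightarrow> bool" where
  "unique_strong_solution M T B b x X \<longleftrightarrow>
     strong_solution M T B b x X \<and>
     (\<forall>Y. strong_solution M T B b x Y \<longrightarrow> (AE \<omega> in M. \<forall>t\<in>{0..T}. Y t \<omega> = X t \<omega>))"


definition test_function :: "real set \<Rightarrow> (real \<Rightarrow> real) \<Rightarrow> bool" where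
  "test_function U \<phi> \<longleftrightarrow>
     (\<forall>n x. (deriv ^^ n) \<phi> differentiable (at x)) \<and>
     compact (closure {x. \<phi> x \<noteq> 0}) \<and> closure {x. \<phi> x \<noteq> 0} \<subseteq> U"

definition locally_integrable_on :: "(real \<Rightarrow> real) \<Rightarrow> real set \<Rightarrow> bool" where
  "locally_integrable_on f U \<longleftrightarrow> (\<forall>K. compact K \<and> K \<subseteq> U \<longrightarrow> set_integrable lebesgue K f)"

definition has_weak_derivative_on :: "(real \<Rightarrow> real) \<Rightarrow> (real \<Rightarrow> real) \<Rightarrow> real set \<Rightarrow> bool" where
  "has_weak_derivative_on f g U \<longleftrightarrow>
     locally_integrable_on f U \<and> locally_integrable_on g U \<and>
     (\<forall>\<phi>. test_function U \<phi> \<longrightarrow>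
        (LINT x:U|lebesgue. f x * deriv \<phi> x) = - (LINT x:U|lebesgue. g x * \<phi> x))"

definition in_Lp :: "real \<Rightarrow> real set \<Rightarrow> (real \<Rightarrow> real) \<Rightarrow> bool" where
  "in_Lp p U f \<longleftrightarrow>
     set_borel_measurable lebesgue U f \<and> set_integrable lebesgue U (\<lambda>x. \<bar>f x\<bar> powr p)"

definition in_W1p :: "real \<Rightarrow> real set \<Rightarrow> (real \<Rightarrow> real) \<Rightarrow> bool" where
  "in_W1p p U f \<longleftrightarrow> in_Lp p U f \<and> (\<exists>g. has_weak_derivative_on f g U \<and> in_Lp p U g)"

text \<open>Pathwise weak derivative of a random field \<open>F x \<omega>\<close> in the variable \<open>x \<in> U\<close>. A field such as
  \<open>x \<mapsto> X\<^sub>t\<^sup>x\<close> is determined only up to a null set depending on \<open>x\<close>, so the derivative is taken of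
  a jointly measurable modification \<open>G\<close>. Any two such modifications agree, for almost every \<open>\<omega>\<close>,
  at almost every \<open>x\<close>, so \<open>D\<close> does not depend on the choice up to null sets of \<open>(x, \<omega>)\<close>.\<close>

definition jointly_measurable_on :: "'a measure \<Rightarrow> real set \<Rightarrow> (real \<Rightarrow> 'a \<Rightarrow> real) \<Rightarrow> bool" where
  "jointly_measurable_on M U F \<longleftrightarrow>
     (\<lambda>(x, \<omega>). F x \<omega>) \<in> borel_measurable (restrict_space borel U \<Otimes>\<^sub>M M)"

definition has_weak_derivative_field ::
  "'a measure \<Rightarrow> (real \<Rightarrow> 'a \<Rightarrow> real) \<Rightarrow> (real \<Rightarrow> 'a \<Rightarrow> real) \<Rightarrow> real set \<Rightarrow> bool" where
  "has_weak_derivative_field M F D U \<longleftrightarrow>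
     jointly_measurable_on M U D \<and>
     (\<exists>G. jointly_measurable_on M U G \<and>
        (\<forall>x\<in>U. AE \<omega> in M. G x \<omega> = F x \<omega>) \<and>
        (AE \<omega> in M. has_weak_derivative_on (\<lambda>x. G x \<omega>) (\<lambda>x. D x \<omega>) U))"

end

theory Submission imports Defs begin

text \<open>
The statement follows once \<open>x \<mapsto> X x t\<close> is Lipschitz in mean square on bounded sets of
initial values, with a constant uniform in time:
\<open>E (X x t - X y t)^2 \<le> c (x - y)^2\<close>.

From the Lipschitz bound to the theorem. The difference quotients of the field along dyadic grids
are bounded in mean square, uniformly in the grid, and successive ones differ by orthogonal
increments. Their energies increase to a finite limit, so they converge to a field \<open>D\<close> with
\<open>X x t = X a t + \<integral>\<^bsub>a\<^esub>\<^bsup>x\<^esup> D s ds\<close> almost surely (\<open>lipschitz_field_derivative\<close>). Almost every path of the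
field is therefore absolutely continuous in \<open>x\<close>; the chain rule for absolutely continuous functions
and Fubini's theorem give \<open>E \<Phi>(X x t) = E \<Phi>(X a t) + \<integral>\<^bsub>a\<^esub>\<^bsup>x\<^esup> E [\<Phi>'(X s t) D s] ds\<close>
(\<open>weak_derivative_of_expectation\<close>). The integrand is bounded, which gives the Sobolev regularity for
every \<open>p\<close>, and any other pair of weak derivatives agrees with this one because weak derivatives are
unique (\<open>weak_derivative_unique\<close>).

The Lipschitz bound. For two solutions \<open>X\<close>, \<open>Y\<close> the difference \<open>Z = X - Y\<close> has no noise. Freeze the
bounded part of the drift at the law of \<open>X\<close> and replace it by a differentiable function \<open>f\<close> that is
close to it for the occupation measures of both solutions (\<open>smooth_approximation_two_measures\<close>). Then
\<open>f(X) - f(Y) = (\<integral>\<^bsub>0\<^esub>\<^bsup>1\<^esup> f'(\<theta> X + (1 - \<theta>) Y) d\<theta>) Z\<close>, so \<open>Z\<close> solves a linear equation along every path, with an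
error that is small in mean and a term controlled by the Kantorovich distance of the laws. Its
solution formula contains \<open>exp \<integral> f'(\<theta> X + (1 - \<theta>) Y) ds\<close>, averaged over \<open>\<theta>\<close>. The bound on \<open>Z\<close> survives the removal of
the approximation because the fourth moment of this exponential has a bound in which \<open>f\<close>
enters through \<open>sup \<bar>f\<bar>\<close> only, not through \<open>f'\<close> (\<open>exponential_functional_bound\<close>). Gronwall's inequality finishes
the argument (\<open>approximate_stability\<close>, \<open>solution_stability\<close>).

The exponential moment. The drift of \<open>Y\<close> is not bounded, so instead of a change of measure a
supermartingale is built. Let \<open>u\<close> solve \<open>u\<^bsub>t\<^esub> + u''/2 + (F u)'/\<gamma> = 0\<close> backwards from \<open>u = 1\<close>, with \<open>0 < \<gamma>\<close> small.
The function \<open>h = u\<^bsup>\<gamma>\<^esup>\<close> satisfies \<open>h\<^bsub>t\<^esub> + h''/2 + F' h = - F u\<^bsup>\<gamma>-1\<^esup> u' - \<gamma> (1 - \<gamma>) u\<^bsup>\<gamma>-2\<^esup> u'\<^sup>2 / 2\<close>: the last term, a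
square of the gradient, absorbs the term with \<open>F\<close> and the effect of a drift of size \<open>\<alpha>\<close> on \<open>h\<close>, at the
price of \<open>36 K\<^sup>2/\<gamma> + 36 \<gamma> \<alpha>\<^sup>2\<close> times \<open>h\<close>. Since the gradient falls on the Gaussian kernel, \<open>u\<close> stays
within \<open>[1/2, 3/2]\<close> on short blocks whose length depends on \<open>K = sup \<bar>F\<bar>\<close> only. The price is
exponentially integrable for small \<open>\<gamma>\<close>, as \<open>\<alpha>\<close> grows linearly in the Brownian path. Everything is done in
discrete time: \<open>u\<close> is given by a recursion with Gaussian steps (\<open>bwd\<close>), one step of it costs an error of
order \<open>\<delta>\<^bsup>3/2\<^esup>\<close> (\<open>one_step\<close>, \<open>step_supermartingale\<close>), and Riemann sums give the integral
(\<open>exponential_bound\<close>). No stochastic integral occurs.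

Most Greek letters of these comments are spelled by two letters in the formulas below, such as \<open>ga\<close>
for \<open>\<gamma>\<close>; the step \<open>\<delta>\<close> is \<open>dt\<close>.
\<close>

section \<open>Integrals and expectations\<close>

text \<open>Bochner integrals are meant throughout; the gauge integral has theorems of the same names.\<close>

lemmas integrable_add = Bochner_Integration.integrable_add
 and integrable_diff = Bochner_Integration.integrable_diff
 and integrable_sum = Bochner_Integration.integrable_sum
 and integrable_bound = Bochner_Integration.integrable_bound
 and integral_add = Bochner_Integration.integral_add
 and integral_diff = Bochner_Integration.integral_diff
 and integral_sum = Bochner_Integration.integral_sum
 and integral_cong = Bochner_Integration.integral_cong
 and integral_nonneg = Bochner_Integration.integral_nonneg

abbreviation (input) "meas == borel_measurable"
abbreviation (input) "conti == continuous_on UNIV"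
abbreviation (input) "lint == set_integrable lborel"
abbreviation (input) "jmeas N f == (%p. f (fst p) (snd p)) \<in> meas (borel \<Otimes>\<^sub>M N)"
abbreviation (input) "jcont f == conti (%p. f (fst p) (snd p))"
abbreviation (in prob_space) mean (binder "EE " 10) where "mean X == expectation X"

lemma integrable_le:
 fixes f g :: "'b => real"
 assumes g: "integrable N g" and f: "f \<in> meas N" and le: "!!x. abs (f x) <= g x"
 shows "integrable N f" "(\<integral>x. abs (f x) \<partial>N) <= (\<integral>x. g x \<partial>N)" "(\<integral>x. f x \<partial>N) <= (\<integral>x. g x \<partial>N)"
proof -
 show i: "integrable N f"
  by (rule integrable_bound[OF g f]) (use order_trans[OF le abs_ge_self] in auto)
 show "(\<integral>x. abs (f x) \<partial>N) <= (\<integral>x. g x \<partial>N)" by (rule integral_mono[OF integrable_abs[OF i] g le])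
 show "(\<integral>x. f x \<partial>N) <= (\<integral>x. g x \<partial>N)" by (rule integral_mono[OF i g order_trans[OF abs_ge_self le]])
qed

text \<open>Turns a small second moment into a small first moment: with \<open>h\<close> of the order of the root mean square of \<open>v\<close> both terms are of this order in mean.\<close>

lemma abs_le_eps_square:
 fixes v h :: real
 assumes h: "0 < h"
 shows "abs v <= h + v^2 / h"
proof -
 have "0 <= (abs v - h)^2 + h * abs v" using h by simp
 then have "h * abs v <= h * (h + v^2 / h)" using h by (simp add: power2_diff power2_eq_square algebra_simps)
 then show ?thesis using h by simp
qed

lemma joint_measurable_compose:
 assumes "(%p. f (fst p) (snd p)) \<in> measurable (N1 \<Otimes>\<^sub>M N2) L" "h1 \<in> measurable N N1" "h2 \<in> measurable N N2"
 shows "(%p. f (h1 p) (h2 p)) \<in> measurable N L"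
 using measurable_compose[OF measurable_Pair[OF assms(2,3)] assms(1)] by simp

lemma LBINT_point:
 fixes f :: "real => real"
 shows "(LBINT s:{a..a}. f s) = 0"
proof -
 have "AE s in lborel. indicator {a..a} s *\<^sub>R f s = 0"
  using AE_lborel_singleton[of a] by eventually_elim simp
 then show ?thesis unfolding set_lebesgue_integral_def by (rule integral_eq_zero_AE)
qed

lemma LBINT_nonneg: "(!!x. 0 <= (f x :: real)) ==> 0 <= (LBINT x:A. f x)"
 unfolding set_lebesgue_integral_def by (rule integral_nonneg) simp

text \<open>The variance of \<open>\<bar>X\<bar>\<close> is nonnegative.\<close>

lemma (in prob_space) mean_abs_square_le:
 fixes X :: "'a => real"
 assumes "integrable M X" "integrable M (%w. (X w)^2)"
 shows "(EE w. abs (X w))^2 <= (EE w. (X w)^2)"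
 using variance_eq[of "%w. abs (X w)"] variance_positive[of "%w. abs (X w)"] assms by simp

text \<open>A special case of Fubini's theorem, used for difference quotients: deterministic steps times random slopes.\<close>

lemma product_integrable:
 fixes f :: "'a => real" and g :: "'b => real"
 assumes s: "sigma_finite_measure N1" "sigma_finite_measure N2" and f: "integrable N1 f" and g: "integrable N2 g"
 shows "integrable (N1 \<Otimes>\<^sub>M N2) (%p. f (fst p) * g (snd p))"
proof -
 interpret pair_sigma_finite N1 N2 by (intro pair_sigma_finite.intro s)
 have [measurable]: "f \<in> meas N1" "g \<in> meas N2" using f g by auto
 show ?thesis by (rule Fubini_integrable) (use f g in \<open>auto simp: abs_mult\<close>)
qed

abbreviation (in prob_space) law :: "('a => real) => real measure" where "law == distr M borel"
abbreviation (in prob_space) mean_le :: "('a => real) => real => bool" where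
 "mean_le X a == integrable M X & expectation X <= a"

definition gauss :: "real measure" where
 "gauss = density lborel (%x. ennreal (std_normal_density x))"

abbreviation gauss_mean (binder "GE " 10) where "gauss_mean f == integral\<^sup>L gauss f"

lemma prob_space_gauss: "prob_space gauss"
 unfolding gauss_def using prob_space_normal_density[of 1 0] by simp

lemma sets_gauss [measurable_cong, simp]: "sets gauss = sets borel"
 by (simp add: gauss_def)

lemma space_gauss [simp]: "space gauss = UNIV"
 by (simp add: gauss_def)

lemma integral_gauss:
 fixes f :: "real => real"
 assumes [measurable]: "f \<in> meas borel"
 shows "integral\<^sup>L gauss f = (LBINT x. std_normal_density x * f x)"
 unfolding gauss_def by (subst integral_density) (auto simp: normal_density_nonneg)

lemma integrable_gauss_iff:
 fixes f :: "real => real"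
 assumes [measurable]: "f \<in> meas borel"
 shows "integrable gauss f \<longleftrightarrow> integrable lborel (%x. std_normal_density x * f x)"
 unfolding gauss_def by (subst integrable_density) (auto simp: normal_density_nonneg)

lemma integrable_gauss_power [simp, intro]: "integrable gauss (%x. x ^ k)"
 using integrable_std_normal_moment[of k] by (subst integrable_gauss_iff) auto

lemma integrable_gauss_id [simp, intro]: "integrable gauss (%x. x)"
 using integrable_gauss_power[of 1] by simp

lemma integrable_gauss_abs_power [simp, intro]: "integrable gauss (%x. abs x ^ k)"
 using integrable_std_normal_moment_abs[of k] by (subst integrable_gauss_iff) auto

lemma integrable_gauss_abs [simp, intro]: "integrable gauss (%x. abs x)"
 using integrable_gauss_abs_power[of 1] by simp

lemma integrable_gauss_bounded:
 fixes f :: "real => real"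
 assumes "f \<in> meas borel" "!!x. abs (f x) <= a"
 shows "integrable gauss f"
proof -
 interpret prob_space gauss by (rule prob_space_gauss)
 show ?thesis
  by (rule integrable_const_bound[of _ a]) (use assms in auto)
qed

lemma gauss_mean: "(GE x. x) = 0"
 using integral_std_normal_moment_odd[of 0] by (simp add: integral_gauss)

lemma gauss_second_moment: "(GE x. x^2) = 1"
 using integral_std_normal_moment_even[of 1] by (simp add: integral_gauss)

lemma gauss_fourth_moment: "(GE x. x ^ 4) = 3"
 using integral_std_normal_moment_even[of 2] by (simp add: integral_gauss fact_numeral)

lemma measure_gauss_UNIV [simp]: "measure gauss UNIV = 1"
 using prob_space.prob_space[OF prob_space_gauss] by simp

lemma gauss_const: "(GE x. (c::real)) = c"
 by simp

lemma gauss_integrable_const [simp, intro]: "integrable gauss (%x. (c::real))"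
 by (rule integrable_gauss_bounded) auto

lemma gauss_abs_moment: "(GE x. abs x) <= 1"
proof -
 have "(GE x. abs x) <= (GE x. (1 + x^2) / 2)"
 proof (rule integral_mono)
  show "abs x <= (1 + x^2) / 2" for x :: real
   using zero_le_power2[of "abs x - 1"] by (simp add: power2_eq_square algebra_simps)
 qed auto
 also have "... = 1" using gauss_second_moment by (simp add: add_divide_distrib)
 finally show ?thesis .
qed

lemma gauss_abs_cube_moment: "(GE x. abs x ^ 3) <= 2"
proof -
 have "(GE x. abs x ^ 3) <= (GE x. (x^2 + x ^ 4) / 2)"
 proof (rule integral_mono)
  show "abs x ^ 3 <= (x^2 + x ^ 4) / 2" for x :: real
  proof -
   have "0 <= (abs x - x^2)^2" by simp
   also have "(abs x - x^2)^2 = x^2 + x ^ 4 - 2 * abs x ^ 3"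
    by (auto simp: power2_eq_square power3_eq_cube power4_eq_xxxx algebra_simps abs_if)
   finally show ?thesis by simp
  qed
 qed auto
 also have "... = 2" using gauss_second_moment gauss_fourth_moment by (simp add: add_divide_distrib)
 finally show ?thesis .
qed

definition heat :: "real => (real => real) => real => real" where
 "heat s f z = (GE xi. f (z + sqrt s * xi))"

text \<open>By partial integration this is the derivative of \<open>heat s f\<close> (lemma \<open>heat_grad_eq_heat_deriv\<close>), but it is written without \<open>f'\<close>: the derivative falls on the Gaussian kernel and costs \<open>1 / sqrt s\<close>.\<close>

definition heat_grad :: "real => (real => real) => real => real" where
 "heat_grad s f z = (GE xi. f (z + sqrt s * xi) * xi) / sqrt s"

text \<open>Differentiability with Lipschitz derivative, with all three bounds explicit. Keeping \<open>a\<close> apart from \<open>b\<close> and \<open>l\<close> matters: the final exponential bound must depend on the sup norm \<open>a\<close> only, while the errors of the time discretization may depend on all three.\<close>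

definition C11 :: "real => real => real => (real => real) => (real => real) => bool" where
 "C11 a b l f f' \<longleftrightarrow>
   (\<forall>z. (f has_real_derivative f' z) (at z)) & (\<forall>z. abs (f z) <= a) & (\<forall>z. abs (f' z) <= b) &
   (\<forall>z w. abs (f' z - f' w) <= l * abs (z - w))"

lemma C11_D:
 assumes "C11 a b l f f'"
 shows "(f has_real_derivative f' z) (at z)" "abs (f z) <= a" "abs (f' z) <= b"
  "abs (f' z - f' w) <= l * abs (z - w)"
 using assms by (auto simp: C11_def)

lemma C11_nonneg:
 assumes "C11 a b l f f'"
 shows "0 <= a" "0 <= b" "0 <= l"
 using C11_D(2)[OF assms, of 0] C11_D(3)[OF assms, of 0] C11_D(4)[OF assms, of 0 1] by auto

lemma C11_mvt:
 assumes "C11 a b l f f'"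
 obtains c where "f w - f z = (w - z) * f' c" "abs (c - z) <= abs (w - z)"
proof (cases "z = w")
 case True
 show ?thesis by (rule that[of z]) (use True in auto)
next
 case False
 have d: "DERIV f x :> f' x" for x using C11_D(1)[OF assms] .
 show ?thesis
 proof (cases "z < w")
  case True
  from MVT2[OF True, of f f'] d obtain c where "z < c" "c < w" "f w - f z = (w - z) * f' c" by blast
  then show ?thesis by (intro that[of c]) auto
 next
  case F: False
  then have "w < z" using False by auto
  from MVT2[OF this, of f f'] d obtain c where "w < c" "c < z" "f z - f w = (z - w) * f' c" by blast
  then show ?thesis by (intro that[of c]) (auto simp: algebra_simps)
 qed
qed

lemma C11_lipschitz:
 assumes "C11 a b l f f'"
 shows "abs (f w - f z) <= b * abs (w - z)"
proof -
 obtain c where "f w - f z = (w - z) * f' c" using C11_mvt[OF assms] by blast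
 then show ?thesis
  using mult_right_mono[OF C11_D(3)[OF assms, of c], of "abs (w - z)"] by (simp add: abs_mult mult.commute)
qed

text \<open>The mean value theorem suffices; the constant \<open>l\<close> instead of \<open>l / 2\<close> is good enough.\<close>

lemma C11_taylor:
 assumes "C11 a b l f f'"
 shows "abs (f (z + w) - f z - f' z * w) <= l * w^2"
proof -
 obtain c where c: "f (z + w) - f z = (z + w - z) * f' c" "abs (c - z) <= abs (z + w - z)"
  by (rule C11_mvt[OF assms])
 have "abs (f (z + w) - f z - f' z * w) = abs w * abs (f' c - f' z)"
  using c(1) by (simp add: abs_mult[symmetric] algebra_simps)
 also have "... <= abs w * (l * abs w)"
  using C11_D(4)[OF assms, of c z] c(2) C11_nonneg(3)[OF assms]
  by (intro mult_left_mono) (auto intro: order_trans[OF _ mult_left_mono])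
 also have "... = l * w^2" by (simp add: power2_eq_square abs_mult_self_eq)
 finally show ?thesis .
qed

lemma lipschitz_borel:
 fixes f :: "real => real"
 assumes "!!z w. abs (f z - f w) <= l * abs (z - w)"
 shows "f \<in> meas borel"
proof -
 have "0 <= l" using assms[of 0 1] by auto
 then have "l-lipschitz_on UNIV f"
  using assms by (intro lipschitz_onI) (auto simp: dist_real_def)
 then show ?thesis by (intro borel_measurable_continuous_onI lipschitz_on_continuous_on)
qed

lemma C11_borel:
 assumes "C11 a b l f f'"
 shows "f \<in> meas borel" "f' \<in> meas borel"
 using lipschitz_borel C11_lipschitz[OF assms] C11_D(4)[OF assms] by blast+

lemma C11_mono:
 assumes "C11 a b l f f'" "a <= a'" "b <= b'" "l <= l'"
 shows "C11 a' b' l' f f'"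
 unfolding C11_def
proof (intro conjI allI)
 fix z w
 show "(f has_real_derivative f' z) (at z)" using C11_D(1)[OF assms(1)] .
 show "abs (f z) <= a'" using C11_D(2)[OF assms(1), of z] assms(2) by simp
 show "abs (f' z) <= b'" using C11_D(3)[OF assms(1), of z] assms(3) by simp
 have "l * abs (z - w) <= l' * abs (z - w)" by (intro mult_right_mono assms) auto
 then show "abs (f' z - f' w) <= l' * abs (z - w)"  using C11_D(4)[OF assms(1), of z w] by simp
qed

lemma C11_const: "C11 (abs c) 0 0 (%_. c) (%_. 0)"
 by (simp add: C11_def)

lemma C11_add:
 assumes "C11 a b l f f'" "C11 a2 b2 l2 g g'"
 shows "C11 (a + a2) (b + b2) (l + l2) (%z. f z + g z) (%z. f' z + g' z)"
 unfolding C11_def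
proof (intro conjI allI)
 fix z w
 note f = C11_D[OF assms(1)] and g = C11_D[OF assms(2)]
 show "((%z. f z + g z) has_real_derivative f' z + g' z) (at z)"
  by (intro DERIV_add f(1) g(1))
 show "abs (f z + g z) <= a + a2" using f(2)[of z] g(2)[of z] by linarith
 show "abs (f' z + g' z) <= b + b2" using f(3)[of z] g(3)[of z] by linarith
 show "abs (f' z + g' z - (f' w + g' w)) <= (l + l2) * abs (z - w)"
  using f(4)[of z w] g(4)[of z w] by (simp add: distrib_right)
qed

lemma C11_scale:
 assumes "C11 a b l f f'"
 shows "C11 (abs c * a) (abs c * b) (abs c * l) (%z. c * f z) (%z. c * f' z)"
 unfolding C11_def
proof (intro conjI allI)
 fix z w
 note f = C11_D[OF assms(1)]
 show "((%z. c * f z) has_real_derivative c * f' z) (at z)"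
  by (rule DERIV_cmult[OF f(1)])
 show "abs (c * f z) <= abs c * a" "abs (c * f' z) <= abs c * b"
  using f(2)[of z] f(3)[of z] by (auto simp: abs_mult intro: mult_left_mono)
 show "abs (c * f' z - c * f' w) <= abs c * l * abs (z - w)"
  using mult_left_mono[OF f(4)[of z w], of "abs c"] by (simp add: abs_mult[symmetric] algebra_simps)
qed

lemma C11_sum:
 assumes "!!i. i \<in> I ==> C11 (a i) (b i) (l i) (f i) (f' i)" "finite I"
 shows "C11 (\<Sum>i\<in>I. a i) (\<Sum>i\<in>I. b i) (\<Sum>i\<in>I. l i) (%z. \<Sum>i\<in>I. f i z) (%z. \<Sum>i\<in>I. f' i z)"
 using assms(2,1)
proof (induction I rule: finite_induct)
 case empty
 then show ?case using C11_const[of 0] by simp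
next
 case (insert i I)
 show ?case
  using C11_add[OF insert.prems[of i] insert.IH] insert by auto
qed

lemma C11_mult:
 assumes "C11 a b l f f'" "C11 a2 b2 l2 g g'"
 shows "C11 (a * a2) (b * a2 + a * b2) (l * a2 + 2 * b * b2 + a * l2)
  (%z. f z * g z) (%z. f' z * g z + f z * g' z)"
 unfolding C11_def
proof (intro conjI allI)
 fix z w
 note f = C11_D[OF assms(1)] and g = C11_D[OF assms(2)]
 note fn = C11_nonneg[OF assms(1)] and gn = C11_nonneg[OF assms(2)]
 show "((%z. f z * g z) has_real_derivative f' z * g z + f z * g' z) (at z)"
  by (rule DERIV_cong[OF DERIV_mult[OF f(1) g(1)]]) (simp add: mult.commute)
 show "abs (f z * g z) <= a * a2" unfolding abs_mult using f g fn by (intro mult_mono) auto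
 have "abs (f' z * g z + f z * g' z) <= abs (f' z) * abs (g z) + abs (f z) * abs (g' z)"
  by (metis abs_triangle_ineq abs_mult)
 also have "... <= b * a2 + a * b2" using f g fn by (intro add_mono mult_mono) auto
 finally show "abs (f' z * g z + f z * g' z) <= b * a2 + a * b2" .
 have "abs (f' z * g z + f z * g' z - (f' w * g w + f w * g' w))
  = abs ((f' z - f' w) * g z + f' w * (g z - g w) + (f z - f w) * g' z + f w * (g' z - g' w))"
  by (simp add: algebra_simps)
 also have "... <= abs (f' z - f' w) * abs (g z) + abs (f' w) * abs (g z - g w) + abs (f z - f w) * abs (g' z) + abs (f w) * abs (g' z - g' w)"
  unfolding abs_mult[symmetric] by linarith
 also have "... <= (l * abs (z - w)) * a2 + b * (b2 * abs (z - w)) + (b * abs (z - w)) * b2 + a * (l2 * abs (z - w))"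
  using f g fn gn C11_lipschitz[OF assms(1), of z w] C11_lipschitz[OF assms(2), of z w]
  by (intro add_mono mult_mono) auto
 also have "... = (l * a2 + 2 * b * b2 + a * l2) * abs (z - w)" by (simp add: algebra_simps)
 finally show "abs (f' z * g z + f z * g' z - (f' w * g w + f w * g' w)) <= (l * a2 + 2 * b * b2 + a * l2) * abs (z - w)" .
qed

lemma weighted_integrable:
 fixes f k :: "real => real"
 assumes f: "f \<in> meas borel" "!!z. abs (f z) <= a"
  and k: "k \<in> meas borel" "integrable gauss (%xi. abs (k xi))"
 shows "integrable gauss (%xi. f (z + s * xi) * k xi)"
proof (rule integrable_le(1)[OF integrable_mult_right[OF k(2), of a]])
 note [measurable] = f(1) k(1)
 show "(%xi. f (z + s * xi) * k xi) \<in> meas gauss" by measurable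
 show "abs (f (z + s * xi) * k xi) <= a * abs (k xi)" for xi unfolding abs_mult by (intro mult_right_mono f) simp
qed

lemma integrable_shift:
 fixes f :: "real => real"
 assumes "f \<in> meas borel" "!!z. abs (f z) <= a"
 shows "integrable gauss (%xi. f (z + s * xi))"
  and "integrable gauss (%xi. f (z + s * xi) * xi)"
 using weighted_integrable[OF assms, of "%_. 1"] weighted_integrable[OF assms, of "%xi. xi"] by simp_all

lemma weighted_bound:
 fixes g k :: "real => real"
 assumes i: "integrable gauss (%xi. g xi * k xi)" and g: "!!xi. abs (g xi) <= e"
  and k: "integrable gauss (%xi. abs (k xi))" "(GE xi. abs (k xi)) <= 1"
 shows "abs (GE xi. g xi * k xi) <= e"
proof -
 have "abs (g xi * k xi) <= e * abs (k xi)" for xi unfolding abs_mult by (intro mult_right_mono g) simp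
 from integrable_le(2)[OF integrable_mult_right[OF k(1)] borel_measurable_integrable[OF i] this]
 have "(GE xi. abs (g xi * k xi)) <= e * (GE xi. abs (k xi))" by simp
 also have "... <= e * 1" using k(2) order_trans[OF abs_ge_zero g] by (rule mult_left_mono)
 finally have "(GE xi. abs (g xi * k xi)) <= e" by simp
 then show ?thesis by (rule order_trans[OF integral_abs_bound])
qed

text \<open>A quadratic remainder at the single point \<open>z\<close> determines the derivative there. This replaces differentiation under the integral sign.\<close>

lemma deriv_from_quadratic:
 fixes f :: "real => real"
 assumes q: "!!w. abs (f w - f z - D * (w - z)) <= c * (w - z)^2"
 shows "(f has_real_derivative D) (at z)"
proof -
 have "((%w. (f w - f z) / (w - z) - D) \<longlongrightarrow> 0) (at z)"
 proof (rule Lim_null_comparison[where g = "%w. c * abs (w - z)"])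
  show "\<forall>\<^sub>F w in at z. norm ((f w - f z) / (w - z) - D) <= c * abs (w - z)"
  proof (rule eventually_at_topological[THEN iffD2], intro exI[of _ UNIV] conjI ballI impI)
   fix w assume "w ~= z"
   then have "norm ((f w - f z) / (w - z) - D) = abs (f w - f z - D * (w - z)) / abs (w - z)"
    by (simp add: abs_divide[symmetric] diff_divide_distrib)
   also have "... <= c * (w - z)^2 / abs (w - z)" by (intro divide_right_mono q) auto
   also have "... = c * abs (w - z)" using \<open>w ~= z\<close> by (simp add: power2_eq_square divide_simps)
   finally show "norm ((f w - f z) / (w - z) - D) <= c * abs (w - z)" .
  qed auto
  show "((%w. c * abs (w - z)) \<longlongrightarrow> 0) (at z)"
   by (rule tendsto_eq_intros | simp)+
 qed
 from tendsto_add[OF this tendsto_const[of D]]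
 show ?thesis by (simp add: has_field_derivative_iff)
qed

section \<open>The Gaussian semigroup\<close>

text \<open>Weighted Gaussian averages inherit all bounds when the weight has absolute mean at most one. The weights \<open>1\<close> and \<open>\<xi>\<close> give the heat semigroup and, up to \<open>1 / sqrt s\<close>, its gradient.\<close>

lemma C11_weighted:
 fixes f k :: "real => real"
 assumes c: "C11 a b l f f'" and km: "k \<in> meas borel"
  and k: "integrable gauss (%xi. abs (k xi))" "(GE xi. abs (k xi)) <= 1"
 shows "C11 a b l (%z. GE xi. f (z + sqrt s * xi) * k xi) (%z. GE xi. f' (z + sqrt s * xi) * k xi)"
 unfolding C11_def
proof (intro conjI allI)
 fix z w
 note f = C11_D[OF c] and m = C11_borel[OF c]
 note i = weighted_integrable[OF m(1) f(2) km k(1)] and i' = weighted_integrable[OF m(2) f(3) km k(1)]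
 show "abs (GE xi. f (z + sqrt s * xi) * k xi) <= a" by (rule weighted_bound[OF i f(2) k])
 show "abs (GE xi. f' (z + sqrt s * xi) * k xi) <= b" by (rule weighted_bound[OF i' f(3) k])
 define d where "d xi = f' (z + sqrt s * xi) - f' (w + sqrt s * xi)" for xi
 have "integrable gauss (%xi. d xi * k xi)" unfolding d_def left_diff_distrib by (intro integrable_diff i')
 moreover have "abs (d xi) <= l * abs (z - w)" for xi using f(4)[of "z + sqrt s * xi" "w + sqrt s * xi"] by (simp add: d_def)
 ultimately have "abs (GE xi. d xi * k xi) <= l * abs (z - w)" by (rule weighted_bound[OF _ _ k])
 then show "abs ((GE xi. f' (z + sqrt s * xi) * k xi) - (GE xi. f' (w + sqrt s * xi) * k xi)) <= l * abs (z - w)"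
  unfolding d_def left_diff_distrib by (subst (asm) integral_diff[OF i' i'])
 show "((%z. GE xi. f (z + sqrt s * xi) * k xi) has_real_derivative (GE xi. f' (z + sqrt s * xi) * k xi)) (at z)"
 proof (rule deriv_from_quadratic[where c = l])
  fix w
  define R where "R xi = f (z + sqrt s * xi + (w - z)) - f (z + sqrt s * xi) - f' (z + sqrt s * xi) * (w - z)" for xi
  have R: "R xi * k xi = f (w + sqrt s * xi) * k xi - f (z + sqrt s * xi) * k xi - (f' (z + sqrt s * xi) * k xi) * (w - z)" for xi
   by (simp add: R_def algebra_simps)
  have "integrable gauss (%xi. R xi * k xi)"
   unfolding R by (intro integrable_diff integrable_mult_left i i')
  then have "abs (GE xi. R xi * k xi) <= l * (w - z)^2"
   by (rule weighted_bound[OF _ _ k]) (unfold R_def, rule C11_taylor[OF c])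
  moreover have "(GE xi. R xi * k xi) = (GE xi. f (w + sqrt s * xi) * k xi) - (GE xi. f (z + sqrt s * xi) * k xi) - (GE xi. f' (z + sqrt s * xi) * k xi) * (w - z)"
   unfolding R using i i' by simp
  ultimately show "abs ((GE xi. f (w + sqrt s * xi) * k xi) - (GE xi. f (z + sqrt s * xi) * k xi) - (GE xi. f' (z + sqrt s * xi) * k xi) * (w - z)) <= l * (w - z)^2"
   by simp
 qed
qed

lemma C11_heat:
 assumes "C11 a b l f f'"
 shows "C11 a b l (heat s f) (heat s f')"
 using C11_weighted[OF assms, of "%_. 1" s] by (simp add: heat_def[abs_def])

lemma C11_heat_grad:
 assumes "C11 a b l f f'" and s: "0 < s"
 shows "C11 (a / sqrt s) (b / sqrt s) (l / sqrt s) (heat_grad s f) (heat_grad s f')"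
 using C11_scale[OF C11_weighted[OF assms(1), of "%xi. xi" s], of "1 / sqrt s"] gauss_abs_moment s
 by (simp add: heat_grad_def[abs_def])

text \<open>Stein's identity: the standard normal density \<open>n\<close> satisfies \<open>n' = - x n\<close>, and \<open>f n\<close> vanishes at infinity.\<close>

lemma gauss_ibp:
 assumes c: "C11 a b l f f'"
 shows "(GE xi. f xi * xi) = (GE xi. f' xi)"
proof -
 note f = C11_D[OF c] and m[measurable] = C11_borel[OF c]
 let ?n = "std_normal_density"
 define F where "F x = f x * ?n x" for x
 have dn: "(?n has_real_derivative - x * ?n x) (at x)" for x
  unfolding std_normal_density_def
  by (auto intro!: derivative_eq_intros simp: power2_eq_square field_simps)
 have dF: "(F has_vector_derivative (f' x - f x * x) * ?n x) (at x)" for x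
  unfolding F_def has_real_derivative_iff_has_vector_derivative[symmetric]
  by (rule DERIV_cong[OF DERIV_mult[OF f(1) dn]]) (simp add: algebra_simps)
 have i1: "integrable gauss f'" by (rule integrable_gauss_bounded[OF m(2) f(3)])
 have i2: "integrable gauss (%xi. f xi * xi)"
  using integrable_shift(2)[OF m(1) f(2), of 0 1] by simp
 have i: "integrable lborel (%x. (f' x - f x * x) * ?n x)"
  using integrable_diff[OF i1 i2] by (subst (asm) integrable_gauss_iff) (auto simp: mult.commute)
 have ncont: "isCont ?n x" for x using DERIV_isCont[OF dn] .
 have cf': "isCont f' x" for x
 proof -
  have "l-lipschitz_on UNIV f'" using f(4) C11_nonneg(3)[OF c]
   by (intro lipschitz_onI) (auto simp: dist_real_def)
  then show ?thesis using lipschitz_on_continuous_on continuous_on_eq_continuous_at[of UNIV f'] by blast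
 qed
 have nlim1: "(?n \<longlongrightarrow> 0) at_top"
 proof -
  have "LIM x at_top. (1/2) * x^2 :> (at_top :: real filter)"
   by (rule filterlim_tendsto_pos_mult_at_top[OF tendsto_const _ filterlim_pow_at_top[OF _ filterlim_ident]]) auto
  then have "LIM x at_top. - (x^2) / 2 :> (at_bot :: real filter)"
   by (simp add: filterlim_uminus_at_bot)
  from filterlim_compose[OF exp_at_bot this] show ?thesis
   unfolding std_normal_density_def
   by (intro tendsto_mult_right_zero) simp
 qed
 have nlim2: "(?n \<longlongrightarrow> 0) at_bot"
 proof -
  have "(%x. ?n (- x)) = ?n" by (simp add: std_normal_density_def fun_eq_iff)
  then show ?thesis using nlim1 by (simp only: filterlim_at_bot_mirror)
 qed
 have Flim: "(F \<longlongrightarrow> 0) G" if "(?n \<longlongrightarrow> 0) G" for G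
  unfolding F_def
 proof (rule Lim_null_comparison[where g = "%x. a * ?n x"])
  show "\<forall>\<^sub>F x in G. norm (f x * ?n x) <= a * ?n x"
   using f(2) by (intro always_eventually allI) (auto simp: abs_mult normal_density_nonneg intro!: mult_right_mono)
  show "((%x. a * ?n x) \<longlongrightarrow> 0) G"
   using tendsto_mult_right_zero[OF that] by simp
 qed
 have "(LBINT x=-\<infinity>..\<infinity>. (f' x - f x * x) * ?n x) = 0 - 0"
 proof (rule interval_integral_FTC_integrable)
  show "isCont (%x. (f' x - f x * x) * ?n x) x" for x
   using cf' ncont DERIV_isCont[OF f(1)] by (intro continuous_intros) auto
  show "lint (einterval (-\<infinity>) \<infinity>) (%x. (f' x - f x * x) * ?n x)"
   using i by (simp add: set_integrable_def einterval_def)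
  show "((F \<circ> real_of_ereal) \<longlongrightarrow> 0) (at_right (-\<infinity>))" "((F \<circ> real_of_ereal) \<longlongrightarrow> 0) (at_left \<infinity>)"
   using Flim nlim1 nlim2 by (simp_all add: ereal_tendsto_simps)
 qed (use dF in auto)
 then have "(LBINT x. ?n x * (f' x - f x * x)) = 0"
  by (simp add: interval_lebesgue_integral_def set_lebesgue_integral_def einterval_def mult.commute)
 then have "(GE xi. f' xi - f xi * xi) = 0"
  by (subst integral_gauss) auto
 then show ?thesis using i1 i2 by simp
qed

lemma heat_grad_eq_heat_deriv:
 assumes c: "C11 a b l f f'" and s: "0 < s"
 shows "heat_grad s f z = heat s f' z"
proof -
 let ?s = "sqrt s"
 have sp: "0 < ?s" using s by simp
 have "C11 a (?s * b) (?s * ?s * l) (%xi. f (z + ?s * xi)) (%xi. ?s * f' (z + ?s * xi))"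
  unfolding C11_def
 proof (intro conjI allI)
  fix x w
  note f = C11_D[OF c]
  have "((%xi. z + ?s * xi) has_real_derivative ?s) (at x)"
   by (auto intro!: derivative_eq_intros)
  from DERIV_chain2[OF f(1) this]
  show "((%xi. f (z + ?s * xi)) has_real_derivative ?s * f' (z + ?s * x)) (at x)"
   by (simp add: mult.commute)
  show "abs (f (z + ?s * x)) <= a" by (rule f)
  show "abs (?s * f' (z + ?s * x)) <= ?s * b"
   using f(3)[of "z + ?s * x"] sp by (simp add: abs_mult)
  have "?s * abs (f' (z + ?s * x) - f' (z + ?s * w)) <= ?s * (l * abs (?s * (x - w)))"
   using f(4)[of "z + ?s * x" "z + ?s * w"] sp by (intro mult_left_mono) (auto simp: algebra_simps)
  then show "abs (?s * f' (z + ?s * x) - ?s * f' (z + ?s * w)) <= ?s * ?s * l * abs (x - w)"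
  proof -
   assume *: "?s * abs (f' (z + ?s * x) - f' (z + ?s * w)) <= ?s * (l * abs (?s * (x - w)))"
   have "abs (?s * f' (z + ?s * x) - ?s * f' (z + ?s * w)) = ?s * abs (f' (z + ?s * x) - f' (z + ?s * w))"
    using sp by (simp only: right_diff_distrib[symmetric] abs_mult abs_of_pos)
   also note *
   also have "?s * (l * abs (?s * (x - w))) = ?s * ?s * l * abs (x - w)"
    using sp by (simp only: abs_mult abs_of_pos mult_ac)
   finally show ?thesis .
  qed
 qed
 from gauss_ibp[OF this] show ?thesis
  using sp by (simp add: heat_grad_def heat_def)
qed

lemma distr_gauss_scaled:
 assumes "0 < s"
 shows "distr gauss borel (%x. sqrt s * x) = density lborel (%x. ennreal (normal_density 0 (sqrt s) x))"
proof -
 interpret prob_space gauss by (rule prob_space_gauss)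
 have "distributed gauss lborel (%x. x) (%x. ennreal (std_normal_density x))"
  unfolding distributed_def
 proof (intro conjI)
  have "distr gauss lborel (%x. x) = distr gauss gauss (%x. x)" by (rule distr_cong) auto
  then show "distr gauss lborel (%x. x) = density lborel (%x. ennreal (std_normal_density x))"
   by (simp add: distr_id2 gauss_def[symmetric])
 qed auto
 from normal_density_affine[OF this, of "sqrt s" 0]
 have "distributed gauss lborel (%x. sqrt s * x) (%x. ennreal (normal_density 0 (sqrt s) x))"
  using assms by simp
 then have "distr gauss lborel (%x. sqrt s * x) = density lborel (%x. ennreal (normal_density 0 (sqrt s) x))"
  by (simp add: distributed_def)
 moreover have "distr gauss lborel (%x. sqrt s * x) = distr gauss borel (%x. sqrt s * x)"
  by (rule distr_cong) auto
 ultimately show ?thesis by simp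
qed

text \<open>The semigroup property is the convolution of centred normal densities.\<close>

lemma heat_heat:
 assumes m[measurable]: "f \<in> meas borel" and f: "!!z. abs (f z) <= a" and s: "0 < s" "0 < t"
 shows "heat s (heat t f) z = heat (s + t) f z"
proof -
 interpret G: prob_space gauss by (rule prob_space_gauss)
 interpret GG: pair_prob_space gauss gauss ..
 define N where "N s = distr gauss borel (%x. sqrt s * x)" for s
 have Nd: "N u = density lborel (%x. ennreal (normal_density 0 (sqrt u) x))" if "0 < u" for u
  using distr_gauss_scaled[OF that] by (simp add: N_def)
 have pN: "prob_space (N u)" for u unfolding N_def by (rule G.prob_space_distr) simp
 have sN[measurable_cong]: "sets (N u) = sets borel" for u by (simp add: N_def)
 have conv: "(N s \<star> N t) = N (s + t)"
 proof -
  have "(N s \<star> N t) = density lborel (%x. \<integral>\<^sup>+y. ennreal (normal_density 0 (sqrt s) (x - y)) * ennreal (normal_density 0 (sqrt t) y) \<partial>lborel)"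
   using pN[of s] pN[of t] unfolding Nd[OF s(1)] Nd[OF s(2)]
   by (intro convolution_density) (auto simp: prob_space_def)
  also have "... = N (s + t)"
   using s conv_normal_density_zero_mean[of "sqrt s" "sqrt t"]
   by (simp add: Nd ennreal_mult'[symmetric] normal_density_nonneg)
  finally show ?thesis .
 qed
 have i: "integrable (gauss \<Otimes>\<^sub>M gauss) (%(x, y). f (z + sqrt s * x + sqrt t * y))"
  by (rule GG.integrable_const_bound[of _ a]) (use f in auto)
 have "heat s (heat t f) z = (GE x. (GE y. f (z + sqrt s * x + sqrt t * y)))"
  by (simp add: heat_def)
 also have "... = (\<integral>(x, y). f (z + sqrt s * x + sqrt t * y) \<partial>(gauss \<Otimes>\<^sub>M gauss))"
  using GG.integral_fst'[OF i] by simp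
 also have "... = (\<integral>w. f (z + w) \<partial>distr (gauss \<Otimes>\<^sub>M gauss) borel (%(x, y). sqrt s * x + sqrt t * y))"
  by (subst integral_distr) (auto simp: split_beta' add.assoc)
 also have "distr (gauss \<Otimes>\<^sub>M gauss) borel (%(x, y). sqrt s * x + sqrt t * y) = (N s \<star> N t)"
 proof -
  have "N s \<Otimes>\<^sub>M N t = distr (gauss \<Otimes>\<^sub>M gauss) (borel \<Otimes>\<^sub>M borel) (%(x, y). (sqrt s * x, sqrt t * y))"
   unfolding N_def
   by (rule pair_measure_distr) (auto intro!: prob_space_imp_sigma_finite G.prob_space_distr)
  then show ?thesis unfolding convolution_def
   by (auto simp: distr_distr comp_def split_beta')
 qed
 also have "(\<integral>w. f (z + w) \<partial>(N s \<star> N t)) = heat (s + t) f z"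
  unfolding conv by (simp add: N_def integral_distr heat_def)
 finally show ?thesis .
qed

lemma heat_heat_grad:
 assumes c: "C11 a b l f f'" and s: "0 < s" "0 < t"
 shows "heat s (heat_grad t f) z = heat_grad (s + t) f z"
proof -
 have "heat_grad t f = heat t f'" using heat_grad_eq_heat_deriv[OF c s(2)] by auto
 then have "heat s (heat_grad t f) z = heat (s + t) f' z"
  using heat_heat[OF C11_borel(2)[OF c] C11_D(3)[OF c] s] by simp
 then show ?thesis using heat_grad_eq_heat_deriv[OF c, of "s + t"] s by simp
qed

section \<open>The backward recursion\<close>

text \<open>Euler scheme, in reversed time with step \<open>dt\<close>, for \<open>u\<^bsub>t\<^esub> + u''/2 + m (F u)' = 0\<close> with terminal value 1. Index \<open>i\<close> counts the steps made; \<open>F i\<close> is the coefficient used in step \<open>i + 1\<close>.\<close>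

primrec bwd :: "real => real => (nat => real => real) => nat => real => real" where
 "bwd dt m F 0 = (%_. 1)"
| "bwd dt m F (Suc i) = (%z. heat dt (bwd dt m F i) z + m * dt * heat_grad dt (%y. F i y * bwd dt m F i y) z)"

text \<open>The singularity \<open>1 / sqrt\<close> of the gradient kernel is summable: \<open>1 / sqrt n \<le> 2 (sqrt n - sqrt (n - 1))\<close>.\<close>

lemma sum_inverse_sqrt: "(\<Sum>i<n. 1 / sqrt (real (n - i))) <= 2 * sqrt (real n)"
proof -
 have "(\<Sum>i<n. 1 / sqrt (real (n - i))) = (\<Sum>i<n. 1 / sqrt (real (Suc i)))"
  by (subst sum.nat_diff_reindex[symmetric]) (auto intro!: sum.cong)
 also have "... <= 2 * sqrt (real n)"
 proof (induction n)
  case (Suc n)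
  define p q where "p = sqrt (real n)" and "q = sqrt (real (Suc n))"
  have q: "q > 0" "p \<ge> 0" "p <= q" by (auto simp: p_def q_def)
  have "(q - p) * (q + p) = 1" by (simp add: p_def q_def algebra_simps)
  then have "1 <= (q - p) * (2 * q)"
   using mult_left_mono[of "q + p" "2 * q" "q - p"] q by simp
  then have "1 <= (2 * (q - p)) * q" by (simp add: mult_ac)
  then have "1 / q <= 2 * (q - p)"
   using q by (simp only: pos_divide_le_eq)
  then have "1 / sqrt (real (Suc n)) <= 2 * sqrt (real (Suc n)) - 2 * sqrt (real n)"
   by (simp add: p_def q_def)
  then show ?case using Suc by simp
 qed simp
 finally show ?thesis .
qed

text \<open>Applying one more heat step to a Duhamel sum shifts every kernel by \<open>dt\<close>.\<close>

lemma bwd_step_sum: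
 assumes f: "!!i. i < n ==> C11 (a i) (b i) (l i) (f i) (f' i)"
  and dt: "0 < dt"
 shows "heat dt (%z. 1 + c * (\<Sum>i<n. heat_grad (real (n - i) * dt) (f i) z)) z
  = 1 + c * (\<Sum>i<n. heat_grad (real (Suc n - i) * dt) (f i) z)"
proof -
 have i: "integrable gauss (%xi. heat_grad (real (n - i) * dt) (f i) (z + sqrt dt * xi))" if "i < n" for i
 proof -
  have "0 < real (n - i) * dt" using that dt by simp
  from C11_heat_grad[OF f[OF that] this]
  show ?thesis by (intro integrable_shift(1)[OF C11_borel(1) C11_D(2)])
 qed
 have "heat dt (%z. 1 + c * (\<Sum>i<n. heat_grad (real (n - i) * dt) (f i) z)) z
   = 1 + c * (\<Sum>i<n. heat dt (heat_grad (real (n - i) * dt) (f i)) z)"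
 proof -
  have iS: "integrable gauss (%xi. c * (\<Sum>i<n. heat_grad (real (n - i) * dt) (f i) (z + sqrt dt * xi)))"
   by (intro integrable_mult_right integrable_sum i) auto
  show ?thesis
   unfolding heat_def
   by (subst integral_add[OF gauss_integrable_const iS])
     (simp add: integral_sum i del: of_nat_diff)
 qed
 also have "(\<Sum>i<n. heat dt (heat_grad (real (n - i) * dt) (f i)) z) = (\<Sum>i<n. heat_grad (real (Suc n - i) * dt) (f i) z)"
 proof (rule sum.cong)
  fix i assume "i \<in> {..<n}"
  then have "i < n" "0 < real (n - i) * dt" "dt + real (n - i) * dt = real (Suc n - i) * dt"
   using dt by (auto simp: of_nat_diff algebra_simps)
  then show "heat dt (heat_grad (real (n - i) * dt) (f i)) z = heat_grad (real (Suc n - i) * dt) (f i) z"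
   using heat_heat_grad[OF f dt] by metis
 qed simp
 finally show ?thesis .
qed

text \<open>The Duhamel formula turns the recursion into a sum of gradient kernels, so that \<open>u - 1\<close> is of size \<open>m K sqrt (N dt)\<close>. On a short block this is at most 1/2 by induction, whatever the derivatives of \<open>F\<close>. The same sums bound the first derivative of \<open>u\<close> and its Lipschitz constant, by constants that also involve \<open>L\<close> and \<open>l\<close> but not the step \<open>dt\<close>.\<close>

lemma bwd_bounds:
 fixes m K L l :: real
 assumes dt: "0 < dt" and m: "0 <= m" and F: "!!i. i < N ==> C11 K L l (F i) (F' i)"
  and KL: "0 <= K" "0 <= L" "0 <= l"
  and small: "2 * m * sqrt (real N * dt) * K <= 1 / 3"
  and c: "c = 2 * m * sqrt (real N * dt)"
  and b: "b = 3 * c * L" and l2: "l2 = 3 * c * (2 * l + 2 * L * b)"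
  and n: "n <= N"
 shows "bwd dt m F n = (%z. 1 + m * dt * (\<Sum>i<n. heat_grad (real (n - i) * dt) (%y. F i y * bwd dt m F i y) z))
  & (\<exists>v. C11 (3/2) b l2 (bwd dt m F n) v) & (\<forall>z. abs (bwd dt m F n z - 1) <= 1/2)"
 using n
proof (induction n rule: less_induct)
 case (less n)
 let ?w = "bwd dt m F"
 have c0: "0 <= c" "c * K <= 1/3" using m dt small by (auto simp: c)
 have b0: "0 <= b" "0 <= l2" using c0 KL by (auto simp: b l2)
 have "\<exists>v. C11 (3/2) b l2 (?w i) v" if "i < n" for i
  using less.IH[OF that] that less.prems by (meson le_trans less_imp_le)
 then obtain v where v: "!!i. i < n ==> C11 (3/2) b l2 (?w i) (v i)" by metis
 define A B D where "A = K * (3/2)" and "B = L * (3/2) + K * b" and "D = l * (3/2) + 2 * L * b + K * l2"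
 define f where "f i y = F i y * ?w i y" for i y
 define f' where "f' i y = F' i y * ?w i y + F i y * v i y" for i y
 have f: "C11 A B D (f i) (f' i)" if "i < n" for i
  using C11_mult[OF F v, of i] that less.prems unfolding f_def f'_def A_def B_def D_def by simp
 have form: "?w n = (%z. 1 + m * dt * (\<Sum>i<n. heat_grad (real (n - i) * dt) (f i) z))"
 proof (cases n)
  case 0
  then show ?thesis by simp
 next
  case (Suc k)
  have wk: "?w k = (%z. 1 + m * dt * (\<Sum>i<k. heat_grad (real (k - i) * dt) (f i) z))"
  proof -
   have "k < n" "k <= N" using less.prems Suc by auto
   from less.IH[OF this] show ?thesis unfolding f_def[abs_def] by (rule conjunct1)
  qed
  have "heat dt (?w k) z = 1 + m * dt * (\<Sum>i<k. heat_grad (real (Suc k - i) * dt) (f i) z)" for z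
   by (subst wk, rule bwd_step_sum[OF f dt]) (use Suc in auto)
  then show ?thesis
   by (simp add: Suc f_def[abs_def] distrib_left add.assoc)
 qed
 let ?S = "\<Sum>i<n. 1 / sqrt (real (n - i) * dt)"
 have hg: "C11 (A / sqrt (real (n - i) * dt)) (B / sqrt (real (n - i) * dt)) (D / sqrt (real (n - i) * dt))
   (heat_grad (real (n - i) * dt) (f i)) (heat_grad (real (n - i) * dt) (f' i))" if "i \<in> {..<n}" for i
  using that dt by (intro C11_heat_grad f) auto
 have sum: "C11 (A * ?S) (B * ?S) (D * ?S) (%z. \<Sum>i<n. heat_grad (real (n - i) * dt) (f i) z)
   (%z. \<Sum>i<n. heat_grad (real (n - i) * dt) (f' i) z)"
 proof -
  have e: "x * ?S = (\<Sum>i<n. x / sqrt (real (n - i) * dt))" for x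
   by (simp only: sum_distrib_left mult_1_right times_divide_eq_right)
  show ?thesis unfolding e by (rule C11_sum[OF hg]) auto
 qed
 have md: "0 <= m * dt" using m dt by simp
 have S: "m * dt * ?S <= c"
 proof -
  have "?S = (\<Sum>i<n. 1 / sqrt (real (n - i))) / sqrt dt"
   by (simp add: real_sqrt_mult sum_divide_distrib)
  also have "... <= (2 * sqrt (real n)) / sqrt dt"
   using dt by (intro divide_right_mono sum_inverse_sqrt) auto
  finally have "m * dt * ?S <= m * dt * ((2 * sqrt (real n)) / sqrt dt)"
   using md by (intro mult_left_mono)
  also have "... = 2 * m * (sqrt (real n) * sqrt dt)"
  proof -
   have "m * dt * ((2 * sqrt (real n)) / sqrt dt) = 2 * m * (sqrt (real n) * (dt / sqrt dt))" by simp
   then show ?thesis using real_div_sqrt[of dt] dt by simp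
  qed
  also have "... = 2 * m * sqrt (real n * dt)" by (simp add: real_sqrt_mult)
  also have "... <= c" unfolding c using m dt less.prems
   by (intro mult_left_mono real_sqrt_le_mono mult_right_mono) auto
  finally show ?thesis .
 qed
 have AB: "0 <= A" "0 <= B" "0 <= D" using KL b0 by (auto simp: A_def B_def D_def)
 have bd: "m * dt * (x * ?S) <= c * x" if "0 <= x" for x
  using mult_right_mono[OF S that] by (simp add: mult_ac)
 have cA: "c * A <= 1/2" using c0 by (simp add: A_def mult_ac)
 have cB: "c * B <= b"
 proof -
  have "c * B = 3/2 * (c * L) + (c * K) * b" by (simp add: B_def algebra_simps)
  also have "... <= 3/2 * (c * L) + 1/3 * b" using mult_right_mono[OF c0(2) b0(1)] by simp
  also have "... <= b" using c0 KL by (simp add: b)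
  finally show ?thesis .
 qed
 have cD: "c * D <= l2"
 proof -
  have "c * D = c * (3/2 * l + 2 * L * b) + (c * K) * l2" by (simp add: D_def algebra_simps)
  also have "... <= c * (2 * l + 2 * L * b) + 1/3 * l2"
   using mult_right_mono[OF c0(2) b0(2)] KL c0 by (intro add_mono mult_left_mono) auto
  also have "... <= l2" using c0 KL b0 by (simp add: l2)
  finally show ?thesis .
 qed
 define V where "V z = m * dt * (\<Sum>i<n. heat_grad (real (n - i) * dt) (f' i) z)" for z
 have tail: "C11 (1/2) b l2 (%z. m * dt * (\<Sum>i<n. heat_grad (real (n - i) * dt) (f i) z)) V"
  unfolding V_def using C11_scale[OF sum, of "m * dt"] md bd[OF AB(1)] bd[OF AB(2)] bd[OF AB(3)] cA cB cD
  by (elim C11_mono) auto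
 have "C11 (3/2) b l2 (?w n) V"
  using C11_add[OF C11_const[of 1] tail] unfolding form by simp
 moreover have "abs (?w n z - 1) <= 1/2" for z
  unfolding form using C11_D(2)[OF tail] by simp
 ultimately show ?case using form unfolding f_def by blast
qed

section \<open>One backward step of a small power\<close>

lemma powr_half_bounds:
 fixes t :: real
 assumes t: "1/2 <= t" "t <= 3/2"
 shows "-1 <= e ==> e <= 0 ==> t powr e <= 2"
  and "-2 <= e ==> e <= 0 ==> t powr e <= 4"
  and "-2 <= e ==> e <= 0 ==> 4/9 <= t powr e"
  and "0 <= e ==> e <= 1 ==> 1/2 <= t powr e"
  and "0 <= e ==> e <= 1 ==> t powr e <= 3/2"
proof -
 have t0: "0 < t" using t by simp
 { assume e: "e <= 0"
  have "t powr e <= (1/2) powr e" using powr_mono2'[OF e _ t(1)] by simp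
  also have "... = 2 powr (- e)" by (simp add: powr_divide powr_minus_divide)
  finally have u: "t powr e <= 2 powr (- e)" .
  { assume "-1 <= e"
   then have "2 powr (- e) <= 2 powr (1::real)" by (intro powr_mono) auto
   with u show "t powr e <= 2" by simp }
  { assume e2: "-2 <= e"
   then have "2 powr (- e) <= 2 powr (2::real)" by (intro powr_mono) auto
   with u show "t powr e <= 4" by simp
   have "(4/9::real) = (3/2) powr (-2)" by (simp add: powr_minus_divide power_divide)
   also have "... <= (3/2) powr e" using e2 by (intro powr_mono) auto
   also have "... <= t powr e" using powr_mono2'[OF e t0 t(2)] .
   finally show "4/9 <= t powr e" . } }
 { assume e: "0 <= e" "e <= 1"
  have "1/2 <= (1/2::real) powr e"
   using powr_mono'[of e 1 "1/2::real"] e by simp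
  also have "... <= t powr e" using e t by (intro powr_mono2) auto
  finally show "1/2 <= t powr e" .
  have "t powr e <= (3/2) powr e" using e t by (intro powr_mono2) auto
  also have "... <= (3/2::real) powr 1" using e by (intro powr_mono) auto
  finally show "t powr e <= 3/2" by simp }
qed

text \<open>Strict concavity of \<open>u\<^bsup>\<gamma>\<^esup>\<close> on \<open>[1/2, 3/2]\<close>: the second derivative is at most \<open>- 2 \<gamma> / 9\<close>. The upper bound keeps this gain; the lower bound only needs a crude constant.\<close>

lemma powr_taylor2:
 fixes u v ga :: real
 assumes g: "0 < ga" "ga <= 1/2" and u: "1/2 <= u" "u <= 3/2" and v: "1/2 <= v" "v <= 3/2"
 shows "v powr ga <= u powr ga + ga * u powr (ga - 1) * (v - u) - ga / 9 * (v - u)^2"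
  and "u powr ga + ga * u powr (ga - 1) * (v - u) - (v - u)^2 <= v powr ga"
proof -
 define d where "d n x = (if n = 0 then x powr ga else if n = 1 then ga * x powr (ga - 1)
  else ga * ((ga - 1) * x powr (ga - 2)))" for n :: nat and x
 have "\<exists>t. 1/2 <= t & t <= 3/2 &
   v powr ga = u powr ga + ga * u powr (ga - 1) * (v - u) + ga * ((ga - 1) * t powr (ga - 2)) / 2 * (v - u)^2"
 proof (cases "v = u")
  case True
  then show ?thesis using u by auto
 next
  case False
  have D: "DERIV (d m) t :> d (Suc m) t" if "m < 2" "1/2 <= t" for m :: nat and t
   using that unfolding d_def by (auto simp: less_2_cases_iff intro!: derivative_eq_intros)
  have d0: "d 0 = (%x. x powr ga)" by (simp add: d_def fun_eq_iff)
  from Taylor[of 2 d "%x. x powr ga" "1/2" "3/2" u v] D d0 u v False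
  obtain t where t: "if v < u then v < t & t < u else u < t & t < v"
   and e: "v powr ga = (\<Sum>m<2. (d m u / fact m) * (v - u)^m) + (d 2 t / fact 2) * (v - u)^2"
   by auto
  have "1/2 <= t" "t <= 3/2" using t u v by (auto split: if_splits)
  moreover have "{..<2::nat} = {0, 1}" by auto
  ultimately show ?thesis using e by (intro exI[of _ t]) (auto simp: d_def)
 qed
 then obtain t where t: "1/2 <= t" "t <= 3/2"
  and e: "v powr ga = u powr ga + ga * u powr (ga - 1) * (v - u) + ga * ((ga - 1) * t powr (ga - 2)) / 2 * (v - u)^2"
  by blast
 define p where "p = t powr (ga - 2)"
 have p: "4/9 <= p" "p <= 4"
  using powr_half_bounds(2,3)[OF t, of "ga - 2"] g by (auto simp: p_def)
 have "ga * (1/2 * (4/9)) <= ga * ((1 - ga) * p)"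
  using g p by (intro mult_left_mono mult_mono) auto
 then have "ga * ((ga - 1) * p) / 2 <= - (ga / 9)" by (simp add: algebra_simps)
 from mult_right_mono[OF this, of "(v - u)^2"]
 show "v powr ga <= u powr ga + ga * u powr (ga - 1) * (v - u) - ga / 9 * (v - u)^2"
  using e by (simp add: p_def)
 have "ga * ((1 - ga) * p) <= (1/2) * (1 * 4)"
  using g p by (intro mult_mono) auto
 then have "-1 <= ga * ((ga - 1) * p) / 2" by (simp add: algebra_simps)
 from mult_right_mono[OF this, of "(v - u)^2"]
 show "u powr ga + ga * u powr (ga - 1) * (v - u) - (v - u)^2 <= v powr ga"
  using e by (simp add: p_def)
qed

lemma C11_powr:
 fixes ga :: real
 assumes g: "0 < ga" "ga <= 1/2" and c: "C11 a b l u u'" and r: "!!z. abs (u z - 1) <= 1/2"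
 shows "C11 (3/2) b (2 * b^2 + l) (%z. u z powr ga) (%z. ga * u z powr (ga - 1) * u' z)"
 unfolding C11_def
proof (intro conjI allI)
 fix z w
 note C = C11_D[OF c] and nn = C11_nonneg[OF c]
 have r: "1/2 <= u z" "u z <= 3/2" for z using r[of z] by linarith+
 have u0: "0 < u z" for z using r[of z] by simp
 show "((%z. u z powr ga) has_real_derivative ga * u z powr (ga - 1) * u' z) (at z)"
  using u0 by (auto intro!: derivative_eq_intros C(1))
 show "abs (u z powr ga) <= 3/2" using powr_half_bounds(5)[OF r, of ga] g by simp
 have p2: "u z powr (ga - 1) <= 2" for z using powr_half_bounds(1)[OF r, of "ga - 1"] g by simp
 have "abs (ga * u z powr (ga - 1) * u' z) = ga * (u z powr (ga - 1)) * abs (u' z)" using g by (simp add: abs_mult)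
 also have "... <= (1/2 * 2) * b" using g p2 C nn by (intro mult_mono) auto
 finally show "abs (ga * u z powr (ga - 1) * u' z) <= b" by simp
 have lip: "abs (s powr (ga - 1) - t powr (ga - 1)) <= 4 * abs (s - t)"
  if st: "1/2 <= s" "s <= 3/2" "1/2 <= t" "t <= 3/2" for s t
 proof -
  have "norm (s powr (ga - 1) - t powr (ga - 1)) <= 4 * norm (s - t)"
  proof (rule field_differentiable_bound[where S = "{1/2..3/2}" and f' = "%x. (ga - 1) * x powr (ga - 2)"])
   fix x :: real assume x: "x \<in> {1/2..3/2}"
   then show "((%x. x powr (ga - 1)) has_field_derivative (ga - 1) * x powr (ga - 2)) (at x within {1/2..3/2})"
    by (auto intro!: derivative_eq_intros)
   have "abs (ga - 1) * x powr (ga - 2) <= 1 * 4"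
    using powr_half_bounds(2)[of x "ga - 2"] x g by (intro mult_mono) auto
   then show "norm ((ga - 1) * x powr (ga - 2)) <= 4" by (simp add: abs_mult)
  qed (use st in auto)
  then show ?thesis by simp
 qed
 have "abs (ga * u z powr (ga - 1) * u' z - ga * u w powr (ga - 1) * u' w)
   = ga * abs ((u z powr (ga - 1) - u w powr (ga - 1)) * u' z + u w powr (ga - 1) * (u' z - u' w))"
  using g by (simp add: abs_mult[symmetric] algebra_simps) (simp add: abs_mult right_diff_distrib[symmetric])
 also have "... <= ga * (abs (u z powr (ga - 1) - u w powr (ga - 1)) * abs (u' z) + u w powr (ga - 1) * abs (u' z - u' w))"
  using g by (intro mult_left_mono order_trans[OF abs_triangle_ineq]) (auto simp: abs_mult)
 also have "... <= 1/2 * ((4 * (b * abs (z - w))) * b + 2 * (l * abs (z - w)))"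
 proof (intro mult_mono add_mono)
  show "abs (u z powr (ga - 1) - u w powr (ga - 1)) <= 4 * (b * abs (z - w))"
   by (rule order_trans[OF lip[OF r r] mult_left_mono[OF C11_lipschitz[OF c]]]) simp
 qed (use g C nn p2 in auto)
 also have "... = (2 * b^2 + l) * abs (z - w)" by (simp add: power2_eq_square algebra_simps)
 finally show "abs (ga * u z powr (ga - 1) * u' z - ga * u w powr (ga - 1) * u' w) <= (2 * b^2 + l) * abs (z - w)" .
qed

text \<open>First order expansion of the Gaussian average, with errors in terms of the Lipschitz constant of \<open>u'\<close>. The third part says that the local variance of \<open>u\<close> is \<open>\<delta> u'\<^sup>2\<close> up to order \<open>\<delta>\<^bsup>3/2\<^esup>\<close>.\<close>

lemma heat_expand:
 assumes c: "C11 a b l u u'" and d: "0 < dt"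
 shows "abs (heat dt u z - u z) <= l * dt"
  and "abs (heat_grad dt u z - u' z) <= 2 * l * sqrt dt"
  and "dt * (u' z)^2 - 4 * b * l * (dt * sqrt dt) <= (GE xi. (u (z + sqrt dt * xi) - u z)^2)"
proof -
 note C = C11_D[OF c] and m[measurable] = C11_borel[OF c] and nn = C11_nonneg[OF c]
 define rh where "rh xi = u (z + sqrt dt * xi) - u z - u' z * (sqrt dt * xi)" for xi
 have [measurable]: "rh \<in> meas borel" unfolding rh_def by measurable
 have rh: "abs (rh xi) <= l * dt * xi^2" for xi
  using C11_taylor[OF c, of z "sqrt dt * xi"] d by (simp add: rh_def power_mult_distrib mult_ac)
 have sq[simp, intro]: "integrable gauss (%x. x^2)" by (rule integrable_gauss_power)
 have irh: "integrable gauss rh"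
  by (rule integrable_bound[where f = "%xi. l * dt * xi^2"]) (use rh nn d in auto)
 have irhxi: "integrable gauss (%xi. rh xi * xi)"
 proof (rule integrable_bound[where f = "%xi. l * dt * abs xi ^ 3"])
  show "AE xi in gauss. norm (rh xi * xi) <= norm (l * dt * abs xi ^ 3)"
   using mult_right_mono[OF rh, of "abs _"] nn d
   by (intro AE_I2) (auto simp: abs_mult power3_eq_cube power2_eq_square mult_ac)
 qed auto
 have eq: "u (z + sqrt dt * xi) = u z + u' z * sqrt dt * xi + rh xi" for xi by (simp add: rh_def)
 have il: "integrable gauss (%xi. u z + u' z * sqrt dt * xi)"
  by (intro integrable_add integrable_mult_right) auto
 have "heat dt u z - u z = (GE xi. rh xi)"
  unfolding heat_def eq using irh il by (simp add: gauss_mean integral_add[OF gauss_integrable_const])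
 also have "abs ... <= (GE xi. abs (rh xi))" by (rule integral_abs_bound)
 also have "... <= (GE xi. l * dt * xi^2)" using irh rh by (intro integral_mono) auto
 finally show "abs (heat dt u z - u z) <= l * dt" by (simp add: gauss_second_moment)

 have il2: "integrable gauss (%xi. u z * xi + u' z * sqrt dt * xi^2)"
  by (intro integrable_add integrable_mult_right) auto
 have "u (z + sqrt dt * xi) * xi = u z * xi + u' z * sqrt dt * xi^2 + rh xi * xi" for xi
  unfolding eq by (simp add: algebra_simps power2_eq_square)
 then have "(GE xi. u (z + sqrt dt * xi) * xi) = u' z * sqrt dt + (GE xi. rh xi * xi)"
  using il2 irhxi by (simp add: gauss_mean gauss_second_moment)
 then have "heat_grad dt u z - u' z = (GE xi. rh xi * xi) / sqrt dt"
  using d by (simp add: heat_grad_def add_divide_distrib)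
 moreover have r3: "(GE xi. abs (rh xi * xi)) <= 2 * l * dt"
 proof -
  have "(GE xi. abs (rh xi * xi)) <= (GE xi. l * dt * abs xi ^ 3)"
  proof (rule integral_mono)
   show "integrable gauss (%xi. abs (rh xi * xi))" by (rule integrable_abs[OF irhxi])
   show "abs (rh xi * xi) <= l * dt * abs xi ^ 3" for xi
    using mult_right_mono[OF rh, of "abs xi" xi]
    by (simp add: abs_mult power3_eq_cube power2_eq_square mult_ac)
  qed auto
  also have "... <= l * dt * 2" using gauss_abs_cube_moment nn d by (simp add: mult_left_mono)
  finally show ?thesis by simp
 qed
 moreover have r4: "abs (GE xi. rh xi * xi) <= 2 * l * dt"
  by (rule order_trans[OF integral_abs_bound r3])
 ultimately have "abs (heat_grad dt u z - u' z) <= 2 * l * dt / sqrt dt"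
  using d by (simp add: abs_divide divide_right_mono)
 also have "... = 2 * l * sqrt dt" using real_div_sqrt[of dt] d by (metis less_imp_le times_divide_eq_right)
 finally show "abs (heat_grad dt u z - u' z) <= 2 * l * sqrt dt" .

 have i1: "integrable gauss (%xi. dt * (u' z)^2 * xi^2)"  by auto
 have i2: "integrable gauss (%xi. 2 * u' z * sqrt dt * (rh xi * xi))" using irhxi by auto
 have "dt * (u' z)^2 - 4 * b * l * (dt * sqrt dt) <= dt * (u' z)^2 + 2 * u' z * sqrt dt * (GE xi. rh xi * xi)"
 proof -
  have "abs (2 * u' z * sqrt dt * (GE xi. rh xi * xi)) <= (2 * b * sqrt dt) * (2 * l * dt)"
   unfolding abs_mult using C(3)[of z] nn d r4
   by (intro mult_mono) auto
  then show ?thesis by (simp add: mult_ac)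
 qed
 also have "... = (GE xi. dt * (u' z)^2 * xi^2 + 2 * u' z * sqrt dt * (rh xi * xi))"
  using i1 i2 by (simp add: gauss_second_moment)
 also have "... <= (GE xi. (u (z + sqrt dt * xi) - u z)^2)"
 proof (rule integral_mono)
  show "integrable gauss (%xi. dt * (u' z)^2 * xi^2 + 2 * u' z * sqrt dt * (rh xi * xi))" using i1 i2 by auto
  show "integrable gauss (%xi. (u (z + sqrt dt * xi) - u z)^2)"
  proof (rule integrable_gauss_bounded[where a = "(2 * a)^2"])
   show "abs ((u (z + sqrt dt * xi) - u z)^2) <= (2 * a)^2" for xi
   proof -
    have "abs (u (z + sqrt dt * xi) - u z) <= abs (2 * a)"
     using C(2)[of "z + sqrt dt * xi"] C(2)[of z] by linarith
    then show ?thesis by (simp only: abs_le_square_iff abs_power2)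
   qed
  qed measurable
  fix xi
  have "(u (z + sqrt dt * xi) - u z)^2 = (u' z * sqrt dt * xi + rh xi)^2" unfolding eq by simp
  also have "... = dt * (u' z)^2 * xi^2 + 2 * u' z * sqrt dt * (rh xi * xi) + (rh xi)^2"
   using d by (simp add: power2_sum power_mult_distrib mult_ac)
  finally show "dt * (u' z)^2 * xi^2 + 2 * u' z * sqrt dt * (rh xi * xi) <= (u (z + sqrt dt * xi) - u z)^2" by simp
 qed
 finally show "dt * (u' z)^2 - 4 * b * l * (dt * sqrt dt) <= (GE xi. (u (z + sqrt dt * xi) - u z)^2)" .
qed

text \<open>The discrete form of the differential inequality for \<open>h = u\<^bsup>\<gamma>\<^esup>\<close>. The Gaussian average of \<open>h\<close> is computed from the concave upper bound, the new value \<open>w\<^bsup>\<gamma>\<^esup>\<close> from the lower bound; in the difference the terms \<open>2 K \<bar>u'\<bar>\<close> and \<open>2 \<gamma> \<alpha> \<bar>u'\<bar>\<close> meet \<open>- \<gamma> u'\<^sup>2 / 9\<close>, and completing the square leaves \<open>18 K\<^sup>2/\<gamma> + 18 \<gamma> \<alpha>\<^sup>2\<close>. The factor 2 up to the constants 36 comes from \<open>w\<^bsup>\<gamma>\<^esup> \<ge> 1/2\<close>.\<close>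

lemma one_step:
 fixes ga K L lF b l dt al :: real
 assumes g: "0 < ga" "ga <= 1/2" and u: "C11 (3/2) b l u u'" and ru: "!!z. abs (u z - 1) <= 1/2"
  and F: "C11 K L lF F F'" and d: "0 < dt" "dt <= 1" and a: "0 <= al"
  and w: "w = heat dt u z + 1 / ga * dt * heat_grad dt (%y. F y * u y) z" and rw: "abs (w - 1) <= 1/2"
  and D: "D = l + (L * (3/2) + K * b + 2 * (lF * (3/2) + 2 * L * b + K * l)) / ga"
  and C: "C = 2 * (lF * (3/2) + 2 * L * b + K * l) / ga + 4 * b * l + D^2 + L * D"
 shows "heat dt (%z. u z powr ga) z + dt * abs (ga * u z powr (ga - 1) * u' z) * al
  <= w powr ga * (1 - dt * (F' z - 36 * ga * al^2 - 36 * K^2 / ga)) + C * (dt * sqrt dt)"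
proof -
 note Cu = C11_D[OF u] and mu[measurable] = C11_borel[OF u] and nu = C11_nonneg[OF u]
 note CF = C11_D[OF F] and nF = C11_nonneg[OF F]
 define f where "f y = F y * u y" for y
 define f' where "f' y = F' y * u y + F y * u' y" for y
 define bf where "bf = L * (3/2) + K * b"
 define lf where "lf = lF * (3/2) + 2 * L * b + K * l"
 have f: "C11 (K * (3/2)) bf lf f f'"
  using C11_mult[OF F u] by (simp add: f_def[abs_def] f'_def[abs_def] bf_def lf_def)
 note nf = C11_nonneg[OF f]
 have r: "1/2 <= u z" "u z <= 3/2" for z using ru[of z] by linarith+
 have rw': "1/2 <= w" "w <= 3/2" using rw by linarith+
 define U p h hw where "U = u z" and "p = u z powr (ga - 1)" and "h = u z powr ga" and "hw = w powr ga"
 have p: "0 <= p" "p <= 2" using powr_half_bounds(1)[OF r, of "ga - 1" z] g by (auto simp: p_def)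
 have hw: "1/2 <= hw" using powr_half_bounds(4)[OF rw', of ga] g by (simp add: hw_def)
 have pU: "p * U = h" using r(1)[of z] by (simp add: p_def U_def h_def powr_mult_base powr_diff)
 have gp: "ga * p <= 1" using mult_mono[of ga "1/2" p 2] g p by simp
 define s where "s = dt * sqrt dt"
 have s: "0 <= s" "dt^2 <= s" "s <= dt"
 proof -
  show "0 <= s" using d by (simp add: s_def)
  have sd: "sqrt dt <= 1" "dt <= sqrt dt"
   using d real_sqrt_le_mono[of "dt^2" dt] by (auto simp: power2_eq_square mult_left_le)
  show "dt^2 <= s" "s <= dt" using sd d by (auto simp: s_def power2_eq_square mult_left_le)
 qed
 define e where "e = heat_grad dt f z - f' z"
 have e: "abs e <= 2 * lf * sqrt dt" unfolding e_def by (rule heat_expand(2)[OF f d(1)])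
 define v where "v = heat dt u z - U"
 have v: "abs v <= l * dt" unfolding v_def U_def by (rule heat_expand(1)[OF u d(1)])
 have wU: "w - U = v + dt * f' z / ga + dt * e / ga"
  by (simp add: w v_def e_def f_def[symmetric, abs_def] diff_divide_distrib algebra_simps)
 \<comment> \<open>the increment of the backward solution over one step is of order delta\<close>
 have D0: "0 <= D" using nu nF g by (simp add: D)
 have Deq: "D = l + (bf + 2 * lf) / ga" by (simp add: D bf_def lf_def)
 have wUb: "abs (w - U) <= dt * D"
 proof -
  have "sqrt dt <= 1" using d by simp
  then have "2 * lf * sqrt dt <= 2 * lf" using nf by (simp add: mult_left_le)
  then have e': "abs e <= 2 * lf" using e by linarith
  have "abs (w - U) <= abs v + dt * abs (f' z) / ga + dt * abs e / ga"
   unfolding wU using d g abs_triangle_ineq[of "v + dt * f' z / ga" "dt * e / ga"] abs_triangle_ineq[of v "dt * f' z / ga"]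
   by (simp add: abs_mult abs_divide)
  also have "... <= l * dt + dt * bf / ga + dt * (2 * lf) / ga"
   using v C11_D(3)[OF f, of z] e' d g by (intro add_mono divide_right_mono mult_left_mono) auto
  also have "... = dt * D" by (simp add: Deq add_divide_distrib algebra_simps)
  finally show ?thesis .
 qed
 \<comment> \<open>concavity of the power function gains a square of the gradient\<close>
 have H: "heat dt (%z. u z powr ga) z <= h + ga * p * v - ga / 9 * (dt * (u' z)^2 - 4 * b * l * s)"
 proof -
  have [measurable]: "(%x. u x powr ga) \<in> meas borel" by measurable
  have iu: "integrable gauss (%xi. u (z + sqrt dt * xi))"
   by (rule integrable_shift(1)[OF mu(1) Cu(2)])
  have isq: "integrable gauss (%xi. (u (z + sqrt dt * xi) - U)^2)"
  proof (rule integrable_gauss_bounded[where a = 1])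
   show "abs ((u (z + sqrt dt * xi) - U)^2) <= 1" for xi
    using r[of "z + sqrt dt * xi"] r[of z] unfolding U_def
    by (simp add: abs_square_le_1 abs_le_iff)
  qed measurable
  have "heat dt (%z. u z powr ga) z <=
   (GE xi. h + ga * p * (u (z + sqrt dt * xi) - U) - ga / 9 * (u (z + sqrt dt * xi) - U)^2)"
   unfolding heat_def
  proof (rule integral_mono)
   show "integrable gauss (%xi. u (z + sqrt dt * xi) powr ga)"
    using integrable_shift(1)[OF C11_borel(1) C11_D(2), OF C11_powr[OF g u ru] C11_powr[OF g u ru]] .
   show "integrable gauss (%xi. h + ga * p * (u (z + sqrt dt * xi) - U) - ga / 9 * (u (z + sqrt dt * xi) - U)^2)"
    using iu isq by auto
   show "u (z + sqrt dt * xi) powr ga <= h + ga * p * (u (z + sqrt dt * xi) - U) - ga / 9 * (u (z + sqrt dt * xi) - U)^2" for xi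
    unfolding h_def p_def U_def by (rule powr_taylor2(1)[OF g r r])
  qed
  also have "... = h + ga * p * v - ga / 9 * (GE xi. (u (z + sqrt dt * xi) - U)^2)"
   using iu isq by (simp add: v_def heat_def)
  also have "... <= h + ga * p * v - ga / 9 * (dt * (u' z)^2 - 4 * b * l * s)"
   using mult_left_mono[OF heat_expand(3)[OF u d(1), of z], of "ga / 9"] g
   by (simp add: s_def U_def)
  finally show ?thesis .
 qed
 have W: "h + ga * p * (w - U) - (w - U)^2 <= hw"
  unfolding h_def p_def U_def hw_def by (rule powr_taylor2(2)[OF g r rw'])
 have w2: "(w - U)^2 <= D^2 * s"
 proof -
  have "(w - U)^2 <= (dt * D)^2" using wUb by (rule power2_le_iff_abs_le[THEN iffD2, rotated]) (use d D0 in auto)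
  also have "... <= D^2 * s" using mult_left_mono[OF s(2), of "D^2"] by (simp add: power_mult_distrib mult_ac)
  finally show ?thesis .
 qed
 have pe: "abs (p * (dt * e)) <= 2 * lf / ga * s"
 proof -
  have "p * ga * (dt * abs e) <= 1 * (dt * (2 * lf * sqrt dt))"
   using gp e d g p nf by (intro mult_mono mult_left_mono) (auto simp: mult_ac)
  then have "p * (dt * abs e) <= (dt * (2 * lf * sqrt dt)) / ga" using g by (simp add: pos_le_divide_eq mult_ac)
  then show ?thesis using p d by (simp add: abs_mult s_def mult_ac)
 qed
 have gpf: "ga * p * (w - U) = ga * p * v + dt * (F' z * h + F z * p * u' z) + p * (dt * e)"
 proof -
  have "ga * (w - U) = ga * v + dt * f' z + dt * e" using g unfolding wU by (simp add: distrib_left)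
  then have "ga * p * (w - U) = p * (ga * v + dt * f' z + dt * e)" by (simp add: mult_ac)
  then show ?thesis unfolding pU[symmetric] by (simp add: f'_def U_def algebra_simps)
 qed
 \<comment> \<open>the first-order terms are absorbed by the square of the gradient\<close>
 define q where "q = abs (u' z)"
 have quad: "2 * K * q + 2 * ga * al * q - ga / 9 * q^2 <= 18 * K^2 / ga + 18 * ga * al^2"
 proof -
  define S where "S = K + ga * al"
  have "0 <= (ga * q - 9 * S)^2" by simp
  also have "... = ga^2 * q^2 - 18 * (ga * q * S) + 81 * S^2" by (simp add: power2_eq_square algebra_simps)
  finally have "18 * ga * q * S - ga^2 * q^2 <= 81 * S^2" by simp
  moreover have "S^2 <= 2 * K^2 + 2 * (ga * al)^2"
   using zero_le_power2[of "K - ga * al"] by (simp add: S_def power2_eq_square algebra_simps)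
  ultimately have "18 * ga * q * S - ga^2 * q^2 <= 162 * K^2 + 162 * ga^2 * al^2" by (simp add: power_mult_distrib)
  then have "(18 * ga * q * S - ga^2 * q^2) / (9 * ga) <= (162 * K^2 + 162 * ga^2 * al^2) / (9 * ga)"
   using g by (intro divide_right_mono) auto
  then show ?thesis using g by (simp add: S_def diff_divide_distrib add_divide_distrib power2_eq_square algebra_simps)
 qed
 have Fp: "- (F z * p * u' z) <= 2 * K * q"
 proof -
  have "abs (F z * p * u' z) <= K * 2 * q" unfolding abs_mult q_def
   using CF(2)[of z] p nF by (intro mult_mono) auto
  then show ?thesis by (simp add: mult_ac)
 qed
 have hp: "abs (ga * p * u' z) * al <= 2 * ga * al * q"
  using g p a mult_right_mono[OF p(2), of "ga * q * al"] by (simp add: abs_mult q_def mult_ac)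
 have hhw: "abs (hw - h) <= D * dt"
 proof -
  have "norm (w powr ga - U powr ga) <= 1 * norm (w - U)"
  proof (rule field_differentiable_bound[where S = "{1/2..3/2}" and f' = "%x. ga * x powr (ga - 1)"])
   fix x :: real assume x: "x \<in> {1/2..3/2}"
   then show "((%x. x powr ga) has_field_derivative ga * x powr (ga - 1)) (at x within {1/2..3/2})"
    by (auto intro!: derivative_eq_intros)
   have "ga * x powr (ga - 1) <= (1/2) * 2"
    using powr_half_bounds(1)[of x "ga - 1"] x g by (intro mult_mono) auto
   then show "norm (ga * x powr (ga - 1)) <= 1" using g by (simp add: abs_mult)
  qed (use rw' r in \<open>auto simp: U_def\<close>)
  then show ?thesis using wUb by (simp add: hw_def h_def U_def mult_ac)
 qed
 have Fh: "- (dt * (F' z * h)) <= - (dt * (F' z * hw)) + L * D * s"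
 proof -
  have "abs (dt * (F' z * (hw - h))) <= dt * (L * (D * dt))"
   unfolding abs_mult using d CF(3)[of z] hhw nF by (intro mult_mono) auto
  also have "... = L * D * dt^2" by (simp add: power2_eq_square mult_ac)
  also have "... <= L * D * s" using s nF D0 by (intro mult_left_mono) auto
  finally have "dt * (F' z * (hw - h)) <= L * D * s" by linarith
  then show ?thesis by (simp add: algebra_simps)
 qed
 have "heat dt (%z. u z powr ga) z + dt * abs (ga * p * u' z) * al
   <= hw + (w - U)^2 - dt * (F' z * h) - dt * (F z * p * u' z) - p * (dt * e)
    - ga / 9 * (dt * q^2) + ga / 9 * (4 * b * l * s) + dt * (2 * ga * al * q)"
  using H W gpf mult_left_mono[OF hp, of dt] d by (simp add: q_def algebra_simps)
 also have "... <= hw + D^2 * s - dt * (F' z * hw) + L * D * s + dt * (2 * K * q) + 2 * lf / ga * s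
    - ga / 9 * (dt * q^2) + 4 * b * l * s + dt * (2 * ga * al * q)"
 proof -
  have "ga / 9 * (4 * b * l * s) <= 1 * (4 * b * l * s)" using g nu s by (intro mult_right_mono) auto
  moreover have "- (dt * (F z * p * u' z)) <= dt * (2 * K * q)" using mult_left_mono[OF Fp, of dt] d by simp
  ultimately show ?thesis using w2 pe Fh by linarith
 qed
 also have "... = hw - dt * (F' z * hw) + dt * (2 * K * q + 2 * ga * al * q - ga / 9 * q^2) + C * s"
  by (simp add: C lf_def algebra_simps)
 also have "... <= hw - dt * (F' z * hw) + dt * (hw * (36 * K^2 / ga + 36 * ga * al^2)) + C * s"
 proof -
  have "1/2 * (36 * K^2 / ga + 36 * ga * al^2) <= hw * (36 * K^2 / ga + 36 * ga * al^2)"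
   using hw g by (intro mult_right_mono) auto
  then have "2 * K * q + 2 * ga * al * q - ga / 9 * q^2 <= hw * (36 * K^2 / ga + 36 * ga * al^2)"
   using quad by simp
  then show ?thesis using d by (simp add: mult_left_mono)
 qed
 also have "... = hw * (1 - dt * (F' z - 36 * ga * al^2 - 36 * K^2 / ga)) + C * s"
  by (simp add: algebra_simps)
 finally show ?thesis by (simp add: p_def hw_def s_def)
qed

section \<open>Brownian increments and the augmented filtration\<close>

abbreviation (input) "Filt == augmented_filtration"

lemma space_augmented [simp]: "space (Filt M B t) = space M"
 unfolding augmented_filtration_def
 by (rule space_measure_of) (auto dest: null_setsD2 sets.sets_into_space)

lemma sets_augmented:
 "sets (Filt M B t) =
  sigma_sets (space M) ({B s -` A \<inter> space M | s A. s \<in> {0..t} & A \<in> sets borel} \<union> null_sets M)"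
 unfolding augmented_filtration_def
 by (rule sets_measure_of) (auto dest: null_setsD2 sets.sets_into_space)

lemma brownian_measurable:
 assumes "brownian_motion M T B" "0 <= t" "t <= T"
 shows "B t \<in> meas M"
 using assms by (auto simp: brownian_motion_def)

text \<open>The values of \<open>B\<close> at finitely many times up to \<open>s\<close> are, almost surely, sums of increments over a common partition, and these are independent of the increment after \<open>s\<close>. The value at time 0 vanishes only almost surely, hence the version \<open>V\<close>.\<close>

lemma brownian_past_indep:
 assumes P: "prob_space M" and bm: "brownian_motion M T B"
  and st: "0 <= s" "s < t" "t <= T" and J: "finite J" "J \<subseteq> {0..s}"
 obtains V where "V \<in> M \<rightarrow>\<^sub>M PiM J (%_. borel)"
  "\<forall>E\<in>sets (PiM J (%_. borel)). \<forall>D\<in>sets borel.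
   measure M (V -` E \<inter> (%w. B t w - B s w) -` D \<inter> space M)
   = measure M (V -` E \<inter> space M) * measure M ((%w. B t w - B s w) -` D \<inter> space M)"
  "AE w in M. V w = (\<lambda>r\<in>J. B r w)"
proof -
 interpret prob_space M by fact
 define S where "S = insert 0 (insert s J)"
 define xs where "xs = sorted_list_of_set S"
 define n where "n = length xs"
 define ta where "ta i = (if i < n then xs ! i else t)" for i
 have fS: "finite S" using J by (simp add: S_def)
 have S: "set xs = S" "sorted xs" "S \<subseteq> {0..s}"
  using fS J st by (simp add: xs_def, simp add: xs_def, auto simp: S_def)
 have xsS: "xs ! i \<in> S" if "i < n" for i using that S by (metis n_def nth_mem)
 have ex: "\<exists>i<n. xs ! i = r" if "r \<in> S" for r
  using that S by (metis in_set_conv_nth n_def)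
 have n0: "0 < n" using ex[of 0] by (auto simp: S_def)
 have first: "ta 0 = 0"
 proof -
  obtain j where "j < n" "xs ! j = 0" using ex[of 0] by (auto simp: S_def)
  then have "xs ! 0 <= 0" using sorted_nth_mono[OF S(2), of 0 j] by (simp add: n_def)
  then show ?thesis using xsS[OF n0] S(3) n0 by (auto simp: ta_def)
 qed
 have last: "ta (n - 1) = s"
 proof -
  obtain j where "j < n" "xs ! j = s" using ex[of s] by (auto simp: S_def)
  then have "s <= xs ! (n - 1)" using sorted_nth_mono[OF S(2), of j "n - 1"] by (simp add: n_def)
  then show ?thesis using xsS[of "n - 1"] S(3) n0 by (auto simp: ta_def)
 qed
 define \<Delta> where "\<Delta> i w = B (ta (Suc i)) w - B (ta i) w" for i w
 have "0 <= ta 0 & ta n <= T & (\<forall>i<n. ta i <= ta (Suc i))"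
 proof (intro conjI allI impI)
  fix i assume i: "i < n"
  show "ta i <= ta (Suc i)"
  proof (cases "Suc i < n")
   case True
   then show ?thesis using sorted_nth_mono[OF S(2), of i "Suc i"] by (simp add: ta_def n_def)
  next
   case False
   then show ?thesis using xsS[OF i] S(3) st i by (auto simp: ta_def)
  qed
 qed (use first st in \<open>auto simp: ta_def\<close>)
 then have ind: "indep_vars (%_. borel) \<Delta> {..<n}"
  using bm unfolding brownian_motion_def \<Delta>_def[abs_def] by blast
 define idx where "idx r = (SOME i. i < n & xs ! i = r)" for r
 have idx: "idx r < n" "xs ! idx r = r" if "r \<in> J" for r
  using someI_ex[OF ex[of r]] that by (auto simp: idx_def S_def)
 have split: "indep_var (PiM {..<n-1} (%_. borel)) (%w. restrict (%i. \<Delta> i w) {..<n-1})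
    (PiM {n-1} (%_. borel)) (%w. restrict (%i. \<Delta> i w) {n-1})"
  by (rule indep_var_restrict[OF ind]) (use n0 in auto)
 define Y1 where "Y1 x = (\<lambda>r\<in>J. \<Sum>i<idx r. (x i :: real))" for x :: "nat => real"
 have Y1: "Y1 \<in> PiM {..<n-1} (%_. borel) \<rightarrow>\<^sub>M PiM J (%_. borel)"
  unfolding Y1_def
 proof (intro measurable_restrict borel_measurable_sum measurable_component_singleton)
  fix r i assume "r \<in> J" "i \<in> {..<idx r}"
  then show "i \<in> {..<n-1}" using idx(1)[of r] by auto
 qed
 define V where "V w = (\<lambda>r\<in>J. \<Sum>i<idx r. \<Delta> i w)" for w
 define W where "W w = B t w - B s w" for w
 define V0 where "V0 w = restrict (%i. \<Delta> i w) {..<n-1}" for w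
 define W0 where "W0 w = restrict (%i. \<Delta> i w) {n-1}" for w
 have V: "V w = Y1 (V0 w)" for w
  unfolding V_def Y1_def V0_def
 proof (intro restrict_ext sum.cong refl)
  fix r i assume "r \<in> J" "i \<in> {..<idx r}"
  then have "i \<in> {..<n-1}" using idx(1)[of r] by auto
  then show "\<Delta> i w = restrict (%i. \<Delta> i w) {..<n-1} i" by simp
 qed
 have W: "W w = W0 w (n-1)" for w
  using last n0 by (auto simp: W0_def W_def \<Delta>_def ta_def)
 note split' = split[folded V0_def W0_def]
 have V0: "V0 \<in> M \<rightarrow>\<^sub>M PiM {..<n-1} (%_. borel)" and W0: "W0 \<in> M \<rightarrow>\<^sub>M PiM {n-1} (%_. borel)"
  using indep_var_rv1[OF split'] indep_var_rv2[OF split'] by auto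
 have Vm: "V \<in> M \<rightarrow>\<^sub>M PiM J (%_. borel)"
  unfolding V[abs_def] by (rule measurable_compose[OF V0 Y1])
 have ind2: "prob (V -` E \<inter> W -` D \<inter> space M) = prob (V -` E \<inter> space M) * prob (W -` D \<inter> space M)"
  if E: "E \<in> sets (PiM J (%_. borel))" and D: "D \<in> sets borel" for E D
 proof -
  define E0 where "E0 = Y1 -` E \<inter> space (PiM {..<n-1} (%_. borel :: real measure))"
  define D0 where "D0 = (%x. x (n-1)) -` D \<inter> space (PiM {n-1} (%_. borel :: real measure))"
  have E0: "E0 \<in> sets (PiM {..<n-1} (%_. borel))" unfolding E0_def by (rule measurable_sets[OF Y1 E])
  have D0: "D0 \<in> sets (PiM {n-1} (%_. borel))" unfolding D0_def
   by (rule measurable_sets[OF _ D]) simp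
  have e: "V -` E \<inter> space M = V0 -` E0 \<inter> space M"
   using measurable_space[OF V0] by (auto simp: E0_def V)
  have d: "W -` D \<inter> space M = W0 -` D0 \<inter> space M"
   using measurable_space[OF W0] by (auto simp: D0_def W)
  have "V -` E \<inter> W -` D \<inter> space M = (V -` E \<inter> space M) \<inter> (W -` D \<inter> space M)" by auto
  also have "... = (%w. (V0 w, W0 w)) -` (E0 \<times> D0) \<inter> space M"
   unfolding e d by auto
  finally have "V -` E \<inter> W -` D \<inter> space M = (%w. (V0 w, W0 w)) -` (E0 \<times> D0) \<inter> space M" .
  then show ?thesis using indep_varD[OF split' E0 D0] e d by simp
 qed
 have "AE w in M. B 0 w = 0" using bm by (simp add: brownian_motion_def)
 then have AE: "AE w in M. V w = (\<lambda>r\<in>J. B r w)"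
 proof eventually_elim
  fix w assume z: "B 0 w = 0"
  have "(\<Sum>i<idx r. \<Delta> i w) = B r w" if "r \<in> J" for r
  proof -
   have "(\<Sum>i<idx r. \<Delta> i w) = B (ta (idx r)) w - B (ta 0) w"
    unfolding \<Delta>_def by (rule sum_lessThan_telescope)
   moreover have "ta (idx r) = r" using idx[OF that] by (simp add: ta_def)
   ultimately show ?thesis using z first by simp
  qed
  then show "V w = (\<lambda>r\<in>J. B r w)" by (auto simp: V_def)
 qed
 show ?thesis by (rule that[OF Vm _ AE]) (use ind2 in \<open>simp add: W_def[abs_def]\<close>)
qed

text \<open>Events that agree almost surely with an event of finitely many past values form a generator of the augmented filtration that is closed under intersection and contains the null sets.\<close>

lemma augmented_indep_increment:
 assumes P: "prob_space M" and bm: "brownian_motion M T B"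
  and st: "0 <= s" "s < t" "t <= T"
  and Z: "Z \<in> Filt M B s \<rightarrow>\<^sub>M N"
 shows "Z \<in> M \<rightarrow>\<^sub>M N" "prob_space.indep_set M (sets (Filt M B s))
   (sigma_sets (space M) {(%w. B t w - B s w) -` A \<inter> space M |A. A \<in> sets borel})"
proof -
 interpret prob_space M by fact
 define W where "W w = B t w - B s w" for w
 have Bm: "B r \<in> meas M" if "0 <= r" "r <= T" for r using brownian_measurable[OF bm that] .
 have W[measurable]: "W \<in> meas M" unfolding W_def using Bm[of t] Bm[of s] st by (intro borel_measurable_diff) auto
 define \<Gamma> where "\<Gamma> = {A\<in>sets M. \<exists>J E. finite J & J \<subseteq> {0..s} & E \<in> sets (PiM J (%_. borel :: real measure))
   & (AE w in M. w \<in> A \<longleftrightarrow> (\<lambda>r\<in>J. B r w) \<in> E)}"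
 define \<W> where "\<W> = {W -` A \<inter> space M |A. A \<in> sets (borel :: real measure)}"
 have "indep_set \<Gamma> \<W>"
 proof (rule indep_setI)
  show "\<Gamma> \<subseteq> events" by (auto simp: \<Gamma>_def)
  show "\<W> \<subseteq> events" using W by (auto simp: \<W>_def)
  fix A C assume "A \<in> \<Gamma>" "C \<in> \<W>"
  then obtain J E D where J: "finite J" "J \<subseteq> {0..s}" and E: "E \<in> sets (PiM J (%_. borel :: real measure))"
   and AE: "AE w in M. w \<in> A \<longleftrightarrow> (\<lambda>r\<in>J. B r w) \<in> E" and D: "D \<in> sets borel" "C = W -` D \<inter> space M"
   and A: "A \<in> sets M"
   by (auto simp: \<Gamma>_def \<W>_def)
  obtain V where Vm: "V \<in> M \<rightarrow>\<^sub>M PiM J (%_. borel)"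
   and V: "\<forall>E\<in>sets (PiM J (%_. borel)). \<forall>D\<in>sets borel.
   prob (V -` E \<inter> W -` D \<inter> space M) = prob (V -` E \<inter> space M) * prob (W -` D \<inter> space M)"
   and VB: "AE w in M. V w = (\<lambda>r\<in>J. B r w)"
   unfolding W_def[abs_def] by (rule brownian_past_indep[OF P bm st J])
  have Cm: "C \<in> sets M" unfolding D(2) by (rule measurable_sets[OF W D(1)])
  have VE: "V -` E \<inter> space M \<in> sets M" by (rule measurable_sets[OF Vm E])
  have AV: "AE w in M. w \<in> A \<longleftrightarrow> w \<in> V -` E \<inter> space M"
   using AE VB AE_space by eventually_elim auto
  have "prob (A \<inter> C) = prob ((V -` E \<inter> space M) \<inter> C)"
   by (rule measure_eq_AE) (use AV A Cm VE in auto)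
  also have "(V -` E \<inter> space M) \<inter> C = V -` E \<inter> W -` D \<inter> space M" by (auto simp: D)
  also have "prob ... = prob (V -` E \<inter> space M) * prob (W -` D \<inter> space M)"
   using V E D(1) by blast
  also have "prob (V -` E \<inter> space M) = prob A"
   by (rule measure_eq_AE) (use AV A VE in auto)
  finally show "prob (A \<inter> C) = prob A * prob C" by (simp add: D)
 qed
 moreover have "Int_stable \<Gamma>"
 proof (rule Int_stableI)
  fix A1 A2 assume "A1 \<in> \<Gamma>" "A2 \<in> \<Gamma>"
  then obtain J1 E1 J2 E2 where 1: "A1 \<in> sets M" "finite J1" "J1 \<subseteq> {0..s}" "E1 \<in> sets (PiM J1 (%_. borel :: real measure))"
   "AE w in M. w \<in> A1 \<longleftrightarrow> (\<lambda>r\<in>J1. B r w) \<in> E1"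
   and 2: "A2 \<in> sets M" "finite J2" "J2 \<subseteq> {0..s}" "E2 \<in> sets (PiM J2 (%_. borel :: real measure))"
   "AE w in M. w \<in> A2 \<longleftrightarrow> (\<lambda>r\<in>J2. B r w) \<in> E2"
   unfolding \<Gamma>_def by blast
  define J where "J = J1 \<union> J2"
  define M' where "M' = PiM J (%_. borel :: real measure)"
  have r1: "(%x. restrict x J1) \<in> M' \<rightarrow>\<^sub>M PiM J1 (%_. borel)" and r2: "(%x. restrict x J2) \<in> M' \<rightarrow>\<^sub>M PiM J2 (%_. borel)"
   unfolding M'_def by (rule measurable_restrict_subset; simp add: J_def)+
  define E where "E = ((%x. restrict x J1) -` E1 \<inter> space M') \<inter> ((%x. restrict x J2) -` E2 \<inter> space M')"
  have "E \<in> sets M'" unfolding E_def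
   by (intro sets.Int measurable_sets[OF r1 1(4)] measurable_sets[OF r2 2(4)])
  moreover have "AE w in M. w \<in> A1 \<inter> A2 \<longleftrightarrow> (\<lambda>r\<in>J. B r w) \<in> E"
   using 1(5) 2(5)
  proof eventually_elim
   fix w assume a: "w \<in> A1 \<longleftrightarrow> (\<lambda>r\<in>J1. B r w) \<in> E1" "w \<in> A2 \<longleftrightarrow> (\<lambda>r\<in>J2. B r w) \<in> E2"
   have "J \<inter> J1 = J1" "J \<inter> J2 = J2" by (auto simp: J_def)
   moreover have "(\<lambda>r\<in>J. B r w) \<in> space M'" by (simp add: M'_def space_PiM)
   ultimately show "w \<in> A1 \<inter> A2 \<longleftrightarrow> (\<lambda>r\<in>J. B r w) \<in> E"
    using a by (simp add: E_def)
  qed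
  ultimately show "A1 \<inter> A2 \<in> \<Gamma>"
   unfolding \<Gamma>_def M'_def
  proof (intro CollectI conjI exI)
   show "finite J" "J \<subseteq> {0..s}" "A1 \<inter> A2 \<in> sets M"
    unfolding J_def using 1 2 by blast+
  qed
 qed
 moreover have "Int_stable \<W>"
 proof (rule Int_stableI)
  fix a b assume "a \<in> \<W>" "b \<in> \<W>"
  then obtain A A' where "A \<in> sets borel" "A' \<in> sets borel" "a = W -` A \<inter> space M" "b = W -` A' \<inter> space M"
   by (auto simp: \<W>_def)
  then show "a \<inter> b \<in> \<W>" unfolding \<W>_def by (intro CollectI exI[of _ "A \<inter> A'"]) auto
 qed
 ultimately have ind: "indep_set (sigma_sets (space M) \<Gamma>) (sigma_sets (space M) \<W>)"
  by (rule indep_set_sigma_sets)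
 have F: "sets (Filt M B s) \<subseteq> sigma_sets (space M) \<Gamma>"
  unfolding sets_augmented
 proof (rule sigma_sets_mono, safe)
  fix r A assume r: "r \<in> {0..s}" and A: "A \<in> sets (borel :: real measure)"
  have "B r -` A \<inter> space M \<in> \<Gamma>"
   unfolding \<Gamma>_def
  proof (intro CollectI conjI exI)
   show "B r -` A \<inter> space M \<in> sets M" using measurable_sets[OF Bm A, of r] r st by auto
   show "(%x. x r) -` A \<inter> space (PiM {r} (%_. borel)) \<in> sets (PiM {r} (%_. borel :: real measure))"
    by (rule measurable_sets[OF _ A]) simp
   show "AE w in M. (w \<in> B r -` A \<inter> space M) \<longleftrightarrow> (\<lambda>r\<in>{r}. B r w) \<in> (%x. x r) -` A \<inter> space (PiM {r} (%_. borel))"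
    by (rule AE_I2) (auto simp: space_PiM)
  qed (use r in auto)
  then show "B r -` A \<inter> space M \<in> sigma_sets (space M) \<Gamma>" by (rule sigma_sets.Basic)
 next
  fix A assume A: "A \<in> null_sets M"
  have "A \<in> \<Gamma>" unfolding \<Gamma>_def using A AE_not_in[OF A]
   by (intro CollectI conjI exI[of _ "{}"]) auto
  then show "A \<in> sigma_sets (space M) \<Gamma>" by (rule sigma_sets.Basic)
 qed
 have \<Gamma>M: "sigma_sets (space M) \<Gamma> \<subseteq> sets M"
  by (rule sets.sigma_sets_subset) (auto simp: \<Gamma>_def)
 show ZM: "Z \<in> M \<rightarrow>\<^sub>M N"
 proof (rule measurableI)
  show "Z x \<in> space N" if "x \<in> space M" for x using measurable_space[OF Z] that by simp
  show "Z -` A \<inter> space M \<in> sets M" if "A \<in> sets N" for A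
   using measurable_sets[OF Z that] F \<Gamma>M by auto
 qed
 show "indep_set (sets (Filt M B s))
   (sigma_sets (space M) {(%w. B t w - B s w) -` A \<inter> space M |A. A \<in> sets borel})"
  unfolding W_def[symmetric, abs_def] \<W>_def[symmetric] indep_set_def
  by (rule indep_sets_mono_sets[OF ind[unfolded indep_set_def]]) (use F in \<open>auto split: bool.split\<close>)
qed

lemma brownian_increment_distr:
 assumes bm: "brownian_motion M T B" and st: "0 <= s" "s < t" "t <= T"
 shows "distr M borel (%w. B t w - B s w) = distr gauss borel (%x. sqrt (t - s) * x)"
proof -
 let ?W = "%w. B t w - B s w"
 have "distributed M lborel ?W (normal_density 0 (sqrt (t - s)))"
  using bm st unfolding brownian_motion_def by blast
 then have "distr M lborel ?W = density lborel (normal_density 0 (sqrt (t - s)))" by (simp add: distributed_def)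
 moreover have "distr M lborel ?W = distr M borel ?W" by (rule distr_cong) auto
 ultimately show ?thesis using distr_gauss_scaled[of "t - s"] st by simp
qed

lemma brownian_increment_moments:
 assumes bm: "brownian_motion M T B" and st: "0 <= s" "s < t" "t <= T"
 shows "integrable M (%w. (B t w - B s w)^2)" "(\<integral>w. (B t w - B s w)^2 \<partial>M) = t - s"
proof -
 let ?W = "%w. B t w - B s w"
 have [measurable]: "?W \<in> meas M"
  using brownian_measurable[OF bm, of t] brownian_measurable[OF bm, of s] st by (intro borel_measurable_diff) auto
 note d = brownian_increment_distr[OF bm st]
 have sq: "(sqrt (t - s) * x)^2 = (t - s) * x^2" for x using st by (simp add: power_mult_distrib)
 have "integrable (distr M borel ?W) (%x. x^2)"
  unfolding d by (subst integrable_distr_eq) (auto simp: sq)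
 then show "integrable M (%w. (?W w)^2)" by (subst (asm) integrable_distr_eq) auto
 have "(\<integral>w. (?W w)^2 \<partial>M) = (\<integral>x. x^2 \<partial>distr M borel ?W)" by (subst integral_distr) auto
 also have "... = t - s" unfolding d by (subst integral_distr) (auto simp: sq gauss_second_moment)
 finally show "(\<integral>w. (?W w)^2 \<partial>M) = t - s" .
qed

text \<open>Conditioning on the past: the increment is an independent centred normal variable, so integrating it out produces the heat semigroup.\<close>

lemma expectation_increment_heat:
 assumes P: "prob_space M" and bm: "brownian_motion M T B"
  and st: "0 <= s" "s < t" "t <= T"
  and z: "ze \<in> meas (Filt M B s)" "!!w. abs (ze w) <= c"
  and Y: "Y \<in> meas (Filt M B s)"
  and f[measurable]: "f \<in> meas borel" and fb: "!!x. abs (f x) <= a"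
 shows "(\<integral>w. ze w * f (Y w + (B t w - B s w)) \<partial>M) = (\<integral>w. ze w * heat (t - s) f (Y w) \<partial>M)"
proof -
 interpret prob_space M by fact
 let ?P = "borel \<Otimes>\<^sub>M borel :: (real \<times> real) measure"
 define W where "W w = B t w - B s w" for w
 define Z where "Z w = (ze w, Y w)" for w
 have Z: "Z \<in> Filt M B s \<rightarrow>\<^sub>M borel \<Otimes>\<^sub>M borel"
  unfolding Z_def using z(1) Y by measurable
 note ai = augmented_indep_increment[OF P bm st Z]
 note ZM[measurable] = ai(1)
 have W[measurable]: "W \<in> meas M"
  unfolding W_def using brownian_measurable[OF bm, of t] brownian_measurable[OF bm, of s] st by auto
 \<comment> \<open>\<^const>\<open>indep_var\<close> takes two variables of the same type, hence the zero component\<close>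
 define W' where "W' w = (0 :: real, W w)" for w
 have W'[measurable]: "W' \<in> M \<rightarrow>\<^sub>M borel \<Otimes>\<^sub>M borel" unfolding W'_def by measurable
 have iv: "indep_var ?P Z ?P W'"
  unfolding indep_var_eq
 proof (intro conjI ZM W')
  have 1: "sigma_sets (space M) {Z -` A \<inter> space M |A. A \<in> sets ?P}
    \<subseteq> sets (Filt M B s)"
  proof -
   have "{Z -` A \<inter> space M |A. A \<in> sets ?P} \<subseteq> sets (Filt M B s)"
    using measurable_sets[OF Z] by auto
   from sets.sigma_sets_subset[OF this] show ?thesis by simp
  qed
  have 2: "sigma_sets (space M) {W' -` A \<inter> space M |A. A \<in> sets ?P}
    \<subseteq> sigma_sets (space M) {W -` A \<inter> space M |A. A \<in> sets borel}"
  proof (rule sigma_sets_mono, safe)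
   fix A :: "(real \<times> real) set" assume "A \<in> sets ?P"
   then have "Pair 0 -` A \<in> sets borel" by (rule sets_Pair1)
   moreover have "W' -` A \<inter> space M = W -` (Pair 0 -` A) \<inter> space M" by (auto simp: W'_def)
   ultimately show "W' -` A \<inter> space M \<in> sigma_sets (space M) {W -` A \<inter> space M |A. A \<in> sets borel}"
    by (intro sigma_sets.Basic) auto
  qed
  show "indep_set (sigma_sets (space M) {Z -` A \<inter> space M |A. A \<in> sets ?P})
    (sigma_sets (space M) {W' -` A \<inter> space M |A. A \<in> sets ?P})"
   unfolding indep_set_def
   by (rule indep_sets_mono_sets[OF ai(2)[unfolded indep_set_def, folded W_def[abs_def]]])
     (use 1 2 in \<open>auto split: bool.split\<close>)
 qed
 have Wd: "distr M borel W = distr gauss borel (%x. sqrt (t - s) * x)"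
  unfolding W_def[abs_def] by (rule brownian_increment_distr[OF bm st])
 have prodeq: "distr M ?P Z \<Otimes>\<^sub>M distr M ?P W' = distr M (?P \<Otimes>\<^sub>M ?P) (%w. (Z w, W' w))"
  using iv unfolding indep_var_distribution_eq by simp
 define g where "g = (%p :: (real \<times> real) \<times> real \<times> real. fst (fst p) * f (snd (fst p) + snd (snd p)))"
 have g[measurable]: "g \<in> meas (?P \<Otimes>\<^sub>M (borel \<Otimes>\<^sub>M (borel :: real measure)))" unfolding g_def by measurable
 interpret D1: prob_space "distr M ?P Z" by (rule prob_space_distr) simp
 interpret D2: prob_space "distr M ?P W'" by (rule prob_space_distr) simp
 interpret DD: pair_prob_space "distr M ?P Z" "distr M ?P W'" ..
 have hm[measurable]: "heat (t - s) f \<in> meas borel"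
  unfolding heat_def[abs_def]
  by (rule sigma_finite_measure.borel_measurable_lebesgue_integral)
    (auto intro: prob_space_imp_sigma_finite prob_space_gauss)
 have c0: "0 <= c" using z(2)[of undefined] by simp
 have ig: "integrable M (%w. g (Z w, W' w))"
 proof (rule integrable_const_bound[of _ "c * a"])
  show "AE w in M. norm (g (Z w, W' w)) <= c * a"
   using z(2) fb c0 by (intro AE_I2) (auto simp: g_def Z_def W'_def abs_mult intro!: mult_mono)
 qed measurable
 then have igd: "integrable (distr M ?P Z \<Otimes>\<^sub>M distr M ?P W') g"
  unfolding prodeq by (subst integrable_distr_eq) auto
 have "(\<integral>w. ze w * f (Y w + W w) \<partial>M) = (\<integral>w. g (Z w, W' w) \<partial>M)" by (simp add: g_def Z_def W'_def)
 also have "... = integral\<^sup>L (distr M ?P Z \<Otimes>\<^sub>M distr M ?P W') g"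
  unfolding prodeq by (subst integral_distr) auto
 also have "... = (\<integral>p. (\<integral>v. g (p, v) \<partial>distr M ?P W') \<partial>distr M ?P Z)"
  using DD.integral_fst'[OF igd] by simp
 also have "... = (\<integral>p. fst p * heat (t - s) f (snd p) \<partial>distr M ?P Z)"
 proof (intro integral_cong refl)
  fix p
  have "(\<integral>v. g (p, v) \<partial>distr M ?P W') = (\<integral>w. fst p * f (snd p + W w) \<partial>M)"
   by (subst integral_distr) (auto simp: g_def W'_def split: prod.split)
  also have "... = fst p * (\<integral>v. f (snd p + v) \<partial>distr M borel W)"
   by (subst integral_distr) auto
  also have "... = fst p * heat (t - s) f (snd p)"
   unfolding Wd heat_def by (subst integral_distr) auto
  finally show "(\<integral>v. g (p, v) \<partial>distr M ?P W') = fst p * heat (t - s) f (snd p)" .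
 qed
 also have "... = (\<integral>w. ze w * heat (t - s) f (Y w) \<partial>M)"
  by (subst integral_distr) (auto simp: Z_def hm)
 finally show ?thesis by (simp add: W_def)
qed

section \<open>The supermartingale along a process with noise\<close>

lemma augmented_mono:
 assumes "s <= t"
 shows "sets (Filt M B s) \<subseteq> sets (Filt M B t)"
 unfolding sets_augmented
proof (rule sigma_sets_mono', rule Un_mono[OF _ order_refl], safe)
 fix r A assume "r \<in> {0..s}" "A \<in> sets (borel :: real measure)"
 then show "\<exists>r' A'. B r -` A \<inter> space M = B r' -` A' \<inter> space M & r' \<in> {0..t} & A' \<in> sets borel"
  using assms by (intro exI[of _ r] exI[of _ A]) auto
qed

lemma adapted_mono:
 assumes "Z \<in> meas (Filt M B s)" "s <= t"
 shows "Z \<in> meas (Filt M B t)"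
 using measurable_mono[of borel borel "Filt M B s" "Filt M B t"]
  augmented_mono[OF assms(2)] assms(1) by auto

lemma augmented_subset:
 assumes "brownian_motion M T B" "t <= T"
 shows "sets (Filt M B t) \<subseteq> sets M"
 unfolding sets_augmented
 by (rule sets.sigma_sets_subset) (use brownian_measurable[OF assms(1)] assms in \<open>auto intro!: measurable_sets\<close>)

lemma augmented_measurable:
 assumes "brownian_motion M T B" "t <= T" "Z \<in> meas (Filt M B t)"
 shows "Z \<in> meas M"
 using measurable_mono[of borel borel "Filt M B t" M] augmented_subset[OF assms(1,2)] assms(3) by auto

text \<open>A process \<open>Y = B + drift\<close> described only through its increments: the drift over \<open>[s, t]\<close> is at most \<open>(t - s) \<alpha> s\<close> up to an excess whose mean is of order \<open>(t - s)\<^bsup>3/2\<^esup>\<close>, and its mean square is of order \<open>(t - s)\<^sup>2\<close>. Convex combinations of two solutions with the same noise are of this kind.\<close>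

locale noisy_process = prob_space M for M :: "'a measure" +
 fixes T :: real and B :: "real => 'a => real" and r0 r1 :: real
  and Y al :: "real => 'a => real" and c :: real
 assumes bm: "brownian_motion M T B" and r: "0 <= r0" "r0 <= r1" "r1 <= T" and c0: "0 <= c"
  and Y_adapted: "!!t. r0 <= t ==> t <= r1 ==> Y t \<in> meas (Filt M B t)"
  and al_adapted: "!!t. r0 <= t ==> t <= r1 ==> al t \<in> meas (Filt M B t)"
  and al_nonneg: "!!t w. 0 <= al t w"
  and al_integrable: "!!t. r0 <= t ==> t <= r1 ==> integrable M (al t)"
  and drift_square: "!!s t. r0 <= s ==> s < t ==> t <= r1 ==>
    integrable M (%w. (Y t w - Y s w - (B t w - B s w))^2)"
   "!!s t. r0 <= s ==> s < t ==> t <= r1 ==>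
    (EE w. (Y t w - Y s w - (B t w - B s w))^2) <= c * (t - s)^2"
  and drift_excess: "!!s t. r0 <= s ==> s < t ==> t <= r1 ==>
    (EE w. max 0 (abs (Y t w - Y s w - (B t w - B s w)) - (t - s) * al s w))
    <= c * ((t - s) * sqrt (t - s))"
begin

lemma filtration_measurable:
 assumes "r0 <= t" "t <= r1" "Z \<in> meas (Filt M B t)"
 shows "Z \<in> meas M"
 by (rule augmented_measurable[OF bm _ assms(3)]) (use assms r in auto)

text \<open>Over one step the weight \<open>exp (\<delta> \<rho>) u\<^bsup>\<gamma>\<^esup>\<close> does not increase in mean, up to an error of order \<open>\<delta>\<^bsup>3/2\<^esup>\<close>. The increment of \<open>Y\<close> is split into the Brownian increment, which gives the heat semigroup, and the drift, which is expanded to first order; its main part is bounded with \<open>\<alpha>\<close> and absorbed by \<open>one_step\<close>. The factor \<open>\<zeta>\<close> carries the past.\<close>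

lemma step_supermartingale:
 assumes st: "r0 <= s" "0 < dt" "s + dt <= r1" "dt <= 1"
  and z: "ze \<in> meas (Filt M B s)" "!!w. 0 <= ze w" "!!w. ze w <= z1"
  and g: "0 < ga" "ga <= 1/2" and u: "C11 (3/2) b l u u'" and ru: "!!z. abs (u z - 1) <= 1/2"
  and F: "C11 K L lF F F'"
  and v: "v = (%z. heat dt u z + 1 / ga * dt * heat_grad dt (%y. F y * u y) z)"
  and rw: "!!z. abs (v z - 1) <= 1/2" "v \<in> meas borel"
  and D: "D = l + (L * (3/2) + K * b + 2 * (lF * (3/2) + 2 * L * b + K * l)) / ga"
  and C: "C = 2 * (lF * (3/2) + 2 * L * b + K * l) / ga + 4 * b * l + D^2 + L * D"
 shows "(EE w. ze w * exp (dt * (F' (Y s w) - 36 * ga * (al s w)^2 - 36 * K^2 / ga)) * u (Y (s + dt) w) powr ga)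
  <= (EE w. ze w * v (Y s w) powr ga)
   + z1 * exp L * (C + b * c + (2 * b^2 + l) * (2 * c + 1)) * (dt * sqrt dt)"
proof -
 define rh where "rh w = F' (Y s w) - 36 * ga * (al s w)^2 - 36 * K^2 / ga" for w
 define lh where "lh = 2 * b^2 + l"
 define h where "h z = u z powr ga" for z
 define h' where "h' z = ga * u z powr (ga - 1) * u' z" for z
 have hC: "C11 (3/2) b lh h h'" unfolding h_def[abs_def] h'_def[abs_def] lh_def by (rule C11_powr[OF g u ru])
 note hD = C11_D[OF hC] and hm[measurable] = C11_borel[OF hC] and hn = C11_nonneg[OF hC]
 note Fm[measurable] = C11_borel[OF F] and FD = C11_D[OF F] and Fn = C11_nonneg[OF F] and un = C11_nonneg[OF u]
 let ?t = "s + dt" and ?k = "%w. dt * abs (h' (Y s w)) * al s w" and ?d = "dt * sqrt dt"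
 have sr: "s <= r1" "0 <= s" "?t <= T" "s < ?t" "r0 <= ?t" using st r by auto
 have [measurable]: "Y s \<in> meas M" "Y ?t \<in> meas M" "al s \<in> meas M" "ze \<in> meas M"
  by (rule filtration_measurable[OF _ _ Y_adapted] filtration_measurable[OF _ _ al_adapted]
    filtration_measurable[OF _ _ z(1)]; use st sr in simp)+
 have Bm[measurable]: "B s \<in> meas M" "B ?t \<in> meas M"
  using brownian_measurable[OF bm] sr r st by auto
 define W where "W w = B ?t w - B s w" for w
 define V where "V w = Y ?t w - Y s w - W w" for w
 define et where "et w = max 0 (abs (V w) - dt * al s w)" for w
 have WV[measurable]: "W \<in> meas M" "V \<in> meas M" "et \<in> meas M"
  unfolding V_def[abs_def] W_def[abs_def] et_def[abs_def] by measurable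
 define xi where "xi w = ze w * exp (dt * rh w)" for w
 define q where "q = z1 * exp L"
 have z10: "0 <= z1" using z(2,3)[of undefined] by linarith
 have q0: "0 <= q" using z10 by (simp add: q_def)
 have rhL: "dt * rh w <= L" for w
 proof -
  have "rh w <= L" using FD(3)[of "Y s w"] g by (simp add: rh_def) (smt (verit, best) divide_nonneg_pos mult_nonneg_nonneg zero_le_power2)
  then have "dt * rh w <= dt * L" using st by (intro mult_left_mono) auto
  also have "... <= L" using st Fn by (simp add: mult_left_le_one_le)
  finally show ?thesis .
 qed
 have xi0: "0 <= xi w" and xiq: "xi w <= q" for w
  using z rhL z10 by (auto simp: xi_def q_def intro!: mult_mono)
 have rhF: "rh \<in> meas (Filt M B s)"
  unfolding rh_def[abs_def]
  using measurable_compose[OF Y_adapted Fm(2), of s] al_adapted[of s] st sr by (intro borel_measurable_diff) auto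
 have xiF: "xi \<in> meas (Filt M B s)"
  unfolding xi_def[abs_def] using rhF z(1) by measurable
 have xiM[measurable]: "xi \<in> meas M" using filtration_measurable[OF _ _ xiF] st sr by auto
 have intxi: "integrable M (%w. xi w * f w)" if "integrable M f" for f :: "'a => real"
 proof (rule integrable_bound[where f = "%w. q * f w"])
  show "AE w in M. norm (xi w * f w) <= norm (q * f w)"
   using xi0 xiq q0 by (intro AE_I2) (auto simp: abs_mult intro!: mult_right_mono)
 qed (use that in auto)
 have ib: "integrable M f" if "f \<in> meas M" "!!w. abs (f w) <= k" for f :: "'a => real" and k
  by (rule integrable_const_bound[of _ k]) (use that in auto)
 have Exi: "(EE w. xi w * f w) <= q * (EE w. f w)" if "integrable M f" "!!w. 0 <= f w" for f
 proof -
  have "(EE w. xi w * f w) <= (EE w. q * f w)"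
   using that intxi[OF that(1)] xiq by (intro integral_mono) (auto intro!: mult_right_mono)
  then show ?thesis by simp
 qed
 \<comment> \<open>moments of the increments\<close>
 have W2: "integrable M (%w. (W w)^2)" "(EE w. (W w)^2) = dt"
  using brownian_increment_moments[OF bm, of s ?t] sr by (auto simp: W_def)
 have V2: "integrable M (%w. (V w)^2)" "(EE w. (V w)^2) <= c * dt^2"
  using drift_square[of s ?t] st by (auto simp: V_def W_def)
 have ali: "integrable M (al s)" using al_integrable st sr by auto
 have Vi: "integrable M V"
  by (rule square_integrable_imp_integrable[OF WV(2) V2(1)])
 have eti: "integrable M et"
  by (rule integrable_bound[OF integrable_abs[OF Vi] WV(3)])
    (use al_nonneg st in \<open>auto simp: et_def max_def\<close>)
 have et0: "0 <= et w" for w by (simp add: et_def)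
 have etE: "(EE w. et w) <= c * (?d)"
  using drift_excess[of s ?t] st by (simp add: et_def V_def W_def)
 \<comment> \<open>\<open>e\<close> collects the quadratic remainders; the mixed term \<open>\<bar>W V\<bar>\<close> is balanced with weight \<open>sqrt dt\<close> since \<open>W\<close> is of size \<open>sqrt dt\<close> and \<open>V\<close> of size \<open>dt\<close>\<close>
 define e where "e w = (1 / sqrt dt) * (V w)^2 / 2 + sqrt dt * (W w)^2 / 2 + (V w)^2" for w
 have ei: "integrable M e" unfolding e_def using V2 W2 by auto
 have e0: "0 <= e w" for w using st by (simp add: e_def)
 have sd: "0 < sqrt dt" "sqrt dt <= 1" "dt <= sqrt dt" "dt = sqrt dt * sqrt dt"
  using st real_sqrt_le_mono[of "dt^2" dt] by (auto simp: power2_eq_square mult_left_le)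
 have eE: "(EE w. e w) <= (2 * c + 1) * (?d)"
 proof -
  have "(EE w. e w) = (1 / sqrt dt) * (EE w. (V w)^2) / 2 + sqrt dt * dt / 2 + (EE w. (V w)^2)"
   unfolding e_def using V2 W2 by simp
  also have "... <= (1 / sqrt dt) * (c * dt^2) / 2 + sqrt dt * dt / 2 + c * dt^2"
   using V2(2) sd by (intro add_mono divide_right_mono mult_left_mono) auto
  also have "(1 / sqrt dt) * (c * dt^2) = c * (?d)"
   using sd by (simp add: power2_eq_square field_simps)
  also have "c * (?d) / 2 + sqrt dt * dt / 2 + c * dt^2 <= (2 * c + 1) * (?d)"
  proof -
   have "c * dt^2 <= c * (?d)" using c0 sd st by (simp add: power2_eq_square mult_left_mono)
   moreover have "0 <= c * (?d)" "0 <= ?d" using c0 st by auto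
   ultimately show ?thesis by (simp add: algebra_simps)
  qed
  finally show ?thesis .
 qed
 \<comment> \<open>Taylor expansion of the weight along one step\<close>
 have taylor: "h (Y ?t w) <= h (Y s w + W w) + ?k w + b * et w + lh * e w" for w
 proof -
  have 1: "h (Y ?t w) <= h (Y s w + W w) + h' (Y s w + W w) * V w + lh * (V w)^2"
   using C11_taylor[OF hC, of "Y s w + W w" "V w"] by (simp add: V_def)
  have "abs ((h' (Y s w + W w) - h' (Y s w)) * V w) <= (lh * abs (W w)) * abs (V w)"
   unfolding abs_mult using hD(4)[of "Y s w + W w" "Y s w"] by (intro mult_right_mono) auto
  also have "... = lh * (abs (W w) * abs (V w))" by simp
  also have "... <= lh * ((1 / sqrt dt) * (V w)^2 / 2 + sqrt dt * (W w)^2 / 2)"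
  proof (intro mult_left_mono hn)
   have "0 <= (abs (V w) - sqrt dt * abs (W w))^2 / (2 * sqrt dt)" using sd by simp
   also have "... = (1 / sqrt dt) * (V w)^2 / 2 + sqrt dt * (W w)^2 / 2 - abs (W w) * abs (V w)"
    using sd(1) by (simp add: power2_diff power_mult_distrib add_divide_distrib diff_divide_distrib)
      (use sd in \<open>simp add: field_simps\<close>)
   finally show "abs (W w) * abs (V w) <= (1 / sqrt dt) * (V w)^2 / 2 + sqrt dt * (W w)^2 / 2" by linarith
  qed
  finally have 2: "(h' (Y s w + W w) - h' (Y s w)) * V w <= lh * ((1 / sqrt dt) * (V w)^2 / 2 + sqrt dt * (W w)^2 / 2)"
   by linarith
  have "h' (Y s w) * V w <= abs (h' (Y s w)) * abs (V w)" by (metis abs_ge_self abs_mult)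
  also have "... <= abs (h' (Y s w)) * (dt * al s w + et w)" by (intro mult_left_mono) (auto simp: et_def)
  also have "... <= ?k w + b * et w"
  proof -
   have "abs (h' (Y s w)) * et w <= b * et w" by (intro mult_right_mono hD) (simp add: et_def)
   then show ?thesis by (simp add: distrib_left mult_ac)
  qed
  finally have 3: "h' (Y s w) * V w <= ?k w + b * et w" .
  show ?thesis using 1 2 3 by (simp add: e_def algebra_simps)
 qed
 have i1: "integrable M (%w. h (Y s w + W w))" by (rule ib[of _ "3/2"]) (use hD(2) in auto)
 have i2: "integrable M (%w. ?k w)"
 proof (rule integrable_bound[where f = "%w. dt * b * al s w"])
  show "AE w in M. norm (?k w) <= norm (dt * b * al s w)"
   using hD(3) hn st al_nonneg by (intro AE_I2) (auto simp: abs_mult intro!: mult_right_mono mult_left_mono)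
 qed (use ali in auto)
 have heatm[measurable]: "heat dt h \<in> meas borel" using C11_borel(1)[OF C11_heat[OF hC]] .
 have i3: "integrable M (%w. heat dt h (Y s w))"
  by (rule ib[of _ "3/2"]) (use C11_D(2)[OF C11_heat[OF hC]] in auto)
 have rwb: "1/2 <= v x" "v x <= 3/2" for x using rw(1)[of x] by linarith+
 have wg: "0 <= v x powr ga" "v x powr ga <= 3/2" for x
  using powr_half_bounds(5)[OF rwb, of ga] g by auto
 have i4: "integrable M (%w. ze w * v (Y s w) powr ga)"
 proof (rule ib)
  show "abs (ze w * v (Y s w) powr ga) <= z1 * (3/2)" for w
   using mult_mono[OF z(3) wg(2) z10 wg(1), of w "Y s w"] z(2)[of w] wg(1) by (simp add: abs_mult)
 qed (use rw(2) in measurable)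
 have C0: "0 <= C"
 proof -
  have "0 <= lF * (3/2) + 2 * L * b + K * l" "0 <= L * (3/2) + K * b" using Fn un by auto
  then have "0 <= D" using un g Fn unfolding D by (intro add_nonneg_nonneg divide_nonneg_pos) auto
  then show ?thesis using \<open>0 <= lF * (3/2) + 2 * L * b + K * l\<close> Fn un g unfolding C
   by (intro add_nonneg_nonneg divide_nonneg_pos) auto
 qed
 have pt: "xi w * (heat dt h (Y s w) + ?k w) <= ze w * v (Y s w) powr ga + q * C * (?d)" for w
 proof -
  have os: "heat dt h (Y s w) + ?k w <= v (Y s w) powr ga * (1 - dt * rh w) + C * (?d)"
   unfolding h_def[abs_def] h'_def rh_def
   by (rule one_step[OF g u ru F st(2,4) al_nonneg _ rw(1) D C]) (simp add: v)
  have "xi w * (heat dt h (Y s w) + ?k w)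
    <= xi w * (v (Y s w) powr ga * (1 - dt * rh w) + C * (?d))"
   by (rule mult_left_mono[OF os xi0])
  also have "... = ze w * v (Y s w) powr ga * (exp (dt * rh w) * (1 - dt * rh w)) + xi w * (C * (?d))"
   by (simp add: xi_def algebra_simps)
  also have "... <= ze w * v (Y s w) powr ga * 1 + q * (C * (?d))"
  proof (intro add_mono mult_left_mono mult_right_mono xiq)
   have "exp (dt * rh w) * (1 - dt * rh w) <= exp (dt * rh w) * exp (- (dt * rh w))"
    using exp_ge_add_one_self[of "- (dt * rh w)"] by (intro mult_left_mono) auto
   also have "... = 1" by (simp add: exp_minus)
   finally show "exp (dt * rh w) * (1 - dt * rh w) <= 1" .
  qed (use z wg C0 st in auto)
  finally show ?thesis by (simp add: mult_ac)
 qed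
 have "(EE w. xi w * h (Y ?t w)) <= (EE w. xi w * h (Y s w + W w) + xi w * (?k w)
   + xi w * (b * et w) + xi w * (lh * e w))"
 proof (rule integral_mono)
  show "integrable M (%w. xi w * h (Y ?t w))"
   by (intro intxi ib[of _ "3/2"]) (use hD(2) in auto)
  show "integrable M (%w. xi w * h (Y s w + W w) + xi w * (?k w)
   + xi w * (b * et w) + xi w * (lh * e w))"
   by (intro integrable_add intxi i1 i2 integrable_mult_right eti ei)
  show "xi w * h (Y ?t w) <= xi w * h (Y s w + W w) + xi w * (?k w)
   + xi w * (b * et w) + xi w * (lh * e w)" for w
   using mult_left_mono[OF taylor xi0, of w w] by (simp only: distrib_left)
 qed
 also have "... = (EE w. xi w * h (Y s w + W w)) + (EE w. xi w * (?k w))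
   + (EE w. xi w * (b * et w)) + (EE w. xi w * (lh * e w))"
  using intxi[OF i1] intxi[OF i2] intxi[OF integrable_mult_right[OF eti, of b]] intxi[OF integrable_mult_right[OF ei, of lh]]
  by (subst integral_add; (intro integrable_add)?; simp)+
 also have "(EE w. xi w * h (Y s w + W w)) = (EE w. xi w * heat dt h (Y s w))"
  using expectation_increment_heat[OF prob_space_axioms bm _ _ _ xiF _ Y_adapted hm(1) hD(2), of "s + dt" q] sr st xi0 xiq
  by (simp add: W_def abs_of_nonneg)
 also have "(EE w. xi w * heat dt h (Y s w)) + (EE w. xi w * (?k w))
   = (EE w. xi w * (heat dt h (Y s w) + ?k w))"
  using intxi[OF i3] intxi[OF i2] by (simp add: distrib_left)
 also have "... <= (EE w. ze w * v (Y s w) powr ga + q * C * (?d))"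
  using intxi[OF integrable_add[OF i3 i2]] i4 pt by (intro integral_mono) auto
 also have "... = (EE w. ze w * v (Y s w) powr ga) + q * C * (?d)"
  using i4 by (simp add: prob_space)
 also have "(EE w. xi w * (b * et w)) <= q * (b * (c * (?d)))"
 proof -
  have "(EE w. xi w * (b * et w)) <= q * (EE w. b * et w)"
   by (rule Exi) (use eti et0 hn in auto)
  also have "... <= q * (b * (c * (?d)))" using etE q0 hn by (simp add: mult_left_mono)
  finally show ?thesis .
 qed
 also have "(EE w. xi w * (lh * e w)) <= q * (lh * ((2 * c + 1) * (?d)))"
 proof -
  have "(EE w. xi w * (lh * e w)) <= q * (EE w. lh * e w)"
   by (rule Exi) (use ei e0 hn in auto)
  also have "... <= q * (lh * ((2 * c + 1) * (?d)))" using eE q0 hn by (simp add: mult_left_mono)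
  finally show ?thesis .
 qed
 finally show ?thesis
  by (simp add: xi_def h_def rh_def q_def lh_def algebra_simps)
qed

text \<open>A block of length \<open>\<tau>\<close> is so short that \<open>u\<close> stays in \<open>[1/2, 3/2]\<close>; hence the weight \<open>u\<^bsup>\<gamma>\<^esup>\<close> at its beginning is at most 2 and at its end it is 1. The errors \<open>\<delta>\<^bsup>3/2\<^esup>\<close> of the steps add up to order \<open>sqrt \<delta>\<close>.\<close>

lemma block_bound:
 assumes g: "0 < ga" "ga <= 1/2" and ta: "0 < ta"
  and F: "!!t. r0 <= t ==> t <= r1 ==> C11 K L lF (F t) (F' t)"
  and KL: "0 <= K" "0 <= L" "0 <= lF"
  and small: "2 * (1 / ga) * sqrt ta * K <= 1 / 3"
 obtains Q where "0 <= Q"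
  "!!s N dt ze z1. r0 <= s ==> s + ta <= r1 ==> 0 < dt ==> dt <= 1 ==> real N * dt = ta ==>
    ze \<in> meas (Filt M B s) ==> (!!w. 0 <= ze w) ==> (!!w. ze w <= z1) ==>
    (EE w. ze w * exp (\<Sum>j<N. dt * (F' (s + real j * dt) (Y (s + real j * dt) w)
      - 36 * ga * (al (s + real j * dt) w)^2 - 36 * K^2 / ga)))
    <= 2 * (EE w. ze w) + z1 * Q * sqrt dt"
proof -
 define m cc where "m = 1 / ga" and "cc = 2 * (1 / ga) * sqrt ta"
 define b where "b = 3 * cc * L"
 define l where "l = 3 * cc * (2 * lF + 2 * L * b)"
 define D where "D = l + (L * (3/2) + K * b + 2 * (lF * (3/2) + 2 * L * b + K * l)) / ga"
 define C where "C = 2 * (lF * (3/2) + 2 * L * b + K * l) / ga + 4 * b * l + D^2 + L * D"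
 define P where "P = C + b * c + (2 * b^2 + l) * (2 * c + 1)"
 define Q where "Q = exp (L * ta) * exp L * P * ta"
 have cc0: "0 <= cc" using g ta by (simp add: cc_def)
 have b0: "0 <= b" "0 <= l" using cc0 KL by (auto simp: b_def l_def)
 have D0: "0 <= D" unfolding D_def using b0 KL g by (intro add_nonneg_nonneg divide_nonneg_pos) auto
 have C0: "0 <= C" unfolding C_def using b0 KL g D0 by (intro add_nonneg_nonneg divide_nonneg_pos) auto
 have P0: "0 <= P" unfolding P_def using C0 b0 c0 by auto
 show ?thesis
 proof (rule that[of Q])
  show "0 <= Q" using P0 ta by (simp add: Q_def)
  fix s dt z1 :: real and N :: nat and ze :: "'a => real"
  assume s: "r0 <= s" "s + ta <= r1" and dt: "0 < dt" "dt <= 1" "real N * dt = ta"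
   and z: "ze \<in> meas (Filt M B s)" "!!w. 0 <= ze w" "!!w. ze w <= z1"
  have z10: "0 <= z1" using z(2,3)[of undefined] by linarith
  define th where "th j = s + real j * dt" for j
  have th: "r0 <= th j" "th j <= r1" "th (Suc j) = th j + dt" if "j <= N" for j
  proof -
   have "real j * dt <= ta" unfolding dt(3)[symmetric] using that dt by (intro mult_right_mono) auto
   then show "r0 <= th j" "th j <= r1" "th (Suc j) = th j + dt"
    using s dt by (auto simp: th_def algebra_simps intro: add_increasing2)
  qed
  have thmono: "th i <= th j" if "i <= j" for i j using that dt by (simp add: th_def mult_right_mono)
  define rh where "rh j w = F' (th j) (Y (th j) w) - 36 * ga * (al (th j) w)^2 - 36 * K^2 / ga" for j w
  define \<Phi> where "\<Phi> i = F (th (N - Suc i))" for i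
  define \<Phi>' where "\<Phi>' i = F' (th (N - Suc i))" for i
  define u where "u = bwd dt m \<Phi>"
  have FC: "C11 K L lF (F (th j)) (F' (th j))" if "j <= N" for j using F th that by blast
  have \<Phi>C: "C11 K L lF (\<Phi> i) (\<Phi>' i)" if "i < N" for i
   using FC[of "N - Suc i"] by (simp add: \<Phi>_def \<Phi>'_def)
  have bw: "(\<exists>v. C11 (3/2) b l (u n) v) & (\<forall>z. abs (u n z - 1) <= 1/2)" if "n <= N" for n
  proof -
   have sm: "2 * m * sqrt (real N * dt) * K <= 1 / 3" "0 <= m" using small g by (auto simp: m_def dt(3))
   have cc: "cc = 2 * m * sqrt (real N * dt)" by (simp add: cc_def m_def dt(3))
   from bwd_bounds[of dt m N K L lF \<Phi> \<Phi>', OF dt(1) sm(2) \<Phi>C KL sm(1) cc b_def l_def that]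
   show ?thesis unfolding u_def by blast
  qed
  then obtain v where v: "!!n. n <= N ==> C11 (3/2) b l (u n) (v n)" by metis
  define G where "G k w = ze w * exp (\<Sum>j<k. dt * rh j w)" for k w
  have rhL: "rh j w <= L" if "j <= N" for j w
  proof -
   have "0 <= 36 * ga * (al (th j) w)^2" "0 <= 36 * K^2 / ga" using g by auto
   then show ?thesis using C11_D(3)[OF FC[OF that], of "Y (th j) w"] unfolding rh_def by linarith
  qed
  define zz where "zz = z1 * exp (L * ta)"
  have Gb: "0 <= G k w" "G k w <= zz" if "k <= N" for k w
  proof -
   show "0 <= G k w" using z by (simp add: G_def)
   have "(\<Sum>j<k. dt * rh j w) <= (\<Sum>j<k. dt * L)"
    using dt rhL that by (intro sum_mono mult_left_mono) auto
   also have "... = L * (real k * dt)" by simp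
   also have "... <= L * ta" unfolding dt(3)[symmetric] using that dt KL by (intro mult_left_mono mult_right_mono) auto
   finally show "G k w <= zz" unfolding G_def zz_def using z z10 by (intro mult_mono) auto
  qed
  have GF: "G k \<in> meas (Filt M B (th k))" if "k <= N" for k
  proof -
   have 1: "ze \<in> meas (Filt M B (th k))"
    by (rule adapted_mono[OF z(1)]) (use dt in \<open>simp add: th_def\<close>)
   have 2: "rh j \<in> meas (Filt M B (th k))" if "j \<in> {..<k}" for j
   proof -
    have jN: "j <= N" using that \<open>k <= N\<close> by auto
    have "rh j \<in> meas (Filt M B (th j))"
     unfolding rh_def[abs_def]
     using measurable_compose[OF Y_adapted C11_borel(2)[OF FC[OF jN]], of "th j"] al_adapted[of "th j"] th[OF jN]
     by (intro borel_measurable_diff) auto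
    then show ?thesis by (rule adapted_mono) (use that in \<open>auto intro: thmono\<close>)
   qed
   show ?thesis unfolding G_def[abs_def] using 1 2
    by (intro borel_measurable_times borel_measurable_exp[THEN measurable_compose[rotated]] borel_measurable_sum) auto
  qed
  define S where "S k = (EE w. G k w * u (N - k) (Y (th k) w) powr ga)" for k
  have step: "S (Suc k) <= S k + zz * exp L * P * (dt * sqrt dt)" if k: "k < N" for k
  proof -
   have kN: "k <= N" "N - Suc k <= N" "N - k <= N" using k by auto
   have nk: "N - k = Suc (N - Suc k)" using k by auto
   have q: "u (N - k) = (%z. heat dt (u (N - Suc k)) z + 1 / ga * dt * heat_grad dt (%y. F (th k) y * u (N - Suc k) y) z)"
   proof -
    have "\<Phi> (N - Suc k) = F (th k)" using k by (simp add: \<Phi>_def)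
    then show ?thesis unfolding nk by (simp add: u_def m_def)
   qed
   have "(EE w. G k w * exp (dt * (F' (th k) (Y (th k) w) - 36 * ga * (al (th k) w)^2 - 36 * K^2 / ga))
      * u (N - Suc k) (Y (th k + dt) w) powr ga)
    <= (EE w. G k w * u (N - k) (Y (th k) w) powr ga) + zz * exp L * (C + b * c + (2 * b^2 + l) * (2 * c + 1)) * (dt * sqrt dt)"
   proof (rule step_supermartingale[OF _ dt(1) _ dt(2) GF Gb g v[OF kN(2)] _ FC q _ _ D_def C_def])
    show "th k + dt <= r1" using th(2)[of "Suc k"] th(3)[of k] k by simp
    show "abs (u (N - Suc k) z - 1) <= 1/2" "abs (u (N - k) z - 1) <= 1/2" for z using bw kN by auto
    show "u (N - k) \<in> meas borel" using C11_borel(1)[OF v[OF kN(3)]] .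
   qed (use th kN in auto)
   moreover have "G (Suc k) w = G k w * exp (dt * (F' (th k) (Y (th k) w) - 36 * ga * (al (th k) w)^2 - 36 * K^2 / ga))" for w
    by (simp add: G_def rh_def exp_add)
   ultimately show ?thesis
    using th(3)[of k] kN by (simp add: S_def P_def)
  qed
  have tel: "S k <= S 0 + real k * (zz * exp L * P * (dt * sqrt dt))" if "k <= N" for k
   using that
  proof (induction k)
   case (Suc k)
   then show ?case using step[of k] by (simp add: algebra_simps)
  qed simp
  have "S N = (EE w. ze w * exp (\<Sum>j<N. dt * rh j w))"
   by (simp add: S_def u_def G_def)
  moreover have "S 0 <= 2 * (EE w. ze w)"
  proof -
   have zM[measurable]: "ze \<in> meas M" using filtration_measurable[OF _ _ z(1)] s ta by simp
   have uM[measurable]: "u N \<in> meas borel" using C11_borel(1)[OF v] by simp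
   have YM[measurable]: "Y (th 0) \<in> meas M"
    by (rule filtration_measurable[OF _ _ Y_adapted]) (use th[of 0] in auto)
   have uu: "abs (u N z - 1) <= 1/2" for z using bw[of N] by simp
   have ub: "1/2 <= u N z" "u N z <= 3/2" for z using uu[of z] by linarith+
   have pb: "0 <= u N z powr ga" "u N z powr ga <= 2" for z
    using powr_half_bounds(5)[OF ub, of ga z] g by auto
   have iz: "integrable M ze" by (rule integrable_const_bound[of _ z1]) (use z in auto)
   have "S 0 <= (EE w. ze w * 2)"
    unfolding S_def
   proof (rule integral_mono)
    show "integrable M (%w. G 0 w * u (N - 0) (Y (th 0) w) powr ga)"
    proof (rule integrable_bound[where f = "%w. ze w * 2"])
     show "AE w in M. norm (G 0 w * u (N - 0) (Y (th 0) w) powr ga) <= norm (ze w * 2)"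
      using pb z by (intro AE_I2) (auto simp: G_def abs_mult intro!: mult_left_mono)
    qed (use iz in \<open>auto simp: G_def\<close>)
    show "G 0 w * u (N - 0) (Y (th 0) w) powr ga <= ze w * 2" for w
     using pb z by (auto simp: G_def intro!: mult_left_mono)
   qed (use iz in auto)
   then show ?thesis using iz by simp
  qed
  moreover have "real N * (zz * exp L * P * (dt * sqrt dt)) = z1 * Q * sqrt dt"
   by (simp add: zz_def Q_def dt(3)[symmetric] mult_ac)
  ultimately have "(EE w. ze w * exp (\<Sum>j<N. dt * rh j w)) <= 2 * (EE w. ze w) + z1 * Q * sqrt dt"
   using tel[of N] by linarith
  then show "(EE w. ze w * exp (\<Sum>j<N. dt * (F' (s + real j * dt) (Y (s + real j * dt) w)
      - 36 * ga * (al (s + real j * dt) w)^2 - 36 * K^2 / ga)))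
    <= 2 * (EE w. ze w) + z1 * Q * sqrt dt"
   by (simp add: rh_def th_def)
 qed
qed

end

section \<open>Exponential moments in continuous time\<close>

lemma riemann_sum_limit:
 fixes g :: "real => real"
 assumes g: "continuous_on {a..b} g" and ab: "a < b"
 shows "(%n. \<Sum>j<n. (b - a) / real n * g (a + real j * ((b - a) / real n))) \<longlonglongrightarrow> integral {a..b} g"
proof (rule LIMSEQ_I)
 fix e :: real assume "0 < e"
 define e' where "e' = e / (2 * (b - a))"
 have e': "0 < e'" using \<open>0 < e\<close> ab by (simp add: e'_def)
 have "uniformly_continuous_on {a..b} g"
  by (rule compact_uniformly_continuous[OF g]) simp
 then obtain d where d: "0 < d" "!!x y. x \<in> {a..b} ==> y \<in> {a..b} ==> dist y x < d ==> dist (g y) (g x) < e'"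
  using e' unfolding uniformly_continuous_on_def by metis
 obtain n0 where n0: "(b - a) / d < real n0" using reals_Archimedean2 by blast
 have "norm ((\<Sum>j<n. (b - a) / real n * g (a + real j * ((b - a) / real n))) - integral {a..b} g) < e" if "n \<ge> n0" for n
 proof -
  have "0 < (b - a) / d" using ab d by simp
  then have n: "0 < n" "(b - a) / d < real n" using n0 that by (cases n, auto)
  define h where "h = (b - a) / real n"
  have h: "0 < h" "h < d" "real n * h = b - a" using n d ab by (auto simp: h_def field_simps)
  have ind: "abs ((\<Sum>j<m. h * g (a + real j * h)) - integral {a..a + real m * h} g) <= real m * (h * e')" if "m <= n" for m
   using that
  proof (induction m)
   case 0
   then show ?case by simp
  next
   case (Suc m)
   let ?p = "a + real m * h" and ?q = "a + real (Suc m) * h"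
   have "real (Suc m) * h <= real n * h" using Suc.prems h by (intro mult_right_mono) auto
   then have pq: "a <= ?p" "?p <= ?q" "?q <= b" "?q = ?p + h" using h by (auto simp: algebra_simps)
   have c: "continuous_on {a..?q} g" by (rule continuous_on_subset[OF g]) (use pq in auto)
   have c2: "continuous_on {?p..?q} g" by (rule continuous_on_subset[OF g]) (use pq in auto)
   have comb: "integral {a..?q} g = integral {a..?p} g + integral {?p..?q} g"
    by (rule Henstock_Kurzweil_Integration.integral_combine[symmetric, OF pq(1,2) integrable_continuous_real[OF c]])
   have "h * g ?p - integral {?p..?q} g = integral {?p..?q} (%x. g ?p - g x)"
    using pq integrable_continuous_real[OF c2] by (subst Henstock_Kurzweil_Integration.integral_diff) auto
   also have "norm ... <= e' * (?q - ?p)"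
   proof (rule integral_bound)
    show "norm (g ?p - g x) <= e'" if "x \<in> {?p..?q}" for x
    proof -
     have "dist ?p x < d" using that pq h by (auto simp: dist_real_def)
     moreover have "x \<in> {a..b}" "?p \<in> {a..b}"
      using that[unfolded atLeastAtMost_iff] pq unfolding atLeastAtMost_iff by linarith+
     ultimately show ?thesis using d(2)[of x ?p] by (simp add: dist_norm)
    qed
   qed (use pq c2 in \<open>auto intro!: continuous_intros\<close>)
   finally have "abs (h * g ?p - integral {?p..?q} g) <= h * e'" using pq(4) by (simp add: mult.commute)
   then show ?case using Suc.IH Suc.prems unfolding comb by (simp add: distrib_right)
  qed
  have "abs ((\<Sum>j<n. h * g (a + real j * h)) - integral {a..b} g) <= real n * h * e'"
   using ind[of n] by (simp add: h(3) mult.assoc[symmetric])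
  also have "... = e / 2"
  proof -
   have "b - a ~= 0" using ab by simp
   then show ?thesis unfolding h(3) e'_def by (metis nonzero_mult_divide_mult_cancel_left times_divide_eq_right mult.commute)
  qed
  also have "... < e" using \<open>0 < e\<close> by simp
  finally show ?thesis by (simp add: h_def)
 qed
 then show "\<exists>n0. \<forall>n\<ge>n0. norm ((\<Sum>j<n. (b - a) / real n * g (a + real j * ((b - a) / real n))) - integral {a..b} g) < e"
  by blast
qed

lemma sum_split_add: "(\<Sum>j<m + n. f j) = (\<Sum>j<m. f j) + (\<Sum>j<n. f (m + j :: nat) :: real)"
 by (induction n) auto

context noisy_process
begin

text \<open>The interval is cut into \<open>J\<close> blocks, each costing a factor 2, and the step within the blocks tends to zero. The sums \<open>\<Sum> \<delta> \<rho>\<close> are bounded above by \<open>L (r1 - r0)\<close>, so dominated convergence applies although the integral itself may be very negative.\<close>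

lemma exponential_bound:
 assumes g: "0 < ga" "ga <= 1/2" and J: "r1 - r0 = real J * ta" "0 < ta" "0 < J"
  and F: "!!t. r0 <= t ==> t <= r1 ==> C11 K L lF (F t) (F' t)"
  and KL: "0 <= K" "0 <= L" "0 <= lF"
  and small: "2 * (1 / ga) * sqrt ta * K <= 1 / 3"
  and cont: "!!w. continuous_on {r0..r1} (%t. F' t (Y t w))" "!!w. continuous_on {r0..r1} (%t. al t w)"
 defines "rh \<equiv> %t w. F' t (Y t w) - 36 * ga * (al t w)^2 - 36 * K^2 / ga"
 shows "integrable M (%w. exp (integral {r0..r1} (%t. rh t w)))"
  and "(EE w. exp (integral {r0..r1} (%t. rh t w))) <= 2 ^ J"
proof -
 obtain Q where Q: "0 <= Q"
  "!!s N dt ze z1. r0 <= s ==> s + ta <= r1 ==> 0 < dt ==> dt <= 1 ==> real N * dt = ta ==>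
    ze \<in> meas (Filt M B s) ==> (!!w. 0 <= ze w) ==> (!!w. ze w <= z1) ==>
    (EE w. ze w * exp (\<Sum>j<N. dt * (F' (s + real j * dt) (Y (s + real j * dt) w)
      - 36 * ga * (al (s + real j * dt) w)^2 - 36 * K^2 / ga)))
    <= 2 * (EE w. ze w) + z1 * Q * sqrt dt"
 proof (rule block_bound[where F = F and F' = F' and K = K and L = L and lF = lF and ga = ga and ta = ta], goal_cases)
  case (9 Q)
  show thesis by (rule 9(1)[OF 9(2)]) (rule 9(3))
 qed (use g J F KL small in auto)
 define z1 where "z1 = exp (L * (r1 - r0))"
 have rhL: "rh t w <= L" if "r0 <= t" "t <= r1" for t w
 proof -
  have "0 <= 36 * ga * (al t w)^2" "0 <= 36 * K^2 / ga" using g by auto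
  then show ?thesis using C11_D(3)[OF F[OF that], of "Y t w"] unfolding rh_def by linarith
 qed
 have rhF: "rh t \<in> meas (Filt M B t)" if "r0 <= t" "t <= r1" for t
  unfolding rh_def
  using measurable_compose[OF Y_adapted C11_borel(2)[OF F[OF that]], of t] al_adapted[of t] that
  by (intro borel_measurable_diff) auto
 define n where "n k = J * Suc k" for k
 define dt where "dt k = ta / real (Suc k)" for k
 define f where "f k m w = exp (\<Sum>j<m. dt k * rh (r0 + real j * dt k) w)" for k m w
 have dt0: "0 < dt k" "real (Suc k) * dt k = ta" for k using J by (auto simp: dt_def)
 have dteq: "dt k = (r1 - r0) / real (n k)" for k
  using J unfolding dt_def n_def J(1) of_nat_mult by (subst mult_divide_mult_cancel_left) auto
 have grid: "r0 <= r0 + real j * dt k" "r0 + real j * dt k <= r1" if "j <= n k" for j k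
 proof -
  show "r0 <= r0 + real j * dt k" using dt0 by (simp add: less_imp_le)
  have "real j * dt k <= real (n k) * dt k" using that dt0 by (intro mult_right_mono) (auto simp: less_imp_le)
  also have "... = r1 - r0"
  proof -
   have "real (n k) ~= 0" using J by (simp add: n_def del: of_nat_mult of_nat_Suc)
   then show ?thesis unfolding dteq by simp
  qed
  finally show "r0 + real j * dt k <= r1" by simp
 qed
 have fb: "0 <= f k m w" "f k m w <= z1" if "m <= n k" for k m w
 proof -
  have "(\<Sum>j<m. dt k * rh (r0 + real j * dt k) w) <= (\<Sum>j<m. dt k * L)"
   using dt0[of k] that by (intro sum_mono mult_left_mono rhL grid) auto
  also have "... = L * (real m * dt k)" by simp
  also have "... <= L * (r1 - r0)" using grid(2)[OF that] KL by (intro mult_left_mono) auto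
  finally show "0 <= f k m w" "f k m w <= z1" by (simp_all add: f_def z1_def)
 qed
 have fF: "f k m \<in> meas (Filt M B (r0 + real m * dt k))" if "m <= n k" for k m
 proof -
  have "rh (r0 + real j * dt k) \<in> meas (Filt M B (r0 + real m * dt k))" if "j \<in> {..<m}" for j
   by (rule adapted_mono[OF rhF]) (use grid[of j k] that \<open>m <= n k\<close> dt0[of k] in \<open>auto intro!: mult_right_mono\<close>)
  then show ?thesis unfolding f_def[abs_def]
   by (intro borel_measurable_exp[THEN measurable_compose[rotated]] borel_measurable_sum borel_measurable_times) auto
 qed
 have fM: "f k m \<in> meas M" if "m <= n k" for k m
  using filtration_measurable[OF _ _ fF] grid that by auto
 have rec: "(EE w. f k (i * Suc k) w) <= 2 ^ i * (1 + real i * (z1 * Q * sqrt (dt k)))" if "i <= J" "dt k <= 1" for i k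
  using that(1)
 proof (induction i)
  case 0
  then show ?case by (simp add: f_def prob_space)
 next
  case (Suc i)
  let ?m = "i * Suc k" and ?s = "r0 + real (i * Suc k) * dt k"
  have le: "?m + Suc k <= n k" using mult_le_mono1[OF Suc.prems, of "Suc k"] by (simp add: n_def algebra_simps)
  have s: "?s + ta <= r1"
   using grid(2)[OF le] dt0(2)[of k] by (simp add: algebra_simps)
  have eq: "f k (Suc i * Suc k) w = f k ?m w * exp (\<Sum>j<Suc k. dt k * rh (?s + real j * dt k) w)" for w
  proof -
   have "Suc i * Suc k = ?m + Suc k" by simp
   moreover have "r0 + real (?m + j) * dt k = ?s + real j * dt k" for j by (simp add: distrib_right)
   ultimately show ?thesis unfolding f_def by (simp only: sum_split_add exp_add)
  qed
  have "(EE w. f k (Suc i * Suc k) w) <= 2 * (EE w. f k ?m w) + z1 * Q * sqrt (dt k)"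
   unfolding eq rh_def
  proof (rule Q(2))
   have m: "?m <= n k" using le by simp
   show "r0 <= ?s" by (rule grid(1)[OF m])
   show "f k ?m \<in> meas (Filt M B ?s)" by (rule fF[OF m])
   show "0 <= f k ?m w" "f k ?m w <= z1" for w by (rule fb[OF m])+
  qed (rule s dt0 that(2))+
  also have "... <= 2 * (2 ^ i * (1 + real i * (z1 * Q * sqrt (dt k)))) + 2 * 2 ^ i * (z1 * Q * sqrt (dt k))"
  proof (intro add_mono mult_left_mono)
   have "0 <= z1 * Q * sqrt (dt k)" using Q dt0[of k] by (simp add: z1_def)
   moreover have "(1::real) <= 2 * 2 ^ i" using one_le_power[of "2::real" "Suc i"] by simp
   ultimately show "z1 * Q * sqrt (dt k) <= 2 * 2 ^ i * (z1 * Q * sqrt (dt k))"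
    by (metis mult_1 mult_right_mono)
  qed (use Suc in auto)
  also have "... = 2 ^ Suc i * (1 + real (Suc i) * (z1 * Q * sqrt (dt k)))" by (simp add: algebra_simps)
  finally show ?case .
 qed
 have ab: "r0 < r1"
 proof -
  have "0 < real J * ta" using J by simp
  then show ?thesis using J(1) by linarith
 qed
 have crh: "continuous_on {r0..r1} (%t. rh t w)" for w
  unfolding rh_def using cont by (intro continuous_intros)
 have lim: "(%k. f k (n k) w) \<longlonglongrightarrow> exp (integral {r0..r1} (%t. rh t w))" for w
 proof -
  have sub: "strict_mono n" using J by (intro strict_monoI_Suc) (simp add: n_def)
  from LIMSEQ_subseq_LIMSEQ[OF riemann_sum_limit[OF crh ab] sub]
  have "(%k. \<Sum>j<n k. dt k * rh (r0 + real j * dt k) w) \<longlonglongrightarrow> integral {r0..r1} (%t. rh t w)"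
   unfolding dteq comp_def by simp
  then show ?thesis unfolding f_def by (rule tendsto_exp)
 qed
 have limM: "(%w. exp (integral {r0..r1} (%t. rh t w))) \<in> meas M"
  by (rule borel_measurable_LIMSEQ_real[OF lim]) (use fM in auto)
 have bound: "AE w in M. norm (f k (n k) w) <= z1" for k using fb[of "n k" k] by (intro AE_I2) auto
 show "integrable M (%w. exp (integral {r0..r1} (%t. rh t w)))"
  by (rule integrable_dominated_convergence[where s = "%k. f k (n k)" and w = "%_. z1"])
    (use limM fM lim bound in auto)
 have conv: "(%k. \<integral>w. f k (n k) w \<partial>M) \<longlonglongrightarrow> (EE w. exp (integral {r0..r1} (%t. rh t w)))"
  by (rule integral_dominated_convergence[where w = "%_. z1"])
    (use limM fM lim bound in auto)
 have dtlim: "dt \<longlonglongrightarrow> 0" unfolding dt_def using LIMSEQ_Suc[OF lim_const_over_n[of ta]] by simp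
 have blim: "(%k. 2 ^ J * (1 + real J * (z1 * Q * sqrt (dt k)))) \<longlonglongrightarrow> 2 ^ J * (1 + real J * (z1 * Q * sqrt 0))"
  by (intro tendsto_intros dtlim)
 have ev: "\<forall>\<^sub>F k in sequentially. dt k <= 1"
  using order_tendstoD(2)[OF dtlim, of 1] by (auto elim: eventually_mono)
 have "(EE w. exp (integral {r0..r1} (%t. rh t w))) <= 2 ^ J * (1 + real J * (z1 * Q * sqrt 0))"
  by (rule tendsto_le[OF _ blim conv]) (use ev rec[of J] in \<open>auto simp: n_def elim!: eventually_mono\<close>)
 then show "(EE w. exp (integral {r0..r1} (%t. rh t w))) <= 2 ^ J" by simp
qed

end

section \<open>Gronwall's inequality, continuous versions and the Kantorovich distance\<close>

text \<open>Only boundedness and measurability of \<open>u\<close> are known when this is applied to moments. The weight \<open>exp (- 2 C s)\<close> turns the integral operator into a contraction with factor 1/2 for the supremum, at the price of the constants 2.\<close>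

lemma gronwall_bounded:
 fixes u :: "real => real"
 assumes C: "0 <= C" and A: "0 <= A"
  and m: "set_borel_measurable lborel {0..T} u"
  and bnd: "!!t. 0 <= t ==> t <= T ==> 0 <= u t & u t <= S"
  and le: "!!t. 0 <= t ==> t <= T ==> u t <= A + C * (LBINT s:{0..t}. u s)"
  and t: "0 <= t" "t <= T"
 shows "u t <= 2 * A * exp (2 * C * t)"
proof -
 define w where "w s = exp (- 2 * C * s) * u s" for s
 define W where "W = (SUP s\<in>{0..T}. w s)"
 have wS: "w s <= S" if "s \<in> {0..T}" for s
 proof -
  have "exp (- 2 * C * s) <= 1" using C that by simp
  then have "w s <= 1 * u s" unfolding w_def using bnd[of s] that by (intro mult_right_mono) auto
  then show ?thesis using bnd[of s] that by auto
 qed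
 have bdd: "bdd_above (w ` {0..T})" by (rule bdd_aboveI2[OF wS])
 have wW: "w s <= W" if "s \<in> {0..T}" for s unfolding W_def by (rule cSUP_upper[OF that bdd])
 have w0: "0 <= w s" if "s \<in> {0..T}" for s using bnd[of s] that by (simp add: w_def)
 have W0: "0 <= W" using w0[of t] wW[of t] t by auto
 have uW: "u s <= W * exp (2 * C * s)" if "s \<in> {0..T}" for s
 proof -
  have "u s = w s * exp (2 * C * s)" by (simp add: w_def exp_minus)
  then show ?thesis using wW[OF that] by simp
 qed
 \<comment> \<open>integrating the bound \<open>W exp (2 C s)\<close> for \<open>u\<close> gains the factor 1/2\<close>
 have key: "w r <= A + W / 2" if r: "0 <= r" "r <= T" for r
 proof -
  have int: "lint {0..r} u"
  proof (rule set_integrable_bound[where f = "%_. S"])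
   show "lint {0..r} (%_. S)" by (rule borel_integrable_atLeastAtMost') (rule continuous_on_const)
   show "set_borel_measurable lborel {0..r} u"
    by (rule set_borel_measurable_subset[OF m]) (use r in auto)
   show "AE x in lborel. x \<in> {0..r} --> norm (u x) <= norm S"
    using bnd r by (intro AE_I2) (smt (verit) atLeastAtMost_iff real_norm_def)
  qed
  have inte: "lint {0..r} (%s. W * exp (2 * C * s))"
   by (rule borel_integrable_atLeastAtMost') (intro continuous_intros)
  have D: "DERIV (%s. exp (2 * C * s) / 2) s :> C * exp (2 * C * s)" for s
   by (auto intro!: derivative_eq_intros)
  have FTC: "(LBINT s:{0..r}. C * exp (2 * C * s)) = exp (2 * C * r) / 2 - exp (2 * C * 0) / 2"
   unfolding set_lebesgue_integral_def
   using integral_FTC_Icc_real[of 0 r "%s. exp (2 * C * s) / 2" "%s. C * exp (2 * C * s)"] r D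
   by (auto simp: mult.commute intro!: continuous_intros)
  have "C * (LBINT s:{0..r}. u s) <= C * (LBINT s:{0..r}. W * exp (2 * C * s))"
   using uW r by (intro mult_left_mono set_integral_mono int inte C) auto
  also have "... = W * (LBINT s:{0..r}. C * exp (2 * C * s))"
   by simp
  also have "... <= W * exp (2 * C * r) / 2" unfolding FTC using W0 by (simp add: algebra_simps)
  finally have "u r <= A + W * exp (2 * C * r) / 2" using le[OF r] by linarith
  then have "w r <= exp (- 2 * C * r) * (A + W * exp (2 * C * r) / 2)"
   unfolding w_def by (intro mult_left_mono) auto
  also have "... = exp (- 2 * C * r) * A + W / 2" by (simp add: exp_minus field_simps)
  also have "... <= 1 * A + W / 2" using C r A by (intro add_mono mult_right_mono) auto
  finally show ?thesis by simp
 qed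
 have "W <= A + W / 2" unfolding W_def
  by (rule cSUP_least) (use key t in \<open>auto simp: W_def\<close>)
 then have "W <= 2 * A" by simp
 then have "W * exp (2 * C * t) <= 2 * A * exp (2 * C * t)" by (intro mult_right_mono) auto
 moreover have "u t <= W * exp (2 * C * t)" using uW[of t] t by simp
 ultimately show ?thesis by linarith
qed

text \<open>The process is the limit of its values at the discretized times \<open>\<lfloor>n t\<rfloor> / n\<close>.\<close>

lemma continuous_process_jointly_measurable:
 fixes Z :: "real => 'a => real"
 assumes m: "!!t. Z t \<in> meas M" and c: "!!w. conti (%t. Z t w)"
 shows "jmeas M Z"
proof (rule borel_measurable_LIMSEQ_real)
 fix p :: "real \<times> 'a"
 have "(%n. of_int \<lfloor>real (Suc n) * fst p\<rfloor> / real (Suc n)) \<longlonglongrightarrow> fst p"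
 proof (rule LIMSEQ_I)
  fix e :: real assume "0 < e"
  then obtain n0 where n0: "1 / e < real n0" using reals_Archimedean2 by blast
  have "norm (of_int \<lfloor>real (Suc n) * fst p\<rfloor> / real (Suc n) - fst p) < e" if "n \<ge> n0" for n
  proof -
   let ?k = "real (Suc n)"
   have k: "1 < e * ?k" using n0 that \<open>0 < e\<close> by (simp add: field_simps) (smt (verit) mult_left_mono of_nat_mono)
   have "abs (of_int \<lfloor>?k * fst p\<rfloor> - ?k * fst p) <= 1" by linarith
   then have "abs (of_int \<lfloor>?k * fst p\<rfloor> - ?k * fst p) / ?k <= 1 / ?k"
    by (intro divide_right_mono) auto
   moreover have "of_int \<lfloor>?k * fst p\<rfloor> / ?k - fst p = (of_int \<lfloor>?k * fst p\<rfloor> - ?k * fst p) / ?k"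
    by (simp add: diff_divide_distrib del: of_nat_Suc)
   ultimately have "abs (of_int \<lfloor>?k * fst p\<rfloor> / ?k - fst p) <= 1 / ?k"
    by (simp add: abs_divide del: of_nat_Suc)
   also have "... < e" using k by (simp add: divide_less_eq)
   finally show ?thesis by simp
  qed
  then show "\<exists>n0. \<forall>n\<ge>n0. norm (of_int \<lfloor>real (Suc n) * fst p\<rfloor> / real (Suc n) - fst p) < e" by blast
 qed
 moreover have "isCont (%t. Z t (snd p)) (fst p)" using c[of "snd p"] by (simp add: continuous_on_eq_continuous_at)
 ultimately show "(%n. Z (of_int \<lfloor>real (Suc n) * fst p\<rfloor> / real (Suc n)) (snd p)) \<longlonglongrightarrow> Z (fst p) (snd p)"
  by (rule isCont_tendsto_compose[rotated])
next
 fix n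
 have "(%p. (%i :: int. %p. Z (of_int i / real (Suc n)) (snd p)) \<lfloor>real (Suc n) * fst p\<rfloor> p) \<in> meas (borel \<Otimes>\<^sub>M M)"
  by (rule measurable_compose_countable) (use m in \<open>measurable\<close>)
 then show "(%p. Z (of_int \<lfloor>real (Suc n) * fst p\<rfloor> / real (Suc n)) (snd p)) \<in> meas (borel \<Otimes>\<^sub>M M)"
  by simp
qed

lemma augmented_null:
 assumes "N \<in> null_sets M" shows "N \<in> sets (Filt M B t)"
 unfolding sets_augmented using assms by (intro sigma_sets.Basic) auto

lemma brownian_adapted:
 assumes "s \<in> {0..t}"
 shows "B s \<in> meas (Filt M B t)"
proof (rule measurableI)
 fix A assume "A \<in> sets (borel :: real measure)"
 then show "B s -` A \<inter> space (Filt M B t) \<in> sets (Filt M B t)"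
  unfolding sets_augmented space_augmented using assms by (intro sigma_sets.Basic) auto
qed simp

text \<open>The paths are set to zero on a null set and extended as constants outside of \<open>[0, T]\<close>. Null sets belong to the augmented filtration, so adaptedness is kept.\<close>

lemma continuous_version:
 assumes T: "0 <= T" and ad: "!!t. t \<in> {0..T} ==> X t \<in> meas (Filt M B t)"
  and Xm: "!!t. t \<in> {0..T} ==> X t \<in> meas M"
  and cont: "AE w in M. continuous_on {0..T} (%t. X t w)"
 obtains Z :: "real => 'a => real" where
  "!!w. conti (%t. Z t w)"
  "!!t. t \<in> {0..T} ==> Z t \<in> meas (Filt M B t)"
  "!!t. Z t \<in> meas M"
  "AE w in M. \<forall>t\<in>{0..T}. Z t w = X t w"
proof -
 obtain N where N: "{w\<in>space M. \<not> continuous_on {0..T} (%t. X t w)} \<subseteq> N" "N \<in> null_sets M"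
  using cont by (auto simp: eventually_ae_filter)
 define clip where "clip t = max 0 (min T t)" for t
 have clip: "clip t \<in> {0..T}" for t using T by (auto simp: clip_def)
 have clip_id: "clip t = t" if "t \<in> {0..T}" for t using that by (auto simp: clip_def)
 define Z where "Z t w = indicator (space M - N) w * X (clip t) w" for t w
 show ?thesis
 proof (rule that[of Z])
  show "conti (%t. Z t w)" for w
  proof (cases "w \<in> space M - N")
   case True
   then have "continuous_on {0..T} (%t. X t w)" using N by auto
   moreover have "conti clip" unfolding clip_def[abs_def] by (intro continuous_intros)
   ultimately have "conti (%t. X (clip t) w)"
    using clip by (intro continuous_on_compose2[of "{0..T}" "%t. X t w" UNIV clip]) auto
   then show ?thesis using True by (simp add: Z_def)
  qed (simp add: Z_def)
  show "Z t \<in> meas (Filt M B t)" if "t \<in> {0..T}" for t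
  proof -
   have "space M - N \<in> sets (Filt M B t)"
    using sets.compl_sets[OF augmented_null[OF N(2), of B t]] by simp
   then show ?thesis unfolding Z_def[abs_def] clip_id[OF that] using ad[OF that] by measurable
  qed
  show "Z t \<in> meas M" for t
  proof -
   have "space M - N \<in> sets M" using N(2) by auto
   then show ?thesis unfolding Z_def[abs_def]
    by (intro borel_measurable_times borel_measurable_indicator Xm clip)
  qed
  show "AE w in M. \<forall>t\<in>{0..T}. Z t w = X t w"
   using AE_not_in[OF N(2)] AE_space by eventually_elim (auto simp: Z_def clip_id)
 qed
qed

lemma kantorovich_le_expectation:
 assumes P: "prob_space M" and m[measurable]: "X \<in> meas M" "Y \<in> meas M"
  and i: "integrable M X" "integrable M Y"
 shows "distr M borel X \<in> P1"
  "kantorovich (distr M borel X) (distr M borel Y) <= (\<integral>w. abs (X w - Y w) \<partial>M)"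
proof -
 interpret prob_space M by fact
 have P1: "distr M borel Z \<in> P1" if "Z \<in> meas M" "integrable M Z" for Z
  unfolding P1_def using that by (auto intro!: prob_space_distr simp: integrable_distr_eq)
 show "distr M borel X \<in> P1" by (rule P1) fact+
 have "(SUP h\<in>{h :: real => real. 1-lipschitz_on UNIV h}. abs ((\<integral>y. h y \<partial>distr M borel X) - (\<integral>y. h y \<partial>distr M borel Y)))
   <= (\<integral>w. abs (X w - Y w) \<partial>M)"
 proof (rule cSUP_least[OF lipschitz_nonempty])
  fix h :: "real => real" assume "h \<in> {h. 1-lipschitz_on UNIV h}"
  then have h: "1-lipschitz_on UNIV h" by simp
  have hm[measurable]: "h \<in> meas borel"
   by (rule borel_measurable_continuous_onI) (rule lipschitz_on_continuous_on[OF h])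
  have ih: "integrable M (%w. h (Z w))" if "Z \<in> meas M" "integrable M Z" for Z
   using lipschitz_integrable_P1[OF P1[OF that] h] that(1) by (subst (asm) integrable_distr_eq) auto
  have "(\<integral>y. h y \<partial>distr M borel X) - (\<integral>y. h y \<partial>distr M borel Y) = (\<integral>w. h (X w) - h (Y w) \<partial>M)"
   using ih[OF m(1) i(1)] ih[OF m(2) i(2)] by (simp add: integral_distr)
  also have "abs ... <= (\<integral>w. abs (h (X w) - h (Y w)) \<partial>M)" by (rule integral_abs_bound)
  also have "... <= (\<integral>w. abs (X w - Y w) \<partial>M)"
   using ih[OF m(1) i(1)] ih[OF m(2) i(2)] i lipschitz_onD[OF h]
   by (intro integral_mono) (auto simp: dist_real_def)
  finally show "abs ((\<integral>y. h y \<partial>distr M borel X) - (\<integral>y. h y \<partial>distr M borel Y)) <= (\<integral>w. abs (X w - Y w) \<partial>M)" .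
 qed
 then show "kantorovich (distr M borel X) (distr M borel Y) <= (\<integral>w. abs (X w - Y w) \<partial>M)"
  using P1[OF m(1) i(1)] P1[OF m(2) i(2)] by (simp add: kantorovich_def)
qed

section \<open>Moments of the Brownian path\<close>

lemma set_integrable_continuous:
 fixes f :: "real => real"
 assumes "conti f"
 shows "lint {a..b} f"
 by (rule borel_integrable_atLeastAtMost') (rule continuous_on_subset[OF assms], simp)

lemma set_integral_const_Icc:
 assumes "a <= b" shows "(LBINT x:{a..b}. (c::real)) = (b - a) * c"
 using assms by (simp add: set_lebesgue_integral_def)

text \<open>Jensen's inequality, from the tangent to the exponential at the mean.\<close>

lemma exp_average_le:
 fixes y :: "real => real"
 assumes y: "conti y" and T: "0 < T"
 shows "exp ((LBINT s:{0..T}. y s) / T) <= (LBINT s:{0..T}. exp (y s)) / T"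
proof -
 define c where "c = (LBINT s:{0..T}. y s) / T"
 have i1: "lint {0..T} (%s. exp c * (1 - c))" by (rule set_integrable_continuous[OF continuous_on_const])
 have i2: "lint {0..T} (%s. exp c * y s)" by (intro set_integrable_continuous continuous_intros y)
 have "(LBINT s:{0..T}. exp c * y s) = exp c * (c * T)" using T by (simp add: c_def)
 then have "exp c * T = (LBINT s:{0..T}. exp c * (1 - c) + exp c * y s)"
  unfolding set_integral_add(2)[OF i1 i2] set_integral_const_Icc[OF less_imp_le[OF T]] by (simp add: algebra_simps)
 also have "... <= (LBINT s:{0..T}. exp (y s))"
 proof (rule set_integral_mono[OF set_integral_add(1)[OF i1 i2]])
  show "lint {0..T} (%s. exp (y s))" by (intro set_integrable_continuous continuous_intros y)
  fix s
  have "exp c * (1 + (y s - c)) <= exp c * exp (y s - c)" by (intro mult_left_mono exp_ge_add_one_self) auto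
  then show "exp c * (1 - c) + exp c * y s <= exp (y s)" by (simp add: exp_diff algebra_simps)
 qed
 finally show ?thesis using T by (simp add: c_def pos_le_divide_eq)
qed

lemma gronwall_path:
 fixes u v :: "real => real"
 assumes u: "conti u" "!!t. 0 <= u t" and v: "conti v" "!!t. 0 <= v t"
  and A: "0 <= A" and C: "0 <= C"
  and le: "!!t. 0 <= t ==> t <= T ==> u t <= A + (LBINT s:{0..t}. C * (u s + v s))"
  and t: "0 <= t" "t <= T"
 shows "u t <= 2 * (A + C * (LBINT s:{0..T}. v s)) * exp (2 * C * T)"
proof -
 let ?A = "A + C * (LBINT s:{0..T}. v s)"
 have vn: "0 <= (LBINT s:{0..r}. v s)" for r
  by (rule LBINT_nonneg) (rule v(2))
 have A': "0 <= ?A" using A C vn by simp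
 have "compact ((%s. u s) ` {0..T})"
  by (rule compact_continuous_image[OF continuous_on_subset[OF u(1)]]) auto
 then obtain S where S: "!!s. s \<in> {0..T} ==> u s <= S"
  using compact_imp_bounded bounded_imp_bdd_above unfolding bdd_above_def by (metis image_eqI)
 have vmono: "(LBINT s:{0..r}. v s) <= (LBINT s:{0..T}. v s)" if "r <= T" for r
  unfolding set_lebesgue_integral_def
 proof (rule integral_mono)
  show "integrable lborel (%x. indicator {0..r} x *\<^sub>R v x)" "integrable lborel (%x. indicator {0..T} x *\<^sub>R v x)"
   using set_integrable_continuous[OF v(1)] by (auto simp: set_integrable_def)
 qed (use that v(2) in \<open>auto simp: indicator_def\<close>)
 have "u t <= 2 * ?A * exp (2 * C * t)"
 proof (rule gronwall_bounded[OF C A' _ _ _ t, of u S])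
  show "set_borel_measurable lborel {0..T} u"
   using set_integrable_continuous[OF u(1), of 0 T] unfolding set_integrable_def set_borel_measurable_def by auto
  show "0 <= u t & u t <= S" if "0 <= t" "t <= T" for t using u(2) S that by auto
  show "u r <= ?A + C * (LBINT s:{0..r}. u s)" if r: "0 <= r" "r <= T" for r
  proof -
   have "u r <= A + (LBINT s:{0..r}. C * (u s + v s))" by (rule le[OF r])
   also have "(LBINT s:{0..r}. C * (u s + v s)) = C * (LBINT s:{0..r}. u s) + C * (LBINT s:{0..r}. v s)"
    using set_integrable_continuous[OF u(1), of 0 r] set_integrable_continuous[OF v(1), of 0 r]
    by (simp add: distrib_left)
   also have "C * (LBINT s:{0..r}. v s) <= C * (LBINT s:{0..T}. v s)"
    by (intro mult_left_mono vmono r C)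
   finally show ?thesis by simp
  qed
 qed
 also have "... <= 2 * ?A * exp (2 * C * T)"
  using A' t C by (intro mult_left_mono) (auto intro: mult_left_mono)
 finally show ?thesis .
qed

lemma (in prob_space) process_Fubini:
 fixes f :: "real => 'a => real"
 assumes m: "jmeas M f"
  and i: "!!t. a <= t ==> t <= b ==> integrable M (f t)"
  and bnd: "!!t. a <= t ==> t <= b ==> (EE w. abs (f t w)) <= c"
 shows "integrable M (%w. LBINT s:{a..b}. f s w)"
  "(EE w. (LBINT s:{a..b}. f s w)) = (LBINT s:{a..b}. (EE w. f s w))"
  "AE w in M. lint {a..b} (%s. f s w)"
  "lint {a..b} (%s. \<integral>w. f s w \<partial>M)"
proof -
 interpret L: sigma_finite_measure "lborel :: real measure" by (rule lborel.sigma_finite_measure_axioms)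
 interpret P: pair_sigma_finite "lborel :: real measure" M ..
 define g where "g = (%p. indicator {a..b} (fst p) * f (fst p) (snd p))"
 have gm[measurable]: "g \<in> meas (lborel \<Otimes>\<^sub>M M)"
 proof -
  have "(%p. f (fst p) (snd p)) \<in> meas (lborel \<Otimes>\<^sub>M M)" using m by simp
  then show ?thesis unfolding g_def by measurable
 qed
 have gi: "integrable (lborel \<Otimes>\<^sub>M M) g"
 proof (rule P.Fubini_integrable[OF gm])
  have "(%x. \<integral>y. norm (g (x, y)) \<partial>M) \<in> meas lborel" by measurable
  then show "integrable lborel (%x. \<integral>y. norm (g (x, y)) \<partial>M)"
  proof (rule integrable_bound[where f = "%x. indicator {a..b} x *\<^sub>R c", rotated])
   show "AE x in lborel. norm (\<integral>y. norm (g (x, y)) \<partial>M) <= norm (indicator {a..b} x *\<^sub>R c)"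
    using bnd by (intro AE_I2) (auto simp: g_def indicator_def abs_mult intro: order_trans[OF _ abs_ge_self])
   show "integrable lborel (%x. indicator {a..b} x *\<^sub>R c)"
    using set_integrable_continuous[OF continuous_on_const, of a b c] by (simp add: set_integrable_def)
  qed
  show "AE x in lborel. integrable M (%y. g (x, y))"
   using i by (intro AE_I2) (auto simp: g_def indicator_def)
 qed
 have gi': "integrable (lborel \<Otimes>\<^sub>M M) (case_prod (%x y. g (x, y)))" using gi by simp
 have eq1: "(LBINT s:{a..b}. f s w) = (LBINT x. g (x, w))" for w
  by (simp add: set_lebesgue_integral_def g_def)
 have eq2: "(LBINT s:{a..b}. (EE w. f s w)) = (LBINT x. (\<integral>y. g (x, y) \<partial>M))"
  by (simp add: set_lebesgue_integral_def g_def)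
 show "integrable M (%w. LBINT s:{a..b}. f s w)"
  unfolding eq1 by (rule P.integrable_snd[OF gi'])
 show "(EE w. (LBINT s:{a..b}. f s w)) = (LBINT s:{a..b}. (EE w. f s w))"
  unfolding eq1 eq2 using P.Fubini_integral[OF gi'] by simp
 show "AE w in M. lint {a..b} (%s. f s w)"
  using P.AE_integrable_snd[OF gi'] by (simp add: set_integrable_def g_def)
 show "lint {a..b} (%s. \<integral>w. f s w \<partial>M)"
  using P.integrable_fst[OF gi'] by (simp add: set_integrable_def g_def)
qed

text \<open>\<open>be\<close> is a version of the Brownian motion \<open>B\<close> whose paths are all continuous.\<close>

locale brownian_space = prob_space M for M :: "'a measure" +
 fixes T :: real and B be :: "real => 'a => real"
 assumes T: "0 < T" and bm: "brownian_motion M T B"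
  and be_cont: "!!w. conti (%t. be t w)"
  and be_meas [measurable]: "!!t. be t \<in> meas M"
  and be_eq: "AE w in M. \<forall>t\<in>{0..T}. be t w = B t w"
begin

lemma be_zero: "AE w in M. be 0 w = 0"
proof -
 have "AE w in M. B 0 w = 0" using bm by (simp add: brownian_motion_def)
 with be_eq show ?thesis by eventually_elim (use T in auto)
qed

lemma increment_moments:
 assumes st: "0 <= s" "s <= t" "t <= T"
 shows "integrable M (%w. (be t w - be s w)^2)" "(EE w. (be t w - be s w)^2) = t - s"
  "integrable M (%w. be t w - be s w)" "(EE w. abs (be t w - be s w)) <= sqrt (t - s)"
proof -
 have 1: "integrable M (%w. (be t w - be s w)^2) & (EE w. (be t w - be s w)^2) = t - s"
 proof (cases "s = t")
  case False
  then have "s < t" using st by simp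
  note m = brownian_increment_moments[OF bm st(1) this st(3)]
  have [measurable]: "B t \<in> meas M" "B s \<in> meas M"
   using brownian_measurable[OF bm] st by auto
  have ae: "AE w in M. (be t w - be s w)^2 = (B t w - B s w)^2"
   using be_eq by eventually_elim (use st in auto)
  show ?thesis
   using m integrable_cong_AE[OF _ _ ae] integral_cong_AE[OF _ _ ae] by simp
 qed simp
 then show i2: "integrable M (%w. (be t w - be s w)^2)" and e2: "(EE w. (be t w - be s w)^2) = t - s" by auto
 show i1: "integrable M (%w. be t w - be s w)"
  by (rule square_integrable_imp_integrable[OF _ i2]) measurable
 show "(EE w. abs (be t w - be s w)) <= sqrt (t - s)"
  using real_le_rsqrt[OF mean_abs_square_le[OF i1 i2]] e2 by simp
qed

lemma be_moments:
 assumes t: "0 <= t" "t <= T"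
 shows "integrable M (%w. (be t w)^2)" "(EE w. (be t w)^2) = t"
  "integrable M (be t)" "(EE w. abs (be t w)) <= sqrt T"
proof -
 have ae: "AE w in M. be t w = be t w - be 0 w" using be_zero by eventually_elim simp
 have ae2: "AE w in M. (be t w)^2 = (be t w - be 0 w)^2" using be_zero by eventually_elim simp
 have ae3: "AE w in M. abs (be t w) = abs (be t w - be 0 w)" using be_zero by eventually_elim simp
 note m = increment_moments[of 0 t, simplified, OF t]
 show "integrable M (%w. (be t w)^2)" using m(1) integrable_cong_AE[OF _ _ ae2] by simp
 show "(EE w. (be t w)^2) = t" using m(2) integral_cong_AE[OF _ _ ae2] by simp
 show "integrable M (be t)" using m(3) integrable_cong_AE[OF _ _ ae] by simp
 have "(EE w. abs (be t w)) <= sqrt t" using m(4) integral_cong_AE[OF _ _ ae3] by simp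
 also have "... <= sqrt T" using t by simp
 finally show "(EE w. abs (be t w)) <= sqrt T" .
qed

definition I :: "'a => real" where
 "I w = (LBINT s:{0..T}. abs (be s w))"

lemma be_joint [measurable]: "jmeas M be"
 by (rule continuous_process_jointly_measurable[OF be_meas be_cont])

lemma I_moments: "integrable M I" "(EE w. I w) <= T * sqrt T" "0 <= I w"
proof -
 have m: "(%p. abs (be (fst p) (snd p))) \<in> meas (borel \<Otimes>\<^sub>M M)" by measurable
 note F = process_Fubini[OF m, of 0 T "sqrt T"]
 show "integrable M I" unfolding I_def[abs_def] by (rule F(1)) (use be_moments in auto)
 have "(EE w. I w) = (LBINT s:{0..T}. (EE w. abs (be s w)))"
  unfolding I_def[abs_def] by (rule F(2)) (use be_moments in auto)
 also have "... <= (LBINT s:{0..T}. sqrt T)"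
  by (rule set_integral_mono) (use F(4) be_moments set_integrable_continuous[OF continuous_on_const] in auto)
 also have "... = T * sqrt T" using T by (simp add: set_lebesgue_integral_def)
 finally show "(EE w. I w) <= T * sqrt T" .
 show "0 <= I w" unfolding I_def by (rule LBINT_nonneg) simp
qed

text \<open>By Jensen's inequality the exponential of the time integral is at most the time average of \<open>exp (k T B\<^sup>2)\<close>, whose means are explicit Gaussian integrals; \<open>4 k T\<^sup>2 \<le> 1\<close> keeps them below \<open>sqrt 2\<close>.\<close>

lemma exp_moment:
 assumes k: "0 <= k" "4 * k * T^2 <= 1"
 shows "integrable M (%w. exp (k * (LBINT s:{0..T}. (be s w)^2)))"
  "(EE w. exp (k * (LBINT s:{0..T}. (be s w)^2))) <= 2"
proof -
 have one: "integrable M (%w. exp (k * T * (be s w)^2)) & (EE w. exp (k * T * (be s w)^2)) <= sqrt 2"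
  if s: "0 <= s" "s <= T" for s
 proof (cases "s = 0")
  case True
  have ae: "AE w in M. exp (k * T * (be s w)^2) = 1" using be_zero by eventually_elim (simp add: True)
  show ?thesis using integrable_cong_AE[OF _ _ ae] integral_cong_AE[OF _ _ ae] by (simp add: prob_space)
 next
  case False
  then have s0: "0 < s" using s by simp
  have [measurable]: "B s \<in> meas M" "B 0 \<in> meas M"
   using brownian_measurable[OF bm] s T by auto
  have d: "distr M borel (be s) = distr gauss borel (%x. sqrt s * x)"
  proof -
   have "distr M borel (be s) = distr M borel (%w. B s w - B 0 w)"
   proof (rule distr_cong_AE)
    have "AE w in M. B 0 w = 0" using bm by (simp add: brownian_motion_def)
    then show "AE w in M. be s w = B s w - B 0 w" using be_eq by eventually_elim (use s in auto)
   qed auto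
   then show ?thesis using brownian_increment_distr[OF bm _ s0 s(2)] by simp
  qed
  have ks: "k * T * s <= 1/4"
  proof -
   have "k * T * s <= k * T * T" using s k T by (intro mult_left_mono) auto
   then show ?thesis using k by (simp add: power2_eq_square)
  qed
  have id: "std_normal_density x * exp (x^2 / 4) = sqrt 2 * normal_density 0 (sqrt 2) x" for x
  proof -
   have "exp (- (x^2) / 2) * exp (x^2 / 4) = exp (- (x^2) / 4)" by (simp add: exp_add[symmetric])
   then show ?thesis
    by (simp add: std_normal_density_def normal_density_def real_sqrt_mult) (simp add: field_simps)
  qed
  have ig: "integrable gauss (%x. exp (x^2 / 4))"
   by (subst integrable_gauss_iff) (auto simp: id)
  have eg: "(GE x. exp (x^2 / 4)) = sqrt 2"
   by (subst integral_gauss) (auto simp: id)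
  have le: "exp (k * T * (sqrt s * x)^2) <= exp (x^2 / 4)" for x
  proof -
   have "k * T * (sqrt s * x)^2 = (k * T * s) * x^2" using s by (simp add: power_mult_distrib)
   also have "... <= (1/4) * x^2" by (intro mult_right_mono ks) simp
   finally show ?thesis by simp
  qed
  have i: "integrable gauss (%x. exp (k * T * (sqrt s * x)^2))"
   by (rule integrable_bound[OF ig]) (use le in auto)
  then have "integrable (distr M borel (be s)) (%x. exp (k * T * x^2))"
   unfolding d by (subst integrable_distr_eq) auto
  then have 1: "integrable M (%w. exp (k * T * (be s w)^2))" by (subst (asm) integrable_distr_eq) auto
  have "(EE w. exp (k * T * (be s w)^2)) = (\<integral>x. exp (k * T * x^2) \<partial>distr M borel (be s))"
   by (subst integral_distr) auto
  also have "... = (GE x. exp (k * T * (sqrt s * x)^2))" unfolding d by (subst integral_distr) auto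
  also have "... <= sqrt 2" unfolding eg[symmetric] by (rule integral_mono[OF i ig le])
  finally show ?thesis using 1 by simp
 qed
 have m: "(%p. exp (k * T * (be (fst p) (snd p))^2)) \<in> meas (borel \<Otimes>\<^sub>M M)" by measurable
 note F = process_Fubini[OF m, of 0 T "sqrt 2"]
 define J where "J w = (LBINT s:{0..T}. exp (k * T * (be s w)^2))" for w
 have iJ: "integrable M J" unfolding J_def[abs_def] by (rule F(1)) (use one in auto)
 have "(EE w. J w) = (LBINT s:{0..T}. (EE w. exp (k * T * (be s w)^2)))"
  unfolding J_def[abs_def] by (rule F(2)) (use one in auto)
 also have "... <= (LBINT s:{0..T}. sqrt 2)"
  by (rule set_integral_mono) (use F(4) one set_integrable_continuous[OF continuous_on_const] in auto)
 also have "... = T * sqrt 2" using T by (simp add: set_lebesgue_integral_def)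
 finally have EJ: "(EE w. J w) <= T * sqrt 2" .
 have le: "exp (k * (LBINT s:{0..T}. (be s w)^2)) <= J w / T" for w
 proof -
  have "conti (%s. k * T * (be s w)^2)" by (intro continuous_intros be_cont)
  from exp_average_le[OF this T] show ?thesis using T by (simp add: J_def)
 qed
 have sm: "(%w. exp (k * (LBINT s:{0..T}. (be s w)^2))) \<in> meas M"
 proof -
  have m2: "(%p. (be (fst p) (snd p))^2) \<in> meas (borel \<Otimes>\<^sub>M M)" by measurable
  have "integrable M (%w. LBINT s:{0..T}. (be s w)^2)"
   by (rule process_Fubini(1)[OF m2, of 0 T T]) (use be_moments in auto)
  then show ?thesis by measurable
 qed
 have "abs (exp (k * (LBINT s:{0..T}. (be s w)^2))) <= J w / T" for w using le by simp
 note I = integrable_le[OF integrable_divide[OF iJ] sm this]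
 show "integrable M (%w. exp (k * (LBINT s:{0..T}. (be s w)^2)))" by (rule I(1))
 note I(3)
 also have "(EE w. J w / T) <= sqrt 2" using EJ T by (simp add: divide_le_eq mult.commute)
 also have "... <= 2" using real_sqrt_le_mono[of 2 4] by simp
 finally show "(EE w. exp (k * (LBINT s:{0..T}. (be s w)^2))) <= 2" .
qed

end

section \<open>Solutions of the mean-field equation\<close>

lemma set_integral_split_point:
 fixes f :: "real => real"
 assumes f: "lint {a..c} f" and b: "a <= b" "b <= c"
 shows "(LBINT x:{a..c}. f x) = (LBINT x:{a..b}. f x) + (LBINT x:{b..c}. f x)"
proof -
 have "{a..c} = {a..b} \<union> {b..c}" using b by auto
 moreover have "(LINT x:{a..b} \<union> {b..c}|lborel. f x) = (LBINT x:{a..b}. f x) + (LBINT x:{b..c}. f x)"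
 proof (rule set_integral_Un_AE)
  have "AE x in lborel. x ~= b" by (rule AE_lborel_singleton)
  then show "AE x in lborel. \<not> (x \<in> {a..b} & x \<in> {b..c})" by eventually_elim auto
  show "lint {a..b} f" "lint {b..c} f"
   by (rule set_integrable_subset[OF f]; use b in auto)+
 qed auto
 ultimately show ?thesis by simp
qed

context brownian_space
begin

text \<open>What is used of a solution in the moment estimates: growth linear in the Brownian path (with \<open>I\<close> its time integral), and increments that exceed those of the noise by the integral of a linear function of the process. The constant \<open>k\<close> can be chosen uniformly over solutions with bounded initial values, see \<open>solves_controlled\<close>.\<close>

definition controlled :: "real => (real => 'a => real) => bool" where
 "controlled k Z \<longleftrightarrow> (\<forall>w. conti (%t. Z t w)) &
   (\<forall>t\<in>{0..T}. Z t \<in> meas (Filt M B t)) & (\<forall>t. Z t \<in> meas M) &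
   (AE w in M. (\<forall>t\<in>{0..T}. abs (Z t w) <= k * (1 + abs (be t w) + I w)) &
    (\<forall>s t. 0 <= s --> s <= t --> t <= T -->
     abs (Z t w - Z s w - (be t w - be s w)) <= (LBINT r:{s..t}. k * (1 + abs (Z r w)))))"

end

locale mckean_drift = brownian_space M T B be for M :: "'a measure" and T B be +
 fixes b bh bt :: "real => real => real measure => real" and K C :: real
 assumes bh_meas: "drift_measurable T bh" and K: "0 <= K" and C: "0 <= C"
  and decomp: "!!t y \<mu>. t \<in> {0..T} ==> \<mu> \<in> P1 ==> b t y \<mu> = bh t y \<mu> + bt t y \<mu>"
  and bh_bound: "!!t y \<mu>. t \<in> {0..T} ==> \<mu> \<in> P1 ==> abs (bh t y \<mu>) <= K"
  and bt_growth: "!!t y \<mu>. t \<in> {0..T} ==> \<mu> \<in> P1 ==> abs (bt t y \<mu>) <= C * (1 + abs y + kantorovich \<mu> (return borel 0))"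
  and bt_lip: "!!t y y' \<mu>. t \<in> {0..T} ==> \<mu> \<in> P1 ==> abs (bt t y \<mu> - bt t y' \<mu>) <= C * abs (y - y')"
  and law_lip: "!!t y \<mu> \<nu>. t \<in> {0..T} ==> \<mu> \<in> P1 ==> \<nu> \<in> P1 ==> abs (b t y \<mu> - b t y \<nu>) <= C * kantorovich \<mu> \<nu>"
begin

text \<open>A strong solution with continuous paths everywhere, measurable at all times and driven by the version \<open>be\<close>. Its integrability replaces the condition that its laws belong to \<^const>\<open>P1\<close>.\<close>

definition solves :: "real => (real => 'a => real) => bool" where
 "solves x Z \<longleftrightarrow> (\<forall>w. conti (%t. Z t w)) &
   (\<forall>t\<in>{0..T}. Z t \<in> meas (Filt M B t)) & (\<forall>t. Z t \<in> meas M) &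
   (\<forall>t\<in>{0..T}. integrable M (Z t)) &
   (AE w in M. lint {0..T} (%s. b s (Z s w) (law (Z s))) &
    (\<forall>t\<in>{0..T}. Z t w = x + (LBINT s:{0..t}. b s (Z s w) (law (Z s))) + be t w))"

lemma strong_solution_version:
 assumes "strong_solution M T B b x X"
 obtains Z where "solves x Z" "AE w in M. \<forall>t\<in>{0..T}. Z t w = X t w"
proof -
 have ad: "X t \<in> meas (Filt M B t)" if "t \<in> {0..T}" for t
  using assms that by (auto simp: strong_solution_def)
 have Xm: "X t \<in> meas M" if "t \<in> {0..T}" for t
  using augmented_measurable[OF bm _ ad[OF that]] that by auto
 have T0: "0 <= T" using T by simp
 have cont: "AE w in M. continuous_on {0..T} (%t. X t w)" using assms by (simp add: strong_solution_def)
 obtain Z where Z: "!!w. conti (%t. Z t w)"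
  "!!t. t \<in> {0..T} ==> Z t \<in> meas (Filt M B t)"
  "!!t. Z t \<in> meas M" "AE w in M. \<forall>t\<in>{0..T}. Z t w = X t w"
 proof (rule continuous_version[where T = T and X = X and M = M and B = B], goal_cases)
  case (5 Z)
  show thesis by (rule 5(1)[OF 5(2) 5(3) 5(4) 5(5)])
 qed (use T0 ad Xm cont in auto)
 have dZ: "law (Z t) = law (X t)" if "t \<in> {0..T}" for t
  by (rule distr_cong_AE) (use Z(3) Xm[OF that] Z(4) that in auto)
 have iZ: "integrable M (Z t)" if "t \<in> {0..T}" for t
 proof -
  have "law (Z t) \<in> P1" using assms that dZ[OF that] by (auto simp: strong_solution_def)
  then have "integrable (law (Z t)) (%x. abs x)" by (simp add: P1_def)
  then have "integrable M (%w. abs (Z t w))" using Z(3)[of t] by (subst (asm) integrable_distr_eq) auto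
  then show ?thesis using Z(3)[of t] by (simp add: integrable_abs_iff)
 qed
 have "AE w in M. lint {0..T} (%s. b s (X s w) (law (X s))) &
    (\<forall>t\<in>{0..T}. X t w = x + (LBINT s:{0..t}. b s (X s w) (law (X s))) + B t w)"
  using assms by (simp add: strong_solution_def)
 then have "AE w in M. lint {0..T} (%s. b s (Z s w) (law (Z s))) &
    (\<forall>t\<in>{0..T}. Z t w = x + (LBINT s:{0..t}. b s (Z s w) (law (Z s))) + be t w)"
  using Z(4) be_eq
 proof eventually_elim
  case (elim w)
  have eq: "b s (X s w) (law (X s)) = b s (Z s w) (law (Z s))" if "s \<in> {0..T}" for s
   using elim(2) dZ[OF that] that by simp
  have "lint {0..T} (%s. b s (Z s w) (law (Z s)))"
  proof -
   have "lint {0..T} (%s. b s (X s w) (law (X s)))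
    = lint {0..T} (%s. b s (Z s w) (law (Z s)))"
    by (rule set_integrable_cong) (use eq in auto)
   then show ?thesis using elim(1) by simp
  qed
  moreover have "(LBINT s:{0..t}. b s (X s w) (law (X s))) = (LBINT s:{0..t}. b s (Z s w) (law (Z s)))"
   if "t \<in> {0..T}" for t
   by (rule set_lebesgue_integral_cong) (use eq that in auto)
  ultimately show ?case using elim by auto
 qed
 then have "solves x Z" unfolding solves_def using Z(1,2,3) iZ by auto
 then show ?thesis using that Z(4) by blast
qed

context
 fixes x Z assumes Z: "solves x Z"
begin

lemma solves_cont: "conti (%t. Z t w)"
 and solves_adapted: "t \<in> {0..T} ==> Z t \<in> meas (Filt M B t)"
 and solves_meas [measurable]: "Z t \<in> meas M"
 and solves_integrable: "t \<in> {0..T} ==> integrable M (Z t)"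
 and solves_eq: "AE w in M. lint {0..T} (%s. b s (Z s w) (law (Z s))) &
    (\<forall>t\<in>{0..T}. Z t w = x + (LBINT s:{0..t}. b s (Z s w) (law (Z s))) + be t w)"
 using Z by (auto simp: solves_def)

lemma solves_joint [measurable]: "jmeas M Z"
 by (rule continuous_process_jointly_measurable[OF solves_meas solves_cont])

lemma solves_law: "t \<in> {0..T} ==> law (Z t) \<in> P1"
 using kantorovich_le_expectation(1)[OF prob_space_axioms solves_meas solves_meas solves_integrable solves_integrable] .

lemma solves_kantorovich_zero:
 assumes "t \<in> {0..T}"
 shows "kantorovich (law (Z t)) (return borel 0) <= (EE w. abs (Z t w))"
proof -
 have "law (%_. 0 :: real) = return borel 0" by (rule distr_const) simp
 then show ?thesis
  using kantorovich_le_expectation(2)[OF prob_space_axioms solves_meas _ solves_integrable[OF assms], of "%_. 0"] by simp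
qed

text \<open>The first moments are finite by assumption, but Gronwall's inequality needs them bounded in time. Comparing an arbitrary path with one fixed good path helps: both drifts contain the same law, so the Kantorovich term cancels and the difference of the paths is bounded by the noise and \<open>K\<close> alone.\<close>

lemma solves_first_moment_bounded: "\<exists>c. \<forall>t\<in>{0..T}. (EE w. abs (Z t w)) <= c"
proof -
 define a where "a s w = b s (Z s w) (law (Z s))" for s w
 define good where "good w \<longleftrightarrow> lint {0..T} (%s. a s w) &
   (\<forall>t\<in>{0..T}. Z t w = x + (LBINT s:{0..t}. a s w) + be t w)" for w
 have ae: "AE w in M. good w" using solves_eq by (simp add: good_def a_def)
 then have "\<exists>w. good w" using AE_contr[of good] by auto
 then obtain w0 where g0: "good w0" by blast
 \<comment> \<open>the same law enters both drifts\<close>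
 have diff: "abs (a s w - a s w') <= 2 * K + C * abs (Z s w - Z s w')" if s: "s \<in> {0..T}" for s w w'
  using decomp[OF s solves_law[OF s], of "Z s w"] decomp[OF s solves_law[OF s], of "Z s w'"]
   bh_bound[OF s solves_law[OF s], of "Z s w"] bh_bound[OF s solves_law[OF s], of "Z s w'"]
   bt_lip[OF s solves_law[OF s], of "Z s w" "Z s w'"]
  by (simp add: a_def)
 define y where "y t w = Z t w - be t w" for t w
 have wc: "conti (%t. y t w)" for w unfolding y_def by (intro continuous_intros solves_cont be_cont)
 obtain S where S: "!!t. t \<in> {0..T} ==> abs (y t w0) <= S"
 proof -
  have "compact ((%t. y t w0) ` {0..T})"
   by (rule compact_continuous_image[OF continuous_on_subset[OF wc]]) auto
  then have "bounded ((%t. y t w0) ` {0..T})" by (rule compact_imp_bounded)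
  then obtain S where "\<forall>t\<in>{0..T}. abs (y t w0) <= S" unfolding bounded_iff by auto
  then show ?thesis by (intro that) auto
 qed
 define E where "E = exp (2 * C * T)"
 have E0: "0 <= E" by (simp add: E_def)
 have path: "abs (Z t w) <= S + abs (be t w) + 2 * (2 * K * T + C * (I w + I w0)) * E" if g: "good w" and t: "t \<in> {0..T}" for w t
 proof -
  have "abs (y t w - y t w0) <= 2 * (2 * K * T + C * (LBINT s:{0..T}. abs (be s w) + abs (be s w0))) * exp (2 * C * T)"
  proof (rule gronwall_path[where u = "%t. abs (y t w - y t w0)" and v = "%s. abs (be s w) + abs (be s w0)"])
   fix r assume r: "0 <= r" "r <= T"
   have ia: "lint {0..r} (%s. a s w)" "lint {0..r} (%s. a s w0)"
    using g g0 r by (auto simp: good_def intro: set_integrable_subset)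
   have i2: "lint {0..r} (%s. C * (abs (y s w - y s w0) + (abs (be s w) + abs (be s w0))))"
    by (intro set_integrable_continuous continuous_intros wc be_cont)
   have ic: "lint {0..r} (%s. 2 * K)" by (intro set_integrable_continuous continuous_intros)
   have "y r w - y r w0 = (LBINT s:{0..r}. a s w - a s w0)"
    using g g0 r set_integral_diff(2)[OF ia] by (simp add: good_def y_def)
   also have "abs ... <= (LBINT s:{0..r}. abs (a s w - a s w0))"
    using set_integral_norm_bound[OF set_integral_diff(1)[OF ia]] by simp
   also have "... <= (LBINT s:{0..r}. 2 * K + C * (abs (y s w - y s w0) + (abs (be s w) + abs (be s w0))))"
   proof (rule set_integral_mono)
    show "lint {0..r} (%s. abs (a s w - a s w0))"
     by (rule set_integrable_abs[OF set_integral_diff(1)[OF ia]])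
    show "lint {0..r} (%s. 2 * K + C * (abs (y s w - y s w0) + (abs (be s w) + abs (be s w0))))"
     by (rule set_integral_add(1)[OF ic i2])
    fix s assume "s \<in> {0..r}"
    then have s: "s \<in> {0..T}" using r by auto
    have "abs (Z s w - Z s w0) <= abs (y s w - y s w0) + (abs (be s w) + abs (be s w0))" unfolding y_def by linarith
    from mult_left_mono[OF this C] diff[OF s, of w w0]
    show "abs (a s w - a s w0) <= 2 * K + C * (abs (y s w - y s w0) + (abs (be s w) + abs (be s w0)))" by linarith
   qed
   also have "... = r * (2 * K) + (LBINT s:{0..r}. C * (abs (y s w - y s w0) + (abs (be s w) + abs (be s w0))))"
    using set_integral_add(2)[OF ic i2] set_integral_const_Icc[OF r(1), of "2 * K"] by simp
   also have "r * (2 * K) <= 2 * K * T" using mult_right_mono[OF r(2), of "2 * K"] K by (simp add: mult_ac)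
   finally show "abs (y r w - y r w0) <= 2 * K * T + (LBINT s:{0..r}. C * (abs (y s w - y s w0) + (abs (be s w) + abs (be s w0))))" by simp
  qed (use K C T t in \<open>auto intro!: continuous_intros wc be_cont\<close>)
  also have "(LBINT s:{0..T}. abs (be s w) + abs (be s w0)) = I w + I w0"
   unfolding I_def by (intro set_integral_add(2) set_integrable_continuous continuous_intros be_cont)
  finally have "abs (y t w - y t w0) <= 2 * (2 * K * T + C * (I w + I w0)) * E" by (simp add: E_def)
  then show ?thesis using S[OF t] unfolding y_def by linarith
 qed
 define c where "c = S + sqrt T + 2 * (2 * K * T + C * (T * sqrt T + I w0)) * E"
 have "(EE w. abs (Z t w)) <= c" if t: "t \<in> {0..T}" for t
 proof -
  have i: "integrable M (%w. S + abs (be t w) + 2 * (2 * K * T + C * (I w + I w0)) * E)"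
   using be_moments(3)[of t] I_moments(1) t by auto
  have "(EE w. abs (Z t w)) <= (EE w. S + abs (be t w) + 2 * (2 * K * T + C * (I w + I w0)) * E)"
  proof (rule integral_mono_AE[OF _ i])
   show "integrable M (%w. abs (Z t w))" using solves_integrable[OF t] by simp
   show "AE w in M. abs (Z t w) <= S + abs (be t w) + 2 * (2 * K * T + C * (I w + I w0)) * E"
    using ae by eventually_elim (rule path[OF _ t])
  qed
  also have "... = S + (EE w. abs (be t w)) + 2 * (2 * K * T + C * ((EE w. I w) + I w0)) * E"
   using be_moments(3)[of t] I_moments(1) t by (simp add: prob_space)
  also have "... <= c" unfolding c_def
   using be_moments(4)[of t] I_moments(2) t C E0 by (intro add_mono mult_right_mono mult_left_mono) auto
  finally show ?thesis .
 qed
 then show ?thesis by blast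
qed

text \<open>Gronwall's inequality for the first moment, which dominates the Kantorovich distance to the Dirac measure.\<close>

lemma solves_first_moment_uniform:
 assumes x: "abs x <= R" and t: "t \<in> {0..T}"
 shows "(EE w. abs (Z t w)) <= 2 * (R + (K + C) * T + sqrt T) * exp (2 * (2 * C) * T)"
proof -
 define m where "m s = (EE w. abs (Z s w))" for s
 obtain c where "\<forall>s\<in>{0..T}. m s <= c" using solves_first_moment_bounded unfolding m_def by blast
 then have c: "m s <= c" if "s \<in> {0..T}" for s using that by blast
 have m0: "0 <= m s" for s by (simp add: m_def)
 have R0: "0 <= R" using x by linarith
 have jm: "(%p. abs (Z (fst p) (snd p))) \<in> meas (borel \<Otimes>\<^sub>M M)" by measurable
 note F = process_Fubini[OF jm, of 0 _ c]
 have iZ: "integrable M (%w. abs (Z s w))" if "s \<in> {0..T}" for s using solves_integrable[OF that] by simp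
 have mi: "lint {0..r} m" if "r <= T" for r
  unfolding m_def by (rule F(4)) (use iZ c that in \<open>auto simp: m_def\<close>)
 have ZI: "integrable M (%w. LBINT s:{0..r}. abs (Z s w))"
  "(EE w. (LBINT s:{0..r}. abs (Z s w))) = (LBINT s:{0..r}. m s)" if "r <= T" for r
  unfolding m_def by (rule F(1) F(2); use iZ c that in \<open>auto simp: m_def\<close>)+
 have le: "m r <= (R + (K + C) * T + sqrt T) + (2 * C) * (LBINT s:{0..r}. m s)" if r: "0 <= r" "r <= T" for r
 proof -
  have path: "AE w in M. abs (Z r w) <= R + ((K + C) * T + C * (LBINT s:{0..r}. abs (Z s w)) + C * (LBINT s:{0..r}. m s)) + abs (be r w)"
   using solves_eq
  proof eventually_elim
   case (elim w)
   define a where "a s = b s (Z s w) (law (Z s))" for s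
   have ia: "lint {0..r} a"
    using elim r by (auto simp: a_def[abs_def] intro: set_integrable_subset)
   have i1: "lint {0..r} (%s. K + C)" by (intro set_integrable_continuous continuous_intros)
   have i2: "lint {0..r} (%s. C * abs (Z s w))" by (intro set_integrable_continuous continuous_intros solves_cont)
   have i3: "lint {0..r} (%s. C * m s)" using mi[OF r(2)] by simp
   note i23 = set_integral_add[OF i2 i3]
   note i123 = set_integral_add[OF i1 i23(1)]
   have "abs (LBINT s:{0..r}. a s) <= (LBINT s:{0..r}. abs (a s))"
    using set_integral_norm_bound[OF ia] by simp
   also have "... <= (LBINT s:{0..r}. (K + C) + (C * abs (Z s w) + C * m s))"
   proof (rule set_integral_mono[OF set_integrable_abs[OF ia] i123(1)])
    fix s assume "s \<in> {0..r}"
    then have s: "s \<in> {0..T}" using r by auto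
    have "C * (1 + abs (Z s w) + kantorovich (law (Z s)) (return borel 0)) <= C * (1 + abs (Z s w) + m s)"
     using solves_kantorovich_zero[OF s] C by (intro mult_left_mono) (auto simp: m_def)
    then show "abs (a s) <= (K + C) + (C * abs (Z s w) + C * m s)"
     using decomp[OF s solves_law[OF s], of "Z s w"] bh_bound[OF s solves_law[OF s], of "Z s w"]
      bt_growth[OF s solves_law[OF s], of "Z s w"] by (simp add: a_def distrib_left)
   qed
   also have "... = r * (K + C) + (C * (LBINT s:{0..r}. abs (Z s w)) + C * (LBINT s:{0..r}. m s))"
    using i123(2) i23(2) set_integral_const_Icc[OF r(1), of "K + C"] by simp
   also have "r * (K + C) <= (K + C) * T" using mult_right_mono[OF r(2), of "K + C"] K C by (simp add: mult.commute)
   finally have "abs (LBINT s:{0..r}. a s) <= (K + C) * T + C * (LBINT s:{0..r}. abs (Z s w)) + C * (LBINT s:{0..r}. m s)" by simp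
   moreover have "Z r w = x + (LBINT s:{0..r}. a s) + be r w" using elim r by (simp add: a_def)
   ultimately show ?case using x by linarith
  qed
  have i: "integrable M (%w. R + ((K + C) * T + C * (LBINT s:{0..r}. abs (Z s w)) + C * (LBINT s:{0..r}. m s)) + abs (be r w))"
   using ZI[OF r(2)] be_moments(3)[OF r] by auto
  have "m r <= (EE w. R + ((K + C) * T + C * (LBINT s:{0..r}. abs (Z s w)) + C * (LBINT s:{0..r}. m s)) + abs (be r w))"
   unfolding m_def[of r] by (rule integral_mono_AE[OF _ i path]) (use iZ r in auto)
  also have "... = R + ((K + C) * T + C * (LBINT s:{0..r}. m s) + C * (LBINT s:{0..r}. m s)) + (EE w. abs (be r w))"
   using ZI[OF r(2)] be_moments(3)[OF r] by (simp add: prob_space)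
  finally show ?thesis using be_moments(4)[OF r] by simp
 qed
 have "m t <= 2 * (R + (K + C) * T + sqrt T) * exp (2 * (2 * C) * t)"
 proof (rule gronwall_bounded[OF _ _ _ _ le])
  show "set_borel_measurable lborel {0..T} m"
   using mi[of T] unfolding set_integrable_def set_borel_measurable_def by auto
  show "0 <= m r & m r <= c" if "0 <= r" "r <= T" for r using m0 c that by auto
 qed (use C K R0 T t in auto)
 also have "... <= 2 * (R + (K + C) * T + sqrt T) * exp (2 * (2 * C) * T)"
  using C K R0 T t by (intro mult_left_mono) (auto intro: mult_left_mono)
 finally show ?thesis by (simp add: m_def)
qed

end

lemma solves_controlled:
 obtains k where "1 <= k" "!!x Z. solves x Z ==> abs x <= R ==> controlled k Z"
proof -
 define R' where "R' = max 0 R"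
 define m where "m = 2 * (R' + (K + C) * T + sqrt T) * exp (2 * (2 * C) * T)"
 have m0: "0 <= m" using C K T by (simp add: m_def R'_def)
 define D where "D = K + C + C * m"
 have D0: "0 <= D" using C K m0 by (simp add: D_def)
 define k1 where "k1 = 2 * (R' + D * T + C) * exp (2 * C * T) + 1"
 have k10: "1 <= k1" using D0 C T by (simp add: k1_def R'_def)
 define k where "k = k1 + D + C"
 show ?thesis
 proof (rule that)
  show "1 <= k" using k10 D0 C by (simp add: k_def)
  fix x Z assume Z: "solves x Z" and x: "abs x <= R"
  have xR: "abs x <= R'" using x by (simp add: R'_def)
  have mm: "(EE w. abs (Z s w)) <= m" if "s \<in> {0..T}" for s
   unfolding m_def by (rule solves_first_moment_uniform[OF Z xR that])
  have "AE w in M. (\<forall>t\<in>{0..T}. abs (Z t w) <= k * (1 + abs (be t w) + I w)) &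
    (\<forall>s t. 0 <= s --> s <= t --> t <= T -->
     abs (Z t w - Z s w - (be t w - be s w)) <= (LBINT r:{s..t}. k * (1 + abs (Z r w))))"
   using solves_eq[OF Z]
  proof eventually_elim
   case (elim w)
   define a where "a s = b s (Z s w) (law (Z s))" for s
   have ia: "lint {s..t} a" if "0 <= s" "t <= T" for s t
    using elim that by (auto simp: a_def[abs_def] intro: set_integrable_subset)
   have eq: "Z t w = x + (LBINT s:{0..t}. a s) + be t w" if "t \<in> {0..T}" for t
    using elim that by (simp add: a_def)
   have ab: "abs (a s) <= D + C * abs (Z s w)" if s: "s \<in> {0..T}" for s
   proof -
    have "C * (1 + abs (Z s w) + kantorovich (law (Z s)) (return borel 0)) <= C * (1 + abs (Z s w) + m)"
     using order_trans[OF solves_kantorovich_zero[OF Z s] mm[OF s]] C by (intro mult_left_mono) auto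
    then show ?thesis
     using decomp[OF s solves_law[OF Z s], of "Z s w"] bh_bound[OF s solves_law[OF Z s], of "Z s w"]
      bt_growth[OF s solves_law[OF Z s], of "Z s w"] by (simp add: a_def D_def distrib_left)
   qed
   have bound: "abs (LBINT r:{s..t}. a r) <= (LBINT r:{s..t}. f r)"
    if st: "0 <= s" "t <= T" and f: "conti f" "!!r. D + C * abs (Z r w) <= f r" for s t f
   proof -
    have "abs (LBINT r:{s..t}. a r) <= (LBINT r:{s..t}. abs (a r))"
     using set_integral_norm_bound[OF ia[OF st]] by simp
    also have "... <= (LBINT r:{s..t}. f r)"
    proof (rule set_integral_mono[OF set_integrable_abs[OF ia[OF st]] set_integrable_continuous[OF f(1)]])
     show "abs (a r) <= f r" if "r \<in> {s..t}" for r using ab[of r] f(2)[of r] that st by auto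
    qed
    finally show ?thesis .
   qed
   define y where "y t = Z t w - be t w" for t
   have wc: "conti y" unfolding y_def[abs_def] by (intro continuous_intros solves_cont[OF Z] be_cont)
   have y: "abs (y t) <= 2 * (R' + D * T + C * (LBINT s:{0..T}. abs (be s w))) * exp (2 * C * T)" if t: "t \<in> {0..T}" for t
   proof (rule gronwall_path[where u = "%t. abs (y t)" and v = "%s. abs (be s w)"])
    fix r assume r: "0 <= r" "r <= T"
    have i2: "lint {0..r} (%s. C * (abs (y s) + abs (be s w)))"
     by (intro set_integrable_continuous continuous_intros wc be_cont)
    have i1: "lint {0..r} (%s. D)" by (intro set_integrable_continuous continuous_intros)
    have "abs (LBINT s:{0..r}. a s) <= (LBINT s:{0..r}. D + C * (abs (y s) + abs (be s w)))"
    proof (rule bound)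
     fix s
     have "abs (Z s w) <= abs (y s) + abs (be s w)" unfolding y_def by linarith
     from mult_left_mono[OF this C]
     show "D + C * abs (Z s w) <= D + C * (abs (y s) + abs (be s w))" by simp
    qed (use r in \<open>auto intro!: continuous_intros wc be_cont\<close>)
    also have "... = r * D + (LBINT s:{0..r}. C * (abs (y s) + abs (be s w)))"
     using set_integral_add(2)[OF i1 i2] set_integral_const_Icc[OF r(1), of D] by simp
    also have "r * D <= D * T" using mult_right_mono[OF r(2) D0] by (simp add: mult.commute)
    finally show "abs (y r) <= R' + D * T + (LBINT s:{0..r}. C * (abs (y s) + abs (be s w)))"
     using eq[of r] r xR by (simp add: y_def)
   qed (use D0 C T t in \<open>auto intro!: continuous_intros wc be_cont simp: R'_def\<close>)
   have I0: "0 <= I w" by (rule I_moments)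
   have 1: "abs (Z t w) <= k * (1 + abs (be t w) + I w)" if t: "t \<in> {0..T}" for t
   proof -
    have "2 * (R' + D * T + C * I w) * exp (2 * C * T) <= 2 * ((R' + D * T + C) * (1 + I w)) * exp (2 * C * T)"
    proof (intro mult_right_mono mult_left_mono)
     have "0 <= (R' + D * T) * I w" "0 <= C" using D0 T C I0 by (auto simp: R'_def)
     then show "R' + D * T + C * I w <= (R' + D * T + C) * (1 + I w)" by (simp add: algebra_simps)
    qed auto
    also have "... = (k1 - 1) * (1 + I w)" by (simp add: k1_def mult_ac)
    finally have "abs (y t) <= (k1 - 1) * (1 + I w)" using y[OF t] by (simp add: I_def)
    moreover have "abs (Z t w) <= abs (y t) + abs (be t w)" unfolding y_def by linarith
    ultimately have "abs (Z t w) <= (k1 - 1) * (1 + I w) + abs (be t w)" by linarith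
    also have "... <= k1 * (1 + I w) + k1 * abs (be t w)"
    proof (rule add_mono)
     show "(k1 - 1) * (1 + I w) <= k1 * (1 + I w)" using I0 by (intro mult_right_mono) auto
     show "abs (be t w) <= k1 * abs (be t w)" using mult_right_mono[OF k10, of "abs (be t w)"] by simp
    qed
    also have "... = k1 * (1 + abs (be t w) + I w)" by (simp add: algebra_simps)
    also have "... <= k * (1 + abs (be t w) + I w)" using I0 D0 C by (intro mult_right_mono) (auto simp: k_def)
    finally show ?thesis .
   qed
   have 2: "abs (Z t w - Z s w - (be t w - be s w)) <= (LBINT r:{s..t}. k * (1 + abs (Z r w)))"
    if st: "0 <= s" "s <= t" "t <= T" for s t
   proof -
    have "Z t w - Z s w - (be t w - be s w) = (LBINT r:{s..t}. a r)"
     using eq[of t] eq[of s] set_integral_split_point[OF ia[of 0 t] st(1,2)] st by simp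
    moreover have "abs (LBINT r:{s..t}. a r) <= (LBINT r:{s..t}. k * (1 + abs (Z r w)))"
    proof (rule bound)
     fix r
     have "D + C * abs (Z r w) <= k + k * abs (Z r w)"
      using k10 D0 C by (intro add_mono mult_right_mono) (auto simp: k_def)
     then show "D + C * abs (Z r w) <= k * (1 + abs (Z r w))" by (simp add: distrib_left)
    qed (use st in \<open>auto intro!: continuous_intros solves_cont[OF Z]\<close>)
    ultimately show ?thesis by simp
   qed
   show ?case using 1 2 by blast
  qed
  then show "controlled k Z"
   unfolding controlled_def using solves_cont[OF Z] solves_adapted[OF Z] solves_meas[OF Z] by auto
 qed
qed

end

section \<open>Moments of controlled processes\<close>

lemma set_integral_Cauchy_Schwarz:
 fixes f :: "real => real"
 assumes f: "lint {a..b} f" and f2: "lint {a..b} (%x. (f x)^2)" and ab: "a <= b"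
 shows "(LBINT x:{a..b}. f x)^2 <= (b - a) * (LBINT x:{a..b}. (f x)^2)"
proof -
 define J where "J = (LBINT x:{a..b}. f x)"
 define S where "S = (LBINT x:{a..b}. (f x)^2)"
 define l where "l = b - a"
 have i1: "lint {a..b} (%x. l^2 * (f x)^2)" using f2 by simp
 have i2: "lint {a..b} (%x. (2 * l * J) * f x)" using f by simp
 have i3: "lint {a..b} (%x. J^2)" by (rule set_integrable_continuous[OF continuous_on_const])
 have "0 <= (LBINT x:{a..b}. (l * f x - J)^2)"
  by (rule LBINT_nonneg) simp
 also have "(%x. (l * f x - J)^2) = (%x. (l^2 * (f x)^2 - (2 * l * J) * f x) + J^2)"
  by (simp add: power2_eq_square algebra_simps)
 also have "(LBINT x:{a..b}. (l^2 * (f x)^2 - (2 * l * J) * f x) + J^2) = (l^2 * S - (2 * l * J) * J) + l * J^2"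
  unfolding set_integral_add(2)[OF set_integral_diff(1)[OF i1 i2] i3] set_integral_diff(2)[OF i1 i2]
  using set_integral_const_Icc[OF ab, of "J^2"] by (simp add: S_def J_def l_def)
 finally have le: "0 <= l * (l * S - J^2)" by (simp add: power2_eq_square algebra_simps)
 show ?thesis
 proof (cases "a = b")
  case True
  then show ?thesis using LBINT_point[of b f] by simp
 next
  case False
  then have "0 < l" using ab by (simp add: l_def)
  then have "J^2 <= l * S" using le by (simp add: zero_le_mult_iff)
  then show ?thesis by (simp add: J_def S_def l_def)
 qed
qed

lemma square_sum3_le: "(a + b + c)^2 <= 3 * (a^2 + b^2 + c^2 :: real)"
proof -
 have "0 <= (a - b)^2 + (b - c)^2 + (a - c)^2" by simp
 then show ?thesis by (simp add: power2_eq_square algebra_simps)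
qed

context brownian_space
begin

definition N2 :: "'a => real" where
 "N2 w = (LBINT s:{0..T}. (be s w)^2)"

lemma N2_nonneg: "0 <= N2 w"
 unfolding N2_def by (rule LBINT_nonneg) simp

lemma N2_moment: "integrable M N2" "(EE w. N2 w) <= T^2"
proof -
 have m2: "(%p. (be (fst p) (snd p))^2) \<in> meas (borel \<Otimes>\<^sub>M M)" by measurable
 note F = process_Fubini[OF m2, of 0 T T]
 show "integrable M N2" unfolding N2_def[abs_def] by (rule F(1)) (use be_moments in auto)
 have "(EE w. N2 w) = (LBINT s:{0..T}. (EE w. (be s w)^2))"
  unfolding N2_def[abs_def] by (rule F(2)) (use be_moments in auto)
 also have "... <= (LBINT s:{0..T}. T)"
  by (rule set_integral_mono) (use F(4) be_moments set_integrable_continuous[OF continuous_on_const] in auto)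
 also have "... = T^2" using set_integral_const_Icc[of 0 T T] T by (simp add: power2_eq_square)
 finally show "(EE w. N2 w) <= T^2" .
qed

lemma I_square_le: "(I w)^2 <= T * N2 w"
proof -
 have "conti (%s. abs (be s w))" by (intro continuous_intros be_cont)
 then have "lint {0..T} (%s. abs (be s w))" "lint {0..T} (%s. abs (be s w)^2)"
  by (intro set_integrable_continuous continuous_intros be_cont)+
 from set_integral_Cauchy_Schwarz[OF this] show ?thesis using T by (simp add: I_def N2_def)
qed

context
 fixes k Z assumes Z: "controlled k Z" and k: "1 <= k"
begin

lemma controlled_cont: "conti (%t. Z t w)"
 and controlled_adapted: "t \<in> {0..T} ==> Z t \<in> meas (Filt M B t)"
 and controlled_meas [measurable]: "Z t \<in> meas M"
 and controlled_bound: "AE w in M. (\<forall>t\<in>{0..T}. abs (Z t w) <= k * (1 + abs (be t w) + I w)) &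
    (\<forall>s t. 0 <= s --> s <= t --> t <= T -->
     abs (Z t w - Z s w - (be t w - be s w)) <= (LBINT r:{s..t}. k * (1 + abs (Z r w))))"
 using Z by (auto simp: controlled_def)

lemma controlled_joint [measurable]: "jmeas M Z"
 by (rule continuous_process_jointly_measurable[OF controlled_meas controlled_cont])

lemma controlled_square_le: "AE w in M. \<forall>t\<in>{0..T}. (Z t w)^2 <= 3 * k^2 * (1 + (be t w)^2 + T * N2 w)"
 using controlled_bound
proof eventually_elim
 case (elim w)
 show ?case
 proof
  fix t assume t: "t \<in> {0..T}"
  have "abs (Z t w) <= k * (1 + abs (be t w) + I w)" using elim t by blast
  then have "abs (Z t w)^2 <= (k * (1 + abs (be t w) + I w))^2" by (intro power_mono) auto
  also have "... = k^2 * (1 + abs (be t w) + I w)^2" by (simp add: power_mult_distrib)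
  also have "... <= k^2 * (3 * (1^2 + abs (be t w)^2 + (I w)^2))" by (intro mult_left_mono square_sum3_le) auto
  also have "... <= k^2 * (3 * (1^2 + abs (be t w)^2 + T * N2 w))" using I_square_le[of w] by (intro mult_left_mono) auto
  finally show "(Z t w)^2 <= 3 * k^2 * (1 + (be t w)^2 + T * N2 w)" by (simp add: algebra_simps)
 qed
qed

lemma controlled_second_moment:
 assumes t: "t \<in> {0..T}"
 shows "integrable M (%w. (Z t w)^2)" "(EE w. (Z t w)^2) <= 3 * k^2 * (1 + T + T ^ 3)"
  "integrable M (Z t)"
proof -
 have t': "0 <= t" "t <= T" using t by auto
 have ae: "AE w in M. (Z t w)^2 <= 3 * k^2 * (1 + (be t w)^2 + T * N2 w)"
  using controlled_square_le by eventually_elim (use t in auto)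
 have i: "integrable M (%w. 3 * k^2 * (1 + (be t w)^2 + T * N2 w))"
  using be_moments(1)[OF t'] N2_moment(1) by auto
 show i2: "integrable M (%w. (Z t w)^2)"
  by (rule integrable_bound[OF i]) (use ae in auto)
 have "(EE w. (Z t w)^2) <= (EE w. 3 * k^2 * (1 + (be t w)^2 + T * N2 w))"
  by (rule integral_mono_AE[OF i2 i ae])
 also have "... = 3 * k^2 * (1 + t + T * (EE w. N2 w))"
  using be_moments(1,2)[OF t'] N2_moment(1) by (simp add: prob_space)
 also have "... <= 3 * k^2 * (1 + T + T * T^2)"
  using t' T N2_moment(2) by (intro mult_left_mono add_mono) auto
 finally show "(EE w. (Z t w)^2) <= 3 * k^2 * (1 + T + T ^ 3)" by (simp add: power3_eq_cube power2_eq_square mult.assoc)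
 show "integrable M (Z t)" by (rule square_integrable_imp_integrable[OF controlled_meas i2])
qed

lemma controlled_first_moment:
 assumes t: "t \<in> {0..T}"
 shows "(EE w. abs (Z t w)) <= 1 + 3 * k^2 * (1 + T + T ^ 3)"
proof -
 have "(EE w. abs (Z t w)) <= (EE w. 1 + (Z t w)^2 / 1)"
  by (rule integrable_le(2)[OF _ _ abs_le_eps_square]) (use controlled_second_moment[OF t] in auto)
 also have "... <= 1 + 3 * k^2 * (1 + T + T ^ 3)" using controlled_second_moment[OF t] by (simp add: prob_space)
 finally show ?thesis .
qed

lemma controlled_increment:
 obtains c where "0 <= c" "!!s t. 0 <= s ==> s <= t ==> t <= T ==> (EE w. abs (Z t w - Z s w)) <= c * sqrt (t - s)"
proof -
 define m where "m = 1 + 3 * k^2 * (1 + T + T ^ 3)"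
 have m0: "0 <= m" using T by (simp add: m_def)
 show ?thesis
 proof (rule that[of "k * (1 + m) * sqrt T + 1"])
  show "0 <= k * (1 + m) * sqrt T + 1" using k m0 T by simp
  fix s t assume st: "0 <= s" "s <= t" "t <= T"
  have jm: "(%p. k * (1 + abs (Z (fst p) (snd p)))) \<in> meas (borel \<Otimes>\<^sub>M M)" by measurable
  have i: "integrable M (%w. k * (1 + abs (Z r w)))" and b: "(EE w. abs (k * (1 + abs (Z r w)))) <= k * (1 + m)"
   if "s <= r" "r <= t" for r
  proof -
   have r: "r \<in> {0..T}" using that st by auto
   show "integrable M (%w. k * (1 + abs (Z r w)))" using controlled_second_moment(3)[OF r] by auto
   have "(EE w. abs (k * (1 + abs (Z r w)))) = k * (1 + (EE w. abs (Z r w)))"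
    using controlled_second_moment(3)[OF r] k by (simp add: abs_mult prob_space)
   also have "... <= k * (1 + m)" using controlled_first_moment[OF r] k by (intro mult_left_mono) (auto simp: m_def)
   finally show "(EE w. abs (k * (1 + abs (Z r w)))) <= k * (1 + m)" .
  qed
  note F = process_Fubini[OF jm i b]
  have "(EE w. (LBINT r:{s..t}. k * (1 + abs (Z r w)))) = (LBINT r:{s..t}. (EE w. k * (1 + abs (Z r w))))"
   using F(2) by simp
  also have "... <= (LBINT r:{s..t}. k * (1 + m))"
  proof (rule set_integral_mono)
   show "lint {s..t} (%r. \<integral>w. k * (1 + abs (Z r w)) \<partial>M)" using F(4) by simp
   show "(EE w. k * (1 + abs (Z r w))) <= k * (1 + m)" if "r \<in> {s..t}" for r
    using b[of r] that k by (simp add: abs_of_nonneg)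
  qed (rule set_integrable_continuous, rule continuous_on_const)
  also have "... = (t - s) * (k * (1 + m))" by (rule set_integral_const_Icc[OF st(2)])
  also have "... = (sqrt (t - s) * sqrt (t - s)) * (k * (1 + m))" using st by simp
  also have "... <= (sqrt T * sqrt (t - s)) * (k * (1 + m))"
   using st k m0 T by (intro mult_right_mono) auto
  finally have 1: "(EE w. (LBINT r:{s..t}. k * (1 + abs (Z r w)))) <= k * (1 + m) * sqrt T * sqrt (t - s)"
   by (simp add: mult_ac)
  have iL: "integrable M (%w. LBINT r:{s..t}. k * (1 + abs (Z r w)))" using F(1) by simp
  have "(EE w. abs (Z t w - Z s w)) <= (EE w. (LBINT r:{s..t}. k * (1 + abs (Z r w))) + abs (be t w - be s w))"
  proof (rule integral_mono_AE)
   show "integrable M (%w. abs (Z t w - Z s w))"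
    using controlled_second_moment(3)[of t] controlled_second_moment(3)[of s] st by auto
   show "integrable M (%w. (LBINT r:{s..t}. k * (1 + abs (Z r w))) + abs (be t w - be s w))"
    using iL increment_moments(3)[OF st] by auto
   show "AE w in M. abs (Z t w - Z s w) <= (LBINT r:{s..t}. k * (1 + abs (Z r w))) + abs (be t w - be s w)"
    using controlled_bound
   proof eventually_elim
    case (elim w)
    then have "abs (Z t w - Z s w - (be t w - be s w)) <= (LBINT r:{s..t}. k * (1 + abs (Z r w)))" using st by blast
    then show ?case by linarith
   qed
  qed
  also have "... = (EE w. (LBINT r:{s..t}. k * (1 + abs (Z r w)))) + (EE w. abs (be t w - be s w))"
   using iL increment_moments(3)[OF st] by simp
  also have "... <= k * (1 + m) * sqrt T * sqrt (t - s) + sqrt (t - s)"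
   by (intro add_mono 1 increment_moments(4)[OF st])
  finally show "(EE w. abs (Z t w - Z s w)) <= (k * (1 + m) * sqrt T + 1) * sqrt (t - s)" by (simp add: algebra_simps)
 qed
qed

end

text \<open>Along a convex combination of two controlled processes the noise is again \<open>B\<close>, and the drift is at most \<open>\<integral> \<alpha>\<close> with \<open>\<alpha> = k (1 + \<bar>Z1\<bar> + \<bar>Z2\<bar>)\<close>. Replacing this by \<open>(t - s) \<alpha> s\<close> costs the mean oscillation of \<open>Z1\<close> and \<open>Z2\<close>, which is of order \<open>sqrt (t - s)\<close>.\<close>

lemma controlled_pair_noisy:
 assumes Z: "controlled k Z1" "controlled k Z2" and k: "1 <= k" and th: "0 <= th" "th <= 1"
  and r: "0 <= r0" "r0 <= r1" "r1 <= T"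
 defines "Y \<equiv> %t w. th * Z1 t w + (1 - th) * Z2 t w"
  and "al \<equiv> %t w. k * (1 + abs (Z1 t w) + abs (Z2 t w))"
 shows "\<exists>c. noisy_process M T B r0 r1 Y al c"
proof -
 note c1 = controlled_cont[OF Z(1) k] and c2 = controlled_cont[OF Z(2) k]
 note m1[measurable] = controlled_meas[OF Z(1) k] and m2[measurable] = controlled_meas[OF Z(2) k]
 note j1[measurable] = controlled_joint[OF Z(1) k] and j2[measurable] = controlled_joint[OF Z(2) k]
 note s1 = controlled_second_moment[OF Z(1) k] and s2 = controlled_second_moment[OF Z(2) k]
 define q where "q = 3 * k^2 * (1 + T + T ^ 3)"
 define cs where "cs = 3 * k^2 * (1 + q + q)"
 have q0: "0 <= q" using T by (simp add: q_def)
 obtain d1 where d1: "0 <= d1" "!!s t. 0 <= s ==> s <= t ==> t <= T ==> (EE w. abs (Z1 t w - Z1 s w)) <= d1 * sqrt (t - s)"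
  using controlled_increment[OF Z(1) k] by metis
 obtain d2 where d2: "0 <= d2" "!!s t. 0 <= s ==> s <= t ==> t <= T ==> (EE w. abs (Z2 t w - Z2 s w)) <= d2 * sqrt (t - s)"
  using controlled_increment[OF Z(2) k] by metis
 define c where "c = cs + k * (d1 + d2)"
 have alc: "conti (%t. al t w)" for w unfolding al_def by (intro continuous_intros c1 c2)
 have al0: "0 <= al t w" for t w using k by (simp add: al_def)
 have jm: "jmeas M al" unfolding al_def by measurable
 have alm[measurable]: "al t \<in> meas M" for t unfolding al_def by measurable
 have Ym[measurable]: "Y t \<in> meas M" for t unfolding Y_def by measurable
 have ali: "integrable M (al t)" if "t \<in> {0..T}" for t
  unfolding al_def using s1(3)[OF that] s2(3)[OF that] by auto
 have alsq: "(al t w)^2 <= 3 * k^2 * (1 + (Z1 t w)^2 + (Z2 t w)^2)" for t w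
 proof -
  have "(al t w)^2 = k^2 * (1 + abs (Z1 t w) + abs (Z2 t w))^2" by (simp add: al_def power_mult_distrib)
  also have "... <= k^2 * (3 * (1^2 + abs (Z1 t w)^2 + abs (Z2 t w)^2))" by (intro mult_left_mono square_sum3_le) auto
  finally show ?thesis by (simp add: algebra_simps)
 qed
 have al2: "integrable M (%w. (al t w)^2)" "(EE w. (al t w)^2) <= cs" if t: "t \<in> {0..T}" for t
 proof -
  have i: "integrable M (%w. 3 * k^2 * (1 + (Z1 t w)^2 + (Z2 t w)^2))" using s1(1)[OF t] s2(1)[OF t] by auto
  have sq: "abs ((al t w)^2) <= 3 * k^2 * (1 + (Z1 t w)^2 + (Z2 t w)^2)" for w using alsq by simp
  show "integrable M (%w. (al t w)^2)" by (rule integrable_le(1)[OF i _ sq]) measurable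
  have "(EE w. (al t w)^2) <= (EE w. 3 * k^2 * (1 + (Z1 t w)^2 + (Z2 t w)^2))"
   by (rule integrable_le(3)[OF i _ sq]) measurable
  also have "... = 3 * k^2 * (1 + (EE w. (Z1 t w)^2) + (EE w. (Z2 t w)^2))"
   using s1(1)[OF t] s2(1)[OF t] by (simp add: prob_space)
  also have "... <= cs" unfolding cs_def q_def using s1(2)[OF t] s2(2)[OF t] by (intro mult_left_mono add_mono) auto
  finally show "(EE w. (al t w)^2) <= cs" .
 qed
 have Vb: "AE w in M. abs (Y t w - Y s w - (B t w - B s w)) <= (LBINT r:{s..t}. al r w)"
  if st: "0 <= s" "s <= t" "t <= T" for s t
  using controlled_bound[OF Z(1) k] controlled_bound[OF Z(2) k] be_eq
 proof eventually_elim
  case (elim w)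
  let ?V1 = "Z1 t w - Z1 s w - (be t w - be s w)" and ?V2 = "Z2 t w - Z2 s w - (be t w - be s w)"
  have le: "(LBINT r:{s..t}. k * (1 + abs (Z1 r w))) <= (LBINT r:{s..t}. al r w)"
   "(LBINT r:{s..t}. k * (1 + abs (Z2 r w))) <= (LBINT r:{s..t}. al r w)"
   unfolding al_def using k
   by (intro set_integral_mono set_integrable_continuous continuous_intros c1 c2 mult_left_mono; simp)+
  have V1: "abs ?V1 <= (LBINT r:{s..t}. al r w)" and V2: "abs ?V2 <= (LBINT r:{s..t}. al r w)"
  proof -
   have "abs ?V1 <= (LBINT r:{s..t}. k * (1 + abs (Z1 r w)))" using elim(1) st by blast
   also note le(1)
   finally show "abs ?V1 <= (LBINT r:{s..t}. al r w)" .
   have "abs ?V2 <= (LBINT r:{s..t}. k * (1 + abs (Z2 r w)))" using elim(2) st by blast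
   also note le(2)
   finally show "abs ?V2 <= (LBINT r:{s..t}. al r w)" .
  qed
  have "be t w = B t w" "be s w = B s w" using elim(3) st by auto
  then have "Y t w - Y s w - (B t w - B s w) = th * ?V1 + (1 - th) * ?V2" by (simp add: Y_def algebra_simps)
  also have "abs ... <= th * abs ?V1 + (1 - th) * abs ?V2"
   using th by (intro order_trans[OF abs_triangle_ineq]) (simp add: abs_mult)
  also have "... <= th * (LBINT r:{s..t}. al r w) + (1 - th) * (LBINT r:{s..t}. al r w)"
   using th V1 V2 by (intro add_mono mult_left_mono) auto
  also have "... = (LBINT r:{s..t}. al r w)" by (simp add: algebra_simps)
  finally show ?case .
 qed
 have Bm[measurable]: "B t \<in> meas M" if "t \<in> {0..T}" for t using brownian_measurable[OF bm] that by auto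
 have "noisy_process M T B r0 r1 Y al c"
 proof (unfold_locales)
  show "brownian_motion M T B" by (rule bm)
  show "0 <= r0" "r0 <= r1" "r1 <= T" by fact+
  show "0 <= c" using q0 d1 d2 k by (simp add: c_def cs_def)
  show "Y t \<in> meas (Filt M B t)" if "r0 <= t" "t <= r1" for t
   unfolding Y_def using controlled_adapted[OF Z(1) k, of t] controlled_adapted[OF Z(2) k, of t] that r by auto
  show "al t \<in> meas (Filt M B t)" if "r0 <= t" "t <= r1" for t
   unfolding al_def using controlled_adapted[OF Z(1) k, of t] controlled_adapted[OF Z(2) k, of t] that r by auto
  show "0 <= al t w" for t w by (rule al0)
  show "integrable M (al t)" if "r0 <= t" "t <= r1" for t using ali that r by auto
  fix s t assume st: "r0 <= s" "s < t" "t <= r1"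
  then have st': "0 <= s" "s <= t" "t <= T" "s \<in> {0..T}" "t \<in> {0..T}" using r by auto
  define V where "V w = Y t w - Y s w - (B t w - B s w)" for w
  have Vm[measurable]: "V \<in> meas M" unfolding V_def using st' by measurable
  note Vb' = Vb[OF st'(1,2,3), folded V_def]
  have sub: "r \<in> {0..T}" if "s <= r" "r <= t" for r using that st' by auto
  have jm2: "(%p. (al (fst p) (snd p))^2) \<in> meas (borel \<Otimes>\<^sub>M M)" using jm by measurable
  have F1: "integrable M (%w. LBINT r:{s..t}. (al r w)^2)"
   "(EE w. (LBINT r:{s..t}. (al r w)^2)) = (LBINT r:{s..t}. (EE w. (al r w)^2))"
   "lint {s..t} (%r. (EE w. (al r w)^2))"
   by (rule process_Fubini[OF jm2, of s t cs]; use al2 sub in simp)+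
  have V2: "AE w in M. (V w)^2 <= (t - s) * (LBINT r:{s..t}. (al r w)^2)"
   using Vb'
  proof eventually_elim
   case (elim w)
   then have "abs (V w)^2 <= (LBINT r:{s..t}. al r w)^2" by (intro power_mono) auto
   also have "... <= (t - s) * (LBINT r:{s..t}. (al r w)^2)" by (intro set_integral_Cauchy_Schwarz set_integrable_continuous continuous_intros alc st'(2))
   finally show ?case by simp
  qed
  have iF: "integrable M (%w. (t - s) * (LBINT r:{s..t}. (al r w)^2))" using F1(1) by simp
  have iV2: "integrable M (%w. (V w)^2)"
   by (rule integrable_bound[OF iF]) (use V2 in \<open>auto elim!: eventually_mono\<close>)
  show "integrable M (%w. (Y t w - Y s w - (B t w - B s w))^2)" using iV2 by (simp add: V_def)
  have "(EE w. (V w)^2) <= (t - s) * (LBINT r:{s..t}. (EE w. (al r w)^2))"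
   using integral_mono_AE[OF iV2 iF V2] F1(2) by simp
  also have "... <= (t - s) * (LBINT r:{s..t}. cs)"
   using st al2 sub by (intro mult_left_mono set_integral_mono F1(3) set_integrable_continuous continuous_on_const) auto
  also have "... = cs * (t - s)^2" using set_integral_const_Icc[OF st'(2), of cs] by (simp add: power2_eq_square)
  also have "... <= c * (t - s)^2" using k d1 d2 by (intro mult_right_mono) (auto simp: c_def)
  finally show "(EE w. (Y t w - Y s w - (B t w - B s w))^2) <= c * (t - s)^2" by (simp add: V_def)
  define g where "g r w = abs (al r w - al s w)" for r w
  have gc: "conti (%r. g r w)" for w unfolding g_def by (intro continuous_intros alc)
  have jg: "jmeas M g" unfolding g_def using jm by measurable
  have gi: "integrable M (g r)" if "s <= r" "r <= t" for r
   unfolding g_def using ali[OF sub[OF that]] ali[OF st'(4)] by auto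
  have gE: "(EE w. abs (g r w)) <= k * (d1 + d2) * sqrt (t - s)" if "s <= r" "r <= t" for r
  proof -
   have iz: "integrable M (%w. k * (abs (Z1 r w - Z1 s w) + abs (Z2 r w - Z2 s w)))"
    using s1(3)[OF sub[OF that]] s1(3)[OF st'(4)] s2(3)[OF sub[OF that]] s2(3)[OF st'(4)] by auto
   have "(EE w. abs (g r w)) <= (EE w. k * (abs (Z1 r w - Z1 s w) + abs (Z2 r w - Z2 s w)))"
   proof (rule integral_mono[OF integrable_abs[OF gi[OF that]] iz])
    fix w
    have "abs (g r w) = k * abs (abs (Z1 r w) - abs (Z1 s w) + (abs (Z2 r w) - abs (Z2 s w)))"
    proof -
     have "al r w - al s w = k * (abs (Z1 r w) - abs (Z1 s w) + (abs (Z2 r w) - abs (Z2 s w)))" by (simp add: al_def algebra_simps)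
     then show ?thesis using k by (simp add: g_def abs_mult)
    qed
    also have "... <= k * (abs (Z1 r w - Z1 s w) + abs (Z2 r w - Z2 s w))"
    proof (rule mult_left_mono)
     show "abs (abs (Z1 r w) - abs (Z1 s w) + (abs (Z2 r w) - abs (Z2 s w))) <= abs (Z1 r w - Z1 s w) + abs (Z2 r w - Z2 s w)"
      by (rule order_trans[OF abs_triangle_ineq add_mono[OF abs_triangle_ineq3 abs_triangle_ineq3]])
    qed (use k in simp)
    finally show "abs (g r w) <= k * (abs (Z1 r w - Z1 s w) + abs (Z2 r w - Z2 s w))" .
   qed
   also have "... = k * ((EE w. abs (Z1 r w - Z1 s w)) + (EE w. abs (Z2 r w - Z2 s w)))"
    using s1(3)[OF sub[OF that]] s1(3)[OF st'(4)] s2(3)[OF sub[OF that]] s2(3)[OF st'(4)] by simp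
   also have "... <= k * (d1 * sqrt (r - s) + d2 * sqrt (r - s))"
    using k that st' by (intro mult_left_mono add_mono d1(2) d2(2)) auto
   also have "... <= k * (d1 * sqrt (t - s) + d2 * sqrt (t - s))"
    using k that d1(1) d2(1) by (intro mult_left_mono add_mono) auto
   finally show ?thesis by (simp add: algebra_simps)
  qed
  have G: "integrable M (%w. LBINT r:{s..t}. g r w)"
   "(EE w. (LBINT r:{s..t}. g r w)) = (LBINT r:{s..t}. (EE w. g r w))"
   "lint {s..t} (%r. (EE w. g r w))"
   by (rule process_Fubini[OF jg gi gE]; assumption)+
  have iV: "integrable M V" by (rule square_integrable_imp_integrable[OF Vm iV2])
  have "(EE w. max 0 (abs (V w) - (t - s) * al s w)) <= (EE w. (LBINT r:{s..t}. g r w))"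
  proof (rule integral_mono_AE[OF _ G(1)])
   show "integrable M (%w. max 0 (abs (V w) - (t - s) * al s w))"
    using iV ali[OF st'(4)] by auto
   show "AE w in M. max 0 (abs (V w) - (t - s) * al s w) <= (LBINT r:{s..t}. g r w)"
    using Vb'
   proof eventually_elim
    case (elim w)
    have "(LBINT r:{s..t}. al r w) <= (LBINT r:{s..t}. al s w + g r w)"
     by (intro set_integral_mono set_integrable_continuous continuous_intros alc gc) (simp add: g_def)
    also have "... = (t - s) * al s w + (LBINT r:{s..t}. g r w)"
     using set_integral_add(2)[OF set_integrable_continuous[OF continuous_on_const] set_integrable_continuous[OF gc]]
      set_integral_const_Icc[OF st'(2), of "al s w"] by simp
    finally have "abs (V w) - (t - s) * al s w <= (LBINT r:{s..t}. g r w)" using elim by linarith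
    moreover have "0 <= (LBINT r:{s..t}. g r w)"
     by (rule LBINT_nonneg) (simp add: g_def)
    ultimately show ?case by simp
   qed
  qed
  also have "... <= (LBINT r:{s..t}. k * (d1 + d2) * sqrt (t - s))"
   unfolding G(2)
  proof (intro set_integral_mono G(3) set_integrable_continuous continuous_on_const)
   show "(EE w. g r w) <= k * (d1 + d2) * sqrt (t - s)" if "r \<in> {s..t}" for r
    using gE[of r] that by (simp add: g_def)
  qed
  also have "... = (t - s) * (k * (d1 + d2) * sqrt (t - s))" by (rule set_integral_const_Icc[OF st'(2)])
  also have "... = (k * (d1 + d2)) * ((t - s) * sqrt (t - s))" by (simp add: mult_ac)
  also have "... <= c * ((t - s) * sqrt (t - s))" using st q0 by (intro mult_right_mono) (auto simp: c_def cs_def)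
  finally show "(EE w. max 0 (abs (Y t w - Y s w - (B t w - B s w)) - (t - s) * al s w)) <= c * ((t - s) * sqrt (t - s))"
   by (simp add: V_def)
 qed
 then show ?thesis by blast
qed

end

section \<open>Exponential functionals of interpolated solutions\<close>

context brownian_space
begin

text \<open>The constant \<open>A\<close> depends on the sup norm \<open>Q\<close> of \<open>f\<close> but not on \<open>L\<close> and \<open>lf\<close>. The exponent is split as \<open>8 \<Psi> = R + D\<close>, where \<open>exp R\<close> is controlled by \<open>exponential_bound\<close> for \<open>8 f\<close> and \<open>D\<close>, the price of the drift, is a small multiple of \<open>\<integral> B\<^sup>2\<close>; the geometric mean of the two exponentials is at most their arithmetic mean.\<close>

lemma exponential_functional_bound:
 assumes k: "1 <= k" and Q: "0 <= Q"
 obtains A where "0 <= A"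
  "!!Z1 Z2 th s t f f' L lf. controlled k Z1 ==> controlled k Z2 ==> 0 <= th ==> th <= 1 ==> 0 <= s ==> s <= t ==> t <= T ==>
   (!!r. C11 Q L lf (f r) (f' r)) ==>
   (!!w. conti (%r. f' r (th * Z1 r w + (1 - th) * Z2 r w))) ==>
   mean_le (%w. exp (4 * (LBINT r:{s..t}. f' r (th * Z1 r w + (1 - th) * Z2 r w)))) A"
proof -
 define a0 where "a0 = 3 * k^2 * (1 + 6 * k^2)"
 \<comment> \<open>with this bound on \<open>ga\<close> the coefficient \<open>ka\<close> of \<open>\<integral> B\<^sup>2\<close> in the price satisfies the condition of \<open>exp_moment\<close>\<close>
 define g0 where "g0 = 1 / (144 * a0 * (1 + T^2) * T^2)"
 define ga where "ga = min (1/2) g0"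
 define ka where "ka = 36 * ga * a0 * (1 + T^2)"
 have a00: "0 < a0" using k by (simp add: a0_def add_pos_nonneg)
 have g00: "0 < g0" using a00 T by (simp add: g0_def add_pos_nonneg)
 have ga: "0 < ga" "ga <= 1/2" "ga <= g0" using g00 by (auto simp: ga_def)
 have ka: "0 <= ka" "4 * ka * T^2 <= 1"
 proof -
  show "0 <= ka" using ga a00 by (simp add: ka_def)
  have "4 * ka * T^2 = ga * (144 * a0 * (1 + T^2) * T^2)" by (simp add: ka_def)
  also have "... <= g0 * (144 * a0 * (1 + T^2) * T^2)" using ga a00 by (intro mult_right_mono) auto
  also have "... = 1"
  proof -
   have "144 * a0 * (1 + T^2) * T^2 ~= 0" using a00 T by (simp add: add_nonneg_eq_0_iff)
   then show ?thesis by (simp add: g0_def)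
  qed
  finally show "4 * ka * T^2 <= 1" .
 qed
 define K where "K = 8 * Q"
 \<comment> \<open>so many blocks that each is short enough for the bounds on the backward recursion with the sup norm \<open>K\<close> of \<open>8 f\<close>\<close>
 define J where "J = nat \<lceil>T * (6 * (1 / ga) * K)^2\<rceil> + 1"
 define D0 where "D0 = 36 * ga * (a0 * T) + T * (36 * K^2 / ga)"
 define A where "A = (2 ^ J + exp D0 * 2) / 2 + 1"
 have J: "0 < J" "T * (6 * (1 / ga) * K)^2 <= real J"
 proof -
  show "0 < J" by (simp add: J_def)
  have "T * (6 * (1 / ga) * K)^2 <= real (nat \<lceil>T * (6 * (1 / ga) * K)^2\<rceil>)" by linarith
  then show "T * (6 * (1 / ga) * K)^2 <= real J" by (simp add: J_def)
 qed
 show ?thesis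
 proof (rule that[of A])
  show "0 <= A" by (simp add: A_def)
  fix Z1 Z2 th s t f f' L lf
  assume Z: "controlled k Z1" "controlled k Z2" and th: "0 <= th" "th <= 1" and st: "0 <= s" "s <= t" "t <= T"
   and f: "!!r. C11 Q L lf (f r) (f' r)"
   and fc: "!!w. conti (%r. f' r (th * Z1 r w + (1 - th) * Z2 r w))"
  define Y where "Y t w = th * Z1 t w + (1 - th) * Z2 t w" for t w
  define al where "al t w = k * (1 + abs (Z1 t w) + abs (Z2 t w))" for t w
  define Ps where "Ps w = (LBINT r:{s..t}. f' r (Y r w))" for w
  have "mean_le (%w. exp (4 * Ps w)) A"
  proof (cases "s = t")
   case True
   then have "Ps w = 0" for w by (simp add: Ps_def set_integral_at_point)
   then show ?thesis by (simp add: prob_space A_def)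
  next
   case False
   note c1 = controlled_cont[OF Z(1) k] and c2 = controlled_cont[OF Z(2) k]
   note j1[measurable] = controlled_joint[OF Z(1) k] and j2[measurable] = controlled_joint[OF Z(2) k]
   have alc: "conti (%t. al t w)" for w unfolding al_def by (intro continuous_intros c1 c2)
   have Yc: "conti (%r. f' r (Y r w))" for w using fc by (simp add: Y_def)
   obtain c where "noisy_process M T B s t Y al c"
    using controlled_pair_noisy[OF Z k th st] by (auto simp: Y_def[abs_def] al_def[abs_def])
   then interpret N: noisy_process M T B s t Y al c .
   define ta where "ta = (t - s) / real J"
   have ta: "t - s = real J * ta" "0 < ta" using J(1) st False by (auto simp: ta_def)
   have F8: "C11 K (8 * L) (8 * lf) (%z. 8 * f r z) (%z. 8 * f' r z)" for r
    using C11_scale[OF f, of 8] by (simp add: K_def)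
   have small: "2 * (1 / ga) * sqrt ta * K <= 1 / 3"
   proof -
    have "ta * (6 * (1 / ga) * K)^2 <= 1"
    proof -
     have "(t - s) * (6 * (1 / ga) * K)^2 <= T * (6 * (1 / ga) * K)^2" using st by (intro mult_right_mono) auto
     also note J(2)
     finally have "(t - s) * (6 * (1 / ga) * K)^2 <= real J" .
     then show ?thesis using J(1) by (simp add: ta_def divide_le_eq)
    qed
    then have "sqrt (ta * (6 * (1 / ga) * K)^2) <= 1" by (subst real_sqrt_le_1_iff)
    moreover have "sqrt (ta * (6 * (1 / ga) * K)^2) = sqrt ta * (6 * (1 / ga) * K)"
     using ga Q by (simp add: real_sqrt_mult K_def)
    ultimately have "sqrt ta * (6 * (1 / ga) * K) <= 1" by linarith
    moreover have "sqrt ta * (6 * (1 / ga) * K) = 3 * (2 * (1 / ga) * sqrt ta * K)" by simp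
    ultimately show ?thesis by linarith
   qed
   define rh where "rh r w = 8 * f' r (Y r w) - 36 * ga * (al r w)^2 - 36 * K^2 / ga" for r w
   have KL: "0 <= K" "0 <= 8 * L" "0 <= 8 * lf" using C11_nonneg[OF F8] by auto
   have cc: "continuous_on {s..t} (%r. 8 * f' r (Y r w))" "continuous_on {s..t} (%r. al r w)" for w
    by (rule continuous_on_subset[OF _ subset_UNIV], intro continuous_intros Yc alc)+
   have EB: "integrable M (%w. exp (integral {s..t} (%r. rh r w)))"
    "(EE w. exp (integral {s..t} (%r. rh r w))) <= 2 ^ J"
    unfolding rh_def
    by (rule N.exponential_bound[where F = "%r z. 8 * f r z" and F' = "%r z. 8 * f' r z" and L = "8 * L" and lF = "8 * lf" and K = K and ta = ta,
      OF ga(1,2) ta J(1) F8 KL small cc])+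
   have rhc: "conti (%r. rh r w)" for w
    unfolding rh_def by (intro continuous_intros Yc alc)
   have LI: "integral {s..t} (%r. rh r w) = (LBINT r:{s..t}. rh r w)" for w
    using set_borel_integral_eq_integral(2)[OF set_integrable_continuous[OF rhc]] by simp
   define D where "D w = (LBINT r:{s..t}. 36 * ga * (al r w)^2 + 36 * K^2 / ga)" for w
   define R where "R w = (LBINT r:{s..t}. rh r w)" for w
   have dc: "conti (%r. 36 * ga * (al r w)^2 + 36 * K^2 / ga)" for w
    by (intro continuous_intros alc)
   have split: "8 * Ps w = R w + D w" for w
   proof -
    have "R w + D w = (LBINT r:{s..t}. rh r w + (36 * ga * (al r w)^2 + 36 * K^2 / ga))"
     unfolding R_def D_def using set_integral_add(2)[OF set_integrable_continuous[OF rhc] set_integrable_continuous[OF dc]] by simp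
    also have "... = (LBINT r:{s..t}. 8 * f' r (Y r w))" by (simp add: rh_def)
    also have "... = 8 * Ps w" unfolding Ps_def by (rule set_integral_mult_right)
    finally show ?thesis by simp
   qed
   have ER: "integrable M (%w. exp (R w))" "(EE w. exp (R w)) <= 2 ^ J"
    using EB unfolding LI R_def by auto
   have Rm[measurable]: "R \<in> meas M"
   proof -
    have "(%w. ln (exp (R w))) \<in> meas M" using ER(1) by measurable
    then show ?thesis by simp
   qed
   have D_le: "AE w in M. D w <= D0 + ka * N2 w"
    using controlled_square_le[OF Z(1) k] controlled_square_le[OF Z(2) k]
   proof eventually_elim
    case (elim w)
    have pt: "(al r w)^2 <= a0 * (1 + (be r w)^2 + T * N2 w)" if r: "r \<in> {0..T}" for r
    proof -
     define y where "y = 1 + (be r w)^2 + T * N2 w"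
     have y: "1 <= y" using T N2_nonneg[of w] by (simp add: y_def)
     have "(al r w)^2 = k^2 * (1 + abs (Z1 r w) + abs (Z2 r w))^2" by (simp add: al_def power_mult_distrib)
     also have "... <= k^2 * (3 * (1^2 + abs (Z1 r w)^2 + abs (Z2 r w)^2))" by (intro mult_left_mono square_sum3_le) auto
     also have "... <= k^2 * (3 * (y + 3 * k^2 * y + 3 * k^2 * y))"
      using elim r y by (intro mult_left_mono add_mono) (auto simp: y_def)
     also have "... = a0 * y" by (simp add: a0_def algebra_simps)
     finally show ?thesis by (simp add: y_def)
    qed
    have "D w = 36 * ga * (LBINT r:{s..t}. (al r w)^2) + (t - s) * (36 * K^2 / ga)"
    proof -
     have "D w = (LBINT r:{s..t}. 36 * ga * (al r w)^2) + (LBINT r:{s..t}. 36 * K^2 / ga)"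
      unfolding D_def by (intro set_integral_add(2) set_integrable_continuous continuous_intros alc)
     then show ?thesis using set_integral_const_Icc[OF st(2), of "36 * K^2 / ga"] by simp
    qed
    also have "... <= 36 * ga * (a0 * T + a0 * (1 + T^2) * N2 w) + T * (36 * K^2 / ga)"
    proof (intro add_mono mult_left_mono mult_right_mono)
     have "(LBINT r:{s..t}. (al r w)^2) <= (LBINT r:{0..T}. (al r w)^2)"
      unfolding set_lebesgue_integral_def
     proof (rule integral_mono)
      show "integrable lborel (%r. indicator {s..t} r *\<^sub>R (al r w)^2)" "integrable lborel (%r. indicator {0..T} r *\<^sub>R (al r w)^2)"
       unfolding set_integrable_def[symmetric] by (intro set_integrable_continuous continuous_intros alc)+
     qed (use st in \<open>auto simp: indicator_def\<close>)
     also have "... <= (LBINT r:{0..T}. a0 * (1 + T * N2 w) + a0 * (be r w)^2)"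
     proof (intro set_integral_mono set_integrable_continuous continuous_intros alc be_cont)
      show "(al r w)^2 <= a0 * (1 + T * N2 w) + a0 * (be r w)^2" if "r \<in> {0..T}" for r
       using pt[OF that] by (simp add: algebra_simps)
     qed
     also have "... = T * (a0 * (1 + T * N2 w)) + a0 * N2 w"
     proof -
      have "(LBINT r:{0..T}. a0 * (1 + T * N2 w) + a0 * (be r w)^2)
       = (LBINT r:{0..T}. a0 * (1 + T * N2 w)) + (LBINT r:{0..T}. a0 * (be r w)^2)"
       by (intro set_integral_add(2) set_integrable_continuous continuous_intros be_cont)
      then show ?thesis using set_integral_const_Icc[of 0 T "a0 * (1 + T * N2 w)"] T by (simp add: N2_def)
     qed
     also have "... = a0 * T + a0 * (1 + T^2) * N2 w" by (simp add: power2_eq_square algebra_simps)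
     finally show "(LBINT r:{s..t}. (al r w)^2) <= a0 * T + a0 * (1 + T^2) * N2 w" .
    qed (use ga st in auto)
    also have "... = D0 + ka * N2 w" by (simp add: D0_def ka_def algebra_simps)
    finally show ?case .
   qed
   note [measurable (raw)] = joint_measurable_compose[OF j1] joint_measurable_compose[OF j2]
   have Dm[measurable]: "D \<in> meas M"
    unfolding D_def[abs_def] al_def set_lebesgue_integral_def by measurable
   have EN: "integrable M (%w. exp D0 * exp (ka * N2 w))" "(EE w. exp D0 * exp (ka * N2 w)) <= exp D0 * 2"
    using exp_moment[OF ka] unfolding N2_def by auto
   have D_le': "AE w in M. exp (D w) <= exp D0 * exp (ka * N2 w)"
    using D_le by eventually_elim (simp add: exp_add[symmetric])
   have ED: "integrable M (%w. exp (D w))"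
    by (rule integrable_bound[OF EN(1)]) (use D_le' in auto)
   have ED2: "(EE w. exp (D w)) <= exp D0 * 2"
    by (rule order_trans[OF integral_mono_AE[OF ED EN(1) D_le'] EN(2)])
   have le: "exp (4 * Ps w) <= (exp (R w) + exp (D w)) / 2" for w
   proof -
    define p q where "p = exp (R w / 2)" and "q = exp (D w / 2)"
    have "4 * Ps w = R w / 2 + D w / 2" using split[of w] by simp
    then have e: "exp (4 * Ps w) = p * q" by (simp add: p_def q_def exp_add)
    have "exp (R w) = p * p" "exp (D w) = q * q" by (simp_all add: p_def q_def exp_add[symmetric])
    moreover have "0 <= (p - q) * (p - q)" by simp
    ultimately show ?thesis unfolding e by (simp add: algebra_simps)
   qed
   have i: "integrable M (%w. (exp (R w) + exp (D w)) / 2)" using ER(1) ED by auto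
   have Psm: "Ps \<in> meas M"
   proof -
    have "Ps = (%w. (R w + D w) / 8)" using split by (auto simp: field_simps)
    then show ?thesis by simp
   qed
   have m: "(%w. exp (4 * Ps w)) \<in> meas M" using Psm by measurable
   have "abs (exp (4 * Ps w)) <= (exp (R w) + exp (D w)) / 2" for w using le by simp
   note I = integrable_le[OF i m this]
   note I(3)
   also have "(EE w. (exp (R w) + exp (D w)) / 2) = ((EE w. exp (R w)) + (EE w. exp (D w))) / 2" using ER(1) ED by simp
   also have "... <= A"
   proof -
    have "(u + v) / 2 <= (u' + v') / 2 + 1" if "u <= u'" "v <= v'" for u v u' v' :: real
     using that unfolding add_divide_distrib by linarith
    from this[OF ER(2) ED2] show ?thesis unfolding A_def by simp
   qed
   finally show ?thesis using I(1) by simp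
  qed
  then show "mean_le (%w. exp (4 * (LBINT r:{s..t}. f' r (th * Z1 r w + (1 - th) * Z2 r w)))) A"
   by (simp add: Ps_def[abs_def] Y_def[abs_def])
 qed
qed

end

section \<open>Smooth approximation of bounded functions\<close>

lemma lipschitz_approx_open_indicator:
 fixes U :: "'a :: metric_space set"
 assumes "open U"
 obtains f :: "nat => 'a => real" where
  "!!n. \<exists>L. L-lipschitz_on UNIV (f n)" "!!n x. 0 <= f n x" "!!n x. f n x <= 1"
  "!!x. (%n. f n x) \<longlonglongrightarrow> indicator U x"
proof (cases "U = UNIV")
 case True
 show ?thesis
 proof (rule that[of "%_ _. 1"])
  show "\<exists>L. L-lipschitz_on UNIV (%_::'a. 1 :: real)" by (intro exI[of _ 0] lipschitz_intros)
 qed (use True in auto)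
next
 case False
 define f where "f n x = min 1 (real n * infdist x (- U))" for n x
 show ?thesis
 proof (rule that[of f])
  show "\<exists>L. L-lipschitz_on UNIV (f n)" for n
  proof (intro exI[of _ "real n"] lipschitz_onI)
   fix x y :: 'a
   have "dist (f n x) (f n y) <= abs (real n * infdist x (- U) - real n * infdist y (- U))"
    by (simp add: f_def dist_real_def min_def)
   also have "... = real n * abs (infdist x (- U) - infdist y (- U))" by (simp add: abs_mult right_diff_distrib[symmetric])
   also have "... <= real n * dist x y" by (intro mult_left_mono infdist_triangle_abs) auto
   finally show "dist (f n x) (f n y) <= real n * dist x y" .
  qed simp
  show "0 <= f n x" "f n x <= 1" for n x by (auto simp: f_def infdist_nonneg)
  show "(%n. f n x) \<longlonglongrightarrow> indicator U x" for x
  proof (cases "x \<in> U")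
   case True
   have "closed (- U)" "- U ~= {}" using assms False by auto
   then have "infdist x (- U) ~= 0" using in_closed_iff_infdist_zero[of "- U" x] True by auto
   then have pos: "0 < infdist x (- U)" using infdist_nonneg[of x "- U"] by linarith
   obtain N where N: "1 / infdist x (- U) < real N" using reals_Archimedean2 by blast
   have "f n x = 1" if "n \<ge> N" for n
   proof -
    have "1 / infdist x (- U) < real n" using N that by linarith
    then show ?thesis using pos by (simp add: f_def field_simps)
   qed
   then have "eventually (%n. f n x = indicator U x) sequentially"
    using True by (auto simp: eventually_sequentially)
   then show ?thesis by (rule tendsto_eventually)
  next
   case F: False
   then have "infdist x (- U) = 0" by (simp add: infdist_zero)
   then show ?thesis using F by (simp add: f_def)
  qed
 qed
qed

text \<open>By outer regularity for indicators, then by linearity and limits. Lipschitz functions are needed, rather than continuous ones, for the smoothing that follows.\<close>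

lemma lipschitz_dense_integrable:
 fixes m :: "'a :: {second_countable_topology, complete_space} measure" and g :: "'a => real"
 assumes fin: "finite_measure m" and sm: "sets m = sets borel" and g: "integrable m g" and e: "0 < e"
 shows "\<exists>f. (\<exists>L. L-lipschitz_on UNIV f) & bounded (range f) & (\<integral>x. abs (f x - g x) \<partial>m) < e"
 using g e
proof (induction arbitrary: e rule: integrable_induct)
 interpret finite_measure m by fact
 note [measurable_cong] = sm
 have meas: "f \<in> meas m" if "\<exists>L. L-lipschitz_on UNIV f" for f :: "'a => real"
  using that lipschitz_on_continuous_on borel_measurable_continuous_onI
  by (metis measurable_cong_sets sm)
 have int: "integrable m f" if l: "\<exists>L. L-lipschitz_on UNIV f" and b: "bounded (range f)" for f :: "'a => real"
 proof -
  obtain c where "!!x. abs (f x) <= c" using b by (auto simp: bounded_iff)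
  then show ?thesis by (intro integrable_const_bound[of _ c] meas l) auto
 qed
 {
  case (base A c)
  then have A: "A \<in> sets borel" using sm by simp
  define d where "d = e / (2 * (abs c + 1))"
  have d: "0 < d" using base by (simp add: d_def)
  have "\<exists>U. A \<subseteq> U & open U & emeasure m U < emeasure m A + ennreal d"
  proof -
   have "(INF U \<in> {U. A \<subseteq> U & open U}. emeasure m U) < emeasure m A + ennreal d"
    using outer_regular[OF sm _ A] d emeasure_finite[of A]
    by (simp add: emeasure_eq_measure ennreal_plus[symmetric] del: ennreal_plus)
   then show ?thesis unfolding Inf_less_iff by auto
  qed
  then obtain U where U: "A \<subseteq> U" "open U" "emeasure m U < emeasure m A + ennreal d" by blast
  have [measurable]: "U \<in> sets m" "A \<in> sets m" using U sm A by auto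
  have mU: "measure m U < measure m A + d"
  proof -
   have "ennreal (measure m U) < ennreal (measure m A + d)"
    using U(3) d by (simp add: emeasure_eq_measure ennreal_plus[symmetric] del: ennreal_plus)
   then show ?thesis using d by (subst (asm) ennreal_less_iff) auto
  qed
  obtain f :: "nat => 'a => real" where f: "!!n. \<exists>L. L-lipschitz_on UNIV (f n)" "!!n x. 0 <= f n x" "!!n x. f n x <= 1"
   "!!x. (%n. f n x) \<longlonglongrightarrow> indicator U x"
   using lipschitz_approx_open_indicator[OF U(2)] by metis
  have fb: "bounded (range (f n))" for n using f(2,3)[of n] by (intro boundedI[of _ 1]) auto
  have "(%n. \<integral>x. abs (f n x - indicator U x) \<partial>m) \<longlonglongrightarrow> (\<integral>x. 0 \<partial>m)"
  proof (rule integral_dominated_convergence[where w = "%_. 1"])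
   show "(%x. abs (f n x - indicator U x)) \<in> meas m" for n using meas[OF f(1)[of n]] by measurable
   show "AE x in m. (%n. abs (f n x - indicator U x)) \<longlonglongrightarrow> 0"
    using f(4) by (intro AE_I2 tendsto_rabs_zero) (simp add: LIM_zero)
   show "AE x in m. norm (abs (f n x - indicator U x)) <= 1" for n
   proof (intro AE_I2)
    fix x
    show "norm (abs (f n x - indicator U x)) <= 1"
     using f(2)[of n x] f(3)[of n x] by (cases "x \<in> U") auto
   qed
  qed auto
  then have "\<forall>\<^sub>F n in sequentially. (\<integral>x. abs (f n x - indicator U x) \<partial>m) < d"
   using d by (intro order_tendstoD(2)) auto
  then obtain n where n: "(\<integral>x. abs (f n x - indicator U x) \<partial>m) < d"
   by (auto simp: eventually_sequentially)
  define h where "h x = c * f n x" for x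
  have hl: "\<exists>L. L-lipschitz_on UNIV h"
  proof -
   obtain L where "L-lipschitz_on UNIV (f n)" using f(1) by blast
   then have "(abs c * L)-lipschitz_on UNIV h" unfolding h_def by (rule lipschitz_on_cmult_real)
   then show ?thesis by blast
  qed
  have hb: "bounded (range h)"
  proof (rule boundedI[of _ "abs c"])
   fix y assume "y \<in> range h"
   then obtain x where "y = c * f n x" by (auto simp: h_def)
   then show "norm y <= abs c" using f(2,3)[of n x] by (simp add: abs_mult mult_left_le)
  qed
  have iA: "integrable m (indicator A :: 'a => real)" and iU: "integrable m (indicator U :: 'a => real)"
   by (rule integrable_real_indicator; auto simp: emeasure_eq_measure)+
  have "(\<integral>x. abs (h x - indicator A x *\<^sub>R c) \<partial>m) <= (\<integral>x. abs c * (abs (f n x - indicator U x) + (indicator U x - indicator A x)) \<partial>m)"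
  proof (rule integral_mono)
   have "integrable m (%x. indicator A x *\<^sub>R c)" using iA by simp
   then show "integrable m (%x. abs (h x - indicator A x *\<^sub>R c))"
    by (intro integrable_abs integrable_diff int[OF hl hb])
   show "integrable m (%x. abs c * (abs (f n x - indicator U x) + (indicator U x - indicator A x)))"
    by (intro integrable_mult_right integrable_add integrable_abs integrable_diff int[OF f(1) fb] iA iU)
   fix x
   have "abs (f n x - indicator A x) <= abs (f n x - indicator U x) + (indicator U x - indicator A x)"
    using U(1) by (auto simp: indicator_def)
   from mult_left_mono[OF this, of "abs c"]
   show "abs (h x - indicator A x *\<^sub>R c) <= abs c * (abs (f n x - indicator U x) + (indicator U x - indicator A x))"
    by (simp add: h_def abs_mult[symmetric] algebra_simps)
  qed
  also have "... = abs c * ((\<integral>x. abs (f n x - indicator U x) \<partial>m) + (measure m U - measure m A))"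
   using int[OF f(1) fb, of n] iA iU by simp
  also have "... <= abs c * (d + d)" using n mU by (intro mult_left_mono) auto
  also have "... < (abs c + 1) * (d + d)" using d by (intro mult_strict_right_mono) auto
  also have "... = e"
  proof -
   have "abs c + 1 ~= 0" by simp
   then show ?thesis unfolding d_def by (simp add: divide_simps)
  qed
  finally show ?case using hl hb by blast
 next
  case (add g1 g2)
  obtain f1 f2 where f1: "\<exists>L. L-lipschitz_on UNIV f1" "bounded (range f1)" "(\<integral>x. abs (f1 x - g1 x) \<partial>m) < e / 2"
   and f2: "\<exists>L. L-lipschitz_on UNIV f2" "bounded (range f2)" "(\<integral>x. abs (f2 x - g2 x) \<partial>m) < e / 2"
   using add.IH(1)[of "e/2"] add.IH(2)[of "e/2"] add.prems by auto
  have l: "\<exists>L. L-lipschitz_on UNIV (%x. f1 x + f2 x)" using f1(1) f2(1) lipschitz_on_add by blast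
  have b: "bounded (range (%x. f1 x + f2 x))" by (rule bounded_plus_comp[OF f1(2) f2(2)])
  have "(\<integral>x. abs ((f1 x + f2 x) - (g1 x + g2 x)) \<partial>m) <= (\<integral>x. abs (f1 x - g1 x) + abs (f2 x - g2 x) \<partial>m)"
   using int[OF l b] int[OF f1(1,2)] int[OF f2(1,2)] add.hyps by (intro integral_mono) auto
  also have "... < e" using int[OF f1(1,2)] int[OF f2(1,2)] add.hyps f1(3) f2(3) by simp
  finally show ?case using l b by blast
 next
  case (lim g s)
  have i: "integrable m (%x. abs (s i x - g x))" for i using lim.hyps by auto
  have "(%i. \<integral>x. abs (s i x - g x) \<partial>m) \<longlonglongrightarrow> (\<integral>x. 0 \<partial>m)"
  proof (rule integral_dominated_convergence[where w = "%x. 3 * abs (g x)"])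
   show "integrable m (%x. 3 * abs (g x))" using lim.hyps by auto
   show "AE x in m. (%i. abs (s i x - g x)) \<longlonglongrightarrow> 0"
    using lim.hyps by (intro AE_I2 tendsto_rabs_zero) (simp add: LIM_zero)
   show "AE x in m. norm (abs (s i x - g x)) <= 3 * abs (g x)" for i
   proof (intro AE_I2)
    fix x assume "x \<in> space m"
    then have "abs (s i x) <= 2 * abs (g x)" using lim.hyps by auto
    then show "norm (abs (s i x - g x)) <= 3 * abs (g x)" by simp
   qed
  qed (use i in auto)
  then have "\<forall>\<^sub>F i in sequentially. (\<integral>x. abs (s i x - g x) \<partial>m) < e / 2"
   using lim.prems by (intro order_tendstoD(2)) auto
  then obtain i0 where i0: "(\<integral>x. abs (s i0 x - g x) \<partial>m) < e / 2" by (auto simp: eventually_sequentially)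
  obtain f where f: "\<exists>L. L-lipschitz_on UNIV f" "bounded (range f)" "(\<integral>x. abs (f x - s i0 x) \<partial>m) < e / 2"
   using lim.IH[of "e/2" i0] lim.prems by auto
  have "(\<integral>x. abs (f x - g x) \<partial>m) <= (\<integral>x. abs (f x - s i0 x) + abs (s i0 x - g x) \<partial>m)"
   using int[OF f(1,2)] lim.hyps by (intro integral_mono) auto
  also have "... < e" using int[OF f(1,2)] lim.hyps f(3) i0 by simp
  finally show ?case using f by blast
 }
qed

text \<open>A Lipschitz approximation, truncated at the level \<open>Q\<close>, is averaged over \<open>[z, z + h]\<close> in the space variable. The average is differentiable with Lipschitz derivative, keeps the bound \<open>Q\<close>, and differs from the function by at most \<open>l h\<close>.\<close>

lemma smooth_approximation:
 fixes m :: "(real \<times> real) measure" and g :: "real \<times> real => real"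
 assumes fin: "finite_measure m" and sm: "sets m = sets borel" and g: "g \<in> meas borel"
  and gb: "!!p. abs (g p) <= Q" and e: "0 < e"
 obtains F F' L lf where "!!s. C11 Q L lf (F s) (F' s)"
  "jcont F" "jcont F'"
  "(\<integral>p. abs (F (fst p) (snd p) - g p) \<partial>m) < e"
proof -
 interpret finite_measure m by fact
 have Q0: "0 <= Q" using gb[of "(0,0)"] by linarith
 note [measurable_cong] = sm
 have gm[measurable]: "g \<in> meas m" using g by measurable
 have gi: "integrable m g" by (rule integrable_const_bound[of _ Q]) (use gb in auto)
 obtain f0 l where f0: "l-lipschitz_on UNIV f0" "(\<integral>p. abs (f0 p - g p) \<partial>m) < e / 2" "bounded (range f0)"
  using lipschitz_dense_integrable[OF fin sm gi, of "e/2"] e by auto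
 define f where "f p = max (- Q) (min Q (f0 p))" for p
 have fl: "dist (f p) (f q) <= l * dist p q" for p q
 proof -
  have "dist (f p) (f q) <= dist (f0 p) (f0 q)" by (auto simp: f_def dist_real_def max_def min_def)
  also have "... <= l * dist p q" using lipschitz_onD[OF f0(1)] by simp
  finally show ?thesis .
 qed
 have l0: "0 <= l" using lipschitz_on_nonneg[OF f0(1)] .
 have fL: "l-lipschitz_on UNIV f" using fl l0 by (intro lipschitz_onI) auto
 have fb: "abs (f p) <= Q" for p using Q0 by (auto simp: f_def)
 have fs: "abs (f (s, z) - f (s, w)) <= l * abs (z - w)" for s z w
  using fl[of "(s,z)" "(s,w)"] by (simp add: dist_real_def dist_Pair_Pair)
 have ft: "abs (f (s, z) - f (t, z)) <= l * abs (s - t)" for s t z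
  using fl[of "(s,z)" "(t,z)"] by (simp add: dist_real_def dist_Pair_Pair)
 have fm[measurable]: "f \<in> meas m"
 proof -
  have "f \<in> meas borel" by (rule borel_measurable_continuous_onI) (rule lipschitz_on_continuous_on[OF fL])
  then show ?thesis by measurable
 qed
 have f0m: "f0 \<in> meas m"
 proof -
  have "f0 \<in> meas borel" by (rule borel_measurable_continuous_onI) (rule lipschitz_on_continuous_on[OF f0(1)])
  then show ?thesis by measurable
 qed
 have f0i: "integrable m f0"
 proof -
  obtain c where "!!x. abs (f0 x) <= c" using f0(3) by (auto simp: bounded_iff)
  then show ?thesis by (intro integrable_const_bound[of _ c] f0m) auto
 qed
 have fi: "integrable m f" by (rule integrable_const_bound[of _ Q]) (use fb in auto)
 have fg: "(\<integral>p. abs (f p - g p) \<partial>m) < e / 2"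
 proof -
  have "(\<integral>p. abs (f p - g p) \<partial>m) <= (\<integral>p. abs (f0 p - g p) \<partial>m)"
  proof (rule integral_mono)
   show "abs (f p - g p) <= abs (f0 p - g p)" for p using gb[of p] by (auto simp: f_def max_def min_def)
  qed (use fi gi f0i in auto)
  then show ?thesis using f0(2) by simp
 qed
 \<comment> \<open>a moving average in the space variable smooths the Lipschitz function\<close>
 \<comment> \<open>the smoothing error \<open>l h\<close> integrates to at most \<open>e / 2\<close>\<close>
 define h where "h = e / (2 * (l + 1) * (measure m UNIV + 1))"
 have "0 < 2 * (l + 1) * (measure m UNIV + 1)" using l0 by (intro mult_pos_pos add_nonneg_pos) auto
 then have h: "0 < h" using e unfolding h_def by (intro divide_pos_pos)
 define H where "H s z = (LBINT y=0..z. f (s, y))" for s and z :: real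
 have Hd: "(H s has_real_derivative f (s, z)) (at z)" for s z
 proof -
  define a b where "a = - abs z - 1" and "b = abs z + 1"
  have c: "continuous_on {a..b} (%y. f (s, y))"
  proof -
   have "l-lipschitz_on {a..b} (%y. f (s, y))" using fs l0 by (intro lipschitz_onI) (auto simp: dist_real_def)
   then show ?thesis by (rule lipschitz_on_continuous_on)
  qed
  have "((%u. LBINT y=0..u. f (s, y)) has_vector_derivative f (s, z)) (at z within {a..b})"
   using interval_integral_FTC2[of a 0 b "%y. f (s, y)" z] c by (auto simp: a_def b_def zero_ereal_def)
  then have "(H s has_vector_derivative f (s, z)) (at z within {a..b})" by (simp add: H_def[abs_def])
  moreover have "at z within {a..b} = at z" by (rule at_within_interior) (auto simp: a_def b_def)
  ultimately show ?thesis by (simp add: has_real_derivative_iff_has_vector_derivative)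
 qed
 define F where "F s z = (H s (z + h) - H s z) / h" for s z
 define F' where "F' s z = (f (s, z + h) - f (s, z)) / h" for s z
 have Fmvt: "\<exists>c. F s z - F t z = f (s, c) - f (t, c) & z <= c & c <= z + h" for s t z
 proof -
  have "((%z. H s z - H t z) has_real_derivative f (s, x) - f (t, x)) (at x)" for x by (intro DERIV_diff Hd)
  then obtain c where "z < c" "c < z + h" "(H s (z + h) - H t (z + h)) - (H s z - H t z) = (z + h - z) * (f (s, c) - f (t, c))"
   using MVT2[of z "z + h" "%z. H s z - H t z" "%x. f (s, x) - f (t, x)"] h by auto
  moreover from this(3) have "F s z - F t z = f (s, c) - f (t, c)"
  proof -
   assume "(H s (z + h) - H t (z + h)) - (H s z - H t z) = (z + h - z) * (f (s, c) - f (t, c))"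
   then have "(H s (z + h) - H s z) - (H t (z + h) - H t z) = h * (f (s, c) - f (t, c))" by simp
   then show ?thesis unfolding F_def diff_divide_distrib[symmetric] using h by simp
  qed
  ultimately show ?thesis by (intro exI[of _ c]) auto
 qed
 have Fmvt1: "\<exists>c. F s z = f (s, c) & z <= c & c <= z + h" for s z
 proof -
  obtain c where "z < c" "c < z + h" "H s (z + h) - H s z = (z + h - z) * f (s, c)"
   using MVT2[of z "z + h" "H s" "%x. f (s, x)"] h Hd by auto
  then show ?thesis using h by (intro exI[of _ c]) (auto simp: F_def)
 qed
 have C: "C11 Q (2 * Q / h) (2 * l / h) (F s) (F' s)" for s
  unfolding C11_def
 proof (intro conjI allI)
  fix z w
  have "((%z. H s (z + h)) has_real_derivative f (s, z + h)) (at z)" using Hd[of s "z + h"] by (simp add: DERIV_shift)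
  then show "(F s has_real_derivative F' s z) (at z)"
   unfolding F_def[abs_def] F'_def using h by (auto intro!: derivative_eq_intros Hd)
  show "abs (F s z) <= Q" using Fmvt1[of s z] fb by auto
  show "abs (F' s z) <= 2 * Q / h"
   unfolding F'_def abs_divide using fb[of "(s, z + h)"] fb[of "(s, z)"] h by (auto intro!: divide_right_mono)
  have "abs ((f (s, z + h) - f (s, z)) - (f (s, w + h) - f (s, w))) <= 2 * l * abs (z - w)"
   using fs[of s "z + h" "w + h"] fs[of s z w] by simp
  then have "abs ((f (s, z + h) - f (s, z)) - (f (s, w + h) - f (s, w))) / h <= 2 * l * abs (z - w) / h"
   using h by (intro divide_right_mono) auto
  moreover have "F' s z - F' s w = ((f (s, z + h) - f (s, z)) - (f (s, w + h) - f (s, w))) / h"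
   by (simp add: F'_def diff_divide_distrib)
  ultimately show "abs (F' s z - F' s w) <= 2 * l / h * abs (z - w)" using h by (simp add: abs_divide)
 qed
 have close: "abs (F s z - f (s, z)) <= l * h" for s z
 proof -
  obtain c where c: "F s z = f (s, c)" "z <= c" "c <= z + h" using Fmvt1 by blast
  have "abs (F s z - f (s, z)) <= l * abs (c - z)" using fs[of s c z] c by simp
  also have "... <= l * h" using c l0 by (intro mult_left_mono) auto
  finally show ?thesis .
 qed
 have Fc: "jcont F"
 proof -
  have "(l + 2 * Q / h)-lipschitz_on UNIV (%p. F (fst p) (snd p))"
  proof (rule lipschitz_onI)
   fix p q :: "real \<times> real"
   have d1: "abs (fst p - fst q) <= dist p q" "abs (snd p - snd q) <= dist p q"
    using dist_fst_le[of p q] dist_snd_le[of p q] by (auto simp: dist_real_def)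
   obtain c where "F (fst p) (snd p) - F (fst q) (snd p) = f (fst p, c) - f (fst q, c)" using Fmvt by blast
   then have "abs (F (fst p) (snd p) - F (fst q) (snd p)) <= l * abs (fst p - fst q)" using ft by simp
   also have "... <= l * dist p q" using d1 l0 by (intro mult_left_mono) auto
   finally have 1: "abs (F (fst p) (snd p) - F (fst q) (snd p)) <= l * dist p q" .
   have "abs (F (fst q) (snd p) - F (fst q) (snd q)) <= 2 * Q / h * abs (snd p - snd q)"
    using C11_lipschitz[OF C] by simp
   also have "... <= 2 * Q / h * dist p q" using d1 Q0 h by (intro mult_left_mono) auto
   finally have 2: "abs (F (fst q) (snd p) - F (fst q) (snd q)) <= 2 * Q / h * dist p q" .
   show "dist (F (fst p) (snd p)) (F (fst q) (snd q)) <= (l + 2 * Q / h) * dist p q"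
    unfolding dist_real_def distrib_right using 1 2 by linarith
  qed (use l0 Q0 h in auto)
  then show ?thesis by (rule lipschitz_on_continuous_on)
 qed
 have F'c: "jcont F'"
 proof -
  have fc: "conti f" by (rule lipschitz_on_continuous_on[OF fL])
  have "conti (%p. f (fst p, snd p + h))" "conti (%p. f (fst p, snd p))"
   by (rule continuous_on_compose2[OF fc]; auto intro!: continuous_intros)+
  then show ?thesis unfolding F'_def using h by (intro continuous_intros) auto
 qed
 have Fm[measurable]: "(%p. F (fst p) (snd p)) \<in> meas m"
  using borel_measurable_continuous_onI[OF Fc] by measurable
 have Fi: "integrable m (%p. F (fst p) (snd p))"
  by (rule integrable_const_bound[of _ Q]) (use C11_D(2)[OF C] in auto)
 have sp: "space m = UNIV" using sets_eq_imp_space_eq[OF sm] by simp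
 have "(\<integral>p. abs (F (fst p) (snd p) - g p) \<partial>m) <= (\<integral>p. l * h + abs (f p - g p) \<partial>m)"
 proof (rule integral_mono)
  show "abs (F (fst p) (snd p) - g p) <= l * h + abs (f p - g p)" for p
   using close[of "fst p" "snd p"] by simp
 qed (use Fi fi gi in auto)
 also have "... = measure m UNIV * (l * h) + (\<integral>p. abs (f p - g p) \<partial>m)"
  using fi gi sp by simp
 also have "measure m UNIV * (l * h) <= e / 2"
 proof -
  have "measure m UNIV * (l * h) <= (measure m UNIV + 1) * ((l + 1) * h)"
   using l0 h by (intro mult_mono) auto
  also have "... = e / 2"
  proof -
   have "(measure m UNIV + 1) ~= 0" "l + 1 ~= 0" using l0 measure_nonneg[of m UNIV] by linarith+
   then have "(measure m UNIV + 1) * ((l + 1) * h) = (measure m UNIV + 1) / (measure m UNIV + 1) * ((l + 1) / (l + 1)) * (e / 2)"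
    unfolding h_def by (simp only: times_divide_times_eq times_divide_eq_right) (simp add: ac_simps)
   then show ?thesis using \<open>measure m UNIV + 1 ~= 0\<close> \<open>l + 1 ~= 0\<close> by simp
  qed
  finally show ?thesis .
 qed
 finally have "(\<integral>p. abs (F (fst p) (snd p) - g p) \<partial>m) < e" using fg by simp
 then show ?thesis by (rule that[OF C Fc F'c])
qed

section \<open>Calculus of absolutely continuous functions\<close>

lemma set_integral_Icc_continuous:
 fixes d :: "real => real"
 assumes d: "lint {l..u} d"
 shows "continuous_on {l..u} (%x. LBINT y:{l..x}. d y)"
proof -
 have "continuous_on {l..u} (%x. integral {l..x} d)"
  using indefinite_integral_continuous_1[OF set_borel_integral_eq_integral(1)[OF d]] by simp
 moreover have "(LBINT y:{l..x}. d y) = integral {l..x} d" if "x \<in> {l..u}" for x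
  by (rule set_borel_integral_eq_integral(2)) (use set_integrable_subset[OF d, of "{l..x}"] that in auto)
 ultimately show ?thesis by (subst continuous_on_cong[OF refl]) auto
qed

lemma set_integrable_continuous_mult:
 fixes d w :: "real => real"
 assumes d: "lint {l..u} d" and w: "continuous_on {l..u} w"
 shows "lint {l..u} (%x. w x * d x)"
proof -
 have "bounded (w ` {l..u})" by (intro compact_imp_bounded compact_continuous_image w) auto
 then obtain c where "\<forall>x\<in>{l..u}. abs (w x) <= c" unfolding bounded_iff by auto
 then have c: "!!x. x \<in> {l..u} ==> abs (w x) <= c" by blast
 have i: "integrable lborel (%x. indicator {l..u} x *\<^sub>R d x)" using d by (simp add: set_integrable_def)
 have wm: "(%x. indicator {l..u} x *\<^sub>R w x) \<in> meas lborel"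
  using borel_measurable_continuous_on_indicator[OF _ w] by simp
 have eq: "indicator {l..u} x *\<^sub>R (w x * d x) = (indicator {l..u} x *\<^sub>R w x) * (indicator {l..u} x *\<^sub>R d x)" for x
  by (simp add: indicator_def)
 show ?thesis unfolding set_integrable_def eq
 proof (rule integrable_bound)
  show "integrable lborel (%x. c * (indicator {l..u} x *\<^sub>R d x))" using i by simp
  show "(%x. (indicator {l..u} x *\<^sub>R w x) * (indicator {l..u} x *\<^sub>R d x)) \<in> meas lborel"
   using wm borel_measurable_integrable[OF i] by measurable
  have "abs (w x * d x) <= abs (c * d x)" if "x \<in> {l..u}" for x
   using mult_right_mono[OF order_trans[OF c[OF that] abs_ge_self], of "abs (d x)"] by (simp add: abs_mult)
  then show "AE x in lborel. norm ((indicator {l..u} x *\<^sub>R w x) * (indicator {l..u} x *\<^sub>R d x)) <= norm (c * (indicator {l..u} x *\<^sub>R d x))"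
   by (intro AE_I2) (auto simp: indicator_def)
 qed
qed

text \<open>Let \<open>V\<close> be the total variation of \<open>G\<close>. The error \<open>R\<close> of the claimed formula changes over \<open>[x, y]\<close> by at most \<open>2 L (V y - V x)\<^sup>2\<close>. Cutting \<open>[l, u]\<close> into \<open>n\<close> pieces of equal variation gives \<open>2 L V\<^sup>2 / n\<close> for the whole interval, for every \<open>n\<close>.\<close>

lemma AC_composition:
 fixes G d \<Phi> \<Phi>' :: "real => real"
 assumes lu: "l <= u" and d: "lint {l..u} d" and L: "0 <= L"
  and G: "!!x. x \<in> {l..u} ==> G x = G l + (LBINT y:{l..x}. d y)"
  and taylor: "!!x y. x \<in> {l..u} ==> y \<in> {l..u} ==> abs (\<Phi> (G y) - \<Phi> (G x) - \<Phi>' (G x) * (G y - G x)) <= L * (G y - G x)^2"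
  and lip: "!!x y. x \<in> {l..u} ==> y \<in> {l..u} ==> abs (\<Phi>' (G y) - \<Phi>' (G x)) <= L * abs (G y - G x)"
 shows "lint {l..u} (%x. \<Phi>' (G x) * d x)"
  "\<Phi> (G u) = \<Phi> (G l) + (LBINT x:{l..u}. \<Phi>' (G x) * d x)"
proof -
 \<comment> \<open>\<open>V\<close> is the total variation of \<open>G\<close>, and \<open>R\<close> below the error of the claimed formula\<close>
 define V where "V x = (LBINT y:{l..x}. abs (d y))" for x
 define W where "W x = \<Phi>' (G x)" for x
 have sub: "lint {x..y} f" if "lint {l..u} f" "l <= x" "y <= u" for x y and f :: "real => real"
  by (rule set_integrable_subset[OF that(1)]) (use that in auto)
 have da: "lint {l..u} (%y. abs (d y))" by (rule set_integrable_abs[OF d])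
 have Vc: "continuous_on {l..u} V" unfolding V_def by (rule set_integral_Icc_continuous[OF da])
 have V0: "V l = 0" unfolding V_def by (rule LBINT_point)
 have Vd: "V y - V x = (LBINT r:{x..y}. abs (d r))" if "l <= x" "x <= y" "y <= u" for x y
  using set_integral_split_point[OF sub[OF da order.refl that(3)] that(1,2)] by (simp add: V_def)
 have Gd: "G y - G x = (LBINT r:{x..y}. d r)" if "l <= x" "x <= y" "y <= u" for x y
  using set_integral_split_point[OF sub[OF d order.refl that(3)] that(1,2)] G[of x] G[of y] that by simp
 have Vmono: "V x <= V y" if "l <= x" "x <= y" "y <= u" for x y
 proof -
  have "0 <= (LBINT r:{x..y}. abs (d r))"
   by (rule LBINT_nonneg) simp
  then show ?thesis using Vd[OF that] by simp
 qed
 have GV: "abs (G y - G x) <= V y - V x" if "l <= x" "x <= y" "y <= u" for x y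
  using set_integral_norm_bound[OF sub[OF d that(1,3)]] by (simp add: Gd[OF that] Vd[OF that])
 have "continuous_on {l..u} (%x. G l + (LBINT y:{l..x}. d y))"
  by (intro continuous_intros set_integral_Icc_continuous d)
 then have Gc: "continuous_on {l..u} G" by (rule continuous_on_eq) (simp add: G[symmetric])
 have Wc: "continuous_on {l..u} W"
 proof -
  have "L-lipschitz_on (G ` {l..u}) \<Phi>'"
   using lip L by (intro lipschitz_onI) (auto simp: dist_real_def)
  then have "continuous_on (G ` {l..u}) \<Phi>'" by (rule lipschitz_on_continuous_on)
  from continuous_on_compose2[OF this Gc] show ?thesis by (simp add: W_def[abs_def])
 qed
 have Wd: "lint {l..u} (%x. W x * d x)" by (rule set_integrable_continuous_mult[OF d Wc])
 define R where "R x = \<Phi> (G x) - (LBINT y:{l..x}. W y * d y)" for x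
 have R1: "abs (R y - R x) <= 2 * L * (V y - V x)^2" if xy: "l <= x" "x <= y" "y <= u" for x y
 proof -
  have x: "x \<in> {l..u}" and y: "y \<in> {l..u}" using xy by auto
  have i1: "lint {x..y} (%r. W r * d r)" by (rule sub[OF Wd xy(1,3)])
  have i2: "lint {x..y} (%r. W x * d r)" using sub[OF d xy(1,3)] by simp
  have i3: "lint {x..y} (%r. L * (V y - V x) * abs (d r))" using sub[OF da xy(1,3)] by simp
  have "R y - R x = (\<Phi> (G y) - \<Phi> (G x) - W x * (G y - G x)) - ((LBINT r:{x..y}. W r * d r) - (LBINT r:{x..y}. W x * d r))"
   using set_integral_split_point[OF sub[OF Wd order.refl xy(3)] xy(1,2)] by (simp add: R_def Gd[OF xy])
  also have "(LBINT r:{x..y}. W r * d r) - (LBINT r:{x..y}. W x * d r) = (LBINT r:{x..y}. W r * d r - W x * d r)"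
   using set_integral_diff(2)[OF i1 i2] by simp
  finally have e: "R y - R x = (\<Phi> (G y) - \<Phi> (G x) - W x * (G y - G x)) - (LBINT r:{x..y}. W r * d r - W x * d r)" .
  have "abs (LBINT r:{x..y}. W r * d r - W x * d r) <= (LBINT r:{x..y}. abs (W r * d r - W x * d r))"
   using set_integral_norm_bound[OF set_integral_diff(1)[OF i1 i2]] by simp
  also have "... <= (LBINT r:{x..y}. L * (V y - V x) * abs (d r))"
  proof (rule set_integral_mono[OF set_integrable_abs[OF set_integral_diff(1)[OF i1 i2]] i3])
   fix r assume r: "r \<in> {x..y}"
   have "abs (W r - W x) <= L * abs (G r - G x)" using lip[of x r] r x y by (simp add: W_def)
   also have "... <= L * (V y - V x)" using GV[of x r] Vmono[of r y] r xy L by (intro mult_left_mono) auto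
   finally have "abs (W r - W x) * abs (d r) <= L * (V y - V x) * abs (d r)" by (rule mult_right_mono) simp
   then show "abs (W r * d r - W x * d r) <= L * (V y - V x) * abs (d r)"
    by (simp add: abs_mult[symmetric] left_diff_distrib)
  qed
  also have "... = L * (V y - V x)^2" using Vd[OF xy] by (simp add: power2_eq_square)
  finally have 1: "abs (LBINT r:{x..y}. W r * d r - W x * d r) <= L * (V y - V x)^2" .
  have "(G y - G x)^2 <= (V y - V x)^2" using GV[OF xy] by (rule abs_le_square_iff[THEN iffD1, OF order_trans[OF _ abs_ge_self]])
  then have "L * (G y - G x)^2 <= L * (V y - V x)^2" by (rule mult_left_mono[OF _ L])
  then have 2: "abs (\<Phi> (G y) - \<Phi> (G x) - W x * (G y - G x)) <= L * (V y - V x)^2"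
   using taylor[OF x y] by (simp add: W_def)
  show ?thesis using 1 2 unfolding e by linarith
 qed
 have R2: "abs (R y - R x) <= 2 * L * (V y - V x)^2" if "x \<in> {l..u}" "y \<in> {l..u}" for x y
  using R1[of x y] R1[of y x] that by (cases "x <= y") (auto simp: abs_minus_commute power2_commute)
 have bound: "abs (R u - R l) <= 2 * L * (V u)^2 / real n" if n: "0 < n" for n :: nat
 proof -
  have Vu: "0 <= V u" using Vmono[of l u] V0 lu by simp
  have "\<exists>x. x \<in> {l..u} & V x = real i * V u / real n" if "i <= n" for i
  proof -
   have "real i * V u <= V u * real n" using mult_right_mono[OF of_nat_mono[OF that, where 'a = real] Vu] by (simp add: mult.commute)
   then have "real i * V u / real n <= V u" using n by (simp add: divide_le_eq)
   then show ?thesis using IVT'[of V l "real i * V u / real n" u] V0 Vu lu Vc by auto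
  qed
  then obtain x where x: "!!i. i <= n ==> x i \<in> {l..u} & V (x i) = real i * V u / real n" by metis
  have ind: "abs (R (x i) - R (x 0)) <= real i * (2 * L * (V u / real n)^2)" if "i <= n" for i
   using that
  proof (induction i)
   case (Suc i)
   have "V (x (Suc i)) - V (x i) = V u / real n"
    using x[of i] x[of "Suc i"] Suc.prems n by (simp add: field_simps)
   then have "abs (R (x (Suc i)) - R (x i)) <= 2 * L * (V u / real n)^2"
    using R2[of "x i" "x (Suc i)"] x[of i] x[of "Suc i"] Suc.prems by simp
   then show ?case using Suc by (simp add: distrib_right)
  qed simp
  have "abs (R (x 0) - R l) <= 0" using R2[of l "x 0"] x[of 0] V0 lu by simp
  moreover have "abs (R u - R (x n)) <= 0" using R2[of "x n" u] x[of n] n lu by simp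
  moreover have "real n * (2 * L * (V u / real n)^2) = 2 * L * (V u)^2 / real n"
   using n by (simp add: power2_eq_square)
  ultimately show ?thesis using ind[of n] by simp
 qed
 have "R u = R l"
 proof (rule ccontr)
  assume "R u ~= R l"
  then have pos: "0 < abs (R u - R l)" by simp
  obtain n where n: "2 * L * (V u)^2 / abs (R u - R l) < real n" using reals_Archimedean2 by blast
  have "0 <= 2 * L * (V u)^2 / abs (R u - R l)" using L by simp
  then have "0 < real n" using n by linarith
  then have n0: "0 < n" by simp
  have "2 * L * (V u)^2 < real n * abs (R u - R l)" using n pos by (simp add: divide_less_eq)
  then have "2 * L * (V u)^2 / real n < abs (R u - R l)" using n0 by (simp add: divide_less_eq mult.commute)
  then show False using bound[OF n0] by simp
 qed
 moreover have "(LBINT y:{l..l}. W y * d y) = 0"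
  by (rule LBINT_point)
 ultimately show "\<Phi> (G u) = \<Phi> (G l) + (LBINT x:{l..u}. \<Phi>' (G x) * d x)" by (simp add: R_def W_def)
 show "lint {l..u} (%x. \<Phi>' (G x) * d x)" using Wd by (simp add: W_def)
qed

text \<open>Polarization of the chain rule for the square.\<close>

lemma AC_product:
 fixes F G f g :: "real => real"
 assumes lu: "l <= u" and f: "lint {l..u} f" and g: "lint {l..u} g"
  and F: "!!x. x \<in> {l..u} ==> F x = F l + (LBINT y:{l..x}. f y)"
  and G: "!!x. x \<in> {l..u} ==> G x = G l + (LBINT y:{l..x}. g y)"
 shows "lint {l..u} (%x. f x * G x + F x * g x)"
  "F u * G u = F l * G l + (LBINT x:{l..u}. f x * G x + F x * g x)"
proof -
 have sub: "lint {l..x} h" if "lint {l..u} h" "x \<in> {l..u}" for x and h :: "real => real"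
  by (rule set_integrable_subset[OF that(1)]) (use that in auto)
 have sq: "abs (y^2 - x^2 - 2 * x * (y - x)) <= 2 * (y - x)^2" for x y :: real
 proof -
  have "y^2 - x^2 - 2 * x * (y - x) = (y - x)^2" by (simp add: power2_eq_square algebra_simps)
  then show ?thesis by simp
 qed
 have dbl: "abs (2 * y - 2 * x) <= 2 * abs (y - x)" for x y :: real
  unfolding right_diff_distrib[symmetric] abs_mult by simp
 have P: "F x + G x = (F l + G l) + (LBINT y:{l..x}. f y + g y)" if "x \<in> {l..u}" for x
  using F[OF that] G[OF that] set_integral_add(2)[OF sub[OF f that] sub[OF g that]] by simp
 have Q: "F x - G x = (F l - G l) + (LBINT y:{l..x}. f y - g y)" if "x \<in> {l..u}" for x
  using F[OF that] G[OF that] set_integral_diff(2)[OF sub[OF f that] sub[OF g that]] by simp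
 note C = AC_composition[where \<Phi> = "%z. z^2" and \<Phi>' = "%z. 2 * z" and L = 2, OF lu _ _ _ sq dbl]
 have A: "lint {l..u} (%x. 2 * (F x + G x) * (f x + g x))"
  "(F u + G u)^2 = (F l + G l)^2 + (LBINT x:{l..u}. 2 * (F x + G x) * (f x + g x))"
  by (rule C[where G = "%x. F x + G x", OF set_integral_add(1)[OF f g] _ P]; simp)+
 have B: "lint {l..u} (%x. 2 * (F x - G x) * (f x - g x))"
  "(F u - G u)^2 = (F l - G l)^2 + (LBINT x:{l..u}. 2 * (F x - G x) * (f x - g x))"
  by (rule C[where G = "%x. F x - G x", OF set_integral_diff(1)[OF f g] _ Q]; simp)+
 have e: "f x * G x + F x * g x = (1/4) * (2 * (F x + G x) * (f x + g x) - 2 * (F x - G x) * (f x - g x))" for x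
  by (simp add: algebra_simps)
 show "lint {l..u} (%x. f x * G x + F x * g x)"
  unfolding e using set_integral_diff(1)[OF A(1) B(1)] by simp
 have "(LBINT x:{l..u}. f x * G x + F x * g x) = (1/4) * ((F u + G u)^2 - (F l + G l)^2 - ((F u - G u)^2 - (F l - G l)^2))"
  unfolding e set_integral_mult_right set_integral_diff(2)[OF A(1) B(1)] using A(2) B(2) by simp
 then show "F u * G u = F l * G l + (LBINT x:{l..u}. f x * G x + F x * g x)"
  by (simp add: power2_eq_square algebra_simps)
qed

section \<open>The linear equation along a path\<close>

lemma exp_integral_derivative:
 fixes ka :: "real => real"
 assumes ka: "conti ka" and s: "0 <= s"
 shows "exp (- (LBINT r:{0..s}. ka r)) = 1 + (LBINT x:{0..s}. - ka x * exp (- (LBINT r:{0..x}. ka r)))"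
proof -
 have c: "continuous_on {0..x} ka" for x by (rule continuous_on_subset[OF ka]) simp
 have eq: "(LBINT r:{0..x}. ka r) = integral {0..x} ka" for x
  by (rule set_borel_integral_eq_integral(2)) (rule borel_integrable_atLeastAtMost'[OF c])
 have d: "((%x. exp (- integral {0..x} ka)) has_vector_derivative - ka x * exp (- integral {0..x} ka)) (at x within {0..s})" if "x \<in> {0..s}" for x
  using integral_has_vector_derivative[OF c that]
  unfolding has_real_derivative_iff_has_vector_derivative[symmetric]
  by (auto intro!: derivative_eq_intros)
 have h: "((%x. - ka x * exp (- integral {0..x} ka)) has_integral (exp (- integral {0..s} ka) - exp (- integral {0..0} ka))) {0..s}"
  by (rule fundamental_theorem_of_calculus[OF s d])
 have "continuous_on {0..s} (%x. - ka x * exp (- integral {0..x} ka))"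
  by (intro continuous_intros c indefinite_integral_continuous_1 integrable_continuous_real)
 then have "lint {0..s} (%x. - ka x * exp (- integral {0..x} ka))" by (rule borel_integrable_atLeastAtMost')
 from set_borel_integral_eq_integral(2)[OF this] integral_unique[OF h] show ?thesis unfolding eq by simp
qed

text \<open>Multiplication with the integrating factor \<open>exp (- \<integral> \<kappa>)\<close> leaves a pathwise Gronwall argument for the remaining Lipschitz part. The coefficient \<open>\<kappa>\<close> enters through its integral, never through \<open>\<bar>\<kappa>\<bar>\<close>; this is what makes the exponential moments applicable.\<close>

lemma linear_path_bound:
 fixes z a ka rh :: "real => real"
 assumes t: "0 <= t" and C: "0 <= C" and ka: "conti ka" and z: "conti z"
  and a: "lint {0..t} a" and eq: "!!s. s \<in> {0..t} ==> z s = z0 + (LBINT r:{0..s}. a r)"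
  and rh: "lint {0..t} rh" and rh0: "!!s. 0 <= rh s"
  and bnd: "!!s. s \<in> {0..t} ==> abs (a s - ka s * z s) <= C * abs (z s) + rh s"
 shows "abs (z t) <= 2 * exp (2 * C * t) * (exp (LBINT r:{0..t}. ka r) * abs z0
  + (LBINT s:{0..t}. exp (LBINT r:{s..t}. ka r) * rh s))"
proof -
 define J where "J s = (LBINT r:{0..s}. ka r)" for s
 define e where "e s = exp (- J s)" for s
 have e0: "0 < e s" for s by (simp add: e_def)
 have kai: "lint {0..t} ka" by (rule set_integrable_continuous[OF ka])
 have Jc: "continuous_on {0..t} J" unfolding J_def by (rule set_integral_Icc_continuous[OF kai])
 have ec: "continuous_on {0..t} e" unfolding e_def by (intro continuous_intros Jc)
 have z00: "z 0 = z0" using eq[of 0] t LBINT_point[of 0 a] by (simp del: atLeastAtMost_singleton)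
 have e00: "e 0 = 1" using LBINT_point[of 0 ka] by (simp add: e_def J_def del: atLeastAtMost_singleton)
 have sub: "lint {0..s} f" if "lint {0..t} f" "s \<in> {0..t}" for s and f :: "real => real"
  by (rule set_integrable_subset[OF that(1)]) (use that in auto)
 have e'i: "lint {0..t} (%x. - ka x * e x)"
  by (rule borel_integrable_atLeastAtMost') (intro continuous_intros ec continuous_on_subset[OF ka] subset_UNIV)
 have H: "z s * e s = z0 + (LBINT x:{0..s}. e x * (a x - ka x * z x))" if s: "s \<in> {0..t}" for s
 proof -
  have "z s * e s = z 0 * e 0 + (LBINT x:{0..s}. a x * e x + z x * (- ka x * e x))"
  proof (rule AC_product(2))
   show "e x = e 0 + (LBINT y:{0..x}. - ka y * e y)" if "x \<in> {0..s}" for x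
    unfolding e00 using exp_integral_derivative[OF ka, of x] that by (simp add: e_def J_def)
   show "z x = z 0 + (LBINT y:{0..x}. a y)" if "x \<in> {0..s}" for x
    using eq[of x] that s z00 by simp
  qed (use s sub[OF a s] sub[OF e'i s] in auto)
  also have "(%x. a x * e x + z x * (- ka x * e x)) = (%x. e x * (a x - ka x * z x))" by (auto simp: algebra_simps)
  finally show ?thesis by (simp add: z00 e00)
 qed
 define q where "q s = max 0 (min t s)" for s
 have q: "q s \<in> {0..t}" for s using t by (auto simp: q_def)
 have qs: "q s = s" if "s \<in> {0..t}" for s using that by (auto simp: q_def)
 have qc: "conti q" unfolding q_def by (intro continuous_intros)
 define u where "u s = abs (z (q s) * e (q s))" for s
 define D where "D = abs z0 + (LBINT x:{0..t}. e x * rh x)"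
 have erh: "lint {0..t} (%x. e x * rh x)" by (rule set_integrable_continuous_mult[OF rh ec])
 have uc: "conti u"
  unfolding u_def by (intro continuous_intros continuous_on_compose2[OF ec qc] continuous_on_compose2[OF z qc]) (use q in auto)
 have erh0: "0 <= (LBINT x:{0..s}. e x * rh x)" for s
  by (rule LBINT_nonneg) (use e0[THEN less_imp_le] rh0 in simp)
 have "u t <= 2 * (D + C * (LBINT s:{0..t}. 0)) * exp (2 * C * t)"
 proof (rule gronwall_path[OF uc])
  show "0 <= u s" for s by (simp add: u_def)
  show "conti (%s. 0 :: real)" by simp
  show "0 <= D" using erh0 by (simp add: D_def)
  fix s assume s: "0 <= s" "s <= t"
  then have st: "s \<in> {0..t}" by simp
  have i: "lint {0..s} (%x. e x * (a x - ka x * z x))"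
  proof -
   have "lint {0..t} (%x. a x - ka x * z x)"
    by (rule set_integral_diff(1)[OF a]) (intro set_integrable_continuous continuous_intros ka z)
   from set_integrable_continuous_mult[OF this ec] show ?thesis by (rule sub[OF _ st])
  qed
  have i1: "lint {0..s} (%x. C * (u x + 0))" by (intro set_integrable_continuous continuous_intros uc)
  have i2: "lint {0..s} (%x. e x * rh x)" by (rule sub[OF erh st])
  have "abs (z s * e s) <= abs z0 + abs (LBINT x:{0..s}. e x * (a x - ka x * z x))" using H[OF st] by simp
  also have "abs (LBINT x:{0..s}. e x * (a x - ka x * z x)) <= (LBINT x:{0..s}. abs (e x * (a x - ka x * z x)))"
   using set_integral_norm_bound[OF i] by simp
  also have "... <= (LBINT x:{0..s}. C * (u x + 0) + e x * rh x)"
  proof (rule set_integral_mono[OF set_integrable_abs[OF i] set_integral_add(1)[OF i1 i2]])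
   fix x assume x: "x \<in> {0..s}"
   then have xt: "x \<in> {0..t}" using s by auto
   have "e x * abs (a x - ka x * z x) <= e x * (C * abs (z x) + rh x)" by (rule mult_left_mono[OF bnd[OF xt] less_imp_le[OF e0]])
   then show "abs (e x * (a x - ka x * z x)) <= C * (u x + 0) + e x * rh x"
    unfolding u_def qs[OF xt] abs_mult abs_of_pos[OF e0] by (simp add: algebra_simps)
  qed
  also have "... = (LBINT x:{0..s}. C * (u x + 0)) + (LBINT x:{0..s}. e x * rh x)" by (rule set_integral_add(2)[OF i1 i2])
  also have "(LBINT x:{0..s}. e x * rh x) <= (LBINT x:{0..t}. e x * rh x)"
  proof -
   have "0 <= (LBINT x:{s..t}. e x * rh x)"
    by (rule LBINT_nonneg) (use e0[THEN less_imp_le] rh0 in simp)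
   then show ?thesis using set_integral_split_point[OF erh s] by simp
  qed
  finally show "u s <= D + (LBINT x:{0..s}. C * (u x + 0))" by (simp add: u_def qs[OF st] D_def)
 qed (use t C in auto)
 then have le: "abs (z t) * e t <= 2 * exp (2 * C * t) * D"
  using t e0[of t] by (simp add: u_def qs abs_mult set_lebesgue_integral_def mult_ac)
 have ee: "exp (J t) * e s = exp (LBINT r:{s..t}. ka r)" if "s \<in> {0..t}" for s
  using set_integral_split_point[OF kai, of s] that by (simp add: e_def J_def exp_add[symmetric])
 have "abs (z t) = exp (J t) * (abs (z t) * e t)" by (simp add: e_def exp_minus)
 also have "... <= exp (J t) * (2 * exp (2 * C * t) * D)" by (rule mult_left_mono[OF le]) simp
 also have "... = 2 * exp (2 * C * t) * (exp (J t) * abs z0 + exp (J t) * (LBINT x:{0..t}. e x * rh x))"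
  by (simp add: D_def algebra_simps)
 also have "exp (J t) * (LBINT x:{0..t}. e x * rh x) = (LBINT x:{0..t}. exp (J t) * (e x * rh x))" by simp
 also have "... = (LBINT s:{0..t}. exp (LBINT r:{s..t}. ka r) * rh s)"
  by (rule set_lebesgue_integral_cong) (use ee in \<open>auto simp: mult.assoc[symmetric]\<close>)
 finally show ?thesis by (simp add: J_def)
qed

lemma LINT_Icc_eq_integral:
 fixes f :: "real => real"
 assumes "conti f"
 shows "(LBINT x:{a..b}. f x) = integral {a..b} f"
 by (rule set_borel_integral_eq_integral(2)[OF set_integrable_continuous[OF assms]])

lemma continuous_on_sections:
 fixes g :: "real => real => real"
 assumes c: "jcont g"
 shows "conti (%p. g (snd p) (fst p))" "conti (%th. g r th)" "conti (%r. g r th)"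
proof -
 have 1: "conti (%p :: real \<times> real. (snd p, fst p))" "conti (%th :: real. (r, th))" "conti (%r :: real. (r, th))"
  by (intro continuous_intros)+
 show "conti (%p. g (snd p) (fst p))" "conti (%th. g r th)" "conti (%r. g r th)"
  using continuous_on_compose2[OF c 1(1)] continuous_on_compose2[OF c 1(2)] continuous_on_compose2[OF c 1(3)] by simp_all
qed

lemma secant_average:
 fixes f f' :: "real => real"
 assumes f: "!!x. (f has_real_derivative f' x) (at x)" and f': "conti f'"
 shows "f x - f y = (LBINT th:{0..1}. f' (th * x + (1 - th) * y)) * (x - y)"
proof -
 have d: "((%th. f (th * x + (1 - th) * y)) has_vector_derivative f' (th * x + (1 - th) * y) * (x - y)) (at th within {0..1})" for th
 proof -
  have "((%th. th * x + (1 - th) * y) has_real_derivative (x - y)) (at th)"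
   by (auto intro!: derivative_eq_intros)
  from DERIV_chain2[OF f this] show ?thesis
   unfolding has_real_derivative_iff_has_vector_derivative[symmetric] by (rule has_field_derivative_at_within)
 qed
 have c: "conti (%th. f' (th * x + (1 - th) * y))"
  by (rule continuous_on_compose2[OF f']) (auto intro!: continuous_intros)
 have h: "((%th. f' (th * x + (1 - th) * y) * (x - y)) has_integral (f x - f y)) {0..1}"
  using fundamental_theorem_of_calculus[OF _ d] by simp
 have "(LBINT th:{0..1}. f' (th * x + (1 - th) * y) * (x - y)) = f x - f y"
  unfolding LINT_Icc_eq_integral[OF continuous_on_mult_right[OF c]] by (rule integral_unique[OF h])
 then show ?thesis by simp
qed

lemma continuous_on_LINT_param:
 fixes g :: "real => real => real"
 assumes c: "jcont g"
 shows "conti (%r. LBINT th:{a..b}. g r th)"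
proof -
 have "conti (%th. g r th)" for r
  by (rule continuous_on_sections[OF c])
 then have eq: "(LBINT th:{a..b}. g r th) = integral (cbox a b) (g r)" for r
  using LINT_Icc_eq_integral[of "g r" a b] by simp
 show ?thesis unfolding eq
  by (rule integral_continuous_on_param, rule continuous_on_subset[OF _ subset_UNIV])
    (use c in \<open>simp add: case_prod_beta\<close>)
qed

lemma LINT_swap_continuous:
 fixes g :: "real => real => real"
 assumes c: "jcont g"
 shows "(LBINT r:{s..t}. LBINT th:{a..b}. g r th) = (LBINT th:{a..b}. LBINT r:{s..t}. g r th)"
proof -
 have sw: "conti (%p. g (snd p) (fst p))"
  by (rule continuous_on_sections[OF c])
 have "conti (%th. g r th)" for r
  by (rule continuous_on_sections[OF c])
 then have eq1: "(LBINT th:{a..b}. g r th) = integral (cbox a b) (g r)" for r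
  using LINT_Icc_eq_integral[of "g r" a b] by simp
 have "conti (%r. g r th)" for th
  by (rule continuous_on_sections[OF c])
 then have eq2: "(LBINT r:{s..t}. g r th) = integral (cbox s t) (%r. g r th)" for th
  using LINT_Icc_eq_integral[of "%r. g r th" s t] by simp
 have 1: "(LBINT r:{s..t}. LBINT th:{a..b}. g r th) = integral (cbox s t) (%r. LBINT th:{a..b}. g r th)"
  using LINT_Icc_eq_integral[OF continuous_on_LINT_param[OF c]] by simp
 have 2: "(LBINT th:{a..b}. LBINT r:{s..t}. g r th) = integral (cbox a b) (%th. LBINT r:{s..t}. g r th)"
  using LINT_Icc_eq_integral[OF continuous_on_LINT_param[of "%th r. g r th", OF sw]] by simp
 show ?thesis unfolding 1 2 unfolding eq1 eq2
  by (rule integral_swap_continuous, rule continuous_on_subset[OF _ subset_UNIV])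
    (use c in \<open>simp add: case_prod_beta\<close>)
qed

context brownian_space
begin

text \<open>Convexity of the exponential moves the average over \<open>\<theta>\<close> outside, and each single \<open>\<theta>\<close> is covered by the hypothesis.\<close>

lemma averaged_exponential_bound:
 fixes g :: "real => real => 'a => real"
 assumes m: "(%p. g (fst p) (fst (snd p)) (snd (snd p))) \<in> meas (borel \<Otimes>\<^sub>M (borel \<Otimes>\<^sub>M M))"
  and c: "!!w. conti (%p. g (fst p) (snd p) w)"
  and e: "!!th. 0 <= th ==> th <= 1 ==> mean_le (%w. exp (4 * (LBINT r:{s..t}. g r th w))) A"
 shows "integrable M (%w. exp (4 * (LBINT r:{s..t}. LBINT th:{0..1}. g r th w)))"
  "(EE w. exp (4 * (LBINT r:{s..t}. LBINT th:{0..1}. g r th w))) <= A"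
proof -
 have gm[measurable (raw)]: "(%p. g (h1 p) (h2 p) (h3 p)) \<in> meas N"
  if "h1 \<in> meas N" "h2 \<in> meas N" "h3 \<in> measurable N M" for N :: "'c measure" and h1 h2 h3
  using measurable_compose[OF measurable_Pair[OF that(1) measurable_Pair[OF that(2,3)]] m] by simp
 define f where "f th w = exp (4 * (LBINT r:{s..t}. g r th w))" for th w
 have fm: "jmeas M f"
  unfolding f_def set_lebesgue_integral_def by measurable
 note F = process_Fubini[where f = f and a = 0 and b = 1 and c = A, OF fm]
 have fi: "integrable M (f th)" "(EE w. abs (f th w)) <= A" "(EE w. f th w) <= A" if "0 <= th" "th <= 1" for th
  using e[OF that] by (auto simp: f_def[abs_def])
 have i: "integrable M (%w. LBINT th:{0..1}. f th w)" by (rule F(1)) (use fi in auto)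
 have le: "exp (4 * (LBINT r:{s..t}. LBINT th:{0..1}. g r th w)) <= (LBINT th:{0..1}. f th w)" for w
 proof -
  have "conti (%p. g (snd p) (fst p) w)"
   by (rule continuous_on_sections[OF c])
  then have cc: "conti (%th. 4 * (LBINT r:{s..t}. g r th w))"
   by (intro continuous_intros continuous_on_LINT_param[of "%th r. g r th w"])
  show ?thesis
   using exp_average_le[OF cc, of 1] LINT_swap_continuous[OF c, of s t 0 1 w] by (simp add: f_def)
 qed
 have m: "(%w. exp (4 * (LBINT r:{s..t}. LBINT th:{0..1}. g r th w))) \<in> meas M"
  unfolding set_lebesgue_integral_def by measurable
 have "abs (exp (4 * (LBINT r:{s..t}. LBINT th:{0..1}. g r th w))) <= (LBINT th:{0..1}. f th w)" for w using le by simp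
 note I = integrable_le[OF i m this]
 show "integrable M (%w. exp (4 * (LBINT r:{s..t}. LBINT th:{0..1}. g r th w)))" by (rule I(1))
 note I(3)
 also have "(EE w. (LBINT th:{0..1}. f th w)) = (LBINT th:{0..1}. (EE w. f th w))" by (rule F(2)) (use fi in auto)
 also have "... <= (LBINT th:{0..1::real}. A)"
 proof (rule set_integral_mono)
  show "lint {0..1} (%th. \<integral>w. f th w \<partial>M)" by (rule F(4)) (use fi in auto)
  show "lint {0..1::real} (%th. A)" by (intro set_integrable_continuous continuous_intros)
 qed (use fi in auto)
 also have "... = A" using set_integral_const_Icc[of 0 1 A] by simp
 finally show "(EE w. exp (4 * (LBINT r:{s..t}. LBINT th:{0..1}. g r th w))) <= A" .
qed

end

section \<open>The bounded drift frozen at the law\<close>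

lemma set_integrable_bounded_Icc:
 fixes f :: "real => real"
 assumes m: "f \<in> meas borel" and b: "!!x. x \<in> {a..b} ==> abs (f x) <= c"
 shows "lint {a..b} f"
proof -
 have i: "lint {a..b} (%x. c)" by (rule set_integrable_continuous[OF continuous_on_const])
 have "(%x. indicator {a..b} x *\<^sub>R f x) \<in> meas lborel" using m by measurable
 then show ?thesis unfolding set_integrable_def
  by (rule integrable_le(1)[OF i[unfolded set_integrable_def]]) (use b in \<open>simp add: indicator_def\<close>)
qed

text \<open>One function close to \<open>g\<close> for both measures: approximate for their sum.\<close>

lemma smooth_approximation_two_measures:
 fixes m1 m2 :: "(real \<times> real) measure" and g :: "real \<times> real => real"
 assumes fin: "finite_measure m1" "finite_measure m2" and sm: "sets m1 = sets borel" "sets m2 = sets borel"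
  and g: "g \<in> meas borel" and gb: "!!p. abs (g p) <= Q" and e: "0 < e"
 obtains F F' L lf where "!!s. C11 Q L lf (F s) (F' s)"
  "jcont F" "jcont F'"
  "(\<integral>p. abs (F (fst p) (snd p) - g p) \<partial>m1) < e" "(\<integral>p. abs (F (fst p) (snd p) - g p) \<partial>m2) < e"
proof -
 define m where "m = measure_of (UNIV :: (real \<times> real) set) (sets borel) (%A. emeasure m1 A + emeasure m2 A)"
 have sa: "sigma_algebra (UNIV :: (real \<times> real) set) (sets borel)" by (metis sets.sigma_algebra_axioms space_borel)
 have mset: "sets m = sets borel" unfolding m_def using sigma_algebra.sets_measure_of_eq[OF sa] by simp
 have em: "emeasure m A = emeasure m1 A + emeasure m2 A" if "A \<in> sets borel" for A
  unfolding m_def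
 proof (rule emeasure_measure_of_sigma[where \<mu> = "%A. emeasure m1 A + emeasure m2 A", OF sa])
  show "positive (sets borel) (%A. emeasure m1 A + emeasure m2 A)" by (simp add: positive_def)
  show "countably_additive (sets borel) (%A. emeasure m1 A + emeasure m2 A)"
   unfolding countably_additive_def
  proof (intro allI impI)
   fix A :: "nat => (real \<times> real) set" assume A: "range A \<subseteq> sets borel" "disjoint_family A"
   have "(\<Sum>i. emeasure m1 (A i) + emeasure m2 (A i)) = (\<Sum>i. emeasure m1 (A i)) + (\<Sum>i. emeasure m2 (A i))"
    by (rule suminf_add[symmetric]) auto
   also have "... = emeasure m1 (\<Union> (range A)) + emeasure m2 (\<Union> (range A))"
    using suminf_emeasure[of A m1] suminf_emeasure[of A m2] A sm by simp
   finally show "(\<Sum>i. emeasure m1 (A i) + emeasure m2 (A i)) = emeasure m1 (\<Union> (range A)) + emeasure m2 (\<Union> (range A))" .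
  qed
  show "A \<in> sets borel" by fact
 qed
 have sp: "space m = UNIV" "space m1 = UNIV" "space m2 = UNIV"
  using sets_eq_imp_space_eq[OF mset] sets_eq_imp_space_eq[OF sm(1)] sets_eq_imp_space_eq[OF sm(2)] by auto
 have fm: "finite_measure m"
 proof (rule finite_measureI)
  have "emeasure m1 UNIV ~= \<infinity>" "emeasure m2 UNIV ~= \<infinity>"
   using finite_measure.finite_emeasure_space[OF fin(1)] finite_measure.finite_emeasure_space[OF fin(2)] sp by auto
  then show "emeasure m (space m) ~= \<infinity>" using em[of UNIV] sp by (simp add: ennreal_add_eq_top)
 qed
 obtain F F' L lf where F: "!!s. C11 Q L lf (F s) (F' s)"
  "jcont F" "jcont F'"
  "(\<integral>p. abs (F (fst p) (snd p) - g p) \<partial>m) < e"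
 proof (rule smooth_approximation[OF fm mset g gb e], goal_cases)
  case (1 F F' L lf)
  show thesis by (rule 1(1)[OF 1(2-5)])
 qed
 have Fm: "(%p. abs (F (fst p) (snd p) - g p)) \<in> meas borel"
  using borel_measurable_continuous_onI[OF F(2)] g by measurable
 have hb: "abs (abs (F (fst p) (snd p) - g p)) <= 2 * Q" for p using C11_D(2)[OF F(1), of "fst p" "snd p"] gb[of p] by linarith
 have le: "(\<integral>p. abs (F (fst p) (snd p) - g p) \<partial>n) < e" if n: "finite_measure n" "sets n = sets borel" "n <= m" for n
 proof -
  have i: "integrable n (%p. abs (F (fst p) (snd p) - g p))"
   by (rule finite_measure.integrable_const_bound[OF n(1), of _ "2 * Q"]) (use Fm hb n(2) in \<open>auto simp: measurable_cong_sets[OF n(2) refl]\<close>)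
  have im: "integrable m (%p. abs (F (fst p) (snd p) - g p))"
   by (rule finite_measure.integrable_const_bound[OF fm, of _ "2 * Q"]) (use Fm hb mset in \<open>auto simp: measurable_cong_sets[OF mset refl]\<close>)
  have "ennreal (\<integral>p. abs (F (fst p) (snd p) - g p) \<partial>n) = (\<integral>\<^sup>+p. ennreal (abs (F (fst p) (snd p) - g p)) \<partial>n)"
   by (rule nn_integral_eq_integral[OF i, symmetric]) simp
  also have "... <= (\<integral>\<^sup>+p. ennreal (abs (F (fst p) (snd p) - g p)) \<partial>m)"
   by (rule nn_integral_mono_measure) (use n mset in auto)
  also have "... = ennreal (\<integral>p. abs (F (fst p) (snd p) - g p) \<partial>m)" by (rule nn_integral_eq_integral[OF im]) simp
  finally have "(\<integral>p. abs (F (fst p) (snd p) - g p) \<partial>n) <= (\<integral>p. abs (F (fst p) (snd p) - g p) \<partial>m)"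
   by (subst (asm) ennreal_le_iff) (auto intro: integral_nonneg)
  then show ?thesis using F(4) by simp
 qed
 have "m1 <= m" "m2 <= m" using sm mset em by (auto simp: le_measure)
 then show ?thesis using that[OF F(1-3)] le[OF fin(1) sm(1)] le[OF fin(2) sm(2)] by blast
qed

context mckean_drift
begin

text \<open>The times are clipped to \<open>[0, T]\<close> so that the function is bounded and measurable on the whole plane.\<close>

definition frozen :: "(real => 'a => real) => real => real => real" where
 "frozen Z s z = bh (max 0 (min T s)) z (law (Z (max 0 (min T s))))"

lemma frozen_bound:
 assumes Z: "solves x Z" shows "abs (frozen Z s z) <= K"
 unfolding frozen_def by (rule bh_bound) (use T solves_law[OF Z] in auto)

text \<open>The law of the solution is Hoelder continuous in time for the Kantorovich distance, so inserting it into the jointly measurable drift keeps measurability.\<close>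

lemma frozen_measurable:
 assumes Z: "solves x Z"
 shows "(%p. frozen Z (fst p) (snd p)) \<in> meas borel"
proof -
 interpret KM: Metric_space P1 kantorovich by (rule Metric_space_P1)
 define q where "q s = max 0 (min T s)" for s
 have q: "q s \<in> {0..T}" for s using T by (auto simp: q_def)
 have qm: "q \<in> meas borel" unfolding q_def by measurable
 have qd: "abs (q s - q s') <= abs (s - s')" for s s' by (auto simp: q_def max_def min_def)
 define \<mu> where "\<mu> s = law (Z (q s))" for s
 have \<mu>: "\<mu> s \<in> P1" for s unfolding \<mu>_def by (rule solves_law[OF Z q])
 obtain k where k: "1 <= k" "controlled k Z"
 proof (rule solves_controlled[of "abs x"], goal_cases)
  case (1 k)
  show thesis by (rule 1(1)[OF 1(2) 1(3)[OF Z order.refl]])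
 qed
 obtain c where c: "0 <= c" "!!s t. 0 <= s ==> s <= t ==> t <= T ==> (\<integral>w. abs (Z t w - Z s w) \<partial>M) <= c * sqrt (t - s)"
 proof (rule controlled_increment[OF k(2,1)], goal_cases)
  case (1 c)
  show thesis by (rule 1(1)[OF 1(2,3)])
 qed
 have d1: "(\<integral>w. abs (Z s w - Z s' w) \<partial>M) <= c * sqrt (abs (s - s'))" if "s \<in> {0..T}" "s' \<in> {0..T}" for s s'
 proof (cases "s <= s'")
  case True
  then show ?thesis using c(2)[of s s'] that by (simp add: abs_minus_commute)
 next
  case False
  then show ?thesis using c(2)[of s' s] that by simp
 qed
 have d2: "kantorovich (\<mu> s) (\<mu> s') <= c * sqrt (abs (s - s'))" for s s'
 proof -
  have "kantorovich (\<mu> s) (\<mu> s') <= (\<integral>w. abs (Z (q s) w - Z (q s') w) \<partial>M)" unfolding \<mu>_def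
   by (rule kantorovich_le_expectation(2)[OF prob_space_axioms]) (use solves_meas[OF Z] solves_integrable[OF Z q] in auto)
  also have "... <= c * sqrt (abs (q s - q s'))" by (rule d1[OF q q])
  also have "... <= c * sqrt (abs (s - s'))" by (intro mult_left_mono c real_sqrt_le_mono qd)
  finally show ?thesis .
 qed
 have \<mu>m: "\<mu> \<in> measurable borel P1_borel"
  unfolding P1_borel_def
 proof (rule measurable_measure_of)
  show "{S. openin KM.mtopology S} \<subseteq> Pow P1" by (auto simp: KM.openin_mtopology)
  show "\<mu> \<in> space borel \<rightarrow> P1" using \<mu> by auto
  fix S assume "S \<in> {S. openin KM.mtopology S}"
  then have S: "openin KM.mtopology S" by simp
  have "open (\<mu> -` S)"
  proof (unfold open_dist, intro ballI)
   fix s assume "s \<in> \<mu> -` S"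
   then obtain r where r: "0 < r" "KM.mball (\<mu> s) r \<subseteq> S" using S by (auto simp: KM.openin_mtopology)
   define d where "d = (r / (c + 1))^2"
   have d: "0 < d" using r c by (simp add: d_def)
   have "\<mu> s' \<in> S" if "dist s' s < d" for s'
   proof -
    have "sqrt (abs (s - s')) < sqrt d" using that by (simp add: dist_real_def abs_minus_commute)
    also have "sqrt d = r / (c + 1)" using r c by (simp add: d_def)
    finally have "(c + 1) * sqrt (abs (s - s')) < r" using c by (simp add: pos_less_divide_eq mult.commute)
    then have "c * sqrt (abs (s - s')) < r"
     unfolding distrib_right using abs_ge_zero[of "s - s'", THEN real_sqrt_ge_zero] by linarith
    then have "kantorovich (\<mu> s) (\<mu> s') < r" using d2[of s s'] by simp
    then have "\<mu> s' \<in> KM.mball (\<mu> s) r" using \<mu> by (simp add: KM.in_mball)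
    then show ?thesis using r by blast
   qed
   then show "\<exists>e>0. \<forall>y. dist y s < e --> y \<in> \<mu> -` S" using d by (intro exI[of _ d]) auto
  qed
  then show "\<mu> -` S \<inter> space borel \<in> sets borel" by simp
 qed
 have qr: "q \<in> measurable borel (restrict_space borel {0..T})"
  by (rule measurable_restrict_space2) (use q qm in auto)
 have "(%p. (q (fst p), (snd p, \<mu> (fst p)))) \<in> measurable (borel \<Otimes>\<^sub>M borel) (restrict_space borel {0..T} \<Otimes>\<^sub>M (borel \<Otimes>\<^sub>M P1_borel))"
  using qr \<mu>m by measurable
 from measurable_compose[OF this bh_meas[unfolded drift_measurable_def]]
 show ?thesis by (simp add: frozen_def[abs_def] q_def[abs_def] \<mu>_def[abs_def] borel_prod)
qed

end

section \<open>Stability in the initial value\<close>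

context mckean_drift
begin

lemma difference_second_moment:
 assumes Z1: "solves x Z1" and Z2: "solves y Z2" and k: "1 <= k" "controlled k Z1" "controlled k Z2" and s: "s \<in> {0..T}"
 shows "integrable M (%w. (Z1 s w - Z2 s w)^2)" "(EE w. (Z1 s w - Z2 s w)^2) <= 12 * k^2 * (1 + T + T ^ 3)"
proof -
 have [measurable]: "Z1 s \<in> meas M" "Z2 s \<in> meas M" using solves_meas[OF Z1] solves_meas[OF Z2] by auto
 note m1 = controlled_second_moment[OF k(2,1) s] and m2 = controlled_second_moment[OF k(3,1) s]
 have i: "integrable M (%w. 2 * (Z1 s w)^2 + 2 * (Z2 s w)^2)" using m1(1) m2(1) by simp
 have sq: "abs ((Z1 s w - Z2 s w)^2) <= 2 * (Z1 s w)^2 + 2 * (Z2 s w)^2" for w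
  unfolding abs_power2 using zero_le_power2[of "Z1 s w + Z2 s w"] by (simp add: power2_eq_square algebra_simps)
 show "integrable M (%w. (Z1 s w - Z2 s w)^2)" by (rule integrable_le(1)[OF i _ sq]) measurable
 have "(EE w. (Z1 s w - Z2 s w)^2) <= (EE w. 2 * (Z1 s w)^2 + 2 * (Z2 s w)^2)" by (rule integrable_le(3)[OF i _ sq]) measurable
 also have "... = 2 * (EE w. (Z1 s w)^2) + 2 * (EE w. (Z2 s w)^2)" using m1(1) m2(1) by simp
 finally show "(EE w. (Z1 s w - Z2 s w)^2) <= 12 * k^2 * (1 + T + T ^ 3)" using m1(2) m2(2) by linarith
qed

text \<open>Along a path the difference of the drifts is \<open>\<kappa> z\<close> plus three errors: the smoothing errors \<open>\<nu>\<close> at both solutions, the Lipschitz part \<open>C \<bar>z\<bar>\<close>, and \<open>C\<close> times the Kantorovich distance of the laws, which is at most the mean \<open>m1\<close> of \<open>\<bar>z\<bar>\<close>. The solution formula is squared and integrated. The factor \<open>\<Psi>\<close>, the exponential of the integrated \<open>\<kappa>\<close>, is separated from \<open>\<nu>\<close> by \<open>v d \<le> \<eta> v\<^sup>2 + d\<^sup>2 / \<eta>\<close> with \<open>v = \<Psi>\<^sup>2\<close>, which is where its fourth moment enters, and \<open>\<nu>\<close> is small in mean by the choice of the approximation.\<close>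

lemma approximate_stability:
 assumes Z1: "solves x Z1" and Z2: "solves y Z2" and k: "1 <= k" and c1: "controlled k Z1" and c2: "controlled k Z2"
  and A0: "0 <= A"
  and A: "!!th s t f f' L lf. 0 <= th ==> th <= 1 ==> 0 <= s ==> s <= t ==> t <= T ==>
   (!!r. C11 K L lf (f r) (f' r)) ==>
   (!!w. conti (%r. f' r (th * Z1 r w + (1 - th) * Z2 r w))) ==>
   mean_le (%w. exp (4 * (LBINT r:{s..t}. f' r (th * Z1 r w + (1 - th) * Z2 r w)))) A"
  and t: "0 <= t" "t <= T" and et: "0 < et"
 shows "(EE w. (Z1 t w - Z2 t w)^2) <= 3 * (2 * exp (2 * C * T))^2 *
  ((1 + A) * (x - y)^2 + T * (et * (T * A + 1)) + T * (C^2 * (1 + A) * (LBINT s:{0..t}. (EE w. (Z1 s w - Z2 s w)^2))))"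
proof -
 have Zm[measurable]: "Z1 s \<in> meas M" "Z2 s \<in> meas M" for s using solves_meas[OF Z1] solves_meas[OF Z2] by auto
 have Zc: "conti (%s. Z1 s w)" "conti (%s. Z2 s w)" for w using solves_cont[OF Z1] solves_cont[OF Z2] by auto
 note [measurable (raw)] = joint_measurable_compose[OF solves_joint[OF Z1]] joint_measurable_compose[OF solves_joint[OF Z2]]
 define g where "g p = frozen Z1 (fst p) (snd p)" for p
 have gm: "g \<in> meas borel" unfolding g_def[abs_def] by (rule frozen_measurable[OF Z1])
 have gb: "abs (g p) <= K" for p unfolding g_def by (rule frozen_bound[OF Z1])
 \<comment> \<open>the occupation measures of the two solutions\<close>
 define La where "La = density lborel (indicator {0..T} :: real => ennreal)"
 have Las[measurable_cong]: "sets La = sets borel" by (simp add: La_def)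
 have fL: "finite_measure La"
  by (rule finite_measureI) (use T in \<open>simp add: La_def emeasure_density nn_integral_indicator\<close>)
 interpret L: finite_measure La by (rule fL)
 interpret P: pair_sigma_finite La M by unfold_locales
 have fP: "finite_measure (La \<Otimes>\<^sub>M M)" by (rule finite_measure_pair_measure) unfold_locales
 define m where "m Z = distr (La \<Otimes>\<^sub>M M) borel (%p. (fst p, Z (fst p) (snd p)))" for Z :: "real => 'a => real"
 have mm: "(%p. (fst p, Z1 (fst p) (snd p))) \<in> measurable (La \<Otimes>\<^sub>M M) borel"
  "(%p. (fst p, Z2 (fst p) (snd p))) \<in> measurable (La \<Otimes>\<^sub>M M) borel"
  unfolding borel_prod[symmetric] by measurable
 have mf: "finite_measure (m Z1)" "finite_measure (m Z2)"
  unfolding m_def using mm by (auto intro!: finite_measure.finite_measure_distr fP)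
 \<comment> \<open>so small that the mean smoothing error stays below \<open>et\<close> after multiplication with \<open>64 K^3 / et\<close>\<close>
 define ep where "ep = et^2 / (128 * K ^ 3 + 1)"
 have K3: "0 < 128 * K ^ 3 + 1" using K by (simp add: add_nonneg_pos)
 have ep: "0 < ep" using et K3 by (simp add: ep_def)
 obtain F F' L lf where F: "!!s. C11 K L lf (F s) (F' s)"
  "jcont F" "jcont F'"
  "(\<integral>p. abs (F (fst p) (snd p) - g p) \<partial>m Z1) < ep" "(\<integral>p. abs (F (fst p) (snd p) - g p) \<partial>m Z2) < ep"
 proof (rule smooth_approximation_two_measures[OF mf _ _ gm gb ep], goal_cases)
  case (3 F F' L lf)
  show thesis by (rule 3(1)[OF 3(2-6)])
 qed (simp_all add: m_def)
 define h where "h p = abs (F (fst p) (snd p) - g p)" for p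
 have Fm: "(%p. F (fst p) (snd p)) \<in> meas borel" using F(2) by (rule borel_measurable_continuous_onI)
 have F'm: "(%p. F' (fst p) (snd p)) \<in> meas borel" using F(3) by (rule borel_measurable_continuous_onI)
 have hm: "h \<in> meas borel" unfolding h_def[abs_def] using Fm gm by measurable
 have hm'[measurable (raw)]: "(%p. h (h1 p, h2 p)) \<in> meas N"
  if "h1 \<in> meas N" "h2 \<in> meas N" for N :: "'c measure" and h1 h2
  by (rule joint_measurable_compose[OF _ that]) (use hm in \<open>simp add: borel_prod\<close>)
 have h0: "0 <= h p" and hb: "h p <= 2 * K" for p
  unfolding h_def using C11_D(2)[OF F(1), of "fst p" "snd p"] gb[of p] by linarith+
 have occ: "(LBINT s:{0..T}. \<integral>w. h (s, Z s w) \<partial>M) < ep"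
  if mZ: "(%p. (fst p, Z (fst p) (snd p))) \<in> measurable (La \<Otimes>\<^sub>M M) borel" and le: "(\<integral>p. h p \<partial>m Z) < ep" for Z
 proof -
  have "(%p. h (fst p, Z (fst p) (snd p))) \<in> meas (La \<Otimes>\<^sub>M M)"
   using measurable_compose[OF mZ hm] by simp
  then have i: "integrable (La \<Otimes>\<^sub>M M) (%p. h (fst p, Z (fst p) (snd p)))"
   by (intro finite_measure.integrable_const_bound[OF fP, of _ "2 * K"]) (use h0 hb in auto)
  have "(\<integral>p. h p \<partial>m Z) = (\<integral>p. h (fst p, Z (fst p) (snd p)) \<partial>(La \<Otimes>\<^sub>M M))"
   unfolding m_def by (rule integral_distr[OF mZ hm])
  also have "... = (\<integral>s. (EE w. h (s, Z s w)) \<partial>La)"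
   using P.integral_fst'[OF i] by simp
  also have "... = (LBINT s:{0..T}. \<integral>w. h (s, Z s w) \<partial>M)"
  proof -
   have "(%s. \<integral>w. h (s, Z s w) \<partial>M) \<in> meas La"
    using borel_measurable_integrable[OF P.integrable_fst'[OF i]] by simp
   then have "(%s. \<integral>w. h (s, Z s w) \<partial>M) \<in> meas lborel" by (simp add: La_def)
   then have "(\<integral>s. (EE w. h (s, Z s w)) \<partial>density lborel (%s. ennreal (indicator {0..T} s))) = (LBINT s. indicator {0..T} s *\<^sub>R (EE w. h (s, Z s w)))"
    by (rule integral_density) auto
   then show ?thesis by (simp add: La_def set_lebesgue_integral_def ennreal_indicator)
  qed
  finally show ?thesis using le by simp
 qed
 note occ1 = occ[OF mm(1) F(4)[folded h_def]] and occ2 = occ[OF mm(2) F(5)[folded h_def]]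
 define G where "G r th w = F' r (th * Z1 r w + (1 - th) * Z2 r w)" for r th w
 define ka where "ka r w = (LBINT th:{0..1}. G r th w)" for r w
 define Ps where "Ps s w = exp (LBINT r:{s..t}. ka r w)" for s w
 have Gc: "conti (%p. G (fst p) (snd p) w)" for w
 proof -
  have "conti (%p :: real \<times> real. Z1 (fst p) w)" "conti (%p :: real \<times> real. Z2 (fst p) w)"
   by (rule continuous_on_compose2[OF Zc(1)], auto intro!: continuous_intros)
     (rule continuous_on_compose2[OF Zc(2)], auto intro!: continuous_intros)
  then have "conti (%p. (fst p, snd p * Z1 (fst p) w + (1 - snd p) * Z2 (fst p) w))"
   by (intro continuous_intros)
  from continuous_on_compose2[OF F(3) this] show ?thesis by (simp add: G_def)
 qed
 note [measurable (raw)] = joint_measurable_compose[where f = F', OF F'm[folded borel_prod]]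
 have Gm: "(%p. G (fst p) (fst (snd p)) (snd (snd p))) \<in> meas (borel \<Otimes>\<^sub>M (borel \<Otimes>\<^sub>M M))"
  unfolding G_def by measurable
 have kac: "conti (%r. ka r w)" for w unfolding ka_def by (rule continuous_on_LINT_param[OF Gc])
 have Ps4: "integrable M (%w. (Ps s w) ^ 4)" "(EE w. (Ps s w) ^ 4) <= A" if s: "0 <= s" "s <= t" for s
 proof -
  have e: "mean_le (%w. exp (4 * (LBINT r:{s..t}. G r th w))) A" if "0 <= th" "th <= 1" for th
   unfolding G_def by (rule A[OF that s t(2) F(1)]) (use continuous_on_sections(3)[OF Gc] in \<open>simp add: G_def\<close>)
  have eq: "exp (4 * x) = exp x ^ 4" for x :: real using exp_of_nat_mult[of 4 x] by simp
  show "integrable M (%w. (Ps s w) ^ 4)" "(EE w. (Ps s w) ^ 4) <= A"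
   using averaged_exponential_bound[OF Gm Gc e] unfolding eq by (simp_all add: Ps_def ka_def)
 qed
 have Psm[measurable (raw)]: "(%p. Ps (h1 p) (h2 p)) \<in> meas N"
  if h[measurable]: "h1 \<in> meas N" "h2 \<in> measurable N M" for N :: "'c measure" and h1 h2
 proof -
  have ind: "indicator {s..t} r *\<^sub>R v = (if s <= r & r <= t then v else 0)" for s r v :: real by (simp add: indicator_def)
  show ?thesis unfolding Ps_def ka_def G_def set_lebesgue_integral_def ind by measurable
 qed
 have Ps0: "0 < Ps s w" for s w by (simp add: Ps_def)
 have Pssq: "(Ps s w)^2 <= 1 + (Ps s w) ^ 4" for s w
 proof -
  have "0 <= ((Ps s w)^2 - 1)^2 + (Ps s w)^2" by simp
  then show ?thesis by (simp add: power2_eq_square eval_nat_numeral algebra_simps)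
 qed
 have Ps2: "integrable M (%w. (Ps s w)^2)" "(EE w. (Ps s w)^2) <= 1 + A" if s: "0 <= s" "s <= t" for s
 proof -
  have i: "integrable M (%w. 1 + (Ps s w) ^ 4)" and m: "(%w. (Ps s w)^2) \<in> meas M" using Ps4[OF s] by auto
  have sq: "abs ((Ps s w)^2) <= 1 + (Ps s w) ^ 4" for w using Pssq by simp
  show "integrable M (%w. (Ps s w)^2)" by (rule integrable_le(1)[OF i m sq])
  show "(EE w. (Ps s w)^2) <= 1 + A" using integrable_le(3)[OF i m sq] Ps4[OF s] by (simp add: prob_space)
 qed
 \<comment> \<open>moments of the difference of the two solutions\<close>
 define z where "z s w = Z1 s w - Z2 s w" for s w
 have zm[measurable]: "z s \<in> meas M" for s unfolding z_def[abs_def] by measurable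
 define m1 where "m1 s = (EE w. abs (z s w))" for s
 define u where "u s = (EE w. (z s w)^2)" for s
 define S where "S = 12 * k^2 * (1 + T + T ^ 3)"
 have zi: "integrable M (%w. (z s w)^2)" "u s <= S" if s: "s \<in> {0..T}" for s
  unfolding z_def u_def S_def by (rule difference_second_moment[OF Z1 Z2 k c1 c2 s])+
 have z1i: "integrable M (%w. abs (z s w))" if "s \<in> {0..T}" for s
  unfolding z_def using solves_integrable[OF Z1 that] solves_integrable[OF Z2 that] by auto
 have m10: "0 <= m1 s" for s unfolding m1_def by (rule integral_nonneg) simp
 have m1u: "(m1 s)^2 <= u s" if s: "s \<in> {0..T}" for s
  using mean_abs_square_le[OF _ zi(1)[OF s]] z1i[OF s] by (simp add: m1_def u_def integrable_abs_iff)
 have m1b: "m1 s <= 1 + S" if s: "s \<in> {0..T}" for s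
 proof -
  have "0 <= (m1 s - 1)^2 + m1 s" using m10[of s] by simp
  then have "m1 s <= 1 + (m1 s)^2" by (simp add: power2_eq_square algebra_simps)
  then show ?thesis using m1u[OF s] zi(2)[OF s] by linarith
 qed
 have m1m[measurable]: "m1 \<in> meas borel" unfolding m1_def[abs_def] z_def by measurable
 have um[measurable]: "u \<in> meas borel" unfolding u_def[abs_def] z_def by measurable
 have u0: "0 <= u s" for s unfolding u_def by (rule integral_nonneg) simp
 have tT: "s \<in> {0..T}" if "s \<in> {0..t}" for s using that t by auto
 have ui: "lint {0..t} u"
  by (rule set_integrable_bounded_Icc[OF um, of _ _ S]) (use u0 zi(2)[OF tT] in auto)
 define \<nu> where "\<nu> s w = h (s, Z1 s w) + h (s, Z2 s w)" for s w
 have \<nu>0: "0 <= \<nu> s w" and \<nu>b: "\<nu> s w <= 4 * K" for s w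
  unfolding \<nu>_def using h0[of "(s, Z1 s w)"] h0[of "(s, Z2 s w)"] hb[of "(s, Z1 s w)"] hb[of "(s, Z2 s w)"] by linarith+
 have \<nu>m[measurable (raw)]: "(%p. \<nu> (h1 p) (h2 p)) \<in> meas N"
  if h[measurable]: "h1 \<in> meas N" "h2 \<in> measurable N M" for N :: "'c measure" and h1 h2
  unfolding \<nu>_def by measurable
 define D0 where "D0 = 2 * exp (2 * C * T)"
 define f1 where "f1 s w = (Ps s w * \<nu> s w)^2" for s w
 define f2 where "f2 s w = (Ps s w * m1 s)^2" for s w
 \<comment> \<open>the pathwise Gronwall bound, squared\<close>
 have path: "AE w in M. (z t w)^2 <= D0^2 * (3 * ((Ps 0 w)^2 * (x - y)^2 + T * (LBINT s:{0..t}. f1 s w) + T * (C^2 * (LBINT s:{0..t}. f2 s w))))"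
  using solves_eq[OF Z1] solves_eq[OF Z2] AE_space
 proof eventually_elim
  case (elim w)
  note w[measurable] = elim(3)
  define a where "a s = b s (Z1 s w) (law (Z1 s)) - b s (Z2 s w) (law (Z2 s))" for s
  have i12: "lint {0..s} (%s. b s (Z1 s w) (law (Z1 s)))" "lint {0..s} (%s. b s (Z2 s w) (law (Z2 s)))"
   if "s <= T" for s
   using elim that by (auto intro: set_integrable_subset)
  have ai: "lint {0..t} a" unfolding a_def[abs_def] by (rule set_integral_diff(1)[OF i12[OF t(2)]])
  have zeq: "z s w = (x - y) + (LBINT r:{0..s}. a r)" if "s \<in> {0..t}" for s
  proof -
   have s: "s \<in> {0..T}" using tT[OF that] .
   have "(LBINT r:{0..s}. a r) = (LBINT r:{0..s}. b r (Z1 r w) (law (Z1 r))) - (LBINT r:{0..s}. b r (Z2 r w) (law (Z2 r)))"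
    unfolding a_def using s by (intro set_integral_diff(2) i12) auto
   then show ?thesis using elim s by (simp add: z_def)
  qed
  have zc: "conti (%s. z s w)" unfolding z_def by (intro continuous_intros Zc)
  have bnd: "abs (a s - ka s w * z s w) <= C * abs (z s w) + (\<nu> s w + C * m1 s)" if "s \<in> {0..t}" for s
  proof -
   have s: "s \<in> {0..T}" using tT[OF that] .
   note P = solves_law[OF Z1 s] solves_law[OF Z2 s]
   have kan: "kantorovich (law (Z1 s)) (law (Z2 s)) <= m1 s" unfolding m1_def z_def
    by (rule kantorovich_le_expectation(2)[OF prob_space_axioms Zm solves_integrable[OF Z1 s] solves_integrable[OF Z2 s]])
   have 1: "abs (b s (Z2 s w) (law (Z1 s)) - b s (Z2 s w) (law (Z2 s))) <= C * m1 s"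
    using order_trans[OF law_lip[OF s P, of "Z2 s w"] mult_left_mono[OF kan C]] .
   have 2: "abs (bt s (Z1 s w) (law (Z1 s)) - bt s (Z2 s w) (law (Z1 s))) <= C * abs (z s w)"
    unfolding z_def by (rule bt_lip[OF s P(1)])
   have fr: "frozen Z1 s v = bh s v (law (Z1 s))" for v using s by (simp add: frozen_def)
   have 3: "ka s w * z s w = F s (Z1 s w) - F s (Z2 s w)"
    unfolding ka_def G_def z_def
    by (rule secant_average[symmetric, OF C11_D(1)[OF F(1)] continuous_on_sections(2)[OF F(3)]])
   have 4: "abs (F s (Z1 s w) - frozen Z1 s (Z1 s w)) + abs (F s (Z2 s w) - frozen Z1 s (Z2 s w)) = \<nu> s w"
    by (simp add: \<nu>_def h_def g_def)
   show ?thesis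
    using 1 2 4 decomp[OF s P(1), of "Z1 s w"] decomp[OF s P(1), of "Z2 s w"]
    unfolding a_def 3 fr by linarith
  qed
  have Psc: "continuous_on {0..t} (%s. Ps s w)"
  proof -
   have ki: "lint {0..t} (%r. ka r w)" by (rule set_integrable_continuous[OF kac])
   have "continuous_on {0..t} (%s. exp ((LBINT r:{0..t}. ka r w) - (LBINT r:{0..s}. ka r w)))"
    by (intro continuous_intros set_integral_Icc_continuous ki)
   then show ?thesis
   proof (rule continuous_on_eq)
    fix s assume "s \<in> {0..t}"
    then have "(LBINT r:{0..t}. ka r w) = (LBINT r:{0..s}. ka r w) + (LBINT r:{s..t}. ka r w)"
     by (intro set_integral_split_point[OF ki]) auto
    then show "exp ((LBINT r:{0..t}. ka r w) - (LBINT r:{0..s}. ka r w)) = Ps s w" by (simp add: Ps_def)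
   qed
  qed
  have \<nu>w: "(%s. \<nu> s w) \<in> meas borel" by measurable
  have \<nu>i: "lint {0..t} (%s. \<nu> s w)"
   by (rule set_integrable_bounded_Icc[OF \<nu>w, of _ _ "4 * K"]) (use \<nu>0 \<nu>b in auto)
  have \<nu>2i: "lint {0..t} (%s. (\<nu> s w)^2)"
  proof (rule set_integrable_bounded_Icc)
   show "(%s. (\<nu> s w)^2) \<in> meas borel" using \<nu>w by measurable
   show "abs ((\<nu> s w)^2) <= (4 * K)^2" for s using power_mono[OF \<nu>b \<nu>0, of s w 2] by simp
  qed
  have mi: "lint {0..t} m1"
   by (rule set_integrable_bounded_Icc[OF m1m, of _ _ "1 + S"]) (use m10 m1b[OF tT] in auto)
  have m2i: "lint {0..t} (%s. (m1 s)^2)"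
  proof (rule set_integrable_bounded_Icc)
   show "(%s. (m1 s)^2) \<in> meas borel" by measurable
   show "abs ((m1 s)^2) <= S" if "s \<in> {0..t}" for s using order_trans[OF m1u[OF tT[OF that]] zi(2)[OF tT[OF that]]] by simp
  qed
  have Ps2c: "continuous_on {0..t} (%s. (Ps s w)^2)" by (intro continuous_intros Psc)
  note j1 = set_integrable_continuous_mult[OF \<nu>i Psc] and j2 = set_integrable_continuous_mult[OF mi Psc]
  have j1': "lint {0..t} (%s. (Ps s w * \<nu> s w)^2)"
   using set_integrable_continuous_mult[OF \<nu>2i Ps2c] by (simp add: power_mult_distrib)
  have j2': "lint {0..t} (%s. (Ps s w * m1 s)^2)"
   using set_integrable_continuous_mult[OF m2i Ps2c] by (simp add: power_mult_distrib)
  have rhi: "lint {0..t} (%s. \<nu> s w + C * m1 s)" using \<nu>i mi by (intro set_integral_add(1)) auto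
  have "abs (z t w) <= 2 * exp (2 * C * t) * (exp (LBINT r:{0..t}. ka r w) * abs (x - y)
   + (LBINT s:{0..t}. exp (LBINT r:{s..t}. ka r w) * (\<nu> s w + C * m1 s)))"
   by (rule linear_path_bound[OF t(1) C kac zc ai zeq rhi _ bnd]) (use \<nu>0 m10 C in auto)
  also have "(LBINT s:{0..t}. exp (LBINT r:{s..t}. ka r w) * (\<nu> s w + C * m1 s)) = (LBINT s:{0..t}. Ps s w * \<nu> s w + C * (Ps s w * m1 s))"
   by (simp add: Ps_def algebra_simps)
  also have "... = (LBINT s:{0..t}. Ps s w * \<nu> s w) + C * (LBINT s:{0..t}. Ps s w * m1 s)"
   using set_integral_add(2)[OF j1, of "%s. C * (Ps s w * m1 s)"] j2 by simp
  finally have le: "abs (z t w) <= 2 * exp (2 * C * t) * (Ps 0 w * abs (x - y) + (LBINT s:{0..t}. Ps s w * \<nu> s w) + C * (LBINT s:{0..t}. Ps s w * m1 s))"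
   by (simp add: Ps_def add.assoc)
  define q1 q2 q3 where "q1 = Ps 0 w * abs (x - y)" and "q2 = (LBINT s:{0..t}. Ps s w * \<nu> s w)" and "q3 = C * (LBINT s:{0..t}. Ps s w * m1 s)"
  have q0: "0 <= q1 + q2 + q3"
  proof -
   have "0 <= q2" unfolding q2_def
    by (rule LBINT_nonneg) (use Ps0[THEN less_imp_le] \<nu>0 in auto)
   moreover have "0 <= q3" unfolding q3_def
    by (intro mult_nonneg_nonneg C LBINT_nonneg) (use Ps0[THEN less_imp_le] m10 in auto)
   moreover have "0 <= q1" using Ps0[of 0 w] by (simp add: q1_def)
   ultimately show ?thesis by simp
  qed
  have "abs (z t w) <= D0 * (q1 + q2 + q3)"
  proof (rule order_trans[OF le[folded q1_def q2_def q3_def] mult_right_mono[OF _ q0]])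
   show "2 * exp (2 * C * t) <= D0" using t C by (simp add: D0_def mult_left_mono)
  qed
  then have "abs (z t w)^2 <= (D0 * (q1 + q2 + q3))^2" by (rule power_mono) simp
  also have "... <= D0^2 * (3 * (q1^2 + q2^2 + q3^2))"
   unfolding power_mult_distrib by (rule mult_left_mono[OF square_sum3_le]) simp
  also have "... <= D0^2 * (3 * ((Ps 0 w)^2 * (x - y)^2 + T * (LBINT s:{0..t}. f1 s w) + T * (C^2 * (LBINT s:{0..t}. f2 s w))))"
  proof (intro mult_left_mono add_mono)
   show "q1^2 <= (Ps 0 w)^2 * (x - y)^2" by (simp add: q1_def power_mult_distrib)
   have n1: "0 <= (LBINT s:{0..t}. f1 s w)" and n2: "0 <= (LBINT s:{0..t}. f2 s w)"
    unfolding f1_def f2_def by (rule LBINT_nonneg; simp)+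
   have "q2^2 <= t * (LBINT s:{0..t}. f1 s w)"
    using set_integral_Cauchy_Schwarz[OF j1 j1' t(1)] by (simp add: q2_def f1_def)
   then show "q2^2 <= T * (LBINT s:{0..t}. f1 s w)" using mult_right_mono[OF t(2) n1] by linarith
   have "(LBINT s:{0..t}. Ps s w * m1 s)^2 <= t * (LBINT s:{0..t}. f2 s w)"
    using set_integral_Cauchy_Schwarz[OF j2 j2' t(1)] by (simp add: f2_def)
   also have "... <= T * (LBINT s:{0..t}. f2 s w)" by (rule mult_right_mono[OF t(2) n2])
   finally have "C^2 * (LBINT s:{0..t}. Ps s w * m1 s)^2 <= C^2 * (T * (LBINT s:{0..t}. f2 s w))"
    by (rule mult_left_mono) simp
   then show "q3^2 <= T * (C^2 * (LBINT s:{0..t}. f2 s w))" by (simp add: q3_def power_mult_distrib mult_ac)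
  qed auto
  finally show ?case by simp
 qed
 have f1m: "jmeas M f1" unfolding f1_def by measurable
 have f2m: "jmeas M f2" unfolding f2_def by measurable
 have f1b: "f1 s w <= (4 * K)^2 * (Ps s w)^2" for s w
 proof -
  have "(\<nu> s w)^2 <= (4 * K)^2" by (rule power_mono[OF \<nu>b \<nu>0])
  from mult_right_mono[OF this, of "(Ps s w)^2"] show ?thesis by (simp add: f1_def power_mult_distrib mult_ac)
 qed
 have f10: "0 <= f1 s w" and f20: "0 <= f2 s w" for s w by (simp_all add: f1_def f2_def)
 have f1i: "integrable M (f1 s)" "(EE w. abs (f1 s w)) <= (4 * K)^2 * (1 + A)" if s: "0 <= s" "s <= t" for s
 proof -
  have i: "integrable M (%w. (4 * K)^2 * (Ps s w)^2)" using Ps2[OF s] by simp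
  have m: "f1 s \<in> meas M" unfolding f1_def[abs_def] by measurable
  have b: "abs (f1 s w) <= (4 * K)^2 * (Ps s w)^2" for w using f1b f10 by simp
  show "integrable M (f1 s)" by (rule integrable_le(1)[OF i m b])
  show "(EE w. abs (f1 s w)) <= (4 * K)^2 * (1 + A)"
   using integrable_le(2)[OF i m b] mult_left_mono[OF Ps2(2)[OF s], of "(4 * K)^2"] by simp
 qed
 have f2i: "integrable M (f2 s)" "(EE w. f2 s w) <= (1 + A) * u s" if s: "0 <= s" "s <= t" for s
 proof -
  show "integrable M (f2 s)" unfolding f2_def[abs_def] power_mult_distrib using Ps2[OF s] by simp
  have "(EE w. f2 s w) = (EE w. (Ps s w)^2) * (m1 s)^2" unfolding f2_def power_mult_distrib by simp
  also have "... <= (1 + A) * (m1 s)^2" by (rule mult_right_mono[OF Ps2(2)[OF s]]) simp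
  also have "... <= (1 + A) * u s" using m1u[of s] s t A0 by (intro mult_left_mono) auto
  finally show "(EE w. f2 s w) <= (1 + A) * u s" .
 qed
 have f2e: "(EE w. abs (f2 s w)) <= (1 + A) * S" if s: "0 <= s" "s <= t" for s
  using order_trans[OF f2i(2)[OF s] mult_left_mono[OF zi(2), of s "1 + A"]] s t A0 f20 by simp
 note FF1 = process_Fubini[where f = f1 and a = 0 and b = t and c = "(4 * K)^2 * (1 + A)", OF f1m f1i]
 note FF2 = process_Fubini[where f = f2 and a = 0 and b = t and c = "(1 + A) * S", OF f2m f2i(1) f2e]
 have i\<nu>: "integrable M (\<nu> s)" for s
 proof -
  have "\<nu> s \<in> meas M" by measurable
  then show ?thesis by (rule integrable_const_bound[of _ "4 * K", rotated]) (use \<nu>0 \<nu>b in auto)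
 qed
 define e1 where "e1 s = (EE w. \<nu> s w)" for s
 have e1m: "e1 \<in> meas borel" unfolding e1_def[abs_def] by measurable
 have e10: "0 <= e1 s" for s unfolding e1_def by (rule integral_nonneg) (use \<nu>0 in auto)
 have e1b: "e1 s <= 4 * K" for s unfolding e1_def by (rule integral_le_const[OF i\<nu>]) (use \<nu>b in auto)
 have e1i: "lint {a..c} e1" for a c
  by (rule set_integrable_bounded_Icc[OF e1m, of _ _ "4 * K"]) (use e10 e1b in auto)
 have e1T: "(LBINT s:{0..t}. e1 s) <= 2 * ep"
 proof -
  have hi: "integrable M (%w. h (s, Z1 s w))" "integrable M (%w. h (s, Z2 s w))" for s
   by (rule integrable_const_bound[of _ "2 * K"]; use h0 hb in simp)+
  have e: "e1 s = (EE w. h (s, Z1 s w)) + (EE w. h (s, Z2 s w))" for s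
   unfolding e1_def \<nu>_def using hi by simp
  have b: "abs (EE w. h (s, Z1 s w)) <= 2 * K" "abs (EE w. h (s, Z2 s w)) <= 2 * K" for s
   by (subst abs_of_nonneg; auto intro!: integral_nonneg integral_le_const hi h0 hb)+
  have j: "lint {0..T} (%s. \<integral>w. h (s, Z1 s w) \<partial>M)" "lint {0..T} (%s. \<integral>w. h (s, Z2 s w) \<partial>M)"
   by (rule set_integrable_bounded_Icc[OF _ b(1)], measurable) (rule set_integrable_bounded_Icc[OF _ b(2)], measurable)
  have "(LBINT s:{0..T}. e1 s) <= 2 * ep"
   unfolding e set_integral_add(2)[OF j] using occ1 occ2 by simp
  moreover have "0 <= (LBINT s:{t..T}. e1 s)"
   by (rule LBINT_nonneg) (rule e10)
  ultimately show ?thesis using set_integral_split_point[OF e1i t] by simp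
 qed
 have f1et: "(EE w. f1 s w) <= et * A + 64 * K ^ 3 / et * e1 s" if s: "0 <= s" "s <= t" for s
 proof -
  have pt: "f1 s w <= et * (Ps s w) ^ 4 + 64 * K ^ 3 / et * \<nu> s w" for w
  proof -
   define v d where "v = (Ps s w)^2" and "d = (\<nu> s w)^2"
   have "0 <= (et * v - d)^2 + et * v * d" using et by (simp add: v_def d_def)
   then have "et * (v * d) <= et * (et * v^2 + d^2 / et)" using et by (simp add: power2_eq_square algebra_simps)
   then have 1: "v * d <= et * v^2 + d^2 / et" using et by simp
   have "d^2 = (\<nu> s w) ^ 3 * \<nu> s w" by (simp add: d_def eval_nat_numeral)
   also have "... <= (4 * K) ^ 3 * \<nu> s w" by (intro mult_right_mono power_mono \<nu>0 \<nu>b)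
   finally have "d^2 / et <= (4 * K) ^ 3 * \<nu> s w / et" using et by (intro divide_right_mono) auto
   moreover have "(4 * K) ^ 3 * \<nu> s w / et = 64 * K ^ 3 / et * \<nu> s w" by (simp add: power_mult_distrib)
   moreover have "v^2 = (Ps s w) ^ 4" by (simp add: v_def)
   moreover have "f1 s w = v * d" by (simp add: f1_def v_def d_def power_mult_distrib)
   ultimately show ?thesis using 1 by simp
  qed
  have "(EE w. f1 s w) <= (EE w. et * (Ps s w) ^ 4 + 64 * K ^ 3 / et * \<nu> s w)"
   by (rule integral_mono[OF f1i(1)[OF s] _ pt]) (use Ps4[OF s] i\<nu> in auto)
  also have "... = et * (EE w. (Ps s w) ^ 4) + 64 * K ^ 3 / et * e1 s" using Ps4[OF s] i\<nu>[of s] by (simp add: e1_def)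
  also have "... <= et * A + 64 * K ^ 3 / et * e1 s" using Ps4(2)[OF s] et by simp
  finally show ?thesis .
 qed
 have I1: "(LBINT s:{0..t}. (EE w. f1 s w)) <= et * (T * A + 1)"
 proof -
  have j: "lint {0..t} (%s. et * A)" by (rule set_integrable_continuous[OF continuous_on_const])
  have j': "lint {0..t} (%s. 64 * K ^ 3 / et * e1 s)" by (rule set_integrable_mult_right) (use e1i in auto)
  have "(LBINT s:{0..t}. (EE w. f1 s w)) <= (LBINT s:{0..t}. et * A + 64 * K ^ 3 / et * e1 s)"
   by (rule set_integral_mono[OF FF1(4) set_integral_add(1)[OF j j']]) (use f1et in auto)
  also have "... = t * (et * A) + 64 * K ^ 3 / et * (LBINT s:{0..t}. e1 s)"
   unfolding set_integral_add(2)[OF j j'] using set_integral_const_Icc[OF t(1), of "et * A"] by simp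
  also have "... <= T * (et * A) + 64 * K ^ 3 / et * (2 * ep)"
   using t A0 et K e1T by (intro add_mono mult_mono mult_left_mono) auto
  also have "64 * K ^ 3 / et * (2 * ep) <= et"
  proof -
   have "64 * K ^ 3 / et * (2 * ep) = et * (128 * K ^ 3 / (128 * K ^ 3 + 1))"
    using et by (simp add: ep_def power2_eq_square)
   also have "... <= et * 1" using et K3 by (intro mult_left_mono) auto
   finally show ?thesis by simp
  qed
  finally show ?thesis by (simp add: algebra_simps)
 qed
 have I2: "(LBINT s:{0..t}. (EE w. f2 s w)) <= (1 + A) * (LBINT s:{0..t}. u s)"
 proof -
  have "(LBINT s:{0..t}. (EE w. f2 s w)) <= (LBINT s:{0..t}. (1 + A) * u s)"
   by (rule set_integral_mono[OF FF2(4)]) (use f2i ui in auto)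
  then show ?thesis by simp
 qed
 have it: "integrable M (%w. (Ps 0 w)^2)" "(EE w. (Ps 0 w)^2) <= 1 + A" using Ps2[of 0] t by auto
 have "(EE w. (z t w)^2) <= (EE w. D0^2 * (3 * ((Ps 0 w)^2 * (x - y)^2 + T * (LBINT s:{0..t}. f1 s w) + T * (C^2 * (LBINT s:{0..t}. f2 s w)))))"
 proof (rule integral_mono_AE[OF _ _ path])
  show "integrable M (%w. (z t w)^2)" using zi(1)[of t] t by simp
  show "integrable M (%w. D0^2 * (3 * ((Ps 0 w)^2 * (x - y)^2 + T * (LBINT s:{0..t}. f1 s w) + T * (C^2 * (LBINT s:{0..t}. f2 s w)))))"
   by (intro integrable_mult_right integrable_add integrable_mult_left it FF1(1) FF2(1))
 qed
 also have "... = D0^2 * (3 * ((EE w. (Ps 0 w)^2) * (x - y)^2 + T * (LBINT s:{0..t}. (EE w. f1 s w)) + T * (C^2 * (LBINT s:{0..t}. (EE w. f2 s w)))))"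
  using it FF1(1) FF2(1) by (simp add: FF1(2) FF2(2))
 also have "... <= D0^2 * (3 * ((1 + A) * (x - y)^2 + T * (et * (T * A + 1)) + T * (C^2 * ((1 + A) * (LBINT s:{0..t}. u s)))))"
  using T by (intro mult_left_mono add_mono mult_right_mono it I1 I2) auto
 also have "... = 3 * D0^2 * ((1 + A) * (x - y)^2 + T * (et * (T * A + 1)) + T * (C^2 * (1 + A) * (LBINT s:{0..t}. u s)))"
  by (simp only: mult_ac)
 finally show ?thesis by (simp only: z_def u_def D0_def)
qed

text \<open>In \<open>approximate_stability\<close> let \<open>\<eta>\<close> tend to zero, which is possible because \<open>A\<close> does not depend on the approximation, and apply Gronwall's inequality.\<close>

lemma solution_stability:
 obtains c where "0 <= c"
  "!!x y Z1 Z2 t. solves x Z1 ==> solves y Z2 ==> abs x <= R ==> abs y <= R ==> 0 <= t ==> t <= T ==>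
   integrable M (%w. (Z1 t w - Z2 t w)^2) & (EE w. (Z1 t w - Z2 t w)^2) <= c * (x - y)^2"
proof -
 obtain k where k: "1 <= k" and ck: "!!x Z. solves x Z ==> abs x <= R ==> controlled k Z"
 proof (rule solves_controlled[of R], goal_cases)
  case (1 k)
  show thesis by (rule 1(1)[OF 1(2,3)])
 qed
 obtain A where A0: "0 <= A" and A: "!!Z1 Z2 th s t f f' L lf. controlled k Z1 ==> controlled k Z2 ==> 0 <= th ==> th <= 1 ==> 0 <= s ==> s <= t ==> t <= T ==>
   (!!r. C11 K L lf (f r) (f' r)) ==>
   (!!w. conti (%r. f' r (th * Z1 r w + (1 - th) * Z2 r w))) ==>
   mean_le (%w. exp (4 * (LBINT r:{s..t}. f' r (th * Z1 r w + (1 - th) * Z2 r w)))) A"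
 proof (rule exponential_functional_bound[OF k K], goal_cases)
  case (1 A)
  show thesis by (rule 1(1)[OF 1(2,3)])
 qed
 define D where "D = 3 * (2 * exp (2 * C * T))^2"
 define C1 where "C1 = D * (1 + A)"
 define C2 where "C2 = D * (T * (C^2 * (1 + A)))"
 define c where "c = 2 * C1 * exp (2 * C2 * T)"
 have C12: "0 <= C1" "0 <= C2" using A0 T by (simp_all add: C1_def C2_def D_def)
 show thesis
 proof (rule that)
  show "0 <= c" using C12 by (simp add: c_def)
  fix x y Z1 Z2 t
  assume Z: "solves x Z1" "solves y Z2" and xy: "abs x <= R" "abs y <= R" and t: "0 <= t" "t <= T"
  note c1 = ck[OF Z(1) xy(1)] and c2 = ck[OF Z(2) xy(2)]
  define u where "u s = (EE w. (Z1 s w - Z2 s w)^2)" for s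
  define S where "S = 12 * k^2 * (1 + T + T ^ 3)"
  have Zm[measurable]: "Z1 s \<in> meas M" "Z2 s \<in> meas M" for s using solves_meas[OF Z(1)] solves_meas[OF Z(2)] by auto
  have zi: "integrable M (%w. (Z1 s w - Z2 s w)^2)" "u s <= S" if s: "s \<in> {0..T}" for s
   unfolding u_def S_def by (rule difference_second_moment[OF Z k c1 c2 s])+
  have u0: "0 <= u s" for s unfolding u_def by (rule integral_nonneg) simp
  have um: "u \<in> meas borel"
  proof -
   note [measurable (raw)] = joint_measurable_compose[OF solves_joint[OF Z(1)]] joint_measurable_compose[OF solves_joint[OF Z(2)]]
   show ?thesis unfolding u_def[abs_def] by measurable
  qed
  have le: "u s <= C1 * (x - y)^2 + C2 * (LBINT r:{0..s}. u r)" if s: "0 <= s" "s <= T" for s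
  proof (rule field_le_epsilon)
   fix e :: real assume e: "0 < e"
   define q where "q = D * (T * (T * A + 1)) + 1"
   have q: "0 < q" using T A0 by (simp add: q_def D_def add_nonneg_pos)
   define et where "et = e / q"
   have et: "0 < et" using e q by (simp add: et_def)
   have "u s <= D * ((1 + A) * (x - y)^2 + T * (et * (T * A + 1)) + T * (C^2 * (1 + A) * (LBINT r:{0..s}. u r)))"
    unfolding u_def D_def by (rule approximate_stability[OF Z k c1 c2 A0 A[OF c1 c2] s et])
   also have "... = C1 * (x - y)^2 + C2 * (LBINT r:{0..s}. u r) + et * (q - 1)"
    by (simp add: C1_def C2_def q_def algebra_simps)
   also have "et * (q - 1) <= et * q" using et by simp
   also have "et * q = e" using q by (simp add: et_def)
   finally show "u s <= C1 * (x - y)^2 + C2 * (LBINT r:{0..s}. u r) + e" by simp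
  qed
  have "u t <= 2 * (C1 * (x - y)^2) * exp (2 * C2 * t)"
  proof (rule gronwall_bounded[OF C12(2) _ _ _ le t])
   show "set_borel_measurable lborel {0..T} u" unfolding set_borel_measurable_def using um by measurable
  qed (use C12 u0 zi(2) in auto)
  also have "... <= 2 * (C1 * (x - y)^2) * exp (2 * C2 * T)"
   using C12 t by (intro mult_left_mono) (auto intro: mult_left_mono)
  finally have "u t <= c * (x - y)^2" by (simp add: c_def mult_ac)
  then show "integrable M (%w. (Z1 t w - Z2 t w)^2) & (EE w. (Z1 t w - Z2 t w)^2) <= c * (x - y)^2"
   using zi(1)[of t] t by (simp add: u_def)
 qed
qed

end

section \<open>Differentiation of mean-square Lipschitz fields\<close>

text \<open>The limit is given pointwise by a subsequence, and set to zero where that diverges. This explicit form is used for bounds that hold at every point rather than almost everywhere.\<close>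

lemma L1_limit:
 fixes f :: "nat => 'b => real"
 assumes i: "!!n. integrable N (f n)"
  and cauchy: "!!e. 0 < e ==> \<exists>k. \<forall>m\<ge>k. \<forall>n\<ge>k. (\<integral>x. abs (f m x - f n x) \<partial>N) < e"
 obtains r D where "strict_mono r" "D \<in> meas N" "integrable N D"
  "!!x. D x = (if convergent (%n. f (r n) x) then lim (%n. f (r n) x) else 0)"
  "AE x in N. (%n. f (r n) x) \<longlonglongrightarrow> D x"
  "!!e. 0 < e ==> \<exists>k. \<forall>m\<ge>k. (\<integral>x. abs (f m x - D x) \<partial>N) <= e"
proof -
 obtain r where r: "strict_mono r" "AE x in N. Cauchy (%i. f (r i) x)"
  using cauchy_L1_AE_cauchy_subseq[OF i, simplified real_norm_def, OF cauchy] by auto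
 have [measurable]: "f n \<in> meas N" for n using i[of n] by simp
 define D where "D x = (if convergent (%n. f (r n) x) then lim (%n. f (r n) x) else 0)" for x
 have Dm[measurable]: "D \<in> meas N"
 proof -
  have "{x \<in> space N. Cauchy (%n. f (r n) x)} \<in> sets N" by (rule sets_Collect_Cauchy) simp
  then have "(%x. if Cauchy (%n. f (r n) x) then lim (%n. f (r n) x) else 0) \<in> meas N"
   by (intro measurable_If borel_measurable_lim_metric) auto
  then show ?thesis by (simp add: D_def[abs_def] Cauchy_convergent_iff)
 qed
 have lim: "AE x in N. (%n. f (r n) x) \<longlonglongrightarrow> D x"
  using r(2) by eventually_elim (simp add: D_def Cauchy_convergent_iff convergent_LIMSEQ_iff)
 have nn: "\<exists>k. \<forall>m\<ge>k. (\<integral>\<^sup>+x. ennreal (abs (f m x - D x)) \<partial>N) <= ennreal e" if e: "0 < e" for e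
 proof -
  obtain k where k: "!!m n. m \<ge> k ==> n \<ge> k ==> (\<integral>x. abs (f m x - f n x) \<partial>N) < e" using cauchy[OF e] by blast
  have "(\<integral>\<^sup>+x. ennreal (abs (f m x - D x)) \<partial>N) <= ennreal e" if m: "m \<ge> k" for m
  proof -
   have "(\<integral>\<^sup>+x. ennreal (abs (f m x - D x)) \<partial>N) = (\<integral>\<^sup>+x. liminf (%n. ennreal (abs (f m x - f (r n) x))) \<partial>N)"
   proof (rule nn_integral_cong_AE)
    show "AE x in N. ennreal (abs (f m x - D x)) = liminf (%n. ennreal (abs (f m x - f (r n) x)))"
     using lim
    proof eventually_elim
     case (elim x)
     have "(%n. ennreal (abs (f m x - f (r n) x))) \<longlonglongrightarrow> ennreal (abs (f m x - D x))"
      by (intro tendsto_ennrealI tendsto_rabs tendsto_diff tendsto_const elim)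
     then show ?case using lim_imp_Liminf[OF sequentially_bot] by metis
    qed
   qed
   also have "... <= liminf (%n. \<integral>\<^sup>+x. ennreal (abs (f m x - f (r n) x)) \<partial>N)" by (rule nn_integral_liminf) simp
   also have "... <= ennreal e"
   proof (rule Liminf_le)
    show "\<forall>\<^sub>F n in sequentially. (\<integral>\<^sup>+x. ennreal (abs (f m x - f (r n) x)) \<partial>N) <= ennreal e"
     unfolding eventually_sequentially
    proof (intro exI[of _ k] allI impI)
     fix n assume "k <= n"
     then have "r n \<ge> k" using seq_suble[OF r(1), of n] by simp
     then show "(\<integral>\<^sup>+x. ennreal (abs (f m x - f (r n) x)) \<partial>N) <= ennreal e"
      using k[OF m, of "r n"] i by (subst nn_integral_eq_integral) (auto intro: ennreal_leI)
    qed
   qed simp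
   finally show ?thesis .
  qed
  then show ?thesis by blast
 qed
 have di: "integrable N (%x. f m x - D x)" if "(\<integral>\<^sup>+x. ennreal (abs (f m x - D x)) \<partial>N) <= ennreal e" for m e
  by (rule integrableI_bounded) (use that in \<open>auto simp: less_top[symmetric] top_unique\<close>)
 show ?thesis
 proof (rule that[OF r(1) Dm _ D_def lim])
  obtain k where "(\<integral>\<^sup>+x. ennreal (abs (f k x - D x)) \<partial>N) <= ennreal 1" using nn[of 1] by auto
  from integrable_diff[OF i[of k] di[OF this]] show "integrable N D" by simp
  fix e :: real assume e: "0 < e"
  obtain k where k: "\<forall>m\<ge>k. (\<integral>\<^sup>+x. ennreal (abs (f m x - D x)) \<partial>N) <= ennreal e" using nn[OF e] by blast
  have "(\<integral>x. abs (f m x - D x) \<partial>N) <= e" if "m \<ge> k" for m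
  proof -
   have "integrable N (%x. abs (f m x - D x))" using di[of m e] k that by auto
   from nn_integral_eq_integral[OF this] k that have "ennreal (\<integral>x. abs (f m x - D x) \<partial>N) <= ennreal e" by auto
   then show ?thesis using e by (subst (asm) ennreal_le_iff) auto
  qed
  then show "\<exists>k. \<forall>m\<ge>k. (\<integral>x. abs (f m x - D x) \<partial>N) <= e" by blast
 qed
qed

lemma emeasure_lborel_Ico_finite: "emeasure lborel {u..<v :: real} < \<top>"
 by (cases "u <= v") (auto simp: emeasure_lborel_Ico)

definition grid :: "real => real => nat => nat => real" where
 "grid a l n i = a + real i * (l / 2 ^ n)"

definition slope :: "real => real => (real => real) => nat => nat => real" where
 "slope a l g n i = (g (grid a l n (Suc i)) - g (grid a l n i)) / (l / 2 ^ n)"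

definition dyadic_quotient :: "real => real => (real => real) => nat => real => real" where
 "dyadic_quotient a l g n x = (\<Sum>i<2 ^ n. indicator {grid a l n i..<grid a l n (Suc i)} x * slope a l g n i)"

text \<open>The squared \<open>L\<^sup>2\<close> norm of the dyadic difference quotient.\<close>

definition dyadic_energy :: "real => real => (real => real) => nat => real" where
 "dyadic_energy a l g n = (\<Sum>i<2 ^ n. l / 2 ^ n * (slope a l g n i)^2)"

context
 fixes a l :: real
 assumes l: "0 < l"
begin

abbreviation "gr == grid a l"
abbreviation "dq == dyadic_quotient a l"
abbreviation "cell n i == {gr n i..<gr n (Suc i)}"

lemma grid_mono: "gr n i <= gr n j \<longleftrightarrow> i <= j" and grid_less: "gr n i < gr n j \<longleftrightarrow> i < j"
 using l by (auto simp: grid_def divide_le_cancel divide_less_cancel mult_le_cancel_right mult_less_cancel_right)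

lemma grid_refine: "gr n i = gr (n + d) (i * 2 ^ d)"
 by (simp add: grid_def power_add)

lemma grid_ends: "gr n 0 = a" "gr n (2 ^ n) = a + l" "gr n (Suc i) = gr n i + l / 2 ^ n"
 by (simp_all add: grid_def algebra_simps add_divide_distrib)

lemma grid_range: "i <= 2 ^ n ==> gr n i \<in> {a..a + l}"
 using grid_mono[of n 0 i] grid_mono[of n i "2 ^ n"] by (simp add: grid_ends)

lemma dyadic_quotient_cell:
 assumes i: "i < 2 ^ n" and x: "x \<in> cell n i"
 shows "dq g n x = slope a l g n i"
proof -
 have "indicator (cell n j) x * slope a l g n j = (if j = i then slope a l g n i else 0)" for j
 proof (cases "j = i")
  case False
  then consider "Suc j <= i" | "Suc i <= j" by linarith
  then have "x \<notin> cell n j"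
  proof cases
   case 1
   then show ?thesis using grid_mono[of n "Suc j" i] x by auto
  next
   case 2
   then show ?thesis using grid_mono[of n "Suc i" j] x by auto
  qed
  then show ?thesis using False by simp
 qed (use x in simp)
 then show ?thesis using i by (simp add: dyadic_quotient_def)
qed

lemma dyadic_quotient_outside:
 assumes "x \<notin> {a..<a + l}"
 shows "dq g n x = 0"
proof -
 have "x \<notin> cell n i" if "i < 2 ^ n" for i
  using grid_mono[of n 0 i] grid_mono[of n "Suc i" "2 ^ n"] assms that by (auto simp: grid_ends(1,2))
 then show ?thesis by (simp add: dyadic_quotient_def)
qed

lemma in_dyadic_cell:
 assumes "x \<in> {a..<a + l}"
 obtains i where "i < 2 ^ n" "x \<in> cell n i"
proof -
 define i where "i = nat \<lfloor>(x - a) / (l / 2 ^ n)\<rfloor>"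
 have h: "0 < l / 2 ^ n" using l by simp
 have 0: "0 <= (x - a) / (l / 2 ^ n)" using assms h by (intro divide_nonneg_pos) auto
 have ri: "real i = real_of_int \<lfloor>(x - a) / (l / 2 ^ n)\<rfloor>" using 0 by (simp add: i_def)
 have 1: "real i * (l / 2 ^ n) <= x - a"
  using of_int_floor_le[of "(x - a) / (l / 2 ^ n)"] pos_le_divide_eq[OF h] ri by metis
 have 2: "x - a < (real i + 1) * (l / 2 ^ n)"
 proof -
  have "(x - a) / (l / 2 ^ n) < real i + 1" using floor_correct[of "(x - a) / (l / 2 ^ n)"] ri by linarith
  then show ?thesis by (rule pos_divide_less_eq[OF h, THEN iffD1])
 qed
 have "real i * (l / 2 ^ n) < l" using 1 assms by simp
 then have "real i < 2 ^ n" using l by (simp add: field_simps)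
 then have "i < 2 ^ n" by (metis of_nat_less_iff of_nat_numeral of_nat_power)
 moreover have "x \<in> cell n i" using 1 2 by (simp add: grid_def algebra_simps)
 ultimately show ?thesis by (rule that)
qed

lemma dyadic_quotient_measurable [measurable]: "dq g n \<in> meas borel"
 unfolding dyadic_quotient_def[abs_def] by measurable

lemma dyadic_product_integrable:
 "integrable lborel (%x. dq g m x * dq g' n x)"
 "integrable lborel (dq g m)"
proof -
 have i: "integrable lborel (%x. indicator {u..<v} x * c)" for u v c :: real
  by (intro integrable_mult_left integrable_real_indicator) (auto simp: emeasure_lborel_Ico_finite)
 have e: "(indicator {u..<v} x * c) * (indicator {u'..<v'} x * c') = indicator {max u u'..<min v v'} x * (c * c')" for u v u' v' x c c' :: real
  by (auto simp: indicator_def)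
 show "integrable lborel (%x. dq g m x * dq g' n x)"
  unfolding dyadic_quotient_def sum_product e by (intro integrable_sum i)
 show "integrable lborel (dq g m)"
  unfolding dyadic_quotient_def[abs_def] by (intro integrable_sum i)
qed

lemma dyadic_quotient_integral:
 assumes ij: "i <= j" "j <= 2 ^ n"
 shows "(LBINT x. indicator {gr n i..<gr n j} x * dq g n x) = g (gr n j) - g (gr n i)"
  "integrable lborel (%x. indicator {gr n i..<gr n j} x * dq g n x)"
proof -
 define I where "I k = {gr n k..<gr n (Suc k)}" for k
 have e: "indicator {gr n i..<gr n j} x * (indicator (I k) x * c) = (if k \<in> {i..<j} then indicator (I k) x * c else 0)" for x c :: real and k :: nat
  using grid_mono[of n i k] grid_mono[of n "Suc k" j] grid_mono[of n "Suc k" i] grid_mono[of n j k]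
  by (auto simp: indicator_def I_def not_less Suc_le_eq)
 have ii: "integrable lborel (%x. indicator (I k) x * c)" for k and c :: real
  unfolding I_def by (intro integrable_mult_left integrable_real_indicator) (auto simp: emeasure_lborel_Ico_finite)
 have ii': "integrable lborel (%x. if k \<in> {i..<j} then indicator (I k) x * c else (0::real))" for k c
  using ii by (cases "k \<in> {i..<j}") auto
 have eq: "indicator {gr n i..<gr n j} x * dq g n x = (\<Sum>k<2 ^ n. if k \<in> {i..<j} then indicator (I k) x * slope a l g n k else 0)" for x
  unfolding dyadic_quotient_def sum_distrib_left I_def[symmetric] e ..
 show "integrable lborel (%x. indicator {gr n i..<gr n j} x * dq g n x)"
  unfolding eq by (intro integrable_sum ii')
 have m: "(LBINT x. indicator (I k) x * c) = (l / 2 ^ n) * c" for k and c :: real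
  unfolding I_def using l by (simp add: grid_ends(3))
 have "(LBINT x. indicator {gr n i..<gr n j} x * dq g n x)
   = (\<Sum>k<2 ^ n. (LBINT x. (if k \<in> {i..<j} then indicator (I k) x * slope a l g n k else 0)))"
  unfolding eq by (rule integral_sum) (rule ii')
 also have "... = (\<Sum>k<2 ^ n. if k \<in> {i..<j} then g (gr n (Suc k)) - g (gr n k) else 0)"
 proof (rule sum.cong[OF refl])
  fix k
  show "(LBINT x. (if k \<in> {i..<j} then indicator (I k) x * slope a l g n k else 0)) = (if k \<in> {i..<j} then g (gr n (Suc k)) - g (gr n k) else 0)"
   using m[of k "slope a l g n k"] l by (cases "k \<in> {i..<j}") (auto simp: slope_def)
 qed
 also have "... = (\<Sum>k\<in>{i..<j}. g (gr n (Suc k)) - g (gr n k))"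
  using ij by (intro sum.mono_neutral_cong_right) auto
 also have "... = g (gr n j) - g (gr n i)" by (rule sum_Suc_diff'[OF ij(1)])
 finally show "(LBINT x. indicator {gr n i..<gr n j} x * dq g n x) = g (gr n j) - g (gr n i)" .
qed

text \<open>On each coarse cell the finer quotient has the coarse slope as its mean value, so the coarse quotient is the orthogonal projection of the finer one.\<close>

lemma dyadic_inner: "(LBINT x. dq g (n + d) x * dq g n x) = dyadic_energy a l g n"
proof -
 have idx: "i * 2 ^ d <= Suc i * 2 ^ d" "Suc i * 2 ^ d <= 2 ^ (n + d)" if "i < 2 ^ n" for i :: nat
 proof -
  show "i * 2 ^ d <= Suc i * 2 ^ d" by simp
  have "Suc i * 2 ^ d <= 2 ^ n * 2 ^ d" using that by (intro mult_right_mono) auto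
  then show "Suc i * 2 ^ d <= 2 ^ (n + d)" by (simp add: power_add)
 qed
 have gc: "cell n i = {gr (n + d) (i * 2 ^ d)..<gr (n + d) (Suc i * 2 ^ d)}" for i
  by (simp only: grid_refine[symmetric])
 have "(LBINT x. dq g (n + d) x * dq g n x)
  = (LBINT x. (\<Sum>i<2 ^ n. indicator (cell n i) x * dq g (n + d) x * slope a l g n i))"
  unfolding dyadic_quotient_def[of _ _ _ n] by (simp only: sum_distrib_left mult_ac)
 also have "... = (\<Sum>i<2 ^ n. (LBINT x. indicator (cell n i) x * dq g (n + d) x * slope a l g n i))"
  by (rule integral_sum)
    (use dyadic_quotient_integral(2)[OF idx] in \<open>auto simp: gc intro!: integrable_mult_left\<close>)
 also have "... = (\<Sum>i<2 ^ n. (g (gr n (Suc i)) - g (gr n i)) * slope a l g n i)"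
 proof (rule sum.cong[OF refl])
  fix i :: nat assume "i \<in> {..<2 ^ n}"
  then have i: "i < 2 ^ n" by simp
  show "(LBINT x. indicator (cell n i) x * dq g (n + d) x * slope a l g n i) = (g (gr n (Suc i)) - g (gr n i)) * slope a l g n i"
   using dyadic_quotient_integral(1)[OF idx[OF i], of g] by (simp add: gc[of i] grid_refine[of n _ d] del: mult_Suc)
 qed
 also have "... = dyadic_energy a l g n"
  unfolding dyadic_energy_def slope_def using l by (intro sum.cong) (auto simp: power2_eq_square)
 finally show ?thesis .
qed

text \<open>Pythagoras, from \<open>dyadic_inner\<close>.\<close>

lemma dyadic_distance:
 "(LBINT x. (dq g (n + d) x - dq g n x)^2) = dyadic_energy a l g (n + d) - dyadic_energy a l g n"
 "integrable lborel (%x. (dq g (n + d) x - dq g n x)^2)"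
proof -
 let ?p = "dq g (n + d)" and ?q = "dq g n"
 have e: "(?p x - ?q x)^2 = ?p x * ?p x - 2 * (?p x * ?q x) + ?q x * ?q x" for x by (simp add: power2_eq_square algebra_simps)
 show "integrable lborel (%x. (?p x - ?q x)^2)"
  unfolding e by (intro integrable_add integrable_diff integrable_mult_right dyadic_product_integrable)
 have "(LBINT x. (?p x - ?q x)^2) = (LBINT x. ?p x * ?p x) - 2 * (LBINT x. ?p x * ?q x) + (LBINT x. ?q x * ?q x)"
  unfolding e by (simp add: dyadic_product_integrable)
 then show "(LBINT x. (?p x - ?q x)^2) = dyadic_energy a l g (n + d) - dyadic_energy a l g n"
  using dyadic_inner[of g n d] dyadic_inner[of g n 0] dyadic_inner[of g "n + d" 0] by simp
qed

end

text \<open>The mean energies of the difference quotients increase and are bounded by \<open>C l\<close>, so by \<open>dyadic_distance\<close> the quotients form a Cauchy sequence in \<open>L\<^sup>1\<close> of the product measure. At a fixed \<open>x\<close> the quotients integrate to increments of \<open>G\<close> between grid points, and the Lipschitz bound compares \<open>x\<close> with the nearest grid point.\<close>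

lemma (in prob_space) lipschitz_field_derivative:
 fixes G :: "real => 'a => real"
 assumes ab: "a < b" and C: "0 <= C"
  and Gm: "!!x. x \<in> {a..b} ==> G x \<in> meas M"
  and Gi: "!!x y. x \<in> {a..b} ==> y \<in> {a..b} ==> integrable M (%w. (G x w - G y w)^2)"
  and Gl: "!!x y. x \<in> {a..b} ==> y \<in> {a..b} ==> (EE w. (G x w - G y w)^2) <= C * (x - y)^2"
 obtains D :: "real => 'a => real" where
  "jmeas M D"
  "!!x. integrable M (%w. (D x w)^2)" "!!x. (EE w. (D x w)^2) <= C"
  "AE w in M. lint {a..b} (%x. D x w)"
  "!!x. x \<in> {a..b} ==> AE w in M. G x w = G a w + (LBINT s:{a..x}. D s w)"
proof -
 define l where "l = b - a"
 let ?dq = "dyadic_quotient a l" and ?en = "dyadic_energy a l" and ?sl = "slope a l" and ?gr = "grid a l"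
 have l: "0 < l" and bl: "b = a + l" using ab by (auto simp: l_def)
 interpret P: pair_sigma_finite lborel M by unfold_locales
 define N where "N = (lborel :: real measure) \<Otimes>\<^sub>M M"
 have Ns: "sets N = sets (borel \<Otimes>\<^sub>M M)" unfolding N_def by (intro sets_pair_measure_cong) auto
 define g where "g w x = G x w" for w x
 define Q where "Q n p = ?dq (g (snd p)) n (fst p)" for n p
 define E where "E n = (EE w. ?en (g w) n)" for n
 have rng: "?gr n i \<in> {a..b}" if "i <= 2 ^ n" for n i using grid_range[OF l that] by (simp add: bl)
 have slm: "(%w. ?sl (g w) n i) \<in> meas M" if "i < 2 ^ n" for n i
  unfolding slope_def g_def using Gm[OF rng, of i n] Gm[OF rng, of "Suc i" n] that by auto
 have h: "0 < l / 2 ^ n" for n :: nat using l by simp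
 have sl2: "integrable M (%w. (?sl (g w) n i)^2)" "(EE w. (?sl (g w) n i)^2) <= C" if i: "i < 2 ^ n" for n i
 proof -
  have r: "?gr n (Suc i) \<in> {a..b}" "?gr n i \<in> {a..b}" using rng i by auto
  show "integrable M (%w. (?sl (g w) n i)^2)"
   unfolding slope_def g_def power_divide using Gi[OF r] by simp
  have "(EE w. (?sl (g w) n i)^2) = (EE w. (G (?gr n (Suc i)) w - G (?gr n i) w)^2) / (l / 2 ^ n)^2"
   unfolding slope_def g_def power_divide by simp
  also have "... <= C * (?gr n (Suc i) - ?gr n i)^2 / (l / 2 ^ n)^2" using Gl[OF r] by (intro divide_right_mono) auto
  also have "... = C" using h[of n] l by (simp add: grid_ends(3)[OF l])
  finally show "(EE w. (?sl (g w) n i)^2) <= C" .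
 qed
 have sl1: "integrable M (%w. ?sl (g w) n i)" if i: "i < 2 ^ n" for n i
  by (rule integrable_le(1)[OF _ slm[OF i] abs_le_eps_square[of 1]]) (use sl2(1)[OF i] in auto)
 have Qe: "Q n = (%p. \<Sum>i<2 ^ n. indicator {?gr n i..<?gr n (Suc i)} (fst p) * ?sl (g (snd p)) n i)" for n
  by (simp add: Q_def[abs_def] dyadic_quotient_def)
 have Qi: "integrable N (Q n)" for n
  unfolding Qe N_def
  by (intro integrable_sum product_integrable sl1 lborel.sigma_finite_measure_axioms sigma_finite_measure_axioms integrable_real_indicator)
   (auto simp: emeasure_lborel_Ico_finite)
 have Qm: "Q n \<in> meas (borel \<Otimes>\<^sub>M M)" for n
  using borel_measurable_integrable[OF Qi] by (simp add: measurable_cong_sets[OF Ns refl])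
 have Q2: "integrable M (%w. (Q n (x, w))^2)" "(EE w. (Q n (x, w))^2) <= C" for n x
 proof -
  have "integrable M (%w. (Q n (x, w))^2) & (EE w. (Q n (x, w))^2) <= C"
  proof (cases "x \<in> {a..<a + l}")
   case True
   then obtain i where i: "i < 2 ^ n" "x \<in> {?gr n i..<?gr n (Suc i)}" using in_dyadic_cell[OF l] by metis
   show ?thesis using sl2[OF i(1)] by (simp add: Q_def dyadic_quotient_cell[OF l i])
  next
   case False
   then show ?thesis using C by (simp add: Q_def dyadic_quotient_outside[OF l])
  qed
  then show "integrable M (%w. (Q n (x, w))^2)" "(EE w. (Q n (x, w))^2) <= C" by auto
 qed
 have enm: "integrable M (%w. ?en (g w) n)" for n
  unfolding dyadic_energy_def using sl2(1) by (intro integrable_sum integrable_mult_right) auto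
 have E_le: "E n <= C * l" for n
 proof -
  have "E n = (\<Sum>i<2 ^ n. l / 2 ^ n * (EE w. (?sl (g w) n i)^2))"
   unfolding E_def dyadic_energy_def using sl2(1) by (subst integral_sum) auto
  also have "... <= (\<Sum>i<(2 :: nat) ^ n. l / 2 ^ n * C)" using sl2(2) l by (intro sum_mono mult_left_mono) auto
  also have "... = C * l" by simp
  finally show ?thesis .
 qed
 have E_diff: "E n <= E (n + d)" for n d
  unfolding E_def
 proof (rule integral_mono[OF enm enm])
  fix w
  have "0 <= (LBINT x. (?dq (g w) (n + d) x - ?dq (g w) n x)^2)"
   by (rule integral_nonneg) simp
  then show "?en (g w) n <= ?en (g w) (n + d)" using dyadic_distance(1)[OF l, where g = "g w" and n = n and d = d and a = a] by simp
 qed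
 have "incseq E" using E_diff by (intro incseq_SucI) (metis Suc_eq_plus1)
 then obtain e where "E \<longlonglongrightarrow> e" using E_le incseq_convergent[of E "C * l"] by blast
 then have "convergent E" by (rule convergentI)
 then have "Cauchy E" by (simp add: Cauchy_convergent_iff)
 have fub: "(\<integral>p. F p \<partial>N) = (EE w. (LBINT x. F (x, w)))" "integrable M (%w. \<integral>x. F (x, w) \<partial>lborel)"
  "AE w in M. integrable lborel (%x. F (x, w))"
  if "integrable N F" for F :: "real \<times> 'a => real"
  using P.integral_snd[of "%x w. F (x, w)"] P.integrable_snd[of "%x w. F (x, w)"] P.AE_integrable_snd[of "%x w. F (x, w)"] that by (auto simp: N_def)
 \<comment> \<open>the L1 distance is controlled by the energy gap\<close>
 have gap: "(\<integral>p. abs (Q (n + d) p - Q n p) \<partial>N) <= et * l + (E (n + d) - E n) / et" if et: "0 < et" for n d et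
 proof -
  have i: "integrable N (%p. abs (Q (n + d) p - Q n p))" using Qi by auto
  have pt: "(LBINT x. abs (Q (n + d) (x, w) - Q n (x, w))) <= et * l + (?en (g w) (n + d) - ?en (g w) n) / et" for w
  proof -
   let ?v = "%x. ?dq (g w) (n + d) x - ?dq (g w) n x"
   have vi: "integrable lborel (%x. abs (?v x))" by (intro integrable_abs integrable_diff dyadic_product_integrable(2)[OF l])
   have ii: "integrable lborel (%x. et * indicator {a..<a + l} x)"
    by (intro integrable_mult_right integrable_real_indicator) (auto simp: emeasure_lborel_Ico_finite)
   have "(LBINT x. abs (?v x)) <= (LBINT x. et * indicator {a..<a + l} x + (?v x)^2 / et)"
   proof (rule integral_mono[OF vi])
    show "integrable lborel (%x. et * indicator {a..<a + l} x + (?v x)^2 / et)"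
     using ii dyadic_distance(2)[OF l, where g = "g w" and n = n and d = d and a = a] by auto
    fix x
    show "abs (?v x) <= et * indicator {a..<a + l} x + (?v x)^2 / et"
     using abs_le_eps_square[OF et, of "?v x"] by (cases "x \<in> {a..<a + l}") (auto simp: dyadic_quotient_outside[OF l])
   qed
   also have "... = et * l + (?en (g w) (n + d) - ?en (g w) n) / et"
    using ii dyadic_distance[OF l, where g = "g w" and n = n and d = d and a = a] l by simp
   finally show ?thesis by (simp add: Q_def)
  qed
  have "(\<integral>p. abs (Q (n + d) p - Q n p) \<partial>N) <= (EE w. et * l + (?en (g w) (n + d) - ?en (g w) n) / et)"
   unfolding fub(1)[OF i] by (rule integral_mono[OF fub(2)[OF i] _ pt]) (use enm in auto)
  also have "... = et * l + (E (n + d) - E n) / et" using enm by (simp add: E_def prob_space)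
  finally show ?thesis .
 qed
 have cau: "\<exists>k. \<forall>m\<ge>k. \<forall>n\<ge>k. (\<integral>p. abs (Q m p - Q n p) \<partial>N) < e" if e: "0 < e" for e
 proof -
  \<comment> \<open>with this weight both terms of the gap bound are at most \<open>e / 4\<close> once the energies are close\<close>
  define et where "et = e / (4 * l)"
  have et: "0 < et" using e l by (simp add: et_def)
  obtain k where k: "!!m n. m \<ge> k ==> n \<ge> k ==> dist (E m) (E n) < et * (e / 4)"
   using \<open>Cauchy E\<close> et e unfolding Cauchy_def by (metis divide_pos_pos mult_pos_pos zero_less_numeral)
  have le: "(\<integral>p. abs (Q m p - Q n p) \<partial>N) < e" if mn: "k <= n" "n <= m" for m n
  proof -
   obtain d where d: "m = n + d" using mn(2) le_Suc_ex by blast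
   have "E (n + d) - E n < et * (e / 4)"
    using k[OF order_trans[OF mn] mn(1)] abs_ge_self[of "E (n + d) - E n"] unfolding d dist_real_def by linarith
   then have "(E (n + d) - E n) / et < e / 4" using et by (simp add: divide_less_eq mult.commute)
   moreover have "et * l = e / 4" using l by (simp add: et_def)
   ultimately show ?thesis using gap[OF et, of n d] e unfolding d by linarith
  qed
  have "(\<integral>p. abs (Q m p - Q n p) \<partial>N) < e" if "k <= m" "k <= n" for m n
   using le[of m n] le[of n m] that by (cases "n <= m") (auto simp: abs_minus_commute)
  then show ?thesis by blast
 qed
 obtain r D' where r: "strict_mono r" and D'm: "D' \<in> meas N" and D'i: "integrable N D'"
  and D'def: "!!p. D' p = (if convergent (%n. Q (r n) p) then lim (%n. Q (r n) p) else 0)"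
  and D'L: "!!e. 0 < e ==> \<exists>k. \<forall>m\<ge>k. (\<integral>p. abs (Q m p - D' p) \<partial>N) <= e"
 proof (rule L1_limit[OF Qi cau], goal_cases)
  case (2 r D)
  show thesis by (rule 2(1)[OF 2(2-5) 2(7)])
 qed auto
 define D where "D x w = D' (x, w)" for x w
 have Dm: "jmeas M D"
  using D'm by (simp add: D_def measurable_cong_sets[OF Ns refl])
 have Dx: "D x \<in> meas M" for x
  using measurable_compose[OF measurable_Pair1' Dm, of x] by simp
 have D2: "integrable M (%w. (D x w)^2) & (EE w. (D x w)^2) <= C" for x
 proof -
  have [measurable]: "(%w. Q n (x, w)) \<in> meas M" for n using measurable_compose[OF measurable_Pair1' Qm, of x n] by simp
  have [measurable]: "D x \<in> meas M" by (rule Dx)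
  have "(\<integral>\<^sup>+w. ennreal ((D x w)^2) \<partial>M) <= (\<integral>\<^sup>+w. liminf (%n. ennreal ((Q (r n) (x, w))^2)) \<partial>M)"
  proof (rule nn_integral_mono)
   fix w
   show "ennreal ((D x w)^2) <= liminf (%n. ennreal ((Q (r n) (x, w))^2))"
   proof (cases "convergent (%n. Q (r n) (x, w))")
    case True
    then have "(%n. Q (r n) (x, w)) \<longlonglongrightarrow> D x w" by (simp add: D_def D'def convergent_LIMSEQ_iff)
    then have "(%n. ennreal ((Q (r n) (x, w))^2)) \<longlonglongrightarrow> ennreal ((D x w)^2)" by (intro tendsto_ennrealI tendsto_power)
    then show ?thesis using lim_imp_Liminf[OF sequentially_bot] by (metis order.refl)
   qed (simp add: D_def D'def)
  qed
  also have "... <= liminf (%n. \<integral>\<^sup>+w. ennreal ((Q (r n) (x, w))^2) \<partial>M)" by (rule nn_integral_liminf) simp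
  also have "... <= ennreal C"
  proof (rule Liminf_le)
   show "\<forall>\<^sub>F n in sequentially. (\<integral>\<^sup>+w. ennreal ((Q (r n) (x, w))^2) \<partial>M) <= ennreal C"
    by (intro always_eventually allI, subst nn_integral_eq_integral) (use Q2 in \<open>auto intro: ennreal_leI\<close>)
  qed simp
  finally have le: "(\<integral>\<^sup>+w. ennreal ((D x w)^2) \<partial>M) <= ennreal C" .
  have i: "integrable M (%w. (D x w)^2)"
   by (rule integrableI_bounded) (use le in \<open>auto simp: less_top[symmetric] top_unique\<close>)
  have "ennreal (EE w. (D x w)^2) <= ennreal C" using le nn_integral_eq_integral[OF i] by simp
  then show ?thesis using i C by (subst (asm) ennreal_le_iff) auto
 qed
 have AEi: "AE w in M. integrable lborel (%x. D x w)" using fub(3)[OF D'i] by (simp add: D_def)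
 have AEs: "AE w in M. lint {a..b} (%x. D x w)"
  using AEi by eventually_elim (unfold set_integrable_def, rule integrable_mult_indicator, simp_all)
 have rep: "AE w in M. G x w = G a w + (LBINT s:{a..x}. D s w)" if x: "x \<in> {a..b}" for x
 proof -
  define W where "W w = G x w - G a w - (LBINT s. indicator {a..<x} s * D s w)" for w
  have ind: "integrable N (%p. indicator {a..<x} (fst p) * F p)" if F: "integrable N F" for F :: "real \<times> 'a => real"
  proof (rule integrable_bound[OF F])
   have [measurable]: "F \<in> meas (borel \<Otimes>\<^sub>M M)" using borel_measurable_integrable[OF F] by (simp add: measurable_cong_sets[OF Ns refl])
   have "(%p. indicator {a..<x} (fst p) * F p) \<in> meas (borel \<Otimes>\<^sub>M M)" by measurable
   then show "(%p. indicator {a..<x} (fst p) * F p) \<in> meas N" by (simp add: measurable_cong_sets[OF Ns refl])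
   show "AE p in N. norm (indicator {a..<x} (fst p) * F p) <= norm (F p)" by (intro AE_I2) (simp add: indicator_def)
  qed
  have a: "a \<in> {a..b}" using ab by simp
  have Wi1: "integrable M (%w. G u w - G v w)" "(EE w. abs (G u w - G v w)) <= h * (1 + C)"
   if uv: "u \<in> {a..b}" "v \<in> {a..b}" "abs (u - v) <= h" "0 < h" for u v h
  proof -
   have i: "integrable M (%w. h + (G u w - G v w)^2 / h)" using Gi[OF uv(1,2)] by simp
   have m: "(%w. G u w - G v w) \<in> meas M" using Gm uv by auto
   note le = integrable_le[OF i m abs_le_eps_square[OF uv(4)]]
   show "integrable M (%w. G u w - G v w)" by (rule le(1))
   have "(EE w. abs (G u w - G v w)) <= (EE w. h + (G u w - G v w)^2 / h)" by (rule le(2))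
   also have "... = h + (EE w. (G u w - G v w)^2) / h" using Gi[OF uv(1,2)] by (simp add: prob_space)
   also have "(EE w. (G u w - G v w)^2) / h <= C * h^2 / h"
   proof (rule divide_right_mono)
    have "(u - v)^2 <= h^2" using uv by (simp add: abs_le_square_iff[symmetric])
    then show "(EE w. (G u w - G v w)^2) <= C * h^2" using order_trans[OF Gl[OF uv(1,2)] mult_left_mono[OF _ C]] by blast
   qed (use uv in simp)
   also have "h + C * h^2 / h = h * (1 + C)" using uv by (simp add: power2_eq_square algebra_simps)
   finally show "(EE w. abs (G u w - G v w)) <= h * (1 + C)" by simp
  qed
  have Ii: "integrable M (%w. \<integral>s. indicator {a..<x} s * D s w \<partial>lborel)"
   using fub(2)[OF ind[OF D'i]] by (simp add: D_def)
  have Wi: "integrable M W" unfolding W_def[abs_def]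
   using Wi1(1)[OF x a, of "abs (x - a) + 1"] Ii by auto
  \<comment> \<open>the cell of level \<open>n\<close> that contains \<open>x\<close>, or the right end point\<close>
  have est: "(EE w. abs (W w)) <= 2 * (l / 2 ^ n * (1 + C)) + (\<integral>p. abs (Q n p - D' p) \<partial>N)" for n
  proof -
   obtain i where i: "i <= 2 ^ n" "?gr n i <= x" "x <= ?gr n i + l / 2 ^ n" "i < 2 ^ n \<or> ?gr n i = x"
   proof (cases "x = b")
    case True
    show ?thesis by (rule that[of "2 ^ n"]) (use True l in \<open>auto simp: grid_ends(2)[OF l] bl\<close>)
   next
    case False
    then have "x \<in> {a..<a + l}" using x by (simp add: bl)
    then obtain i where "i < 2 ^ n" "x \<in> {?gr n i..<?gr n (Suc i)}" by (rule in_dyadic_cell[OF l])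
    then show ?thesis by (intro that[of i]) (auto simp: grid_ends(3)[OF l])
   qed
   define u where "u = ?gr n i"
   have u: "u \<in> {a..b}" using rng[OF i(1)] by (simp add: u_def)
   define v where "v = (if i < 2 ^ n then ?gr n (Suc i) else u)"
   have v: "v \<in> {a..b}" using rng[of "Suc i" n] u by (auto simp: v_def)
   have uv: "abs (v - u) <= l / 2 ^ n" using l by (simp add: v_def u_def grid_ends(3)[OF l])
   have ux: "abs (x - u) <= l / 2 ^ n" using i by (simp add: u_def)
   have tail: "abs (LBINT s. indicator {u..<x} s * Q n (s, w)) <= abs (G v w - G u w)" for w
   proof (cases "i < 2 ^ n")
    case True
    have "indicator {u..<x} s * Q n (s, w) = indicator {u..<x} s * ?sl (g w) n i" for s
    proof (cases "s \<in> {u..<x}")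
     case s: True
     then have "s \<in> {?gr n i..<?gr n (Suc i)}" using i by (simp add: u_def grid_ends(3)[OF l])
     then show ?thesis by (simp add: Q_def dyadic_quotient_cell[OF l True])
    qed simp
    then have "(LBINT s. indicator {u..<x} s * Q n (s, w)) = (LBINT s. indicator {u..<x} s * ?sl (g w) n i)"
     by (rule integral_cong[OF refl])
    also have "... = (x - u) * ?sl (g w) n i" using i(2) by (simp add: u_def)
    also have "abs ... <= (l / 2 ^ n) * abs (?sl (g w) n i)" unfolding abs_mult by (rule mult_right_mono[OF ux]) simp
    also have "... = abs (G v w - G u w)"
    proof -
     have "c * abs (z / c) = abs z" if "0 < c" for c z :: real using that by (simp add: abs_divide)
     from this[OF h[of n]] show ?thesis using True by (simp only: slope_def v_def u_def g_def if_True)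
    qed
    finally show ?thesis .
   next
    case False
    then have "u = x" using i(4) by (simp add: u_def)
    then show ?thesis by simp
   qed
   have ai: "{a..<u} = {?gr n 0..<?gr n i}" by (simp add: u_def grid_ends(1)[OF l])
   have main: "abs (W w) <= abs (G x w - G u w) + abs (G v w - G u w) + (LBINT s. abs (Q n (s, w) - D s w))" if Di: "integrable lborel (%s. D s w)" for w
   proof -
    have Qw: "integrable lborel (%s. Q n (s, w))" by (simp add: Q_def dyadic_product_integrable(2)[OF l])
    have ii: "integrable lborel (%s. indicator A s * F s)" if "integrable lborel F" "A \<in> sets borel" for A and F :: "real => real"
     using integrable_mult_indicator[of A lborel F] that by simp
    have e1: "(LBINT s. indicator {a..<u} s * Q n (s, w)) = G u w - G a w"
     unfolding ai Q_def fst_conv snd_conv dyadic_quotient_integral(1)[OF l le0 i(1), where g = "g w" and a = a]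
     by (simp add: g_def u_def grid_ends(1)[OF l])
    have "indicator {a..<x} s = (indicator {a..<u} s + indicator {u..<x} s :: real)" for s
     using i(2) u by (auto simp: indicator_def u_def)
    then have "(LBINT s. indicator {a..<x} s * Q n (s, w)) = (LBINT s. indicator {a..<u} s * Q n (s, w) + indicator {u..<x} s * Q n (s, w))"
     by (simp add: distrib_right)
    also have "... = (LBINT s. indicator {a..<u} s * Q n (s, w)) + (LBINT s. indicator {u..<x} s * Q n (s, w))"
     by (intro integral_add ii Qw) auto
    finally have e2: "(LBINT s. indicator {a..<x} s * Q n (s, w)) = G u w - G a w + (LBINT s. indicator {u..<x} s * Q n (s, w))" using e1 by simp
    have "(LBINT s. indicator {a..<x} s * Q n (s, w)) - (LBINT s. indicator {a..<x} s * D s w)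
      = (LBINT s. indicator {a..<x} s * Q n (s, w) - indicator {a..<x} s * D s w)"
     by (intro integral_diff[symmetric] ii Qw Di) auto
    also have "abs ... <= (LBINT s. abs (indicator {a..<x} s * Q n (s, w) - indicator {a..<x} s * D s w))" by (rule integral_abs_bound)
    also have "... <= (LBINT s. abs (Q n (s, w) - D s w))"
    proof (rule integral_mono)
     show "integrable lborel (%s. abs (indicator {a..<x} s * Q n (s, w) - indicator {a..<x} s * D s w))"
      by (intro integrable_abs integrable_diff ii Qw Di) auto
     show "integrable lborel (%s. abs (Q n (s, w) - D s w))"
      by (intro integrable_abs integrable_diff Qw Di)
     show "abs (indicator {a..<x} s * Q n (s, w) - indicator {a..<x} s * D s w) <= abs (Q n (s, w) - D s w)" for s
      by (cases "s \<in> {a..<x}") auto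
    qed
    finally have "abs ((LBINT s. indicator {a..<x} s * Q n (s, w)) - (LBINT s. indicator {a..<x} s * D s w)) <= (LBINT s. abs (Q n (s, w) - D s w))" .
    then show ?thesis using tail[of w] e2 unfolding W_def by linarith
   qed
   have i1: "integrable M (%w. abs (G x w - G u w))" "integrable M (%w. abs (G v w - G u w))"
    using Wi1(1)[OF x u ux h] Wi1(1)[OF v u uv h] by auto
   have QD: "integrable N (%p. abs (Q n p - D' p))" using Qi D'i by auto
   have i3: "integrable M (%w. \<integral>s. abs (Q n (s, w) - D s w) \<partial>lborel)" using fub(2)[OF QD] by (simp add: D_def)
   have "(EE w. abs (W w)) <= (EE w. abs (G x w - G u w) + abs (G v w - G u w) + (LBINT s. abs (Q n (s, w) - D s w)))"
   proof (rule integral_mono_AE[OF integrable_abs[OF Wi]])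
    show "AE w in M. abs (W w) <= abs (G x w - G u w) + abs (G v w - G u w) + (LBINT s. abs (Q n (s, w) - D s w))"
     using AEi by eventually_elim (rule main)
   qed (use i1 i3 in auto)
   also have "... = (EE w. abs (G x w - G u w)) + (EE w. abs (G v w - G u w)) + (EE w. (LBINT s. abs (Q n (s, w) - D s w)))"
    using i1 i3 by simp
   also have "(EE w. (LBINT s. abs (Q n (s, w) - D s w))) = (\<integral>p. abs (Q n p - D' p) \<partial>N)" using fub(1)[OF QD] by (simp add: D_def)
   finally have le: "(EE w. abs (W w)) <= (EE w. abs (G x w - G u w)) + (EE w. abs (G v w - G u w)) + (\<integral>p. abs (Q n p - D' p) \<partial>N)" .
   have "z <= 2 * c + q" if "z <= p + p' + q" "p <= c" "p' <= c" for z p p' q c :: real using that by linarith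
   from this[OF le Wi1(2)[OF x u ux h] Wi1(2)[OF v u uv h]] show ?thesis .
  qed
  have "(EE w. abs (W w)) <= 0 + e" if e: "0 < e" for e
  proof -
   obtain k where k: "\<forall>m\<ge>k. (\<integral>p. abs (Q m p - D' p) \<partial>N) <= e / 2" using D'L[of "e/2"] e by auto
   have "(%n. 2 * (l / 2 ^ n * (1 + C))) \<longlonglongrightarrow> 2 * (0 * (1 + C))"
    by (intro tendsto_mult tendsto_const LIMSEQ_divide_realpow_zero) auto
   then have "\<forall>\<^sub>F n in sequentially. 2 * (l / 2 ^ n * (1 + C)) < e / 2" using e by (intro order_tendstoD(2)) auto
   then obtain k' where k': "!!n. n \<ge> k' ==> 2 * (l / 2 ^ n * (1 + C)) < e / 2" by (auto simp: eventually_sequentially)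
   have "(\<integral>p. abs (Q (max k k') p - D' p) \<partial>N) <= e / 2" using k by simp
   moreover have "2 * (l / 2 ^ (max k k') * (1 + C)) < e / 2" by (rule k') simp
   ultimately have "2 * (l / 2 ^ (max k k') * (1 + C)) + (\<integral>p. abs (Q (max k k') p - D' p) \<partial>N) <= e / 2 + e / 2"
    by (intro add_mono) (simp_all only: less_imp_le)
   then have "2 * (l / 2 ^ (max k k') * (1 + C)) + (\<integral>p. abs (Q (max k k') p - D' p) \<partial>N) <= 0 + e" by simp
   then show ?thesis by (rule order_trans[OF est])
  qed
  then have "(EE w. abs (W w)) <= 0" by (rule field_le_epsilon)
  then have "(EE w. abs (W w)) = 0" by (intro antisym integral_nonneg) auto
  then have "AE w in M. abs (W w) = 0"
   using integral_nonneg_eq_0_iff_AE[OF integrable_abs[OF Wi]] by simp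
  then show ?thesis using AE_space
  proof eventually_elim
   case (elim w)
   have "(LBINT s. indicator {a..<x} s * D s w) = (LBINT s:{a..x}. D s w)"
    unfolding set_lebesgue_integral_def real_scaleR_def
   proof (rule integral_cong_AE)
    have [measurable]: "(%s. D s w) \<in> meas borel" using measurable_compose[OF measurable_Pair2'[OF elim(2)] Dm] by simp
    show "(%s. indicator {a..<x} s * D s w) \<in> meas lborel" "(%s. indicator {a..x} s * D s w) \<in> meas lborel"
     by measurable
    show "AE s in lborel. indicator {a..<x} s * D s w = indicator {a..x} s * D s w"
     using AE_lborel_singleton[of x] by eventually_elim (auto simp: indicator_def)
   qed
   then show ?case using elim by (simp add: W_def)
  qed
 qed
 show thesis by (rule that[OF Dm _ _ AEs rep]) (use D2 in auto)
qed

section \<open>Uniqueness of weak derivatives\<close>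

lemma power_le_fact_exp:
 fixes y :: real
 assumes "0 <= y"
 shows "y ^ n <= fact n * exp y"
proof -
 have s: "summable (%n. y ^ n /\<^sub>R fact n)" by (rule summable_exp_generic)
 have "(\<Sum>k\<in>{n}. y ^ k /\<^sub>R fact k) <= (\<Sum>k. y ^ k /\<^sub>R fact k)"
  by (rule sum_le_suminf[OF s]) (use assms in auto)
 then have "y ^ n / fact n <= exp y" by (simp add: exp_def divide_inverse mult.commute)
 then show ?thesis by (simp add: divide_le_eq mult.commute)
qed

text \<open>The building blocks of the derivatives of \<open>exp (- 1 / x)\<close>: the family is closed under differentiation and flat at zero.\<close>

definition flat_exp :: "nat => real => real" where
 "flat_exp n x = (if 0 < x then exp (- inverse x) * inverse x ^ n else 0)"

lemma flat_bounds: "0 <= flat_exp n x" "flat_exp n x <= fact (n + 2) * x^2" "flat_exp 0 x <= 1"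
proof -
 show "0 <= flat_exp n x" by (simp add: flat_exp_def)
 show "flat_exp 0 x <= 1" by (simp add: flat_exp_def)
 show "flat_exp n x <= fact (n + 2) * x^2"
 proof (cases "0 < x")
  case True
  have "inverse x ^ (n + 2) <= fact (n + 2) * exp (inverse x)" by (rule power_le_fact_exp) (use True in simp)
  then have 1: "inverse x ^ (n + 2) * (x^2 * exp (- inverse x)) <= fact (n + 2) * exp (inverse x) * (x^2 * exp (- inverse x))"
   using True by (intro mult_right_mono) auto
  have 2: "inverse x ^ (n + 2) * (x^2 * exp (- inverse x)) = flat_exp n x"
   using True by (simp add: flat_exp_def power_add power2_eq_square field_simps)
  have 3: "fact (n + 2) * exp (inverse x) * (x^2 * exp (- inverse x)) = fact (n + 2) * x^2"
   by (simp add: exp_minus)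
  show ?thesis using 1 unfolding 2 3 .
 qed (simp add: flat_exp_def)
qed

lemma flat_derivative: "(flat_exp n has_real_derivative flat_exp (n + 2) x - real n * flat_exp (n + 1) x) (at x)"
proof -
 consider "0 < x" | "x < 0" | "x = 0" by linarith
 then show ?thesis
 proof cases
  case 1
  have d1: "((%x. exp (- inverse x)) has_real_derivative exp (- inverse x) * (inverse x)^2) (at x)"
   using 1 by (auto intro!: derivative_eq_intros simp: power2_eq_square)
  have d2: "((%x. inverse x ^ n) has_real_derivative real n * (- ((inverse x)^2) * inverse x ^ (n - 1))) (at x)"
   using 1 by (auto intro!: derivative_eq_intros simp: power2_eq_square)
  have "((%x. exp (- inverse x) * inverse x ^ n) has_real_derivative flat_exp (n + 2) x - real n * flat_exp (n + 1) x) (at x)"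
   using DERIV_mult[OF d1 d2] 1 by (cases n) (simp_all add: flat_exp_def power2_eq_square algebra_simps)
  then show ?thesis
   by (rule has_field_derivative_transform_within_open[of _ _ _ "{0<..}"]) (use 1 in \<open>auto simp: flat_exp_def\<close>)
 next
  case 2
  have "((%x. 0) has_real_derivative flat_exp (n + 2) x - real n * flat_exp (n + 1) x) (at x)"
   using 2 by (simp add: flat_exp_def)
  then show ?thesis
   by (rule has_field_derivative_transform_within_open[of _ _ _ "{..<0}"]) (use 2 in \<open>auto simp: flat_exp_def\<close>)
 next
  case 3
  have "(flat_exp n has_real_derivative 0) (at 0)"
   by (rule deriv_from_quadratic[where c = "fact (n + 2)"]) (use flat_bounds[of n] in \<open>auto simp: flat_exp_def[of n 0]\<close>)
  then show ?thesis using 3 by (simp add: flat_exp_def)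
 qed
qed

text \<open>The cutoffs belong to this class, and it contains the derivative of each of its members; so they have derivatives of all orders.\<close>

inductive smooth_class :: "real => real => real => (real => real) => bool" for a b k where
 base: "smooth_class a b k (%x. flat_exp i (k * (x - a)) * flat_exp j (k * (b - x)))"
| add: "smooth_class a b k f ==> smooth_class a b k g ==> smooth_class a b k (%x. f x + g x)"
| scale: "smooth_class a b k f ==> smooth_class a b k (%x. c * f x)"

lemma smooth_class_derivative:
 assumes "smooth_class a b k f"
 shows "\<exists>f'. smooth_class a b k f' & (\<forall>x. (f has_real_derivative f' x) (at x))"
 using assms
proof induction
 case (base i j)
 let ?p = "%i j x. flat_exp i (k * (x - a)) * flat_exp j (k * (b - x))"
 have d1: "((%x. flat_exp i (k * (x - a))) has_real_derivative (flat_exp (i + 2) (k * (x - a)) - real i * flat_exp (i + 1) (k * (x - a))) * k) (at x)" for x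
  by (rule DERIV_chain2[OF flat_derivative]) (auto intro!: derivative_eq_intros)
 have d2: "((%x. flat_exp j (k * (b - x))) has_real_derivative (flat_exp (j + 2) (k * (b - x)) - real j * flat_exp (j + 1) (k * (b - x))) * (- k)) (at x)" for x
  by (rule DERIV_chain2[OF flat_derivative]) (auto intro!: derivative_eq_intros)
 define f' where "f' x = (k * ?p (i + 2) j x + (- k * real i) * ?p (i + 1) j x) + ((- k) * ?p i (j + 2) x + (k * real j) * ?p i (j + 1) x)" for x
 have "(?p i j has_real_derivative f' x) (at x)" for x
  using DERIV_mult[OF d1[of x] d2[of x]] unfolding f'_def by (simp add: algebra_simps)
 moreover have "smooth_class a b k f'"
  unfolding f'_def[abs_def] by (intro smooth_class.add smooth_class.scale smooth_class.base)
 ultimately show ?case by blast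
next
 case (add f g)
 then obtain f' g' where "smooth_class a b k f'" "\<forall>x. (f has_real_derivative f' x) (at x)"
  "smooth_class a b k g'" "\<forall>x. (g has_real_derivative g' x) (at x)" by blast
 then show ?case by (intro exI[of _ "%x. f' x + g' x"]) (auto intro: smooth_class.add DERIV_add)
next
 case (scale f c)
 then obtain f' where "smooth_class a b k f'" "\<forall>x. (f has_real_derivative f' x) (at x)" by blast
 then show ?case by (intro exI[of _ "%x. c * f' x"]) (auto intro: smooth_class.scale DERIV_cmult)
qed

lemma smooth_class_differentiable:
 assumes "smooth_class a b k f"
 shows "(deriv ^^ n) f differentiable (at x)"
proof -
 have "smooth_class a b k ((deriv ^^ n) f)"
 proof (induction n)
  case (Suc n)
  then obtain f' where f': "smooth_class a b k f'" "\<forall>x. ((deriv ^^ n) f has_real_derivative f' x) (at x)"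
   using smooth_class_derivative by blast
  have "deriv ((deriv ^^ n) f) = f'" using f'(2) by (auto intro!: DERIV_imp_deriv)
  then show ?case using f'(1) by simp
 qed (use assms in simp)
 from smooth_class_derivative[OF this] show ?thesis
  unfolding real_differentiable_def by blast
qed

definition cutoff :: "real => real => nat => real => real" where
 "cutoff a b k x = flat_exp 0 (real (Suc k) * (x - a)) * flat_exp 0 (real (Suc k) * (b - x))"

lemma cutoff_outside: "x \<notin> {a<..<b} ==> cutoff a b k x = 0"
 by (auto simp: cutoff_def flat_exp_def zero_less_mult_iff)

lemma cutoff_bounds: "0 <= cutoff a b k x" "cutoff a b k x <= 1"
 using mult_mono[OF flat_bounds(3) flat_bounds(3) _ flat_bounds(1)] flat_bounds(1) by (auto simp: cutoff_def)

lemma cutoff_test_function: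
 assumes "{a..b} \<subseteq> U"
 shows "test_function U (cutoff a b k)"
proof -
 have "smooth_class a b (real (Suc k)) (cutoff a b k)"
  unfolding cutoff_def[abs_def] by (rule smooth_class.base)
 then have 1: "\<forall>n x. (deriv ^^ n) (cutoff a b k) differentiable (at x)" using smooth_class_differentiable by blast
 have "{x. cutoff a b k x ~= 0} \<subseteq> {a..b}"
 proof
  fix x assume "x \<in> {x. cutoff a b k x ~= 0}"
  then have "x \<in> {a<..<b}" using cutoff_outside by blast
  then show "x \<in> {a..b}" by simp
 qed
 then have 2: "closure {x. cutoff a b k x ~= 0} \<subseteq> {a..b}" by (rule closure_minimal) simp
 have "compact (closure {x. cutoff a b k x ~= 0})"
  using compact_Int_closed[OF compact_Icc closed_closure, of a b "{x. cutoff a b k x ~= 0}"] 2 by (simp add: Int_absorb1)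
 then show ?thesis using 1 2 assms by (auto simp: test_function_def)
qed

lemma cutoff_tendsto:
 assumes "x \<in> {a<..<b}"
 shows "(%k. cutoff a b k x) \<longlonglongrightarrow> 1"
proof -
 have *: "(%k. flat_exp 0 (real (Suc k) * c)) \<longlonglongrightarrow> 1" if c: "0 < c" for c
 proof -
  have "(%k. exp (- (inverse (real (Suc k)) * inverse c))) \<longlonglongrightarrow> exp (- (0 * inverse c))"
   by (intro tendsto_exp tendsto_minus tendsto_mult LIMSEQ_inverse_real_of_nat tendsto_const)
  moreover have "flat_exp 0 (real (Suc k) * c) = exp (- (inverse (real (Suc k)) * inverse c))" for k
  proof -
   have "0 < real (Suc k) * c" using c by simp
   then show ?thesis by (simp only: flat_exp_def if_True power_0 mult_1_right inverse_mult_distrib)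
  qed
  ultimately show ?thesis by simp
 qed
 have "(%k. cutoff a b k x) \<longlonglongrightarrow> 1 * 1" unfolding cutoff_def by (intro tendsto_mult *) (use assms in auto)
 then show ?thesis by simp
qed

text \<open>Half-lines generate the Borel sets and are closed under intersection, so the integral of \<open>h\<close> vanishes on all Borel sets.\<close>

lemma zero_on_intervals_imp_AE_zero:
 fixes h :: "real => real"
 assumes hi: "integrable lborel h" and z: "!!c. (LBINT x:{..c}. h x) = 0"
 shows "AE x in lborel. h x = 0"
proof -
 have hs: "lint A h" if "A \<in> sets borel" for A
  unfolding set_integrable_def by (rule integrable_mult_indicator) (use that hi in auto)
 have all: "(LBINT x. h x) = 0"
 proof -
  have "(%n. LBINT x:{..real n}. h x) \<longlonglongrightarrow> (LBINT x. h x)"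
   unfolding set_lebesgue_integral_def
  proof (rule integral_dominated_convergence[where w = "%x. abs (h x)"])
   show "AE x in lborel. (%n. indicat_real {..real n} x *\<^sub>R h x) \<longlonglongrightarrow> h x"
   proof (rule AE_I2)
    fix x
    obtain N where N: "x <= real N" using real_arch_simple by blast
    show "(%n. indicat_real {..real n} x *\<^sub>R h x) \<longlonglongrightarrow> h x"
     by (rule tendsto_eventually) (use N in \<open>auto simp: eventually_sequentially indicator_def intro!: exI[of _ N]\<close>)
   qed
   show "AE x in lborel. norm (indicat_real {..real n} x *\<^sub>R h x) <= abs (h x)" for n by (auto simp: indicator_def)
  qed (use hi hs in \<open>auto simp: set_integrable_def\<close>)
  then have "(%n. 0) \<longlonglongrightarrow> (LBINT x. h x)" unfolding z .
  then show ?thesis by (simp add: LIMSEQ_const_iff)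
 qed
 have "(LINT x:A|lborel. h x) = 0" if "A \<in> sets borel" for A
 proof -
  have A: "A \<in> sigma_sets UNIV (range (%c::real. {..c}))" using that by (simp add: borel_eq_atMost)
  have "{..c} \<inter> {..d} = {..min c d}" for c d :: real by auto
  then have stable: "Int_stable (range (%c::real. {..c}))" by (auto simp: Int_stable_def)
  have sub: "range (%c::real. {..c}) \<subseteq> Pow UNIV" by simp
  show ?thesis
  proof (induction rule: sigma_sets_induct_disjoint[OF stable sub A])
   case (1 A)
   then show ?case using z by auto
  next
   case 2
   show ?case by (simp add: set_lebesgue_integral_def)
  next
   case compl: (3 A)
   then have A: "A \<in> sets borel" by (simp add: borel_eq_atMost)
   have "(LINT x:UNIV - A|lborel. h x) = (LBINT x. h x - indicator A x *\<^sub>R h x)"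
    unfolding set_lebesgue_integral_def by (intro integral_cong) (auto simp: indicator_def)
   also have "... = (LBINT x. h x) - (LINT x:A|lborel. h x)"
    unfolding set_lebesgue_integral_def using hi hs[OF A] by (intro integral_diff) (auto simp: set_integrable_def)
   finally show ?case using all compl by simp
  next
   case union: (4 A)
   then have A: "A i \<in> sets borel" for i by (auto simp: borel_eq_atMost)
   have "(LINT x:(\<Union>i. A i)|lborel. h x) = (\<Sum>i. (LINT x:(A i)|lborel. h x))"
    by (rule lebesgue_integral_countable_add) (use A union hs in \<open>auto simp: disjoint_family_on_def\<close>)
   then show ?case using union by simp
  qed
 qed
 then show ?thesis using density_unique_real[OF hi, of "%_. 0"] by simp
qed

text \<open>The cutoffs of a compact interval in \<open>U\<close> converge to its indicator, so \<open>h\<close> has integral zero over all these intervals; countably many of them with rational endpoints cover \<open>U\<close>.\<close>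

lemma fundamental_lemma:
 fixes h :: "real => real"
 assumes U: "open U" and hl: "locally_integrable_on h U"
  and z: "!!\<phi>. test_function U \<phi> ==> (LINT x:U|lebesgue. h x * \<phi> x) = 0"
 shows "AE x in lebesgue. x \<in> U --> h x = 0"
proof -
 have hi: "set_integrable lebesgue {a..b} h" if "{a..b} \<subseteq> U" for a b
  using hl that by (auto simp: locally_integrable_on_def)
 have ne: "AE x in lebesgue. x ~= c" for c :: real by (rule AE_completion) (rule AE_lborel_singleton)
 have int0: "(LINT x:{a..b}|lebesgue. h x) = 0" if ab: "{a..b} \<subseteq> U" for a b
 proof -
  have "(%k. \<integral>x. indicator {a..b} x *\<^sub>R h x * cutoff a b k x \<partial>lebesgue) \<longlonglongrightarrow> (\<integral>x. indicator {a..b} x *\<^sub>R h x \<partial>lebesgue)"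
  proof (rule integral_dominated_convergence[where w = "%x. abs (indicator {a..b} x *\<^sub>R h x)"])
   have cm: "cutoff a b k \<in> meas lebesgue" for k
   proof -
    have "conti (cutoff a b k)"
    proof (rule differentiable_imp_continuous_on)
     have "(deriv ^^ 0) (cutoff a b k) differentiable (at x)" for x
      using cutoff_test_function[OF ab, of k] unfolding test_function_def by blast
     then show "cutoff a b k differentiable_on UNIV" by (simp add: differentiable_on_def)
    qed
    then have "cutoff a b k \<in> meas borel" by (rule borel_measurable_continuous_onI)
    then show ?thesis by (intro measurable_completion) simp
   qed
   have hm: "(%x. indicator {a..b} x *\<^sub>R h x) \<in> meas lebesgue"
    using hi[OF ab] unfolding set_integrable_def by (rule borel_measurable_integrable)
   show "(%x. indicator {a..b} x *\<^sub>R h x * cutoff a b k x) \<in> meas lebesgue" for k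
    by (rule borel_measurable_times[OF hm cm])
   show "(%x. indicator {a..b} x *\<^sub>R h x) \<in> meas lebesgue" by (rule hm)
   show "integrable lebesgue (%x. abs (indicator {a..b} x *\<^sub>R h x))"
    using hi[OF ab] unfolding set_integrable_def by (rule integrable_abs)
   show "AE x in lebesgue. (%k. indicator {a..b} x *\<^sub>R h x * cutoff a b k x) \<longlonglongrightarrow> indicator {a..b} x *\<^sub>R h x"
    using ne[of a] ne[of b]
   proof eventually_elim
    case (elim x)
    show ?case
    proof (cases "x \<in> {a..b}")
     case True
     then have "x \<in> {a<..<b}" using elim by auto
     from tendsto_mult[OF tendsto_const cutoff_tendsto[OF this], of "indicator {a..b} x *\<^sub>R h x"] show ?thesis by simp
    qed simp
   qed
   have "abs (cutoff a b k x) <= 1" for k x using cutoff_bounds[of a b k x] by simp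
   then show "AE x in lebesgue. norm (indicator {a..b} x *\<^sub>R h x * cutoff a b k x) <= abs (indicator {a..b} x *\<^sub>R h x)" for k
    by (intro AE_I2) (simp add: abs_mult mult_left_le)
  qed
  moreover have "(\<integral>x. indicator {a..b} x *\<^sub>R h x * cutoff a b k x \<partial>lebesgue) = 0" for k
  proof -
   have "(\<integral>x. indicator {a..b} x *\<^sub>R h x * cutoff a b k x \<partial>lebesgue) = (LINT x:U|lebesgue. h x * cutoff a b k x)"
    unfolding set_lebesgue_integral_def
   proof (rule integral_cong[OF refl])
    fix x
    show "indicator {a..b} x *\<^sub>R h x * cutoff a b k x = indicator U x *\<^sub>R (h x * cutoff a b k x)"
    proof (cases "x \<in> {a<..<b}")
     case True
     then have "x \<in> U" "x \<in> {a..b}" using ab by auto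
     then show ?thesis by simp
    next
     case False
     then show ?thesis by (simp add: cutoff_outside)
    qed
   qed
   then show ?thesis using z[OF cutoff_test_function[OF ab]] by simp
  qed
  ultimately have "(%k. 0) \<longlonglongrightarrow> (LINT x:{a..b}|lebesgue. h x)" by (simp add: set_lebesgue_integral_def)
  then show ?thesis by (simp add: LIMSEQ_const_iff)
 qed
 have cell: "AE x in lborel. x \<in> {a..b} --> h x = 0" if ab: "{a..b} \<subseteq> U" for a b
 proof -
  have i: "integrable lebesgue (%x. indicator {a..b} x *\<^sub>R h x)" using hi[OF ab] by (simp add: set_integrable_def)
  obtain h' where h': "h' \<in> meas lborel" "AE x in lborel. indicator {a..b} x *\<^sub>R h x = h' x"
   using completion_ex_borel_measurable_real[OF borel_measurable_integrable[OF i]] by blast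
  have ae: "AE x in lebesgue. indicator {a..b} x *\<^sub>R h x = h' x" by (rule AE_completion[OF h'(2)])
  have hm: "h' \<in> meas lebesgue" using h'(1) by (rule measurable_completion)
  have "integrable lebesgue h'"
   by (rule integrable_cong_AE_imp[OF i hm]) (use ae in eventually_elim, simp)
  then have hi': "integrable lborel h'" using integrable_completion[OF h'(1)] by simp
  have "(LBINT x:{..c}. h' x) = 0" for c
  proof -
   have mm: "(%x. indicator {..c} x *\<^sub>R h' x) \<in> meas lborel" using h'(1) by measurable
   have "(LBINT x:{..c}. h' x) = (\<integral>x. indicator {..c} x *\<^sub>R h' x \<partial>lebesgue)"
    unfolding set_lebesgue_integral_def by (rule integral_completion[OF mm, symmetric])
   also have "... = (\<integral>x. indicator {..c} x *\<^sub>R (indicator {a..b} x *\<^sub>R h x) \<partial>lebesgue)"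
   proof (rule integral_cong_AE)
    show "(%x. indicator {..c} x *\<^sub>R h' x) \<in> meas lebesgue" by (rule measurable_completion[OF mm])
    show "(%x. indicator {..c} x *\<^sub>R (indicator {a..b} x *\<^sub>R h x)) \<in> meas lebesgue"
     by (rule borel_measurable_scaleR[OF borel_measurable_indicator borel_measurable_integrable[OF i]]) simp
   qed (use ae in eventually_elim, simp)
   also have "... = (LINT x:{a..min b c}|lebesgue. h x)"
    unfolding set_lebesgue_integral_def by (intro integral_cong) (auto simp: indicator_def)
   also have "... = 0" by (rule int0) (use ab in auto)
   finally show ?thesis .
  qed
  from zero_on_intervals_imp_AE_zero[OF hi' this] h'(2) show ?thesis
   by eventually_elim (auto simp: indicator_def)
 qed
 define J where "J = {p \<in> \<rat> \<times> \<rat>. {fst p..snd p} \<subseteq> U}"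
 have J: "countable J" unfolding J_def by (rule countable_Collect) (intro countable_SIGMA countable_rat)
 have "\<forall>p\<in>J. AE x in lborel. x \<in> {fst p..snd p} --> h x = 0"
 proof
  fix p assume "p \<in> J"
  then show "AE x in lborel. x \<in> {fst p..snd p} --> h x = 0" by (intro cell) (simp add: J_def)
 qed
 then have "AE x in lborel. \<forall>p\<in>J. x \<in> {fst p..snd p} --> h x = 0" unfolding AE_ball_countable[OF J] .
 then have "AE x in lborel. x \<in> U --> h x = 0"
 proof eventually_elim
  case (elim x)
  show ?case
  proof
   assume x: "x \<in> U"
   obtain e where e: "0 < e" "ball x e \<subseteq> U" using U x openE by blast
   obtain p where p: "p \<in> \<rat>" "x - e < p" "p < x" using Rats_dense_in_real[of "x - e" x] e by auto
   obtain q where q: "q \<in> \<rat>" "x < q" "q < x + e" using Rats_dense_in_real[of x "x + e"] e by auto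
   note pq = p q
   have "{p..q} \<subseteq> ball x e" using pq by (auto simp: dist_real_def)
   then have "(p, q) \<in> J" using pq e by (auto simp: J_def)
   then have "x \<in> {p..q} --> h x = 0" using elim by force
   then show "h x = 0" using pq by simp
  qed
 qed
 then show ?thesis by (rule AE_completion)
qed

lemma test_function_cont:
 assumes "test_function U \<phi>"
 shows "(\<phi> has_real_derivative deriv \<phi> x) (at x)" "conti \<phi>" "conti (deriv \<phi>)"
  "x \<notin> U ==> \<phi> x = 0" "x \<notin> U ==> deriv \<phi> x = 0"
proof -
 have d: "(deriv ^^ n) \<phi> differentiable (at x)" for n x using assms unfolding test_function_def by blast
 have c: "conti ((deriv ^^ n) \<phi>)" for n
  by (rule differentiable_imp_continuous_on) (use d in \<open>auto simp: differentiable_on_def\<close>)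
 show "conti \<phi>" "conti (deriv \<phi>)" using c[of 0] c[of 1] by simp_all
 show D: "(\<phi> has_real_derivative deriv \<phi> x) (at x)"
  using d[of 0 x] by (simp add: DERIV_deriv_iff_real_differentiable)
 assume x: "x \<notin> U"
 have cl: "x \<notin> closure {x. \<phi> x ~= 0}" using assms x by (auto simp: test_function_def)
 have z: "\<phi> y = 0" if "y \<notin> closure {x. \<phi> x ~= 0}" for y
  using that closure_subset[of "{x. \<phi> x ~= 0}"] by auto
 show "\<phi> x = 0" by (rule z[OF cl])
 have op: "open (- closure {x. \<phi> x ~= 0})" by (rule open_Compl) simp
 have d0: "((%_. 0) has_real_derivative 0) (at x)" by simp
 have "(\<phi> has_real_derivative 0) (at x)"
 proof (rule has_field_derivative_transform_within_open[OF d0 op])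
  show "x \<in> - closure {x. \<phi> x ~= 0}" using cl by simp
  show "0 = \<phi> y" if "y \<in> - closure {x. \<phi> x ~= 0}" for y
   by (rule z[symmetric]) (use that in simp)
 qed
 then show "deriv \<phi> x = 0" by (rule DERIV_imp_deriv)
qed

lemma test_function_product_integrable:
 assumes U: "open U" and h: "locally_integrable_on h U" and \<phi>: "test_function U \<phi>"
 shows "set_integrable lebesgue U (%x. h x * \<phi> x)" "set_integrable lebesgue U (%x. h x * deriv \<phi> x)"
proof -
 define K where "K = closure {x. \<phi> x ~= 0}"
 have K: "compact K" "K \<subseteq> U" using \<phi> by (auto simp: K_def test_function_def)
 have hK: "integrable lebesgue (%x. indicator K x *\<^sub>R h x)"
  using h K by (auto simp: locally_integrable_on_def set_integrable_def)
 have main: "set_integrable lebesgue U (%x. h x * \<psi> x)" if c: "conti \<psi>" and z: "!!x. x \<notin> K ==> \<psi> x = 0" for \<psi>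
 proof -
  have "bounded (\<psi> ` K)" by (rule compact_imp_bounded[OF compact_continuous_image[OF continuous_on_subset[OF c] K(1)]]) simp
  then obtain B where "\<forall>x\<in>K. abs (\<psi> x) <= B" unfolding bounded_iff by auto
  then have B: "abs (\<psi> x) <= B" if "x \<in> K" for x using that by blast
  have e: "indicator U x *\<^sub>R (h x * \<psi> x) = (indicator K x *\<^sub>R h x) * \<psi> x" for x
   using z[of x] K(2) by (cases "x \<in> K") (auto simp: indicator_def)
  show ?thesis unfolding set_integrable_def e
  proof (rule integrable_bound)
   show "integrable lebesgue (%x. B * (indicator K x *\<^sub>R h x))" using hK by (rule integrable_mult_right)
   have "\<psi> \<in> meas borel" by (rule borel_measurable_continuous_onI[OF c])
   then have "\<psi> \<in> meas lebesgue" by (intro measurable_completion) simp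
   then show "(%x. (indicator K x *\<^sub>R h x) * \<psi> x) \<in> meas lebesgue"
    by (rule borel_measurable_times[OF borel_measurable_integrable[OF hK]])
   have "abs (h x * \<psi> x) <= abs (B * h x)" if "x \<in> K" for x
    using mult_left_mono[OF order_trans[OF B[OF that] abs_ge_self], of "abs (h x)"] by (simp add: abs_mult mult.commute)
   then show "AE x in lebesgue. norm ((indicator K x *\<^sub>R h x) * \<psi> x) <= norm (B * (indicator K x *\<^sub>R h x))"
    by (intro AE_I2) (auto simp: indicator_def)
  qed
 qed
 have \<phi>K: "test_function K' \<phi>" if "K \<subseteq> K'" for K' using \<phi> that by (auto simp: test_function_def K_def)
 show "set_integrable lebesgue U (%x. h x * \<phi> x)" "set_integrable lebesgue U (%x. h x * deriv \<phi> x)"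
  using main[OF test_function_cont(2)[OF \<phi>] test_function_cont(4)[OF \<phi>K[OF order.refl]]]
   main[OF test_function_cont(3)[OF \<phi>] test_function_cont(5)[OF \<phi>K[OF order.refl]]] by simp_all
qed

lemma weak_derivative_unique:
 assumes U: "open U" and 1: "has_weak_derivative_on F f U" and 2: "has_weak_derivative_on G g U"
  and eq: "AE x in lebesgue. x \<in> U --> F x = G x"
 shows "AE x in lebesgue. x \<in> U --> f x = g x"
proof -
 have l: "locally_integrable_on F U" "locally_integrable_on G U" "locally_integrable_on f U" "locally_integrable_on g U"
  using 1 2 by (auto simp: has_weak_derivative_on_def)
 have "AE x in lebesgue. x \<in> U --> f x - g x = 0"
 proof (rule fundamental_lemma[OF U])
  show "locally_integrable_on (%x. f x - g x) U"
   using l(3,4) by (auto simp: locally_integrable_on_def intro!: set_integral_diff(1))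
  fix \<phi> assume \<phi>: "test_function U \<phi>"
  note i = test_function_product_integrable[OF U _ \<phi>]
  have "(LINT x:U|lebesgue. F x * deriv \<phi> x) = (LINT x:U|lebesgue. G x * deriv \<phi> x)"
   unfolding set_lebesgue_integral_def
  proof (rule integral_cong_AE)
   show "(%x. indicator U x *\<^sub>R (F x * deriv \<phi> x)) \<in> meas lebesgue" "(%x. indicator U x *\<^sub>R (G x * deriv \<phi> x)) \<in> meas lebesgue"
    using i(2)[OF l(1)] i(2)[OF l(2)] by (auto simp: set_integrable_def)
  qed (use eq in eventually_elim, auto simp: indicator_def)
  then have "(LINT x:U|lebesgue. f x * \<phi> x) = (LINT x:U|lebesgue. g x * \<phi> x)"
   using 1 2 \<phi> by (simp add: has_weak_derivative_on_def)
  then show "(LINT x:U|lebesgue. (f x - g x) * \<phi> x) = 0"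
   using set_integral_diff(2)[OF i(1)[OF l(3)] i(1)[OF l(4)]] by (simp add: left_diff_distrib)
 qed
 then show ?thesis by eventually_elim simp
qed

lemma set_integrable_lborel_imp_lebesgue:
 fixes f :: "real => real"
 assumes "lint A f"
 shows "set_integrable lebesgue A f" "(LINT x:A|lebesgue. f x) = (LINT x:A|lborel. f x)"
proof -
 have "(%x. indicator A x *\<^sub>R f x) \<in> meas lborel" using assms unfolding set_integrable_def by (rule borel_measurable_integrable)
 from integrable_completion[OF this] integral_completion[OF this]
 show "set_integrable lebesgue A f" "(LINT x:A|lebesgue. f x) = (LINT x:A|lborel. f x)"
  using assms by (simp_all add: set_integrable_def set_lebesgue_integral_def)
qed

text \<open>Integration by parts, that is, \<open>AC_product\<close>; a test function vanishes at the endpoints, which do not belong to the open set \<open>U\<close>.\<close>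

lemma AC_has_weak_derivative:
 assumes U: "open U" "U \<subseteq> {a..b}" and ab: "a <= b" and d: "lint {a..b} d"
  and G: "!!x. x \<in> {a..b} ==> G x = G a + (LBINT y:{a..x}. d y)"
 shows "has_weak_derivative_on G d U"
proof -
 have "continuous_on {a..b} (%x. G a + (LBINT y:{a..x}. d y))"
  by (intro continuous_intros set_integral_Icc_continuous d)
 then have Gc: "continuous_on {a..b} G" by (rule continuous_on_eq) (simp add: G[symmetric])
 have Gi: "lint {a..b} G" by (rule borel_integrable_atLeastAtMost'[OF Gc])
 have loc: "locally_integrable_on f U" if "lint {a..b} f" for f
  unfolding locally_integrable_on_def
 proof (intro allI impI)
  fix K assume K: "compact K & K \<subseteq> U"
  then have "K \<in> sets borel" using borel_compact by blast
  then have "lint K f" by (intro set_integrable_subset[OF that]) (use K U in auto)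
  then show "set_integrable lebesgue K f" by (rule set_integrable_lborel_imp_lebesgue(1))
 qed
 have nU: "a \<notin> U" "b \<notin> U"
 proof -
  have "interior {a..b} = {a<..<b}" by simp
  then show "a \<notin> U" "b \<notin> U" using interior_maximal[OF U(2,1)] by auto
 qed
 show ?thesis unfolding has_weak_derivative_on_def
 proof (intro conjI allI impI loc Gi d)
  fix \<phi> assume \<phi>: "test_function U \<phi>"
  note T = test_function_cont[OF \<phi>]
  have c': "continuous_on S (deriv \<phi>)" "continuous_on S \<phi>" for S using T(2,3) continuous_on_subset by blast+
  have \<phi>eq: "\<phi> x = \<phi> a + (LBINT y:{a..x}. deriv \<phi> y)" if "x \<in> {a..b}" for x
  proof -
   have "(deriv \<phi> has_integral (\<phi> x - \<phi> a)) {a..x}"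
    by (rule fundamental_theorem_of_calculus)
      (use that T(1) in \<open>auto simp: has_real_derivative_iff_has_vector_derivative[symmetric] intro: has_field_derivative_at_within\<close>)
   then show ?thesis using LINT_Icc_eq_integral[OF T(3), of a x] by (simp add: integral_unique)
  qed
  have di: "lint {a..b} (deriv \<phi>)" by (rule set_integrable_continuous[OF T(3)])
  note P = AC_product[OF ab d di G \<phi>eq]
  have i1: "lint {a..b} (%x. d x * \<phi> x)" using set_integrable_continuous_mult[OF d c'(2)] by (simp add: mult.commute)
  have i2: "lint {a..b} (%x. G x * deriv \<phi> x)" using set_integrable_continuous_mult[OF Gi c'(1)] by (simp add: mult.commute)
  have s: "(LBINT x:{a..b}. d x * \<phi> x) + (LBINT x:{a..b}. G x * deriv \<phi> x) = 0"
   using P(2) set_integral_add(2)[OF i1 i2] T(4)[OF nU(1)] T(4)[OF nU(2)] by simp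
  have r: "(LINT x:U|lebesgue. f x) = (LBINT x:{a..b}. f x)" if "lint {a..b} f" "!!x. x \<notin> U ==> f x = 0" for f :: "real => real"
  proof -
   have "(LINT x:U|lebesgue. f x) = (LINT x:{a..b}|lebesgue. f x)"
    unfolding set_lebesgue_integral_def using that(2) U(2) by (intro integral_cong) (auto simp: indicator_def)
   then show ?thesis using set_integrable_lborel_imp_lebesgue(2)[OF that(1)] by simp
  qed
  have "(LINT x:U|lebesgue. G x * deriv \<phi> x) = (LBINT x:{a..b}. G x * deriv \<phi> x)" by (rule r[OF i2]) (simp add: T(5))
  moreover have "(LINT x:U|lebesgue. d x * \<phi> x) = (LBINT x:{a..b}. d x * \<phi> x)" by (rule r[OF i1]) (simp add: T(4))
  ultimately show "(LINT x:U|lebesgue. G x * deriv \<phi> x) = - (LINT x:U|lebesgue. d x * \<phi> x)" using s by simp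
 qed
qed

section \<open>The weak derivative of the expectation\<close>

lemma in_Lp_bounded:
 assumes U: "open U" "bounded U" and p: "0 < p" and f: "set_integrable lebesgue U f" and b: "!!x. x \<in> U ==> abs (f x) <= c"
 shows "in_Lp p U f"
proof -
 have fm: "(%x. indicator U x *\<^sub>R f x) \<in> meas lebesgue"
  using f unfolding set_integrable_def by (rule borel_measurable_integrable)
 have "emeasure lborel U < \<infinity>" by (rule emeasure_bounded_finite[OF U(2)])
 then have fin: "emeasure lebesgue U < \<infinity>" using U(1) by (simp add: emeasure_completion)
 have e: "indicator U x *\<^sub>R (abs (f x) powr p) = abs (indicator U x *\<^sub>R f x) powr p" for x
  using p by (auto simp: indicator_def)
 have "integrable lebesgue (%x. indicator U x *\<^sub>R (abs (f x) powr p))"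
 proof (rule integrable_le(1))
  show "integrable lebesgue (%x. indicator U x * (c powr p))"
   by (intro integrable_mult_left integrable_real_indicator) (use U fin in auto)
  show "(%x. indicator U x *\<^sub>R (abs (f x) powr p)) \<in> meas lebesgue"
   unfolding e using fm by measurable
  show "abs (indicator U x *\<^sub>R (abs (f x) powr p)) <= indicator U x * (c powr p)" for x
   using b p by (auto simp: indicator_def intro!: powr_mono2)
 qed
 then show ?thesis using fm unfolding in_Lp_def set_borel_measurable_def set_integrable_def by simp
qed

text \<open>Outside of \<open>U\<close> the parameter is replaced by a point of \<open>U\<close>, which gives measurability on the full product space and with it Fubini's theorem.\<close>

lemma jointly_measurable_on_extension:
 assumes F: "jointly_measurable_on M U F" and U: "open U" "u0 \<in> U"
 shows "(%p. F (if fst p \<in> U then fst p else u0) (snd p)) \<in> meas (borel \<Otimes>\<^sub>M M)"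
proof -
 have "(%x. if x \<in> U then x else u0) \<in> measurable borel (restrict_space borel U)"
  by (rule measurable_restrict_space2) (use U in \<open>auto intro!: measurable_If\<close>)
 then have "(%p. (if fst p \<in> U then fst p else u0, snd p)) \<in> measurable (borel \<Otimes>\<^sub>M M) (restrict_space borel U \<Otimes>\<^sub>M M)"
  by (intro measurable_Pair measurable_compose[OF measurable_fst] measurable_snd)
 from measurable_compose[OF this F[unfolded jointly_measurable_on_def]] show ?thesis by simp
qed

lemma jointly_measurable_on_restrict:
 assumes F: "jmeas M F"
 shows "jointly_measurable_on M U F"
proof -
 have "fst \<in> measurable (restrict_space borel U \<Otimes>\<^sub>M M) (borel :: real measure)"
 proof -
  have "(%x. x) \<in> measurable (restrict_space borel U) (borel :: real measure)" by (rule measurable_restrict_space1) simp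
  then show ?thesis by (rule measurable_compose[OF measurable_fst])
 qed
 then have "(%p. (fst p, snd p)) \<in> measurable (restrict_space borel U \<Otimes>\<^sub>M M) (borel \<Otimes>\<^sub>M M)"
  by (intro measurable_Pair measurable_snd)
 from measurable_compose[OF this F] show ?thesis by (simp add: jointly_measurable_on_def case_prod_beta)
qed

text \<open>The process \<open>G\<close> is the version of the field whose paths are absolutely continuous in \<open>x\<close>. Another version of the weak derivative \<open>D'\<close> belongs to another version \<open>G'\<close> of the field; by Fubini's theorem \<open>G'\<close> and \<open>G\<close> agree almost everywhere along almost every path, so uniqueness of weak derivatives applies path by path, and Fubini's theorem is used once more to return from paths to points.\<close>

lemma (in prob_space) weak_derivative_of_expectation:
 fixes F D :: "real => 'a => real" and \<Phi> \<Phi>' :: "real => real"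
 assumes ab: "a < b" and U: "open U" "U \<subseteq> {a..b}" and p: "0 < p"
  and Fm: "!!x. x \<in> {a..b} ==> F x \<in> meas M"
  and G0: "integrable M G0"
  and Dm: "jmeas M D"
  and D2: "!!x. integrable M (%w. (D x w)^2)" "!!x. (EE w. (D x w)^2) <= C"
  and Di: "AE w in M. lint {a..b} (%x. D x w)"
  and FG: "!!x. x \<in> {a..b} ==> AE w in M. F x w = G0 w + (LBINT s:{a..x}. D s w)"
  and d\<Phi>: "!!y. (\<Phi> has_real_derivative \<Phi>' y) (at y)"
  and b\<Phi>: "!!y. abs (\<Phi>' y) <= B" and l\<Phi>: "L-lipschitz_on UNIV \<Phi>'"
 shows "in_W1p p U (%x. \<integral>w. \<Phi> (F x w) \<partial>M)"
  "\<exists>D. has_weak_derivative_field M F D U"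
  "has_weak_derivative_field M F D' U ==> has_weak_derivative_on (%x. \<integral>w. \<Phi> (F x w) \<partial>M) g' U ==>
   AE x in lebesgue. x \<in> U --> integrable M (%w. \<Phi>' (F x w) * D' x w) & g' x = (EE w. \<Phi>' (F x w) * D' x w)"
proof -
 interpret P: pair_sigma_finite lborel M by unfold_locales
 have L0: "0 <= L" using l\<Phi> by (rule lipschitz_on_nonneg)
 have B0: "0 <= B" using b\<Phi>[of 0] by linarith
 have bU: "bounded U" by (rule bounded_subset[OF compact_imp_bounded[OF compact_Icc] U(2)])
 have lip: "abs (\<Phi>' y - \<Phi>' x) <= L * abs (y - x)" for x y using lipschitz_onD[OF l\<Phi>, of y x] by (simp add: dist_real_def)
 have mvt: "\<exists>c. \<Phi> y - \<Phi> x = \<Phi>' c * (y - x) & abs (c - x) <= abs (y - x)" for x y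
 proof -
  consider "x < y" | "y < x" | "x = y" by linarith
  then show ?thesis
  proof cases
   case 1
   then obtain c where "x < c" "c < y" "\<Phi> y - \<Phi> x = (y - x) * \<Phi>' c" using MVT2[OF 1, of \<Phi> \<Phi>'] d\<Phi> by auto
   then show ?thesis by (intro exI[of _ c]) (auto simp: mult.commute)
  next
   case 2
   then obtain c where "y < c" "c < x" "\<Phi> x - \<Phi> y = (x - y) * \<Phi>' c" using MVT2[OF 2, of \<Phi> \<Phi>'] d\<Phi> by auto
   then show ?thesis by (intro exI[of _ c]) (auto simp: algebra_simps)
  qed auto
 qed
 have taylor: "abs (\<Phi> y - \<Phi> x - \<Phi>' x * (y - x)) <= L * (y - x)^2" for x y
 proof -
  obtain c where c: "\<Phi> y - \<Phi> x = \<Phi>' c * (y - x)" "abs (c - x) <= abs (y - x)" using mvt by blast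
  have "abs (\<Phi> y - \<Phi> x - \<Phi>' x * (y - x)) = abs (\<Phi>' c - \<Phi>' x) * abs (y - x)"
   unfolding c(1) left_diff_distrib[symmetric] by (rule abs_mult)
  also have "... <= (L * abs (y - x)) * abs (y - x)"
   using order_trans[OF lip mult_left_mono[OF c(2) L0]] by (intro mult_right_mono) auto
  finally show ?thesis by (simp add: power2_eq_square)
 qed
 have \<Phi>c: "conti \<Phi>" by (rule DERIV_continuous_on) (rule d\<Phi>)
 have \<Phi>'c: "conti \<Phi>'" by (rule lipschitz_on_continuous_on[OF l\<Phi>])
 have [measurable]: "\<Phi> \<in> meas borel" "\<Phi>' \<in> meas borel"
  by (rule borel_measurable_continuous_onI, fact)+
 have G0m[measurable]: "G0 \<in> meas M" using G0 by auto
 note [measurable (raw)] = joint_measurable_compose[OF Dm]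
 define G where "G x w = G0 w + (LBINT s:{a..x}. D s w)" for x w
 have Gm'[measurable (raw)]: "(%p. G (h1 p) (h2 p)) \<in> meas N"
  if h[measurable]: "h1 \<in> meas N" "h2 \<in> measurable N M" for N :: "'c measure" and h1 h2
 proof -
  have ind: "indicator {a..x} r *\<^sub>R v = (if a <= r & r <= x then v else 0)" for x r v :: real by (simp add: indicator_def)
  show ?thesis unfolding G_def set_lebesgue_integral_def ind by measurable
 qed
 have Gm: "jmeas M G" by measurable
 have FGx: "AE w in M. F x w = G x w" if "x \<in> {a..b}" for x using FG[OF that] by (simp add: G_def)
 have D1: "integrable M (D x)" "(EE w. abs (D x w)) <= 1 + C" for x
 proof -
  have i: "integrable M (%w. 1 + (D x w)^2)" and m: "D x \<in> meas M" using D2(1) by (simp, measurable)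
  note le = integrable_le[OF i m abs_le_eps_square[of 1, simplified]]
  show "integrable M (D x)" by (rule le(1))
  show "(EE w. abs (D x w)) <= 1 + C" using le(2) D2[of x] by (simp add: prob_space)
 qed
 have Gi: "integrable M (G x)" for x
  unfolding G_def[abs_def] by (intro integrable_add G0 process_Fubini(1)[OF Dm D1(1) D1(2)])
 have \<Phi>Gi: "integrable M (%w. \<Phi> (G x w))" for x
 proof (rule integrable_le(1))
  show "integrable M (%w. abs (\<Phi> 0) + B * abs (G x w))" using Gi[of x] by simp
  show "(%w. \<Phi> (G x w)) \<in> meas M" by measurable
  show "abs (\<Phi> v) <= abs (\<Phi> 0) + B * abs v" for v
  proof -
   obtain c where "\<Phi> v - \<Phi> 0 = \<Phi>' c * (v - 0)" using mvt by blast
   then have "abs (\<Phi> v - \<Phi> 0) = abs (\<Phi>' c) * abs v" by (simp add: abs_mult)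
   also have "... <= B * abs v" by (intro mult_right_mono b\<Phi>) simp
   finally show ?thesis by linarith
  qed
 qed
 define f where "f x = (EE w. \<Phi> (F x w))" for x
 define g where "g x = (EE w. \<Phi>' (G x w) * D x w)" for x
 have fG: "f x = (EE w. \<Phi> (G x w))" if x: "x \<in> {a..b}" for x
  unfolding f_def
 proof (rule integral_cong_AE)
  have [measurable]: "F x \<in> meas M" by (rule Fm[OF x])
  show "(%w. \<Phi> (F x w)) \<in> meas M" by measurable
  show "(%w. \<Phi> (G x w)) \<in> meas M" by measurable
  show "AE w in M. \<Phi> (F x w) = \<Phi> (G x w)" using FGx[OF x] by eventually_elim simp
 qed
 have \<phi>m: "(%p. \<Phi>' (G (fst p) (snd p)) * D (fst p) (snd p)) \<in> meas (borel \<Otimes>\<^sub>M M)" by measurable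
 have le: "abs (\<Phi>' (G x w) * D x w) <= B * abs (D x w)" for x w unfolding abs_mult by (intro mult_right_mono b\<Phi>) simp
 have \<phi>i: "integrable M (%w. \<Phi>' (G x w) * D x w)" and \<phi>b: "(EE w. abs (\<Phi>' (G x w) * D x w)) <= B * (1 + C)" for x
 proof -
  have i: "integrable M (%w. B * abs (D x w))" and m: "(%w. \<Phi>' (G x w) * D x w) \<in> meas M" using D1(1)[of x] by (simp, measurable)
  show "integrable M (%w. \<Phi>' (G x w) * D x w)" by (rule integrable_le(1)[OF i m le])
  show "(EE w. abs (\<Phi>' (G x w) * D x w)) <= B * (1 + C)"
   using integrable_le(2)[OF i m le] mult_left_mono[OF D1(2)[of x] B0] by simp
 qed
 note PF = process_Fubini[where f = "%x w. \<Phi>' (G x w) * D x w", OF \<phi>m \<phi>i \<phi>b]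
 have gi: "lint {u..v} g" for u v unfolding g_def[abs_def] by (rule PF(4))
 have gb: "abs (g x) <= B * (1 + C)" for x
  unfolding g_def by (rule order_trans[OF integral_abs_bound \<phi>b])
 \<comment> \<open>the chain rule along almost every path, integrated\<close>
 have fg: "f x = f a + (LBINT s:{a..x}. g s)" if x: "x \<in> {a..b}" for x
 proof -
  have a: "a \<in> {a..b}" using ab by simp
  have "AE w in M. \<Phi> (G x w) = \<Phi> (G a w) + (LBINT s:{a..x}. \<Phi>' (G s w) * D s w)"
   using Di
  proof eventually_elim
   case (elim w)
   have d: "lint {a..x} (%s. D s w)" by (rule set_integrable_subset[OF elim]) (use x in auto)
   show ?case
    by (rule AC_composition(2)[where G = "%s. G s w" and d = "%s. D s w" and L = L, OF _ d L0 _ taylor lip])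
      (use x LBINT_point[of a "%s. D s w"] in \<open>auto simp: G_def\<close>)
  qed
  then have "(EE w. \<Phi> (G x w)) = (EE w. \<Phi> (G a w) + (LBINT s:{a..x}. \<Phi>' (G s w) * D s w))"
   by (rule integral_cong_AE[rotated 2])
     (use \<Phi>Gi[of x] \<Phi>Gi[of a] PF(1)[of a x] in \<open>auto intro!: borel_measurable_add borel_measurable_integrable\<close>)
  also have "... = (EE w. \<Phi> (G a w)) + (LBINT s:{a..x}. g s)"
   using \<Phi>Gi[of a] PF(1)[of a x] PF(2)[of a x] by (simp add: g_def)
  finally show ?thesis using fG[OF x] fG[OF a] by simp
 qed
 have wf: "has_weak_derivative_on f g U" by (rule AC_has_weak_derivative[OF U less_imp_le[OF ab] gi fg])
 have "continuous_on {a..b} (%x. f a + (LBINT y:{a..x}. g y))"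
  by (intro continuous_intros set_integral_Icc_continuous gi)
 then have fc: "continuous_on {a..b} f" by (rule continuous_on_eq) (simp add: fg[symmetric])
 then have fi: "lint {a..b} f" by (rule borel_integrable_atLeastAtMost')
 have toU: "set_integrable lebesgue U h" if "lint {a..b} h" for h :: "real => real"
  by (rule set_integrable_lborel_imp_lebesgue(1), rule set_integrable_subset[OF that]) (use U in auto)
 have "bounded (f ` {a..b})" by (rule compact_imp_bounded[OF compact_continuous_image[OF fc]]) simp
 then obtain c where "\<forall>x\<in>{a..b}. abs (f x) <= c" unfolding bounded_iff by auto
 then have fb: "abs (f x) <= c" if "x \<in> U" for x using that U(2) by blast
 have "in_W1p p U f"
  unfolding in_W1p_def using in_Lp_bounded[OF U(1) bU p toU[OF fi] fb] in_Lp_bounded[OF U(1) bU p toU[OF gi] gb] wf by blast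
 then show "in_W1p p U (%x. \<integral>w. \<Phi> (F x w) \<partial>M)" by (simp add: f_def[abs_def])
 have wG: "AE w in M. has_weak_derivative_on (%x. G x w) (%x. D x w) U"
  using Di
 proof eventually_elim
  case (elim w)
  show ?case by (rule AC_has_weak_derivative[OF U less_imp_le[OF ab] elim]) (use LBINT_point[of a "%s. D s w"] in \<open>simp add: G_def\<close>)
 qed
 have "has_weak_derivative_field M F D U"
  unfolding has_weak_derivative_field_def
 proof (intro conjI exI[of _ G] ballI)
  show "jointly_measurable_on M U D" "jointly_measurable_on M U G" by (rule jointly_measurable_on_restrict, fact)+
  show "AE w in M. G x w = F x w" if "x \<in> U" for x
   using FGx[of x] that U(2) by (auto simp: eq_commute)
 qed (rule wG)
 then show "\<exists>D. has_weak_derivative_field M F D U" by blast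
 assume D': "has_weak_derivative_field M F D' U" and g': "has_weak_derivative_on (%x. \<integral>w. \<Phi> (F x w) \<partial>M) g' U"
 show "AE x in lebesgue. x \<in> U --> integrable M (%w. \<Phi>' (F x w) * D' x w) & g' x = (EE w. \<Phi>' (F x w) * D' x w)"
 proof (cases "U = {}")
  case False
  then obtain u0 where u0: "u0 \<in> U" by blast
  obtain G' where G': "jointly_measurable_on M U G'" "!!x. x \<in> U ==> AE w in M. G' x w = F x w"
   "AE w in M. has_weak_derivative_on (%x. G' x w) (%x. D' x w) U"
   using D' unfolding has_weak_derivative_field_def by blast
  have D'j: "jointly_measurable_on M U D'" using D' by (simp add: has_weak_derivative_field_def)
  define \<pi> where "\<pi> x = (if x \<in> U then x else u0)" for x
  have G'm: "(%p. G' (\<pi> (fst p)) (snd p)) \<in> meas (borel \<Otimes>\<^sub>M M)"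
   unfolding \<pi>_def by (rule jointly_measurable_on_extension[OF G'(1) U(1) u0])
  have D'm: "(%p. D' (\<pi> (fst p)) (snd p)) \<in> meas (borel \<Otimes>\<^sub>M M)"
   unfolding \<pi>_def by (rule jointly_measurable_on_extension[OF D'j U(1) u0])
  have comm: "(AE x in lborel. AE w in M. x \<in> U --> H1 x w = H2 x w) \<longleftrightarrow> (AE w in M. AE x in lborel. x \<in> U --> H1 x w = H2 x w)"
   if H1[measurable]: "(%p. H1 (\<pi> (fst p)) (snd p)) \<in> meas (borel \<Otimes>\<^sub>M M)" and H2[measurable]: "jmeas M H2"
   for H1 H2 :: "real => 'a => real"
  proof -
   have [measurable]: "U \<in> sets borel" using U(1) by simp
   have "{p \<in> space (borel \<Otimes>\<^sub>M M). fst p \<in> U --> H1 (\<pi> (fst p)) (snd p) = H2 (fst p) (snd p)} \<in> sets (borel \<Otimes>\<^sub>M M)"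
    by measurable
   moreover have "sets (lborel \<Otimes>\<^sub>M M) = sets (borel \<Otimes>\<^sub>M M)" by (intro sets_pair_measure_cong) auto
   moreover have "space (lborel \<Otimes>\<^sub>M M) = space ((borel :: real measure) \<Otimes>\<^sub>M M)" by (simp add: space_pair_measure)
   ultimately have "{p \<in> space (lborel \<Otimes>\<^sub>M M). fst p \<in> U --> H1 (\<pi> (fst p)) (snd p) = H2 (fst p) (snd p)} \<in> sets (lborel \<Otimes>\<^sub>M M)" by simp
   from P.AE_commute[of "%x w. x \<in> U --> H1 (\<pi> x) w = H2 x w", OF this] show ?thesis by (simp add: \<pi>_def cong: imp_cong)
  qed
  have "AE x in lborel. AE w in M. x \<in> U --> G' x w = G x w"
  proof (rule AE_I2)
   fix x
   show "AE w in M. x \<in> U --> G' x w = G x w"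
   proof (cases "x \<in> U")
    case True
    then have "x \<in> {a..b}" using U(2) by blast
    from G'(2)[OF True] FGx[OF this] show ?thesis by eventually_elim simp
   qed simp
  qed
  then have "AE w in M. AE x in lborel. x \<in> U --> G' x w = G x w" unfolding comm[OF G'm Gm] .
  then have "AE w in M. AE x in lborel. x \<in> U --> D' x w = D x w"
   using G'(3) wG
  proof eventually_elim
   case (elim w)
   have "AE x in lebesgue. x \<in> U --> D' x w = D x w"
    by (rule weak_derivative_unique[OF U(1) elim(2,3) AE_completion[OF elim(1)]])
   then show ?case by (simp add: AE_completion_iff)
  qed
  then have "AE x in lborel. AE w in M. x \<in> U --> D' x w = D x w" unfolding comm[OF D'm Dm] .
  then have "AE x in lebesgue. AE w in M. x \<in> U --> D' x w = D x w" by (rule AE_completion)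
  moreover have "AE x in lebesgue. x \<in> U --> g' x = g x"
   by (rule weak_derivative_unique[OF U(1) g' wf]) (simp add: f_def)
  ultimately show ?thesis
  proof eventually_elim
   case (elim x)
   show ?case
   proof
    assume x: "x \<in> U"
    then have xab: "x \<in> {a..b}" using U(2) by blast
    have [measurable]: "F x \<in> meas M" by (rule Fm[OF xab])
    have "(%w. D' (\<pi> x) w) \<in> meas M"
     using measurable_compose[OF measurable_Pair1' D'm, of x] by simp
    then have [measurable]: "D' x \<in> meas M" using x by (simp add: \<pi>_def)
    have m: "(%w. \<Phi>' (F x w) * D' x w) \<in> meas M" by measurable
    have ae: "AE w in M. \<Phi>' (G x w) * D x w = \<Phi>' (F x w) * D' x w"
     using elim(1) FGx[OF xab] by eventually_elim (use x in simp)
    have "integrable M (%w. \<Phi>' (F x w) * D' x w)" by (rule integrable_cong_AE_imp[OF \<phi>i m]) (use ae in eventually_elim, simp)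
    moreover have "g x = (EE w. \<Phi>' (F x w) * D' x w)"
     unfolding g_def by (rule integral_cong_AE[OF borel_measurable_integrable[OF \<phi>i] m ae])
    ultimately show "integrable M (%w. \<Phi>' (F x w) * D' x w) & g' x = (EE w. \<Phi>' (F x w) * D' x w)"
     using elim(2) x by simp
   qed
  qed
 qed simp
qed

text \<open>The larger of the two Lipschitz constants serves for both hypotheses.\<close>

lemma mckean_drift_exists:
 assumes T: "0 < T" and M: "prob_space M" and bm: "brownian_motion M T B"
  and dec: "decomposable_drift T b" and lip: "lipschitz_in_law T b"
 obtains be bh bt K C where "mckean_drift M T B be b bh bt K C"
proof -
 interpret prob_space M by fact
 obtain be where be: "!!w. conti (%t. be t w)" "!!t. be t \<in> meas M" "AE w in M. \<forall>t\<in>{0..T}. be t w = B t w"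
 proof (rule continuous_version[where T = T and X = B and M = M and B = B], goal_cases)
  case 2
  then show ?case by (intro brownian_adapted) auto
 next
  case 3
  then show ?case using bm by (simp add: brownian_motion_def)
 next
  case 4
  show ?case using bm by (simp add: brownian_motion_def)
 next
  case (5 Z)
  show thesis by (rule 5(1)[OF 5(2) 5(4) 5(5)])
 qed (use T in auto)
 obtain bh bt where b: "drift_measurable T bh" "\<forall>t\<in>{0..T}. \<forall>y. \<forall>\<mu>\<in>P1. b t y \<mu> = bh t y \<mu> + bt t y \<mu>"
  "\<exists>K. \<forall>t\<in>{0..T}. \<forall>y. \<forall>\<mu>\<in>P1. abs (bh t y \<mu>) <= K"
  "\<exists>C>0. (\<forall>t\<in>{0..T}. \<forall>y. \<forall>\<mu>\<in>P1. abs (bt t y \<mu>) <= C * (1 + abs y + kantorovich \<mu> (return borel 0))) &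
    (\<forall>t\<in>{0..T}. \<forall>y1 y2. \<forall>\<mu>\<in>P1. abs (bt t y1 \<mu> - bt t y2 \<mu>) <= C * abs (y1 - y2))"
  using dec unfolding decomposable_drift_def by blast
 obtain K where K: "\<forall>t\<in>{0..T}. \<forall>y. \<forall>\<mu>\<in>P1. abs (bh t y \<mu>) <= K" using b(3) by blast
 obtain C1 where C1: "C1 > 0" "\<forall>t\<in>{0..T}. \<forall>y. \<forall>\<mu>\<in>P1. abs (bt t y \<mu>) <= C1 * (1 + abs y + kantorovich \<mu> (return borel 0))"
  "\<forall>t\<in>{0..T}. \<forall>y1 y2. \<forall>\<mu>\<in>P1. abs (bt t y1 \<mu> - bt t y2 \<mu>) <= C1 * abs (y1 - y2)" using b(4) by blast
 obtain C2 where C2: "C2 > 0" "\<forall>t\<in>{0..T}. \<forall>y. \<forall>\<mu>\<in>P1. \<forall>\<nu>\<in>P1. abs (b t y \<mu> - b t y \<nu>) <= C2 * kantorovich \<mu> \<nu>"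
  using lip unfolding lipschitz_in_law_def by blast
 define C where "C = max C1 C2"
 have kn: "0 <= kantorovich \<mu> \<nu>" for \<mu> \<nu> using Metric_space.nonneg[OF Metric_space_P1] .
 have up: "c * v <= C * v" if "c <= C" "0 <= v" for c v using that by (rule mult_right_mono)
 have CC: "C1 <= C" "C2 <= C" by (auto simp: C_def)
 have "mckean_drift M T B be b bh bt (max 0 K) C"
 proof
  fix t y y' :: real and \<mu> \<nu> assume t: "t \<in> {0..T}" and \<mu>: "\<mu> \<in> P1"
  show "abs (bh t y \<mu>) <= max 0 K" using bspec[OF spec[OF bspec[OF K t]] \<mu>] by (rule max.coboundedI2)
  show "abs (bt t y \<mu>) <= C * (1 + abs y + kantorovich \<mu> (return borel 0))"
   using bspec[OF spec[OF bspec[OF C1(2) t]] \<mu>] by (rule order_trans) (intro up CC add_nonneg_nonneg kn, auto)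
  show "abs (bt t y \<mu> - bt t y' \<mu>) <= C * abs (y - y')"
   using bspec[OF spec[OF spec[OF bspec[OF C1(3) t]]] \<mu>] by (rule order_trans) (intro up CC, auto)
  assume \<nu>: "\<nu> \<in> P1"
  show "abs (b t y \<mu> - b t y \<nu>) <= C * kantorovich \<mu> \<nu>"
   using bspec[OF bspec[OF spec[OF bspec[OF C2(2) t]] \<mu>] \<nu>] by (rule order_trans) (intro up CC kn)
 qed (use T bm be b C1(1) in \<open>auto simp: C_def\<close>)
 then show ?thesis by (rule that)
qed

theorem lemma4p1:
 fixes M :: "'a measure" and T :: real
  and B :: "real \<Rightarrow> 'a \<Rightarrow> real"
  and b :: "real \<Rightarrow> real \<Rightarrow> real measure \<Rightarrow> real"
  and X :: "real \<Rightarrow> real \<Rightarrow> 'a \<Rightarrow> real"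
  and U :: "real set"
  and \<Phi> \<Phi>' :: "real \<Rightarrow> real"
  and t p :: real
 assumes "T > 0"
  and "prob_space M" and "complete_measure M"
  and "brownian_motion M T B"
  and "decomposable_drift T b"
  and "lipschitz_in_law T b"
  and "\<And>x. unique_strong_solution M T B b x (X x)"
  and "open U" and "bounded U"
  and "\<And>y. (\<Phi> has_real_derivative \<Phi>' y) (at y)"
  and "continuous_on UNIV \<Phi>'"
  and "bounded (range \<Phi>')"
  and "\<exists>L. L-lipschitz_on UNIV \<Phi>'"
  and "t \<in> {0..T}"
  and "1 < p"
 shows "in_W1p p U (\<lambda>x. \<integral>\<omega>. \<Phi> (X x t \<omega>) \<partial>M) \<and>
  (\<exists>D. has_weak_derivative_field M (\<lambda>x. X x t) D U) \<and>
  (\<forall>D g. has_weak_derivative_field M (\<lambda>x. X x t) D U \<and>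
      has_weak_derivative_on (\<lambda>x. \<integral>\<omega>. \<Phi> (X x t \<omega>) \<partial>M) g U \<longrightarrow>
    (AE x in lebesgue. x \<in> U \<longrightarrow>
     integrable M (\<lambda>\<omega>. \<Phi>' (X x t \<omega>) * D x \<omega>) \<and>
     g x = (\<integral>\<omega>. \<Phi>' (X x t \<omega>) * D x \<omega> \<partial>M)))"
proof -
 obtain \<beta> bh bt K C where "mckean_drift M T B \<beta> b bh bt K C"
  by (rule mckean_drift_exists[OF assms(1,2,4,5,6)])
 then interpret mckean_drift M T B \<beta> b bh bt K C .
 have t: "0 <= t" "t <= T" using assms(14) by auto
 have sol: "strong_solution M T B b x (X x)" for x using assms(7)[of x] by (simp add: unique_strong_solution_def)
 have "\<exists>Z. solves x Z & (AE w in M. \<forall>t\<in>{0..T}. Z t w = X x t w)" for x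
  using strong_solution_version[OF sol[of x]] by blast
 then have "\<forall>x. \<exists>Z. solves x Z & (AE w in M. \<forall>t\<in>{0..T}. Z t w = X x t w)" by (rule allI)
 then obtain Z where ZX: "\<forall>x. solves x (Z x) & (AE w in M. \<forall>t\<in>{0..T}. Z x t w = X x t w)"
  by (rule choice[THEN exE])
 have Z: "solves x (Z x)" "AE w in M. \<forall>t\<in>{0..T}. Z x t w = X x t w" for x
  using spec[OF ZX, of x] by auto
 obtain r where r: "\<forall>x\<in>U. abs x <= r" using assms(9) unfolding bounded_iff real_norm_def by blast
 define R where "R = max 1 r"
 have R: "- R < R" by (simp add: R_def)
 have UR: "U \<subseteq> {- R..R}"
 proof
  fix x assume "x \<in> U"
  then have "abs x <= r" using r by blast
  then show "x \<in> {- R..R}" by (auto simp: R_def)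
 qed
 obtain c where c: "0 <= c" and stab: "!!x y Z1 Z2 t. solves x Z1 ==> solves y Z2 ==> abs x <= R ==> abs y <= R ==> 0 <= t ==> t <= T ==>
   integrable M (%w. (Z1 t w - Z2 t w)^2) & (\<integral>w. (Z1 t w - Z2 t w)^2 \<partial>M) <= c * (x - y)^2"
 proof (rule solution_stability[of R], goal_cases)
  case (1 c)
  show thesis by (rule 1(1), rule 1(2)) (rule 1(3))
 qed
 obtain D :: "real => 'a => real" where D:
  "jmeas M D"
  "!!x. integrable M (%w. (D x w)^2)" "!!x. (\<integral>w. (D x w)^2 \<partial>M) <= c"
  "AE w in M. set_integrable lborel {- R..R} (%x. D x w)"
  "!!x. x \<in> {- R..R} ==> AE w in M. Z x t w = Z (- R) t w + (LBINT s:{- R..x}. D s w)"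
 proof (rule lipschitz_field_derivative[where G = "%x. Z x t" and a = "- R" and b = R and C = c, OF R c], goal_cases)
  case (1 x)
  show ?case by (rule solves_meas[OF Z(1)])
 next
  case (2 x y)
  then show ?case using stab[OF Z(1) Z(1) _ _ t, of x y] by auto
 next
  case (3 x y)
  then show ?case using stab[OF Z(1) Z(1) _ _ t, of x y] by auto
 next
  case (4 D)
  show thesis by (rule 4(1)[OF 4(2-6)])
 qed
 have Xm: "X x t \<in> meas M" for x
 proof -
  have "X x t \<in> meas (augmented_filtration M B t)" using sol[of x] assms(14) unfolding strong_solution_def by blast
  then show ?thesis by (rule augmented_measurable[OF assms(4) t(2)])
 qed
 have XD: "AE w in M. X x t w = Z (- R) t w + (LBINT s:{- R..x}. D s w)" if "x \<in> {- R..R}" for x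
  using D(5)[OF that] Z(2)[of x] by eventually_elim (use assms(14) in auto)
 obtain B' where B': "\<forall>y\<in>range \<Phi>'. abs y <= B'" using assms(12) unfolding bounded_iff real_norm_def by blast
 have b\<Phi>: "abs (\<Phi>' y) <= B'" for y using B' by blast
 obtain L where L: "L-lipschitz_on UNIV \<Phi>'" using assms(13) by blast
 have p: "0 < p" using assms(15) by simp
 note W = weak_derivative_of_expectation[where F = "%x. X x t", OF R assms(8) UR p Xm solves_integrable[OF Z(1) assms(14)] D(1-4) XD assms(10) b\<Phi> L]
 show ?thesis
 proof (intro conjI allI impI)
  show "in_W1p p U (%x. \<integral>w. \<Phi> (X x t w) \<partial>M)" by (rule W(1))
  show "\<exists>D. has_weak_derivative_field M (%x. X x t) D U" by (rule W(2))
 qed (rule W(3), simp_all)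
qed

end
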